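(* Let $G$ be a Métivier group with Lie algebra $\mathfrak g=\mathfrak z\oplus\mathfrak v$, $\dim\mathfrak z=d\ge1$, $\dim\mathfrak v=2n\ge2$, and let $m$ be a proper function (defined in the context). For $\mu>0$ define, for $f\in\mathcal S(G)$, the restriction operator $$\mathcal P_\mu^mf(V,Z)=(2\pi)^{-(n+d)}\sum_{k}\mu_k^{n+d-1}|\mu_k'|\int_{S}e^{-i\mu_k\omega(Z)}\big(\Pi_k^{\mu_k\omega}[\mathfrak F_{\mathfrak z}f(\cdot,\mu_k\omega)]\big)(V)\,d\sigma(\omega),$$ the sum being over those $k\in\{0,1,2,\dots\}$ for which $\mu_k$ exists. Then every $f\in\mathcal S(G)$ has the expansion $$f=\int_{\mathbb R^+}\mathcal P_\mu^mf\,d\mu ,$$ and this is a spectral decomposition of $m(\mathcal L,-\Delta_{\mathfrak z})$ in the sense that $$m(\mathcal L,-\Delta_{\mathfrak z})\circ\mathcal P_\mu^m=\mu\,\mathcal P_\mu^m .$$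
   Context: **Métivier groups.** $G$ is a connected, simply connected two-step nilpotent Lie group whose Lie algebra $\mathfrak g$ carries an inner product $\langle\cdot,\cdot\rangle$; $\mathfrak g=\mathfrak z\oplus\mathfrak v$ with $\mathfrak z$ the center and $\mathfrak v$ its complement. $\mathfrak z^*$ has the dual norm and $S=\{\omega\in\mathfrak z^*:|\omega|=1\}$ (identified with $\mathbb S^{d-1}$, with surface measure $d\sigma$). For $\omega\in S$ put $B_\omega(U,V)=\omega([U,V])$, $U,V\in\mathfrak v$. $G$ is a Métivier group if for every $\omega\in S$ the skew form $B_\omega$ is non-degenerate. Then $\dim\mathfrak v=2n$ is even. Through the exponential map $G$ is identified with $\mathfrak v\times\mathfrak z\cong\mathbb R^{2n}\times\mathbb R^d$, with points $(V,Z)$, orthonormal bases $V_1,\dots,V_{2n}$ of $\mathfrak v$ and $Z_1,\dots,Z_d$ of $\mathfrak z$, coordinates $v_j,z_i$ and Lebesgue measure; $\mathcal S(G)$ is the Schwartz space. The sub-Laplacian is $\mathcal L=-\sum_j\widetilde V_j^2$ with $\widetilde V_j=\partial_{v_j}+\frac12\sum_i\langle Z_i,[V,V_j]\rangle\partial_{z_i}$, and $-\Delta_{\mathfrak z}=-\sum_i\partial_{z_i}^2$. **Twisted spectral projections.** For $\lambda>0$ and $k=0,1,2,\dots$, $\varphi_k^\lambda(z)=L_k^{n-1}(\tfrac\lambda2|z|^2)e^{-\frac\lambda4|z|^2}$ on $\mathbb C^n$, where $L_k^{n-1}$ is the Laguerre polynomial of type $n-1$ and degree $k$, and $$\Lambda_k^\lambda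 g(z)=\int_{\mathbb C^n}g(z-w)\varphi_k^\lambda(w)e^{i\frac\lambda2\mathrm{Im}(z\cdot\bar w)}\,dw .$$ For each $\omega\in S$ fix (measurably in $\omega$) an invertible linear map $A_\omega:\mathfrak v\to\mathbb R^{2n}\cong\mathbb C^n$ with $B_\omega(U,V)=(A_\omega U)^TJ(A_\omega V)$, $J=\begin{pmatrix}0&I_n\\-I_n&0\end{pmatrix}$, where $y\in\mathbb R^{2n}$ is identified with $(y_j+iy_{j+n})_{j=1}^n\in\mathbb C^n$. For a function $g$ on $\mathfrak v$ put $\Pi_k^{\lambda\omega}g=\big(\Lambda_k^\lambda(g\circ A_\omega^{-1})\big)\circ A_\omega$. **Fourier transform.** $\mathfrak F_{\mathfrak z}f(V,\eta)=\int_{\mathfrak z}e^{i\eta(Z)}f(V,Z)\,dZ$ for $\eta\in\mathfrak z^*$. **Proper functions, $\mu_k$.** A function $m$ of two positive variables is proper if for every $k\ge0$ the function $\lambda\mapsto m((2k+n)\lambda,\lambda^2)$ on $\mathbb R^+=(0,\infty)$ is differentiable, positive and strictly monotonic. For $\mu>0$, $\mu_k=\mu_k(\mu)$ is the solution $\lambda>0$ of $m((2k+n)\lambda,\lambda^2)=\mu$, when it exists, and $\mu_k'=d\mu_k/d\mu$ (assumed to exist). **Joint functional calculus.** The operator $m(\mathcal L,-\Delta_{\mathfrak z})$ is defined by $$m(\mathcal L,-\Delta_{\mathfrak z})f(V,Z)=(2\pi)^{-(n+d)}\int_0^\infty\sum_{k=0}^\infty m\big((2k+n)\lambda,\lambda^2\big)\lambda^{n+d-1}\int_Se^{-i\lambda\omega(Z)}\big(\Pi_k^{\lambda\omega}[\mathfrak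 F_{\mathfrak z}f(\cdot,\lambda\omega)]\big)(V)\,d\sigma(\omega)\,d\lambda ,$$ that is, it acts on each component $e^{-i\lambda\omega(Z)}(\Pi_k^{\lambda\omega}h)(V)$ as multiplication by $m((2k+n)\lambda,\lambda^2)$; it is applied to $\mathcal P_\mu^mf$ (a superposition of such components) in this sense.
   Formalization: The series defining P_μ f can diverge at exceptional μ; the identity m(L,−Δ)P_μ f = μ P_μ f is therefore stated for those μ>0 at which P_μ f converges absolutely with at most polynomial growth in V on average, and this is shown to hold for almost every μ. *)

theory Defs
  imports "HOL-Analysis.Analysis"
begin

text \<open>
  The simply connected Metivier group is identified, via the exponential map, with its Lie algebra
  \<open>\<gg> = \<vv> \<oplus> \<zz>\<close>, represented as the product type \<open>'v \<times> 'z\<close> of two Euclidean spaces (so \<open>\<vv>\<close> and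
  \<open>\<zz>\<close> are orthogonal, points are pairs \<open>(V, Z)\<close>, and Lebesgue measure is \<open>lborel\<close>).
  The dual \<open>\<zz>\<^sup>*\<close> with the dual norm is identified with \<open>'z\<close> by the Riesz isometry, i.e.
  \<open>\<omega>(Z) = \<omega> \<bullet> Z\<close>, and \<open>S = sphere 0 1\<close>.
\<close>

definition lie_center :: "('g::real_vector \<Rightarrow> 'g \<Rightarrow> 'g) \<Rightarrow> 'g set" where
  "lie_center br = {X. \<forall>Y. br X Y = 0}"

definition lie_bracket :: "('g::real_vector \<Rightarrow> 'g \<Rightarrow> 'g) \<Rightarrow> bool" where
  "lie_bracket br \<longleftrightarrow> bilinear br \<and> (\<forall>X. br X X = 0) \<and>
     (\<forall>X Y W. br X (br Y W) + br Y (br W X) + br W (br X Y) = 0)"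

definition two_step_nilpotent :: "('g::real_vector \<Rightarrow> 'g \<Rightarrow> 'g) \<Rightarrow> bool" where
  "two_step_nilpotent br \<longleftrightarrow> (\<forall>X Y. br X Y \<in> lie_center br) \<and> (\<exists>X Y. br X Y \<noteq> 0)"

definition Bform ::
  "('v::euclidean_space \<times> 'z::euclidean_space \<Rightarrow> 'v \<times> 'z \<Rightarrow> 'v \<times> 'z) \<Rightarrow> 'z \<Rightarrow> 'v \<Rightarrow> 'v \<Rightarrow> real" where
  "Bform br \<omega> U V = \<omega> \<bullet> snd (br (U, 0) (V, 0))"

definition metivier ::
  "('v::euclidean_space \<times> 'z::euclidean_space \<Rightarrow> 'v \<times> 'z \<Rightarrow> 'v \<times> 'z) \<Rightarrow> bool" where
  "metivier br \<longleftrightarrow> lie_bracket br \<and> two_step_nilpotent br \<and>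
     lie_center br = {0} \<times> UNIV \<and>
     (\<forall>\<omega>\<in>sphere 0 1. \<forall>U. (\<forall>V. Bform br \<omega> U V = 0) \<longrightarrow> U = 0)"

definition dir_deriv :: "'a::euclidean_space \<Rightarrow> ('a \<Rightarrow> complex) \<Rightarrow> 'a \<Rightarrow> complex" where
  "dir_deriv b f = (\<lambda>x. frechet_derivative f (at x) b)"

definition schwartz :: "('a::euclidean_space \<Rightarrow> complex) \<Rightarrow> bool" where
  "schwartz f \<longleftrightarrow> (\<forall>bs\<in>lists Basis.
     (\<forall>x. foldr dir_deriv bs f differentiable (at x)) \<and>
     (\<forall>N::nat. bounded (range (\<lambda>x. (1 + norm x) ^ N *\<^sub>R foldr dir_deriv bs f x))))"

text \<open>
  Surface measure on the unit sphere as the cone measure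
  \<open>\<sigma>(E) = d \<cdot> |{x. 0 < |x| < 1, x/|x| \<in> E}|\<close>, which is the measure in the polar coordinates formula
  \<open>dx = r\<^bsup>d-1\<^esup> dr d\<sigma>\<close>; for \<open>d = 1\<close> it is counting measure on the two unit vectors.
\<close>

definition sphere_measure :: "'z::euclidean_space measure" where
  "sphere_measure = scale_measure (of_nat DIM('z))
     (distr (restrict_space lborel (ball 0 1 - {0})) (restrict_space borel (sphere 0 1)) sgn)"

definition fourier_z ::
  "('v::euclidean_space \<times> 'z::euclidean_space \<Rightarrow> complex) \<Rightarrow> 'z \<Rightarrow> 'v \<Rightarrow> complex" where
  "fourier_z f \<eta> V = (LINT Z|lborel. cis (\<eta> \<bullet> Z) * f (V, Z))"

text \<open>
  \<open>n = CARD('n)\<close>. In \<open>\<real>\<^sup>2\<^sup>n = real^('n + 'n)\<close> the index \<open>Inl j\<close> stands for \<open>j\<close> and \<open>Inr j\<close> for \<open>j + n\<close>.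
\<close>

definition to_cvec :: "real^('n::finite + 'n) \<Rightarrow> complex^'n" where
  "to_cvec y = (\<chi> j. Complex (y $ Inl j) (y $ Inr j))"

definition of_cvec :: "complex^'n::finite \<Rightarrow> real^('n + 'n)" where
  "of_cvec z = (\<chi> s. case s of Inl j \<Rightarrow> Re (z $ j) | Inr j \<Rightarrow> Im (z $ j))"

definition Jmat :: "real^('n::finite + 'n)^('n + 'n)" where
  "Jmat = (\<chi> s t. case (s, t) of
       (Inl i, Inr j) \<Rightarrow> (if i = j then 1 else 0)
     | (Inr i, Inl j) \<Rightarrow> (if i = j then -1 else 0)
     | _ \<Rightarrow> 0)"

text \<open>The family \<open>A\<^sub>\<omega>\<close>; its values for \<open>\<omega>\<close> off the unit sphere are irrelevant.\<close>

definition symplectic_frames ::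
  "('v::euclidean_space \<times> 'z::euclidean_space \<Rightarrow> 'v \<times> 'z \<Rightarrow> 'v \<times> 'z) \<Rightarrow>
   ('z \<Rightarrow> 'v \<Rightarrow> real^('n::finite + 'n)) \<Rightarrow> bool" where
  "symplectic_frames br A \<longleftrightarrow>
     (\<forall>\<omega>\<in>sphere 0 1. linear (A \<omega>) \<and> bij (A \<omega>) \<and>
        (\<forall>U V. Bform br \<omega> U V = A \<omega> U \<bullet> (Jmat *v A \<omega> V))) \<and>
     (\<forall>U. (\<lambda>\<omega>. A \<omega> U) \<in> borel_measurable (restrict_space borel (sphere 0 1)))"

definition laguerre :: "nat \<Rightarrow> nat \<Rightarrow> real \<Rightarrow> real" where
  "laguerre \<alpha> k x = (\<Sum>i\<le>k. (-1) ^ i * real ((k + \<alpha>) choose (k - i)) * x ^ i / fact i)"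

definition laguerre_fun :: "nat \<Rightarrow> real \<Rightarrow> complex^'n::finite \<Rightarrow> real" where
  "laguerre_fun k r z =
     laguerre (CARD('n) - 1) k (r / 2 * (norm z)\<^sup>2) * exp (- (r / 4) * (norm z)\<^sup>2)"

definition twisted_proj ::
  "nat \<Rightarrow> real \<Rightarrow> (complex^'n::finite \<Rightarrow> complex) \<Rightarrow> complex^'n \<Rightarrow> complex" where
  "twisted_proj k r g z = (LINT w|lborel. g (z - w) * of_real (laguerre_fun k r w) *
     cis (r / 2 * Im (\<Sum>j\<in>UNIV. z $ j * cnj (w $ j))))"

definition spec_proj ::
  "('z \<Rightarrow> 'v \<Rightarrow> real^('n::finite + 'n)) \<Rightarrow> nat \<Rightarrow> real \<Rightarrow> 'z \<Rightarrow> ('v \<Rightarrow> complex) \<Rightarrow> 'v \<Rightarrow> complex" where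
  "spec_proj A k r \<omega> g V =
     twisted_proj k r (\<lambda>z. g (inv (A \<omega>) (of_cvec z))) (to_cvec (A \<omega> V))"

definition joint_mult :: "nat \<Rightarrow> (real \<Rightarrow> real \<Rightarrow> real) \<Rightarrow> nat \<Rightarrow> real \<Rightarrow> real" where
  "joint_mult n m k r = m ((2 * real k + real n) * r) (r\<^sup>2)"

definition proper_function :: "nat \<Rightarrow> (real \<Rightarrow> real \<Rightarrow> real) \<Rightarrow> bool" where
  "proper_function n m \<longleftrightarrow> (\<forall>k.
     joint_mult n m k differentiable_on {0<..} \<and>
     (\<forall>r>0. joint_mult n m k r > 0) \<and>
     (strict_mono_on {0<..} (joint_mult n m k) \<or> strict_antimono_on {0<..} (joint_mult n m k)))"

definition mu_indices :: "nat \<Rightarrow> (real \<Rightarrow> real \<Rightarrow> real) \<Rightarrow> real \<Rightarrow> nat set" where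
  "mu_indices n m \<mu> = {k. \<exists>r>0. joint_mult n m k r = \<mu>}"

definition mu_sol :: "nat \<Rightarrow> (real \<Rightarrow> real \<Rightarrow> real) \<Rightarrow> nat \<Rightarrow> real \<Rightarrow> real" where
  "mu_sol n m k \<mu> = (THE r. r > 0 \<and> joint_mult n m k r = \<mu>)"

definition restriction_op ::
  "('z \<Rightarrow> 'v \<Rightarrow> real^('n::finite + 'n)) \<Rightarrow> (real \<Rightarrow> real \<Rightarrow> real) \<Rightarrow> real \<Rightarrow>
   ('v::euclidean_space \<times> 'z::euclidean_space \<Rightarrow> complex) \<Rightarrow> 'v \<times> 'z \<Rightarrow> complex" where
  "restriction_op A m \<mu> f = (\<lambda>(V, Z).
     of_real (1 / (2 * pi) ^ (CARD('n) + DIM('z))) *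
     (\<Sum>\<^sub>\<infinity>k\<in>mu_indices CARD('n) m \<mu>. let r = mu_sol CARD('n) m k \<mu> in
        of_real (r ^ (CARD('n) + DIM('z) - 1) * \<bar>deriv (mu_sol CARD('n) m k) \<mu>\<bar>) *
        (LINT \<omega>|sphere_measure. cis (- r * (\<omega> \<bullet> Z)) *
           spec_proj A k r \<omega> (fourier_z f (r *\<^sub>R \<omega>)) V)))"

text \<open>
  Since \<open>m\<close> is unrelated for different \<open>k\<close>, the factors \<open>|\<mu>\<^sub>k'|\<close> may make the series for
  \<open>\<P>\<^sub>\<mu> f\<close> diverge for exceptional \<open>\<mu>\<close>. The next two predicates express absolute convergence of
  the sum and spherical integral defining \<open>\<P>\<^sub>\<mu> f (V, Z)\<close> at a given \<open>V\<close> (it does not depend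
  on \<open>Z\<close>), and absolute convergence with at most polynomial growth in \<open>V\<close> on average.
\<close>

definition restriction_summand ::
  "('z \<Rightarrow> 'v \<Rightarrow> real^('n::finite + 'n)) \<Rightarrow> (real \<Rightarrow> real \<Rightarrow> real) \<Rightarrow> real \<Rightarrow>
   ('v::euclidean_space \<times> 'z::euclidean_space \<Rightarrow> complex) \<Rightarrow> 'v \<Rightarrow> nat \<Rightarrow> 'z \<Rightarrow> complex" where
  "restriction_summand A m \<mu> f V k \<omega> = (let r = mu_sol CARD('n) m k \<mu> in
     of_real (r ^ (CARD('n) + DIM('z) - 1) * \<bar>deriv (mu_sol CARD('n) m k) \<mu>\<bar>) *
     spec_proj A k r \<omega> (fourier_z f (r *\<^sub>R \<omega>)) V)"

definition restriction_converges_at ::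
  "('z \<Rightarrow> 'v \<Rightarrow> real^('n::finite + 'n)) \<Rightarrow> (real \<Rightarrow> real \<Rightarrow> real) \<Rightarrow> real \<Rightarrow>
   ('v::euclidean_space \<times> 'z::euclidean_space \<Rightarrow> complex) \<Rightarrow> 'v \<Rightarrow> bool" where
  "restriction_converges_at A m \<mu> f V \<longleftrightarrow>
     integrable (count_space (mu_indices CARD('n) m \<mu>) \<Otimes>\<^sub>M sphere_measure)
       (\<lambda>(k, \<omega>). restriction_summand A m \<mu> f V k \<omega>)"

definition restriction_tempered ::
  "('z \<Rightarrow> 'v \<Rightarrow> real^('n::finite + 'n)) \<Rightarrow> (real \<Rightarrow> real \<Rightarrow> real) \<Rightarrow> real \<Rightarrow>
   ('v::euclidean_space \<times> 'z::euclidean_space \<Rightarrow> complex) \<Rightarrow> bool" where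
  "restriction_tempered A m \<mu> f \<longleftrightarrow> (\<exists>N::nat.
     integrable (lborel \<Otimes>\<^sub>M (count_space (mu_indices CARD('n) m \<mu>) \<Otimes>\<^sub>M sphere_measure))
       (\<lambda>(V, k, \<omega>). restriction_summand A m \<mu> f V k \<omega> /\<^sub>R (1 + norm V) ^ N))"

text \<open>This is \<open>m(\<L>, -\<Delta>\<^sub>\<zz>) f\<close> for Schwartz functions \<open>f\<close>.\<close>

definition joint_calculus_formula ::
  "('z \<Rightarrow> 'v \<Rightarrow> real^('n::finite + 'n)) \<Rightarrow> (real \<Rightarrow> real \<Rightarrow> real) \<Rightarrow>
   ('v::euclidean_space \<times> 'z::euclidean_space \<Rightarrow> complex) \<Rightarrow> 'v \<times> 'z \<Rightarrow> complex" where
  "joint_calculus_formula A m f = (\<lambda>(V, Z).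
     of_real (1 / (2 * pi) ^ (CARD('n) + DIM('z))) *
     (LINT r:{0<..}|lborel. (\<Sum>\<^sub>\<infinity>k.
        of_real (joint_mult CARD('n) m k r * r ^ (CARD('n) + DIM('z) - 1)) *
        (LINT \<omega>|sphere_measure. cis (- r * (\<omega> \<bullet> Z)) *
           spec_proj A k r \<omega> (fourier_z f (r *\<^sub>R \<omega>)) V))))"

text \<open>
  \<open>is_superposition A \<nu> a h F\<close>: almost everywhere \<open>F\<close> is the superposition, with respect to \<open>\<nu>\<close> in
  \<open>(k, \<lambda>)\<close> and surface measure in \<open>\<omega>\<close>, of the components
  \<open>e\<^bsup>-i\<lambda>\<omega>(Z)\<^esup> (\<Pi>\<^sub>k\<^bsup>\<lambda>\<omega>\<^esup> h\<^bsub>k,\<lambda>,\<omega>\<^esub>)(V)\<close> with amplitudes \<open>a(k, \<lambda>)\<close>, converging absolutely and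
  with at most polynomial growth in \<open>V\<close> on average.
\<close>

definition is_superposition ::
  "('z \<Rightarrow> 'v \<Rightarrow> real^('n::finite + 'n)) \<Rightarrow> (nat \<times> real) measure \<Rightarrow> (nat \<Rightarrow> real \<Rightarrow> complex) \<Rightarrow>
   (nat \<Rightarrow> real \<Rightarrow> 'z \<Rightarrow> 'v \<Rightarrow> complex) \<Rightarrow>
   ('v::euclidean_space \<times> 'z::euclidean_space \<Rightarrow> complex) \<Rightarrow> bool" where
  "is_superposition A \<nu> a h F \<longleftrightarrow>
     sigma_finite_measure \<nu> \<and>
     sets \<nu> = sets (count_space UNIV \<Otimes>\<^sub>M restrict_space borel {0<..}) \<and>
     (\<forall>k r \<omega>. schwartz (h k r \<omega>)) \<and>
     (\<exists>N::nat. integrable (lborel \<Otimes>\<^sub>M (\<nu> \<Otimes>\<^sub>M sphere_measure))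
        (\<lambda>(V, (k, r), \<omega>). (a k r * spec_proj A k r \<omega> (h k r \<omega>) V) /\<^sub>R (1 + norm V) ^ N)) \<and>
     (AE (V, Z) in lborel. F (V, Z) =
        (LINT ((k, r), \<omega>)|(\<nu> \<Otimes>\<^sub>M sphere_measure).
           cis (- r * (\<omega> \<bullet> Z)) * (a k r * spec_proj A k r \<omega> (h k r \<omega>) V)))"

text \<open>
  \<open>joint_calculus A m F H\<close> reads \<open>m(\<L>, -\<Delta>\<^sub>\<zz>) F = H\<close>: the operator multiplies each component
  of a superposition by \<open>m((2k+n)\<lambda>, \<lambda>\<^sup>2)\<close>; for Schwartz \<open>F\<close> see
  \<open>superposition_schwartz\<close> below. \<open>F\<close> and \<open>H\<close> matter up to null sets.
\<close>

definition joint_calculus ::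
  "('z \<Rightarrow> 'v \<Rightarrow> real^('n::finite + 'n)) \<Rightarrow> (real \<Rightarrow> real \<Rightarrow> real) \<Rightarrow>
   ('v::euclidean_space \<times> 'z::euclidean_space \<Rightarrow> complex) \<Rightarrow> ('v \<times> 'z \<Rightarrow> complex) \<Rightarrow> bool" where
  "joint_calculus A m F H \<longleftrightarrow> (\<exists>\<nu> a h.
     is_superposition A \<nu> a h F \<and>
     is_superposition A \<nu> (\<lambda>k r. of_real (joint_mult CARD('n) m k r) * a k r) h H)"


text \<open>
  For \<open>\<nu> = d\<lambda>\<close> on \<open>\<nat> \<times> (0,\<infinity>)\<close> and \<open>h = \<FF>\<^sub>\<zz> f(\<cdot>, \<lambda>\<omega>)\<close>, multiplying the amplitudes
  \<open>(2\<pi>)\<^bsup>-(n+d)\<^esup> \<lambda>\<^bsup>n+d-1\<^esup>\<close> (those of \<open>f\<close> itself, by Fourier inversion and the special Hermite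
  expansion) by \<open>m((2k+n)\<lambda>, \<lambda>\<^sup>2)\<close> gives the defining formula of \<open>m(\<L>, -\<Delta>\<^sub>\<zz>) f\<close>.
\<close>

lemma finite_sphere_measure: "finite_measure (sphere_measure :: 'z::euclidean_space measure)"
proof
  have m: "(sgn :: 'z \<Rightarrow> 'z) \<in> restrict_space lborel (ball 0 1 - {0}) \<rightarrow>\<^sub>M restrict_space borel (sphere 0 1)"
    by (rule measurable_restrict_space3) (auto simp: norm_sgn sgn_div_norm[abs_def])
  have "emeasure lborel (ball (0::'z) 1 - {0}) \<le> emeasure lborel (ball (0::'z) 1)"
    by (rule emeasure_mono) auto
  also have "\<dots> < \<infinity>" by (rule emeasure_bounded_finite) auto
  finally have fin: "emeasure lborel (ball (0::'z) 1 - {0}) < \<infinity>" .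
  have "emeasure (distr (restrict_space lborel (ball 0 1 - {0})) (restrict_space borel (sphere 0 1)) sgn)
      (space (restrict_space borel (sphere (0::'z) 1)))
    \<le> emeasure (restrict_space lborel (ball (0::'z) 1 - {0})) (space (restrict_space lborel (ball (0::'z) 1 - {0})))"
    by (subst emeasure_distr[OF m sets.top]) (rule emeasure_space)
  also have "\<dots> < \<infinity>"
    using fin by (simp add: emeasure_restrict_space space_restrict_space)
  finally show "emeasure (sphere_measure :: 'z measure) (space sphere_measure) \<noteq> \<infinity>"
    by (simp add: sphere_measure_def space_scale_measure ennreal_mult_eq_top_iff)
qed

lemma superposition_schwartz:
  fixes A :: "'z::euclidean_space \<Rightarrow> 'v::euclidean_space \<Rightarrow> real^('n::finite + 'n)"
  assumes "is_superposition A (count_space UNIV \<Otimes>\<^sub>M restrict_space lborel {0<..})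
     (\<lambda>k r. of_real (joint_mult CARD('n) m k r) *
        of_real (1 / (2 * pi) ^ (CARD('n) + DIM('z)) * r ^ (CARD('n) + DIM('z) - 1)))
     (\<lambda>k r \<omega>. fourier_z f (r *\<^sub>R \<omega>)) H"
  shows "AE p in lborel. H p = joint_calculus_formula A m f p"
proof -
  let ?L = "restrict_space lborel {0::real<..}"
  let ?N = "count_space UNIV \<Otimes>\<^sub>M ?L :: (nat \<times> real) measure"
  let ?S = "sphere_measure :: 'z measure"
  define c where "c = 1 / (2 * pi) ^ (CARD('n) + DIM('z))"
  define G where "G = (\<lambda>V k r \<omega>. (of_real (joint_mult CARD('n) m k r) *
        of_real (c * r ^ (CARD('n) + DIM('z) - 1))) * spec_proj A k r \<omega> (fourier_z f (r *\<^sub>R \<omega>)) V)"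
  interpret S: finite_measure ?S by (rule finite_sphere_measure)
  interpret L: sigma_finite_measure ?L
    by (rule sigma_finite_measure_restrict_space) (auto intro: sigma_finite_lborel)
  interpret C: sigma_finite_measure "count_space (UNIV :: nat set)"
    by (rule sigma_finite_measure_count_space_countable) simp
  interpret CL: pair_sigma_finite "count_space (UNIV :: nat set)" ?L ..
  interpret NS: pair_sigma_finite ?N ?S ..
  interpret VNS: pair_sigma_finite "lborel :: 'v measure" "?N \<Otimes>\<^sub>M ?S" ..
  from assms obtain N where int: "integrable (lborel \<Otimes>\<^sub>M (?N \<Otimes>\<^sub>M ?S))
        (\<lambda>(V, (k, r), \<omega>). G V k r \<omega> /\<^sub>R (1 + norm V) ^ N)"
    and eq: "AE (V, Z) in lborel. H (V, Z) =
        (LINT ((k, r), \<omega>)|(?N \<Otimes>\<^sub>M ?S). cis (- r * (\<omega> \<bullet> Z)) * G V k r \<omega>)"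
    unfolding is_superposition_def G_def c_def by blast
  have "AE V in lborel. integrable (?N \<Otimes>\<^sub>M ?S) (\<lambda>((k, r), \<omega>). G V k r \<omega> /\<^sub>R (1 + norm V) ^ N)"
    using VNS.AE_integrable_fst'[OF int] by (simp add: case_prod_unfold)
  then have *: "AE V in lborel. integrable (?N \<Otimes>\<^sub>M ?S) (\<lambda>((k, r), \<omega>). G V k r \<omega>)"
  proof eventually_elim
    case (elim V)
    have "(1 + norm V) ^ N \<noteq> 0" using norm_ge_zero[of V] by (smt (verit) zero_less_power)
    then show ?case
      using integrable_scaleR_right[of "(1 + norm V) ^ N", OF elim] by (simp add: case_prod_unfold)
  qed
  obtain X where X: "X \<in> null_sets (lborel :: 'v measure)"
      "\<And>V. V \<in> space lborel - X \<Longrightarrow> integrable (?N \<Otimes>\<^sub>M ?S) (\<lambda>((k, r), \<omega>). G V k r \<omega>)"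
    by (rule AE_E3[OF *]) blast
  have "X \<times> (UNIV :: 'z set) \<in> null_sets (lborel \<Otimes>\<^sub>M lborel)"
    using X(1) by (auto simp: null_sets_def lborel.emeasure_pair_measure_Times simp del: lborel_prod)
  then have "X \<times> (UNIV :: 'z set) \<in> null_sets lborel" by (simp add: lborel_prod)
  then have "AE p in (lborel :: ('v \<times> 'z) measure).
      integrable (?N \<Otimes>\<^sub>M ?S) (\<lambda>((k, r), \<omega>). G (fst p) k r \<omega>)"
  proof (rule AE_I')
    show "{p \<in> space (lborel :: ('v \<times> 'z) measure).
        \<not> integrable (?N \<Otimes>\<^sub>M ?S) (\<lambda>((k, r), \<omega>). G (fst p) k r \<omega>)} \<subseteq> X \<times> UNIV"
    proof
      fix p assume "p \<in> {p \<in> space (lborel :: ('v \<times> 'z) measure).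
        \<not> integrable (?N \<Otimes>\<^sub>M ?S) (\<lambda>((k, r), \<omega>). G (fst p) k r \<omega>)}"
      then have n: "\<not> integrable (?N \<Otimes>\<^sub>M ?S) (\<lambda>((k, r), \<omega>). G (fst p) k r \<omega>)"
        by (simp only: mem_Collect_eq simp_thms)
      have "fst p \<in> X"
      proof (rule ccontr)
        assume "fst p \<notin> X"
        then have "fst p \<in> space lborel - X" by simp
        from n X(2)[OF this] show False by (rule notE)
      qed
      then show "p \<in> X \<times> UNIV" by (cases p) simp
    qed
  qed
  with eq show ?thesis
  proof eventually_elim
    case (elim p)
    obtain V Z where p: "p = (V, Z)" by (cases p)
    let ?g = "\<lambda>k r \<omega>. cis (- r * (\<omega> \<bullet> Z)) * G V k r \<omega>"
    have iG: "integrable (?N \<Otimes>\<^sub>M ?S) (\<lambda>((k, r), \<omega>). G V k r \<omega>)"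
      using elim(2) p by simp
    have mS: "(\<lambda>\<omega>. \<omega>) \<in> ?S \<rightarrow>\<^sub>M borel"
    proof -
      have "sets ?S = sets (restrict_space borel (sphere 0 1))"
        by (simp add: sphere_measure_def)
      then show ?thesis
        by (subst measurable_cong_sets[OF _ refl]) (auto intro: measurable_restrict_space1)
    qed
    have mr: "(\<lambda>x. x) \<in> ?L \<rightarrow>\<^sub>M borel" by (simp add: measurable_restrict_space1)
    have mc: "(\<lambda>x. cis (- snd (fst x) * (snd x \<bullet> Z))) \<in> borel_measurable (?N \<Otimes>\<^sub>M ?S)"
    proof -
      have 1: "(\<lambda>x. snd (fst x)) \<in> borel_measurable (?N \<Otimes>\<^sub>M ?S)"
        by (rule measurable_compose[OF _ mr]) measurable
      have 2: "(\<lambda>x. snd x) \<in> borel_measurable (?N \<Otimes>\<^sub>M ?S)"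
        by (rule measurable_compose[OF _ mS]) measurable
      have 3: "(\<lambda>x. - snd (fst x) * (snd x \<bullet> Z)) \<in> borel_measurable (?N \<Otimes>\<^sub>M ?S)"
        using 1 2 by (intro borel_measurable_times borel_measurable_uminus borel_measurable_inner) auto
      have "cis \<in> borel_measurable borel"
        by (intro borel_measurable_continuous_onI) (auto intro!: continuous_intros)
      with 3 show ?thesis by (rule measurable_compose)
    qed
    have ig: "integrable (?N \<Otimes>\<^sub>M ?S) (\<lambda>((k, r), \<omega>). ?g k r \<omega>)"
    proof (rule Bochner_Integration.integrable_bound[OF iG])
      show "(\<lambda>((k, r), \<omega>). ?g k r \<omega>) \<in> borel_measurable (?N \<Otimes>\<^sub>M ?S)"
        using borel_measurable_times[OF mc borel_measurable_integrable[OF iG]]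
        by (simp add: case_prod_unfold)
    qed (auto simp: norm_mult)
    have ig': "integrable (?N \<Otimes>\<^sub>M ?S) (\<lambda>(x, \<omega>). ?g (fst x) (snd x) \<omega>)"
      using ig by (simp add: case_prod_unfold)
    have ik: "integrable ?N (\<lambda>x. LINT \<omega>|?S. ?g (fst x) (snd x) \<omega>)"
      using NS.integrable_fst[OF ig'] .
    have ik': "integrable ?N (\<lambda>(k, r). LINT \<omega>|?S. ?g k r \<omega>)"
      using ik by (simp add: case_prod_unfold)
    have "H p = (LINT ((k, r), \<omega>)|(?N \<Otimes>\<^sub>M ?S). ?g k r \<omega>)" using elim(1) p by simp
    also have "\<dots> = (LINT x|?N. LINT \<omega>|?S. ?g (fst x) (snd x) \<omega>)"
      using NS.integral_fst[OF ig'] by (simp add: case_prod_unfold)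
    also have "\<dots> = (LINT r|?L. LINT k|count_space UNIV. LINT \<omega>|?S. ?g k r \<omega>)"
      using CL.integral_snd[OF ik'] by (simp add: case_prod_unfold)
    also have "\<dots> = (LINT r|?L. (\<Sum>\<^sub>\<infinity>k. LINT \<omega>|?S. ?g k r \<omega>))"
    proof -
      have "(LINT k|count_space UNIV. u k) = (\<Sum>\<^sub>\<infinity>k. u k)" for u :: "nat \<Rightarrow> complex"
      proof (cases "integrable (count_space UNIV) u")
        case True
        then show ?thesis by (metis abs_summable_on_def infsetsum_def infsetsum_infsum)
      next
        case False
        then have "\<not> u summable_on UNIV"
          by (metis abs_summable_on_def abs_summable_equivalent summable_on_iff_abs_summable_on_complex)
        with False show ?thesis
          by (simp add: not_integrable_integral_eq infsum_not_exists)
      qed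
      then show ?thesis by simp
    qed
    also have "\<dots> = (LINT r|?L. of_real c * (\<Sum>\<^sub>\<infinity>k.
        of_real (joint_mult CARD('n) m k r * r ^ (CARD('n) + DIM('z) - 1)) *
        (LINT \<omega>|?S. cis (- r * (\<omega> \<bullet> Z)) * spec_proj A k r \<omega> (fourier_z f (r *\<^sub>R \<omega>)) V)))"
    proof -
      have "?g k r \<omega> = of_real c * (of_real (joint_mult CARD('n) m k r * r ^ (CARD('n) + DIM('z) - 1)) *
        (cis (- r * (\<omega> \<bullet> Z)) * spec_proj A k r \<omega> (fourier_z f (r *\<^sub>R \<omega>)) V))" for k r \<omega>
        by (simp add: G_def)
      then show ?thesis
        by (simp only: integral_mult_right_zero infsum_cmult_right')
    qed
    also have "\<dots> = joint_calculus_formula A m f p"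
      by (simp only: integral_mult_right_zero, simp add: joint_calculus_formula_def p c_def
          set_lebesgue_integral_def integral_restrict_space)
    finally show ?case .
  qed
qed

end

theory Submission
  imports Defs "HOL-Probability.Probability"
begin

text \<open>
  Weighting the special Hermite expansion with \<open>t\<^sup>k\<close> turns the twisted projections into Mehler
  kernels, which are Gaussians and form an approximate identity as \<open>t\<close> tends to 1; an Abel-type
  argument then gives \<open>(2\<pi>)\<^sup>n g = \<Sum>\<^sub>k \<lambda>\<^sup>n \<Pi>\<^sub>k g\<close> once the series converges absolutely. Absolute
  convergence has to be uniform in \<open>\<omega>\<close>, although nothing bounds the frames \<open>A\<^sub>\<omega>\<close>. By duality it
  suffices to bound finite sums with unimodular coefficients. Writing \<open>f\<close> as a product of
  resolvents of left-invariant fields applied to another Schwartz function trades the pointwise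
  bound for an \<open>L\<^sup>2\<close> bound, and there Bessel's inequality holds with a constant that does not
  see the frame. The resolvent commutes with every projection because left-invariant flows
  become twisted translations.

  Fourier inversion on \<open>\<zz>\<close> in polar coordinates \<open>\<eta> = \<lambda>\<omega>\<close> then expands \<open>f\<close> in \<open>(\<lambda>, \<omega>, k)\<close>, and
  the substitution \<open>\<lambda> = \<mu>\<^sub>k(\<mu>)\<close>, carried out for each \<open>k\<close> separately, produces the expansion in
  \<open>\<mu>\<close>. On the components of \<open>\<P>\<^sub>\<mu> f\<close> the multiplier takes the constant value \<open>\<mu>\<close>.
\<close>

section \<open>Gaussian integrals and Fourier inversion\<close>

text \<open>Everything about the projections comes from one Gaussian identity, K_t K_s = K_{ts} for
  the Mehler kernels: comparing coefficients of t^j s^k makes the Laguerre kernels idempotent and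
  mutually orthogonal. Termwise integration is at first possible only for |t| \<le> 1/4, where a
  Gaussian majorant exists; the projection property then gives |\<phi>_k(w)| \<le> \<phi>_k(0), and
  this reaches every t < 1. The frames are merely measurable and the symplectic group is not
  compact, so a bound through the size of \<open>A \<omega>\<close> could not be integrated over the
  sphere. An L^2 norm sees a frame only through its Jacobian, which cancels in Bessel's inequality.
  One resolvent per direction of the complement passes from a point value to an L^2 norm, and two
  per central direction give an integrable weight in \<eta>. The resulting bound for the sum over k
  is uniform in V and in the frame, and it justifies every exchange of sums and integrals. The
  branches \<mu>_k are unrelated to each other, so Tonelli's theorem yields convergence for almost
  every \<mu> only, although the expansion itself holds at every point.\<close>

lemma cis_sum: "finite A \<Longrightarrow> cis (sum f A) = (\<Prod>a\<in>A. cis (f a))"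
  by (induction A rule: finite_induct) (auto simp flip: cis_mult)

lemma borel_measurable_cis [measurable (raw)]:
  "f \<in> borel_measurable M \<Longrightarrow> (\<lambda>x. cis (f x)) \<in> borel_measurable M"
  by (rule measurable_compose[where N=borel])
     (auto intro!: borel_measurable_continuous_onI continuous_intros)

lemma norm_square_Basis: "(norm (x::'a::euclidean_space))\<^sup>2 = (\<Sum>b\<in>Basis. (x \<bullet> b)\<^sup>2)"
  by (subst power2_norm_eq_inner, subst euclidean_inner) (simp add: power2_eq_square)

text \<open>Lebesgue measure is the image of the product measure over \<open>Basis\<close>. Gaussian
  integrals and the weight \<open>cauchy_weight\<close> reduce to dimension one through
  this.\<close>

lemma
  fixes g :: "'a::euclidean_space \<Rightarrow> real \<Rightarrow> 'c::{real_normed_field,banach,second_countable_topology}"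
  assumes int: "\<And>b. b \<in> Basis \<Longrightarrow> integrable lborel (g b)"
  shows integrable_lborel_prod: "integrable lborel (\<lambda>x::'a. \<Prod>b\<in>Basis. g b (x \<bullet> b))" (is ?A)
    and integral_lborel_prod:
      "(LINT x|lborel. (\<Prod>b\<in>Basis. g b ((x::'a) \<bullet> b))) = (\<Prod>b\<in>Basis. (LINT t|lborel. g b t))" (is ?B)
proof -
  interpret P: product_sigma_finite "\<lambda>_::'a. lborel :: real measure" ..
  have m [measurable]: "g b \<in> borel_measurable borel" if "b \<in> Basis" for b
    using borel_measurable_integrable[OF int[OF that]] by simp
  have m1: "(\<lambda>f. \<Sum>b\<in>Basis. f b *\<^sub>R b) \<in> (\<Pi>\<^sub>M b\<in>Basis. lborel) \<rightarrow>\<^sub>M (borel :: 'a measure)"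
    by measurable
  have m2: "(\<lambda>x::'a. \<Prod>b\<in>Basis. g b (x \<bullet> b)) \<in> borel_measurable borel"
    by measurable
  have eq: "(\<Prod>b\<in>Basis. g b ((\<Sum>b\<in>Basis. f b *\<^sub>R b) \<bullet> b)) = (\<Prod>b\<in>Basis. g b (f b))" for f :: "'a \<Rightarrow> real"
    by (intro prod.cong refl) (simp add: inner_sum_left_Basis)
  show ?A
    by (subst lborel_eq, subst integrable_distr_eq[OF m1 m2], unfold eq)
       (intro P.product_integrable_prod int; simp)
  show ?B
    by (subst lborel_eq, subst integral_distr[OF m1 m2], unfold eq)
       (intro P.product_integral_prod int; simp)
qed

text \<open>The characteristic function of the standard normal law, rescaled by \<open>s\<close> =
  sqrt(2a), which turns exp(-x^2/2) into exp(-a x^2).\<close>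

lemma gauss_fourier_real:
  fixes a b :: real
  assumes a: "a > 0"
  shows "has_bochner_integral lborel (\<lambda>x. of_real (exp (- a * x\<^sup>2)) * cis (b * x))
    (complex_of_real (sqrt (pi / a) * exp (- b\<^sup>2 / (4 * a))))"
proof -
  define s where "s = sqrt (2 * a)"
  have s: "s > 0" "s\<^sup>2 = 2 * a" using a by (auto simp: s_def)
  have *: "(LINT x|lborel. std_normal_density x *\<^sub>R cis (t * x)) = complex_of_real (exp (- (t^2) / 2))" for t
  proof -
    have "(CLINT x|std_normal_distribution. iexp (t * x)) = complex_of_real (exp (- (t^2) / 2))"
      using char_std_normal_distribution by (simp add: char_def fun_eq_iff)
    then show ?thesis
      by (subst (asm) integral_density) (auto simp: cis_conv_exp)
  qed
  have i: "integrable lborel (\<lambda>x. std_normal_density x *\<^sub>R cis (t * x))" for t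
    by (rule Bochner_Integration.integrable_bound[of _ std_normal_density])
       (auto simp: norm_mult)
  have e: "std_normal_density (s * x) *\<^sub>R cis (b / s * (s * x)) =
     of_real (1 / sqrt (2 * pi)) * (of_real (exp (- a * x\<^sup>2)) * cis (b * x))" for x
    using s by (simp add: std_normal_density_def power_mult_distrib scaleR_conv_of_real)
  have hb: "has_bochner_integral lborel (\<lambda>x. std_normal_density x *\<^sub>R cis (b / s * x))
      (complex_of_real (exp (- ((b/s)^2) / 2)))"
    using i[of "b/s"] *[of "b/s"] by (simp add: has_bochner_integral_iff)
  have "has_bochner_integral lborel (\<lambda>x. std_normal_density (0 + s * x) *\<^sub>R cis (b / s * (0 + s * x)))
      (complex_of_real (exp (- ((b/s)^2) / 2)) /\<^sub>R \<bar>s\<bar>)"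
    by (rule iffD1[OF lborel_has_bochner_integral_real_affine_iff hb]) (use s in simp)
  then have "has_bochner_integral lborel (\<lambda>x. of_real (1 / sqrt (2 * pi)) * (of_real (exp (- a * x\<^sup>2)) * cis (b * x)))
      (complex_of_real (exp (- ((b/s)^2) / 2)) /\<^sub>R \<bar>s\<bar>)"
    unfolding add_0 e .
  then have "has_bochner_integral lborel (\<lambda>x. of_real (sqrt (2 * pi)) * (of_real (1 / sqrt (2 * pi)) * (of_real (exp (- a * x\<^sup>2)) * cis (b * x))))
      (of_real (sqrt (2 * pi)) * (complex_of_real (exp (- ((b/s)^2) / 2)) /\<^sub>R \<bar>s\<bar>))"
    by (rule has_bochner_integral_mult_right)
  moreover have "sqrt (2 * pi) / s = sqrt (pi / a)"
    by (simp add: s_def real_sqrt_divide real_sqrt_mult)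
  then have "of_real (sqrt (2 * pi)) * (complex_of_real (exp (- ((b/s)^2) / 2)) /\<^sub>R \<bar>s\<bar>)
     = complex_of_real (sqrt (pi / a) * exp (- b\<^sup>2 / (4 * a)))"
    using s by (simp add: scaleR_conv_of_real power_divide field_simps flip: of_real_mult)
  moreover have "complex_of_real (sqrt (2 * pi)) * (of_real (1 / sqrt (2 * pi)) * w) = w" for w
    by (simp flip: mult.assoc of_real_mult)
  ultimately show ?thesis by simp
qed

lemma gauss_fourier:
  fixes b :: "'a::euclidean_space"
  assumes a: "a > 0"
  shows "has_bochner_integral lborel (\<lambda>x::'a. of_real (exp (- a * (norm x)\<^sup>2)) * cis (b \<bullet> x))
    (complex_of_real (sqrt (pi / a) ^ DIM('a) * exp (- (norm b)\<^sup>2 / (4 * a))))"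
proof -
  note g = gauss_fourier_real[OF a]
  have e: "of_real (exp (- a * (norm x)\<^sup>2)) * cis (b \<bullet> x) =
      (\<Prod>i\<in>Basis. of_real (exp (- a * (x \<bullet> i)\<^sup>2)) * cis ((b \<bullet> i) * (x \<bullet> i)))" for x :: 'a
    by (simp add: norm_square_Basis euclidean_inner[of b x] cis_sum prod.distrib sum_distrib_left exp_sum
        flip: of_real_prod)
  have "(\<Prod>i\<in>(Basis::'a set). complex_of_real (sqrt (pi / a) * exp (- (b \<bullet> i)\<^sup>2 / (4 * a)))) =
     complex_of_real (sqrt (pi / a) ^ DIM('a) * exp (- (norm b)\<^sup>2 / (4 * a)))"
    by (simp add: norm_square_Basis[of b] prod.distrib sum_divide_distrib sum_negf[symmetric] exp_sum
        del: sum_negf flip: of_real_prod)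
  with integrable_lborel_prod[of "\<lambda>i t. of_real (exp (- a * t\<^sup>2)) * cis ((b \<bullet> i) * t)"]
    integral_lborel_prod[of "\<lambda>i t. of_real (exp (- a * t\<^sup>2)) * cis ((b \<bullet> i) * t)"] g
  show ?thesis unfolding e by (simp add: has_bochner_integral_iff)
qed

lemma gauss_integral:
  assumes a: "a > 0"
  shows "has_bochner_integral lborel (\<lambda>x::'a::euclidean_space. exp (- a * (norm x)\<^sup>2)) (sqrt (pi / a) ^ DIM('a))"
proof -
  have "has_bochner_integral lborel (\<lambda>x::'a. Re (of_real (exp (- a * (norm x)\<^sup>2)) * cis (0 \<bullet> x)))
     (Re (complex_of_real (sqrt (pi / a) ^ DIM('a) * exp (- (norm (0::'a))\<^sup>2 / (4 * a)))))"
    by (rule has_bochner_integral_bounded_linear[OF bounded_linear_Re gauss_fourier[OF a]])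
  then show ?thesis by (simp flip: of_real_power)
qed

lemma integral_lborel_affine:
  fixes f :: "'a::euclidean_space \<Rightarrow> 'b::{banach, second_countable_topology}"
  assumes c: "c \<noteq> 0" and f: "f \<in> borel_measurable borel"
  shows "(LINT x|lborel. f x) = \<bar>c\<bar> ^ DIM('a) *\<^sub>R (LINT x|lborel. f (t + c *\<^sub>R x))"
  using f by (subst lborel_affine[OF c, of t]) (simp add: integral_density integral_distr)

lemma integral_lborel_translate:
  fixes f :: "'a::euclidean_space \<Rightarrow> 'b::{banach, second_countable_topology}"
  assumes f: "f \<in> borel_measurable borel"
  shows "(LINT x|lborel. f (t + x)) = (LINT x|lborel. f x)"
  using integral_lborel_affine[of 1 f t] f by simp

lemma integral_lborel_reflect:
  fixes f :: "'a::euclidean_space \<Rightarrow> 'b::{banach, second_countable_topology}"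
  assumes f: "f \<in> borel_measurable borel"
  shows "(LINT x|lborel. f (t - x)) = (LINT x|lborel. f x)"
  using integral_lborel_affine[of "-1" f t] f by simp

lemma integrable_lborel_affine:
  fixes f :: "'a::euclidean_space \<Rightarrow> 'b::{banach, second_countable_topology}"
  assumes c: "c \<noteq> 0" and f: "integrable lborel f"
  shows "integrable lborel (\<lambda>x. f (t + c *\<^sub>R x))"
proof -
  have m: "f \<in> borel_measurable borel" using borel_measurable_integrable[OF f] by simp
  have "integrable (density (distr lborel borel (\<lambda>x. t + c *\<^sub>R x)) (\<lambda>_. ennreal (\<bar>c\<bar> ^ DIM('a)))) f"
    using f by (subst (asm) lborel_affine[OF c, of t]) (simp add: ennreal_power)
  then have "integrable lborel (\<lambda>x. \<bar>c\<bar> ^ DIM('a) *\<^sub>R f (t + c *\<^sub>R x))"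
    using m by (simp add: integrable_density integrable_distr_eq)
  then have "integrable lborel (\<lambda>x. (1 / \<bar>c\<bar> ^ DIM('a)) *\<^sub>R (\<bar>c\<bar> ^ DIM('a) *\<^sub>R f (t + c *\<^sub>R x)))"
    by (rule integrable_scaleR_right)
  then show ?thesis using c by simp
qed

lemma integrable_lborel_reflect:
  fixes f :: "'a::euclidean_space \<Rightarrow> 'b::{banach, second_countable_topology}"
  assumes f: "integrable lborel f"
  shows "integrable lborel (\<lambda>x. f (t - x))"
  using integrable_lborel_affine[of "-1" f t] f by simp

lemma nn_integral_lborel_affine:
  fixes f :: "'a::euclidean_space \<Rightarrow> ennreal"
  assumes c: "c \<noteq> 0" and f: "f \<in> borel_measurable borel"
  shows "(\<integral>\<^sup>+x. f x \<partial>lborel) = ennreal (\<bar>c\<bar> ^ DIM('a)) * (\<integral>\<^sup>+x. f (t + c *\<^sub>R x) \<partial>lborel)"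
  using f by (subst lborel_affine[OF c, of t]) (simp add: nn_integral_density nn_integral_distr nn_integral_cmult)

lemma nn_integral_lborel_translate:
  fixes f :: "'a::euclidean_space \<Rightarrow> ennreal"
  assumes f: "f \<in> borel_measurable borel"
  shows "(\<integral>\<^sup>+x. f (t + x) \<partial>lborel) = (\<integral>\<^sup>+x. f x \<partial>lborel)"
  using nn_integral_lborel_affine[of 1 f t] f by simp

text \<open>In the rescaled variable the Gaussian stays fixed while \<open>h\<close> is sampled ever
  closer to \<open>x\<close>, so B times the Gaussian is a majorant for dominated convergence. It
  serves for Fourier inversion and again for the Mehler kernels as t tends to 1.\<close>

lemma gauss_approximate_identity:
  fixes h :: "'a::euclidean_space \<Rightarrow> complex"
  assumes h: "isCont h x" and [measurable]: "h \<in> borel_measurable borel" and B: "\<And>y. norm (h y) \<le> B"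
    and e: "e \<longlonglongrightarrow> 0"
  shows "(\<lambda>n::nat. LINT u|lborel. of_real (exp (- (norm u)\<^sup>2)) * h (x + e n *\<^sub>R u)) \<longlonglongrightarrow>
    of_real (sqrt pi ^ DIM('a)) * h x"
proof -
  note g = gauss_integral[of 1, where 'a='a, simplified]
  have i: "integrable lborel (\<lambda>u::'a. exp (- (norm u)\<^sup>2))"
    and v: "(LINT u|lborel. exp (- (norm (u::'a))\<^sup>2)) = sqrt pi ^ DIM('a)"
    using g by (auto simp: has_bochner_integral_iff)
  have "(\<lambda>n::nat. LINT u|lborel. of_real (exp (- (norm u)\<^sup>2)) * h (x + e n *\<^sub>R u)) \<longlonglongrightarrow>
     (LINT u|lborel. of_real (exp (- (norm (u::'a))\<^sup>2)) * h x)"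
  proof (rule integral_dominated_convergence[where w="\<lambda>u. B * exp (- (norm u)\<^sup>2)"])
    show "integrable lborel (\<lambda>u::'a. B * exp (- (norm u)\<^sup>2))" using i by simp
    show "AE u in lborel. (\<lambda>n. complex_of_real (exp (- (norm u)\<^sup>2)) * h (x + e n *\<^sub>R u))
        \<longlonglongrightarrow> complex_of_real (exp (- (norm (u::'a))\<^sup>2)) * h x"
    proof (intro AE_I2 tendsto_mult_left)
      fix u :: 'a
      have "(\<lambda>n. x + e n *\<^sub>R u) \<longlonglongrightarrow> x + 0 *\<^sub>R u" by (intro tendsto_intros e)
      then show "(\<lambda>n. h (x + e n *\<^sub>R u)) \<longlonglongrightarrow> h x"
        using isCont_tendsto_compose[OF h] by simp
    qed
    show "AE u in lborel. norm (complex_of_real (exp (- (norm u)\<^sup>2)) * h (x + e n *\<^sub>R u))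
        \<le> B * exp (- (norm (u::'a))\<^sup>2)" for n
      using B by (auto simp: norm_mult mult.commute intro!: mult_right_mono)
  qed auto
  also have "(LINT u|lborel. of_real (exp (- (norm (u::'a))\<^sup>2)) * h x) = of_real (sqrt pi ^ DIM('a)) * h x"
    using v by (simp del: of_real_power)
  finally show ?thesis .
qed

lemma gauss_convolution:
  fixes h :: "'a::euclidean_space \<Rightarrow> complex"
  assumes a: "a > 0" and [measurable]: "h \<in> borel_measurable borel"
  shows "(LINT y|lborel. of_real (exp (- a * (norm (x - y))\<^sup>2)) * h y) =
     of_real ((1 / sqrt a) ^ DIM('a)) * (LINT u|lborel. of_real (exp (- (norm u)\<^sup>2)) * h (x + (1 / sqrt a) *\<^sub>R u))"
proof -
  have e: "- a * (norm (x - (x + (1 / sqrt a) *\<^sub>R u)))\<^sup>2 = - (norm u)\<^sup>2" for u :: 'a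
    using a by (simp add: power_divide)
  show ?thesis
    using a by (subst integral_lborel_affine[of "1 / sqrt a" _ x]) 
      (auto simp only: e, auto simp: scaleR_conv_of_real)
qed


lemma (in pair_sigma_finite) integrable_product_mult:
  fixes f :: "'a \<Rightarrow> 'c::{real_normed_field,banach,second_countable_topology}"
  assumes f: "integrable M1 f" and g: "integrable M2 g"
  shows "integrable (M1 \<Otimes>\<^sub>M M2) (\<lambda>(x, y). f x * g y)"
proof (rule Fubini_integrable)
  show "(\<lambda>(x, y). f x * g y) \<in> borel_measurable (M1 \<Otimes>\<^sub>M M2)"
    using f g by (auto dest!: borel_measurable_integrable)
qed (use f g in \<open>auto simp: norm_mult\<close>)

text \<open>The inverse integral is damped by exp(-a |\<eta>|^2) with a tending to 0 and evaluated
  in two ways: directly by dominated convergence, and after Fubini as a Gaussian average of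
  \<open>\<phi>\<close> around \<open>x\<close> of width 2 sqrt(a).\<close>

lemma fourier_inversion:
  fixes \<phi> :: "'a::euclidean_space \<Rightarrow> complex"
  defines "\<psi> \<equiv> \<lambda>\<eta>. LINT x|lborel. cis (\<eta> \<bullet> x) * \<phi> x"
  assumes cont: "continuous_on UNIV \<phi>" and B: "\<And>y. norm (\<phi> y) \<le> B"
    and int: "integrable lborel \<phi>" and inth: "integrable lborel \<psi>"
  shows "(LINT \<eta>|lborel. cis (- (\<eta> \<bullet> x)) * \<psi> \<eta>) = of_real ((2 * pi) ^ DIM('a)) * \<phi> x"
proof -
  have [measurable]: "\<phi> \<in> borel_measurable borel" "\<psi> \<in> borel_measurable borel"
    using int inth by (auto dest!: borel_measurable_integrable)
  define a where "a = (\<lambda>n. 1 / real (Suc n))"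
  have apos: "a n > 0" for n by (simp add: a_def)
  have a0: "a \<longlonglongrightarrow> 0" unfolding a_def using LIMSEQ_Suc[OF lim_1_over_n[where 'a=real]] by simp
  define I where "I = (\<lambda>n. LINT \<eta>|lborel. of_real (exp (- a n * (norm \<eta>)\<^sup>2)) * (cis (- (\<eta> \<bullet> x)) * \<psi> \<eta>))"
  have "I \<longlonglongrightarrow> (LINT \<eta>|lborel. cis (- (\<eta> \<bullet> x)) * \<psi> \<eta>)"
    unfolding I_def
  proof (rule integral_dominated_convergence[where w="\<lambda>\<eta>. norm (\<psi> \<eta>)"])
    show "AE \<eta> in lborel. (\<lambda>n. complex_of_real (exp (- a n * (norm \<eta>)\<^sup>2)) * (cis (- (\<eta> \<bullet> x)) * \<psi> \<eta>))
       \<longlonglongrightarrow> cis (- (\<eta> \<bullet> x)) * \<psi> \<eta>"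
    proof (rule AE_I2)
      fix \<eta> :: 'a
      have "(\<lambda>n. complex_of_real (exp (- a n * (norm \<eta>)\<^sup>2)) * (cis (- (\<eta> \<bullet> x)) * \<psi> \<eta>))
       \<longlonglongrightarrow> complex_of_real (exp (- 0 * (norm \<eta>)\<^sup>2)) * (cis (- (\<eta> \<bullet> x)) * \<psi> \<eta>)"
        by (intro tendsto_intros a0)
      then show "(\<lambda>n. complex_of_real (exp (- a n * (norm \<eta>)\<^sup>2)) * (cis (- (\<eta> \<bullet> x)) * \<psi> \<eta>))
       \<longlonglongrightarrow> cis (- (\<eta> \<bullet> x)) * \<psi> \<eta>" by simp
    qed
    show "AE \<eta> in lborel. norm (complex_of_real (exp (- a n * (norm \<eta>)\<^sup>2)) * (cis (- (\<eta> \<bullet> x)) * \<psi> \<eta>))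
       \<le> norm (\<psi> \<eta>)" for n
      using apos[of n] by (auto simp: norm_mult mult_le_cancel_right2)
  qed (use inth in auto)
  moreover have "I n = of_real ((2 * sqrt pi) ^ DIM('a)) *
      (LINT u|lborel. of_real (exp (- (norm u)\<^sup>2)) * \<phi> (x + (2 * sqrt (a n)) *\<^sub>R u))" for n
  proof -
    have an: "a n > 0" by (rule apos)
    have g: "integrable lborel (\<lambda>\<eta>::'a. exp (- a n * (norm \<eta>)\<^sup>2))"
      using gauss_integral[OF an] by (auto simp: has_bochner_integral_iff)
    let ?F = "\<lambda>\<eta> y. of_real (exp (- a n * (norm \<eta>)\<^sup>2)) * cis (\<eta> \<bullet> (y - x)) * \<phi> y"
    have "integrable (lborel \<Otimes>\<^sub>M lborel) (\<lambda>(\<eta>::'a, y). exp (- a n * (norm \<eta>)\<^sup>2) * norm (\<phi> y))"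
      using g int by (intro lborel_pair.integrable_product_mult integrable_norm; simp)
    then have i2: "integrable (lborel \<Otimes>\<^sub>M lborel) (\<lambda>(\<eta>, y). ?F \<eta> y)"
      by (rule Bochner_Integration.integrable_bound) (auto simp: norm_mult)
    have "of_real (exp (- a n * (norm \<eta>)\<^sup>2)) * (cis (- (\<eta> \<bullet> x)) * \<psi> \<eta>) = (LINT y|lborel. ?F \<eta> y)" for \<eta>
    proof -
      have "?F \<eta> y = of_real (exp (- a n * (norm \<eta>)\<^sup>2)) * (cis (- (\<eta> \<bullet> x)) * (cis (\<eta> \<bullet> y) * \<phi> y))" for y
        by (simp add: inner_diff_right mult.assoc[symmetric] mult.assoc[of _ "cis _" "cis _"] cis_mult)
      then show ?thesis by (simp only: \<psi>_def integral_mult_right_zero)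
    qed
    then have "I n = (LINT \<eta>|lborel. LINT y|lborel. ?F \<eta> y)"
      unfolding I_def by simp
    also have "\<dots> = (LINT y|lborel. LINT \<eta>|lborel. ?F \<eta> y)"
      using lborel_pair.Fubini_integral[OF i2] by simp
    also have "\<dots> = (LINT y|lborel. of_real (sqrt (pi / a n) ^ DIM('a)) *
        (of_real (exp (- (1 / (4 * a n)) * (norm (x - y))\<^sup>2)) * \<phi> y))"
    proof (intro Bochner_Integration.integral_cong refl)
      fix y
      have "(LINT \<eta>|lborel. ?F \<eta> y) = (LINT \<eta>|lborel. of_real (exp (- a n * (norm \<eta>)\<^sup>2)) * cis ((y - x) \<bullet> \<eta>)) * \<phi> y"
        by (simp add: inner_commute)
      also have "\<dots> = complex_of_real (sqrt (pi / a n) ^ DIM('a) * exp (- (norm (y - x))\<^sup>2 / (4 * a n))) * \<phi> y"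
        using gauss_fourier[OF an, of "y - x"] by (simp add: has_bochner_integral_iff del: of_real_mult)
      finally show "(LINT \<eta>|lborel. ?F \<eta> y) = of_real (sqrt (pi / a n) ^ DIM('a)) *
        (of_real (exp (- (1 / (4 * a n)) * (norm (x - y))\<^sup>2)) * \<phi> y)"
        by (simp add: norm_minus_commute)
    qed
    also have "\<dots> = of_real (sqrt (pi / a n) ^ DIM('a)) * (of_real ((1 / sqrt (1 / (4 * a n))) ^ DIM('a)) *
       (LINT u|lborel. of_real (exp (- (norm u)\<^sup>2)) * \<phi> (x + (1 / sqrt (1 / (4 * a n))) *\<^sub>R u)))"
      unfolding integral_mult_right_zero
      by (subst gauss_convolution) (use an in auto)
    also have "1 / sqrt (1 / (4 * a n)) = 2 * sqrt (a n)"
      using an by (simp add: real_sqrt_divide real_sqrt_mult)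
    also have "of_real (sqrt (pi / a n) ^ DIM('a)) * (of_real ((2 * sqrt (a n)) ^ DIM('a)) * w) =
        of_real ((2 * sqrt pi) ^ DIM('a)) * w" for w :: complex
    proof -
      have "sqrt (pi / a n) ^ DIM('a) * (2 * sqrt (a n)) ^ DIM('a) = (2 * sqrt pi) ^ DIM('a)"
        unfolding power_mult_distrib[symmetric] using an by (simp add: real_sqrt_divide)
      then show ?thesis by (metis mult.assoc of_real_mult)
    qed
    finally show ?thesis .
  qed
  then have "I = (\<lambda>n. of_real ((2 * sqrt pi) ^ DIM('a)) *
      (LINT u|lborel. of_real (exp (- (norm u)\<^sup>2)) * \<phi> (x + (2 * sqrt (a n)) *\<^sub>R u)))"
    by (rule ext)
  moreover have "(\<lambda>n. of_real ((2 * sqrt pi) ^ DIM('a)) *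
      (LINT u|lborel. of_real (exp (- (norm u)\<^sup>2)) * \<phi> (x + (2 * sqrt (a n)) *\<^sub>R u))) \<longlonglongrightarrow>
      of_real ((2 * sqrt pi) ^ DIM('a)) * (of_real (sqrt pi ^ DIM('a)) * \<phi> x)"
  proof (intro tendsto_mult_left gauss_approximate_identity[where B=B])
    show "(\<lambda>n. 2 * sqrt (a n)) \<longlonglongrightarrow> 0"
      using tendsto_mult_left[OF tendsto_real_sqrt[OF a0], of 2] by simp
    show "isCont \<phi> x" using cont by (simp add: continuous_on_eq_continuous_at)
  qed (use B in auto)
  ultimately have "(LINT \<eta>|lborel. cis (- (\<eta> \<bullet> x)) * \<psi> \<eta>) =
     of_real ((2 * sqrt pi) ^ DIM('a)) * (of_real (sqrt pi ^ DIM('a)) * \<phi> x)"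
    by (metis LIMSEQ_unique)
  moreover have "(2 * sqrt pi) ^ DIM('a) * sqrt pi ^ DIM('a) = (2 * pi) ^ DIM('a)"
    unfolding power_mult_distrib[symmetric] by (simp add: mult.assoc)
  ultimately show ?thesis by (metis mult.assoc of_real_mult)
qed

section \<open>Linear changes of variables for Lebesgue measure\<close>

lemma linear_inv:
  assumes "linear L" "bij L"
  shows "linear (inv L)"
proof (rule linearI)
  note s = surj_f_inv_f[OF bij_is_surj[OF assms(2)]] and i = inv_f_eq[OF bij_is_inj[OF assms(2)]]
  show "inv L (x + y) = inv L x + inv L y" for x y
    by (rule i) (simp add: linear_add[OF assms(1)] s)
  show "inv L (c *\<^sub>R x) = c *\<^sub>R inv L x" for c x
    by (rule i) (simp add: linear_cmul[OF assms(1)] s)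
qed

lemma emeasure_lborel_open_bounded:
  fixes S :: "'a::euclidean_space set"
  assumes "open S" "bounded S" "S \<noteq> {}"
  shows "emeasure lborel S \<noteq> \<infinity>" "emeasure lborel S \<noteq> 0"
  using assms emeasure_bounded_finite[of S] open_not_negligible[of S]
  by (auto simp: negligible_iff_null_sets null_sets_def)

text \<open>The uniqueness argument for Haar measure: pairing f(Lx) with a fixed test function
  \<open>g\<close> and translating in each variable shows that both integrals are proportional. As
  \<open>L\<close> joins different Euclidean types, the factor is left as a bare constant instead of
  a determinant.\<close>

lemma lborel_linear_image:
  fixes L :: "'a::euclidean_space \<Rightarrow> 'b::euclidean_space"
  assumes lin: "linear L" and bij: "bij L"
  obtains c :: real where "c > 0" "\<And>f. f \<in> borel_measurable borel \<Longrightarrow>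
     (\<integral>\<^sup>+y. f y \<partial>lborel) = ennreal c * (\<integral>\<^sup>+x. f (L x) \<partial>lborel)"
proof -
  have Lm [measurable]: "L \<in> borel_measurable borel"
    using lin by (intro borel_measurable_continuous_onI linear_continuous_on linear_conv_bounded_linear[THEN iffD1])
  \<comment> \<open>The unit ball is a good test set: it is symmetric, which the translations below
    use, and both it and its preimage under \<open>L\<close> have finite nonzero measure.\<close>
  define g :: "'b \<Rightarrow> ennreal" where "g = indicator (ball 0 1)"
  have g[measurable]: "g \<in> borel_measurable borel" unfolding g_def by (rule borel_measurable_indicator) simp
  have gm: "g (- y) = g y" for y by (simp add: g_def indicator_def)
  have main: "(\<integral>\<^sup>+x. f (L x) \<partial>lborel) * (\<integral>\<^sup>+y. g y \<partial>lborel) = (\<integral>\<^sup>+x. g (L x) \<partial>lborel) * (\<integral>\<^sup>+y. f y \<partial>lborel)"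
    if [measurable]: "f \<in> borel_measurable borel" for f
  proof -
    have "(\<integral>\<^sup>+x. f (L x) \<partial>lborel) * (\<integral>\<^sup>+y. g y \<partial>lborel) = (\<integral>\<^sup>+x. \<integral>\<^sup>+y. f (L x) * g y \<partial>lborel \<partial>lborel)"
      by (simp add: nn_integral_cmult nn_integral_multc)
    also have "\<dots> = (\<integral>\<^sup>+x. \<integral>\<^sup>+y. f (L x) * g (- L x + y) \<partial>lborel \<partial>lborel)"
    proof (rule nn_integral_cong)
      fix x
      show "(\<integral>\<^sup>+y. f (L x) * g y \<partial>lborel) = (\<integral>\<^sup>+y. f (L x) * g (- L x + y) \<partial>lborel)"
        using nn_integral_lborel_translate[of "\<lambda>y. f (L x) * g y" "- L x"] by simp
    qed
    also have "\<dots> = (\<integral>\<^sup>+y. \<integral>\<^sup>+x. f (L x) * g (- L x + y) \<partial>lborel \<partial>lborel)"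
      by (rule lborel_pair.Fubini'[symmetric]) measurable
    also have "\<dots> = (\<integral>\<^sup>+y. \<integral>\<^sup>+x. f (y + L x) * g (L x) \<partial>lborel \<partial>lborel)"
    proof (rule nn_integral_cong)
      fix y
      \<comment> \<open>Shifting x by \<open>t\<close> shifts L x by \<open>y\<close>, after which
        \<open>g\<close> no longer contains \<open>y\<close> and the two integrals separate.\<close>
      obtain t where t: "L t = y" using bij by (metis bij_pointE)
      have "(\<integral>\<^sup>+x. f (L x) * g (- L x + y) \<partial>lborel) = (\<integral>\<^sup>+x. f (L (t + x)) * g (- L (t + x) + y) \<partial>lborel)"
        by (subst nn_integral_lborel_translate[where f="\<lambda>x. f (L x) * g (- L x + y)"]) auto
      also have "\<dots> = (\<integral>\<^sup>+x. f (y + L x) * g (- L x) \<partial>lborel)"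
        using lin by (simp add: linear_add t)
      finally show "(\<integral>\<^sup>+x. f (L x) * g (- L x + y) \<partial>lborel) = (\<integral>\<^sup>+x. f (y + L x) * g (L x) \<partial>lborel)"
        by (simp add: gm)
    qed
    also have "\<dots> = (\<integral>\<^sup>+x. \<integral>\<^sup>+y. f (y + L x) * g (L x) \<partial>lborel \<partial>lborel)"
      by (rule lborel_pair.Fubini') measurable
    also have "\<dots> = (\<integral>\<^sup>+x. g (L x) * (\<integral>\<^sup>+y. f y \<partial>lborel) \<partial>lborel)"
    proof (rule nn_integral_cong)
      fix x
      show "(\<integral>\<^sup>+y. f (y + L x) * g (L x) \<partial>lborel) = g (L x) * (\<integral>\<^sup>+y. f y \<partial>lborel)"
        using nn_integral_lborel_translate[of f "L x"]
        by (subst nn_integral_multc) (auto simp: add.commute mult.commute)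
    qed
    also have "\<dots> = (\<integral>\<^sup>+x. g (L x) \<partial>lborel) * (\<integral>\<^sup>+y. f y \<partial>lborel)"
      by (rule nn_integral_multc) measurable
    finally show ?thesis .
  qed
  define p where "p = (\<integral>\<^sup>+y. g y \<partial>lborel)"
  define q where "q = (\<integral>\<^sup>+x. g (L x) \<partial>lborel)"
  have p: "p \<noteq> \<infinity>" "p \<noteq> 0"
    using emeasure_lborel_open_bounded[of "ball (0::'b) 1"] by (auto simp: p_def g_def)
  have q': "q = emeasure lborel (L -` ball 0 1)"
  proof -
    have "(\<lambda>x. indicator (ball 0 1) (L x) :: ennreal) = indicator (L -` ball 0 1)"
      by (auto simp: indicator_def)
    then show ?thesis
      using measurable_sets[OF Lm, of "ball 0 1"] by (simp add: q_def g_def)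
  qed
  have "bounded (L -` ball 0 1)"
  proof -
    have "L -` ball 0 1 = inv L ` ball 0 1" using bij by (rule bij_vimage_eq_inv_image)
    moreover have "linear (inv L)" using lin bij by (rule linear_inv)
    ultimately show ?thesis by (simp add: bounded_linear_image linear_conv_bounded_linear)
  qed
  moreover have "open (L -` ball 0 1)"
    using lin by (intro continuous_open_vimage) (auto intro: linear_continuous_at simp: linear_conv_bounded_linear)
  moreover have "0 \<in> L -` ball 0 1" using lin by (simp add: linear_0)
  ultimately have q: "q \<noteq> \<infinity>" "q \<noteq> 0"
    unfolding q' using emeasure_lborel_open_bounded[of "L -` ball 0 1"] by blast+
  define c where "c = enn2real p / enn2real q"
  have c: "c > 0" using p q unfolding c_def
    by (intro divide_pos_pos) (auto simp: enn2real_positive_iff top.not_eq_extremum zero_less_iff_neq_zero)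
  have cq: "ennreal c * q = p"
    using p q by (cases p; cases q) (auto simp: c_def ennreal_mult[symmetric] simp flip: ennreal_mult)
  show ?thesis
  proof (rule that[OF c])
    fix f :: "'b \<Rightarrow> ennreal" assume f: "f \<in> borel_measurable borel"
    have "(\<integral>\<^sup>+x. f (L x) \<partial>lborel) * (ennreal c * q) = q * (\<integral>\<^sup>+y. f y \<partial>lborel)"
      unfolding cq using main[OF f] by (simp only: p_def q_def)
    then have "q * (ennreal c * (\<integral>\<^sup>+x. f (L x) \<partial>lborel)) = q * (\<integral>\<^sup>+y. f y \<partial>lborel)"
      by (simp add: mult_ac)
    then show "(\<integral>\<^sup>+y. f y \<partial>lborel) = ennreal c * (\<integral>\<^sup>+x. f (L x) \<partial>lborel)"
      using q by (metis ennreal_mult_cancel_left infinity_ennreal_def)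
  qed
qed

section \<open>Laguerre functions and Mehler kernels\<close>

text \<open>Induction on \<open>m\<close>: each series is the Cauchy product of the previous one
  with the geometric series, and the coefficients add up by the hockey-stick identity. Both claims
  are proved together because the Cauchy product needs absolute summability of the previous
  series.\<close>

lemma negative_binomial_sums:
  fixes t :: real
  assumes "\<bar>t\<bar> < 1"
  shows "(\<lambda>j. real ((m + j) choose j) * t ^ j) sums (1 / (1 - t) ^ Suc m)"
    and "summable (\<lambda>j. \<bar>real ((m + j) choose j) * t ^ j\<bar>)"
proof -
  have "(\<lambda>j. real ((m + j) choose j) * t ^ j) sums (1 / (1 - t) ^ Suc m) \<and>
     summable (\<lambda>j. \<bar>real ((m + j) choose j) * t ^ j\<bar>)" if t: "\<bar>t\<bar> < 1" for t :: real
    using t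
  proof (induction m arbitrary: t)
    case 0
    then show ?case using geometric_sums[of t] summable_geometric[of "\<bar>t\<bar>"]
      by (simp add: power_abs)
  next
    case (Suc m)
    have IH: "(\<lambda>j. real ((m + j) choose j) * s ^ j) sums (1 / (1 - s) ^ Suc m)"
        "summable (\<lambda>j. norm (real ((m + j) choose j) * s ^ j))" if "\<bar>s\<bar> < 1" for s
      using Suc.IH that by auto
    have g: "summable (\<lambda>j. norm (s ^ j))" if "\<bar>s\<bar> < 1" for s :: real
      using that summable_geometric[of "\<bar>s\<bar>"] by (simp add: power_abs)
    have e: "(\<Sum>i\<le>k. real ((m + i) choose i) * s ^ i * s ^ (k - i)) = real ((Suc m + k) choose k) * s ^ k" for k s
    proof -
      have "(\<Sum>i\<le>k. real ((m + i) choose i) * s ^ i * s ^ (k - i)) = (\<Sum>i\<le>k. real ((m + i) choose i) * s ^ k)"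
        by (intro sum.cong refl) (simp add: mult.assoc flip: power_add)
      also have "\<dots> = real (\<Sum>i\<le>k. (m + i) choose i) * s ^ k"
        by (simp add: sum_distrib_right)
      also have "(\<Sum>i\<le>k. (m + i) choose i) = (Suc m + k) choose k"
        by (simp only: sum_choose_lower add_Suc)
      finally show ?thesis .
    qed
    have S: "(\<lambda>k. real ((Suc m + k) choose k) * s ^ k) sums (1 / (1 - s) ^ Suc (Suc m))" if s: "\<bar>s\<bar> < 1" for s
    proof -
      have "(\<lambda>k. \<Sum>i\<le>k. real ((m + i) choose i) * s ^ i * s ^ (k - i)) sums
         ((\<Sum>j. real ((m + j) choose j) * s ^ j) * (\<Sum>j. s ^ j))"
        by (rule Cauchy_product_sums[OF IH(2)[OF s] g[OF s]])
      then show ?thesis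
        unfolding e sums_unique[OF IH(1)[OF s], symmetric] using suminf_geometric[of s] s
        by (simp add: mult.commute mult.left_commute)
    qed
    have "summable (\<lambda>k. real ((Suc m + k) choose k) * \<bar>t\<bar> ^ k)"
      using S[of "\<bar>t\<bar>"] Suc.prems by (auto intro: sums_summable)
    then show ?case using S[OF Suc.prems] by (simp add: abs_mult power_abs)
  qed
  with assms show "(\<lambda>j. real ((m + j) choose j) * t ^ j) sums (1 / (1 - t) ^ Suc m)"
    and "summable (\<lambda>j. \<bar>real ((m + j) choose j) * t ^ j\<bar>)" by blast+
qed

text \<open>Inserting the definition gives a double series. Summed along the powers of
  \<open>t\<close> first it becomes negative binomial series, and then the exponential series in x
  t/(1-t).\<close>

lemma laguerre_generating_function:
  fixes t x :: real
  assumes t: "\<bar>t\<bar> < 1"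
  shows "(\<lambda>k. t ^ k * laguerre \<alpha> k x) sums (exp (- (x * t / (1 - t))) / (1 - t) ^ Suc \<alpha>)"
proof -
  \<comment> \<open>The term of degree i in x and i + j in t: for k = i + j the binomial coefficient
    of \<open>laguerre\<close> is (j + i + \<alpha>) choose j.\<close>
  define u where "u = (\<lambda>x t (i::nat) (j::nat). (- x * t) ^ i / fact i * (real ((j + i + \<alpha>) choose j) * t ^ j))"
  have b: "(\<lambda>j. u x t i j) sums ((- x * t / (1 - t)) ^ i / fact i / (1 - t) ^ Suc \<alpha>)"
      "summable (\<lambda>j. norm (u x t i j))" if "\<bar>t\<bar> < 1" for x t i
  proof -
    note n = negative_binomial_sums[of t "i + \<alpha>"]
    have "(\<lambda>j. (- x * t) ^ i / fact i * (real ((i + \<alpha> + j) choose j) * t ^ j)) sums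
       ((- x * t) ^ i / fact i * (1 / (1 - t) ^ Suc (i + \<alpha>)))"
      by (intro sums_mult n that)
    also have "(- x * t) ^ i / fact i * (1 / (1 - t) ^ Suc (i + \<alpha>)) = (- x * t / (1 - t)) ^ i / fact i / (1 - t) ^ Suc \<alpha>"
      using that by (simp add: power_divide power_add power_minus[of "x * t / (1 - t)"] power_minus[of "x * t"])
    finally show "(\<lambda>j. u x t i j) sums ((- x * t / (1 - t)) ^ i / fact i / (1 - t) ^ Suc \<alpha>)"
      unfolding u_def by (simp add: add_ac)
    have "summable (\<lambda>j. \<bar>(- x * t) ^ i / fact i\<bar> * \<bar>real ((i + \<alpha> + j) choose j) * t ^ j\<bar>)"
      by (intro summable_mult n that)
    then show "summable (\<lambda>j. norm (u x t i j))"
      unfolding u_def real_norm_def abs_mult by (simp add: add_ac)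
  qed
  have ex: "(\<lambda>i. (- x * t / (1 - t)) ^ i / fact i / (1 - t) ^ Suc \<alpha>) sums (exp (- (x * t / (1 - t))) / (1 - t) ^ Suc \<alpha>)" for x t :: real
  proof -
    have "(\<lambda>i. (- (x * t / (1 - t))) ^ i /\<^sub>R fact i / (1 - t) ^ Suc \<alpha>) sums (exp (- (x * t / (1 - t))) / (1 - t) ^ Suc \<alpha>)"
      by (intro sums_divide exp_converges)
    moreover have "y /\<^sub>R fact i = y / fact i" for y :: real and i
      by (simp add: divide_inverse mult.commute)
    ultimately show ?thesis by simp
  qed
  have inf: "infsum f UNIV = s" if "f sums s" "summable (\<lambda>j. norm (f j))" for f :: "nat \<Rightarrow> real" and s
    using that by (metis has_sum_imp_sums infsumI norm_summable_imp_has_sum sums_unique2)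
  have abs: "(\<lambda>p. norm (case p of (i, j) \<Rightarrow> u x t i j)) summable_on UNIV \<times> UNIV"
  proof (subst Infinite_Sum.abs_summable_on_Sigma_iff, intro conjI ballI)
    show "(\<lambda>y. norm (case (i, y) of (i, j) \<Rightarrow> u x t i j)) summable_on UNIV" for i
      using b(2)[OF t] by (simp add: summable_on_UNIV_nonneg_real_iff)
    \<comment> \<open>Taking absolute values only replaces the parameters by -|x| and |t|, so the
      same closed form proves absolute convergence.\<close>
    have nu: "norm (u x t i j) = u (- \<bar>x\<bar>) \<bar>t\<bar> i j" for i j
      by (simp add: u_def abs_mult power_abs)
    have "(\<Sum>\<^sub>\<infinity>y. norm (u x t i y)) = (\<bar>x\<bar> * \<bar>t\<bar> / (1 - \<bar>t\<bar>)) ^ i / fact i / (1 - \<bar>t\<bar>) ^ Suc \<alpha>" for i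
      unfolding nu using inf[OF b(1) b(2), of "\<bar>t\<bar>" "- \<bar>x\<bar>" i] t by simp
    moreover have "summable (\<lambda>i. (\<bar>x\<bar> * \<bar>t\<bar> / (1 - \<bar>t\<bar>)) ^ i / fact i / (1 - \<bar>t\<bar>) ^ Suc \<alpha>)"
      using ex[of "- \<bar>x\<bar>" "\<bar>t\<bar>"] by (simp add: sums_iff)
    ultimately show "(\<lambda>i. norm (\<Sum>\<^sub>\<infinity>y. norm (case (i, y) of (i, j) \<Rightarrow> u x t i j))) summable_on UNIV"
      using t by (simp add: summable_on_UNIV_nonneg_real_iff infsum_nonneg)
  qed
  then have sm: "(\<lambda>(i, j). u x t i j) summable_on UNIV \<times> UNIV"
    by (rule abs_summable_summable)
  have "infsum (\<lambda>(i, j). u x t i j) (UNIV \<times> UNIV) = (\<Sum>\<^sub>\<infinity>i. \<Sum>\<^sub>\<infinity>j. u x t i j)"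
    by (rule infsum_Sigma'_banach[OF sm, symmetric])
  also have "\<dots> = (\<Sum>\<^sub>\<infinity>i. (- x * t / (1 - t)) ^ i / fact i / (1 - t) ^ Suc \<alpha>)"
    by (intro infsum_cong inf b t)
  also have "\<dots> = exp (- (x * t / (1 - t))) / (1 - t) ^ Suc \<alpha>"
  proof (rule inf[OF ex])
    show "summable (\<lambda>i. norm ((- x * t / (1 - t)) ^ i / fact i / (1 - t) ^ Suc \<alpha>))"
      using summable_divide[OF summable_norm_exp[of "- x * t / (1 - t)"], of "\<bar>1 - t\<bar> ^ Suc \<alpha>"]
      by (simp add: power_abs abs_divide abs_mult divide_inverse mult_ac)
  qed
  finally have total: "infsum (\<lambda>(i, j). u x t i j) (UNIV \<times> UNIV) = exp (- (x * t / (1 - t))) / (1 - t) ^ Suc \<alpha>" .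
  \<comment> \<open>Regrouping along k = i + j, where the terms with fixed k form t^k times the
    Laguerre polynomial.\<close>
  have bij: "bij_betw (\<lambda>(k, i). (i, k - i)) (SIGMA k:UNIV. {..k}) (UNIV \<times> (UNIV :: nat set))"
    by (rule bij_betw_byWitness[where f'="\<lambda>(i, j). (i + j, i)"]) auto
  have sm2: "(\<lambda>(k, i). u x t i (k - i)) summable_on (SIGMA k:UNIV. {..k})"
    using summable_on_reindex_bij_betw[OF bij, of "\<lambda>(i, j). u x t i j"] sm by (simp add: case_prod_unfold)
  have in2: "infsum (\<lambda>(k, i). u x t i (k - i)) (SIGMA k:UNIV. {..k}) = exp (- (x * t / (1 - t))) / (1 - t) ^ Suc \<alpha>"
    using infsum_reindex_bij_betw[OF bij, of "\<lambda>(i, j). u x t i j"] total by (simp add: case_prod_unfold)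
  have e: "(\<Sum>\<^sub>\<infinity>i\<in>{..k}. u x t i (k - i)) = t ^ k * laguerre \<alpha> k x" for k
  proof -
    have "(\<Sum>\<^sub>\<infinity>i\<in>{..k}. u x t i (k - i)) = (\<Sum>i\<le>k. u x t i (k - i))" by simp
    also have "\<dots> = (\<Sum>i\<le>k. t ^ k * ((-1) ^ i * real ((k + \<alpha>) choose (k - i)) * x ^ i / fact i))"
    proof (intro sum.cong refl)
      fix i assume "i \<in> {..k}"
      then have "t ^ k = t ^ i * t ^ (k - i)" by (simp flip: power_add)
      moreover have "(- x * t) ^ i = (-1) ^ i * x ^ i * t ^ i"
        by (simp add: power_mult_distrib[symmetric])
      ultimately show "u x t i (k - i) = t ^ k * ((-1) ^ i * real ((k + \<alpha>) choose (k - i)) * x ^ i / fact i)"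
        using \<open>i \<in> {..k}\<close> by (simp add: u_def)
    qed
    finally show ?thesis by (simp add: laguerre_def sum_distrib_left)
  qed
  have "((\<lambda>k. \<Sum>\<^sub>\<infinity>i\<in>{..k}. u x t i (k - i)) has_sum infsum (\<lambda>(k, i). u x t i (k - i)) (SIGMA k:UNIV. {..k})) UNIV"
    using infsum_Sigma'_banach[OF sm2] summable_on_Sigma_banach[OF sm2] by (simp add: has_sum_iff)
  then show ?thesis unfolding e in2 by (rule has_sum_imp_sums)
qed

text \<open>At a negative argument all terms of the polynomial are nonnegative, so sums of absolute
  values are again controlled by the generating function.\<close>

lemma abs_laguerre_le: "\<bar>laguerre \<alpha> k x\<bar> \<le> laguerre \<alpha> k (- \<bar>x\<bar>)"
proof -
  have "\<bar>laguerre \<alpha> k x\<bar> \<le> (\<Sum>i\<le>k. \<bar>(-1) ^ i * real ((k + \<alpha>) choose (k - i)) * x ^ i / fact i\<bar>)"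
    unfolding laguerre_def by (rule sum_abs)
  also have "\<dots> = laguerre \<alpha> k (- \<bar>x\<bar>)"
    unfolding laguerre_def
  proof (intro sum.cong refl)
    fix i
    have "(-1) ^ i * (- \<bar>x\<bar>) ^ i = \<bar>x\<bar> ^ i" by (simp flip: power_mult_distrib)
    moreover have "(-1) ^ i * c * (- \<bar>x\<bar>) ^ i / fact i = c * ((-1) ^ i * (- \<bar>x\<bar>) ^ i) / fact i" for c
      by (simp only: mult_ac)
    ultimately have *: "(-1) ^ i * real ((k + \<alpha>) choose (k - i)) * (- \<bar>x\<bar>) ^ i / fact i = real ((k + \<alpha>) choose (k - i)) * \<bar>x\<bar> ^ i / fact i"
      by (simp only:)
    show "\<bar>(-1) ^ i * real ((k + \<alpha>) choose (k - i)) * x ^ i / fact i\<bar> =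
         (-1) ^ i * real ((k + \<alpha>) choose (k - i)) * (- \<bar>x\<bar>) ^ i / fact i"
      unfolding * by (simp add: abs_mult power_abs)
  qed
  finally show ?thesis .
qed

text \<open>The means by which kernel identities are read off from generating functions. Once the
  coefficients below \<open>k\<close> vanish, dividing by t^k and letting t tend to 0 isolates the
  next one; real and imaginary parts are treated apart because \<open>t\<close> is real.\<close>

lemma power_series_zero:
  fixes a :: "nat \<Rightarrow> complex"
  assumes s: "s > 0" and z: "\<And>t::real. \<bar>t\<bar> < s \<Longrightarrow> (\<lambda>k. of_real t ^ k * a k) sums 0"
  shows "a k = 0"
proof (induction k rule: less_induct)
  case (less k)
  have "(\<lambda>n. complex_of_real t ^ n * a (n + k)) sums 0" if t: "t \<noteq> 0" "\<bar>t\<bar> < s" for t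
  proof -
    have "(\<lambda>n. of_real t ^ (n + k) * a (n + k)) sums (0 - (\<Sum>i<k. of_real t ^ i * a i))"
      using z[OF t(2)] by (rule sums_split_initial_segment)
    then have "(\<lambda>n. (1 / of_real t ^ k) * (of_real t ^ (n + k) * a (n + k))) sums ((1 / of_real t ^ k) * 0)"
      using less by (intro sums_mult) simp
    then show ?thesis using t by (simp add: power_add)
  qed
  then have r: "(\<lambda>n. Re (a (n + k)) * t ^ n) sums 0" "(\<lambda>n. Im (a (n + k)) * t ^ n) sums 0"
    if "t \<noteq> 0" "norm t < s" for t :: real
    using that sums_Re[of "\<lambda>n. complex_of_real t ^ n * a (n + k)" 0] sums_Im[of "\<lambda>n. complex_of_real t ^ n * a (n + k)" 0]
    by (auto simp flip: of_real_power simp: mult.commute)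
  have "((\<lambda>_::real. 0::real) \<longlongrightarrow> Re (a (0 + k))) (at 0)" "((\<lambda>_::real. 0::real) \<longlongrightarrow> Im (a (0 + k))) (at 0)"
    by (rule powser_limit_0_strong[OF s r(1)], assumption+, rule powser_limit_0_strong[OF s r(2)])
  then have "Re (a k) = 0" "Im (a k) = 0"
    by (auto simp: tendsto_const_iff)
  then show ?case by (simp add: complex_eq_iff)
qed

section \<open>The symplectic form and the kernels with twisted phase\<close>

definition sympl_form :: "complex^'n::finite \<Rightarrow> complex^'n \<Rightarrow> real" where
  "sympl_form z w = Im (\<Sum>j\<in>UNIV. z $ j * cnj (w $ j))"

text \<open>Multiplication by -i. It writes the phase as a real inner product, so that a Gaussian
  integral with twisted phase becomes an ordinary Fourier transform of a Gaussian.\<close>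

definition rot :: "complex^'n::finite \<Rightarrow> complex^'n" where
  "rot z = (\<chi> j. - (\<i> * z $ j))"

lemma sympl_form_eq_inner: "sympl_form z w = rot z \<bullet> w"
  by (simp add: sympl_form_def rot_def inner_vec_def inner_complex_def Im_sum algebra_simps)

lemma linear_rot: "linear rot"
  by (rule linearI) (auto simp: rot_def vec_eq_iff algebra_simps scaleR_conv_of_real)

lemma norm_rot [simp]: "norm (rot z) = norm z"
  by (simp add: norm_vec_def rot_def norm_mult)

lemma sympl_form_self [simp]: "sympl_form z z = 0"
  by (simp add: sympl_form_def Im_sum)

lemma sympl_form_swap: "sympl_form w z = - sympl_form z w"
  by (simp add: sympl_form_def Im_sum sum_negf[symmetric] mult.commute del: sum_negf)

lemma sympl_form_add_left: "sympl_form (z + w) x = sympl_form z x + sympl_form w x"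
  and sympl_form_add_right: "sympl_form x (z + w) = sympl_form x z + sympl_form x w"
  and sympl_form_diff_left: "sympl_form (z - w) x = sympl_form z x - sympl_form w x"
  and sympl_form_diff_right: "sympl_form x (z - w) = sympl_form x z - sympl_form x w"
  and sympl_form_scaleR_left: "sympl_form (c *\<^sub>R z) x = c * sympl_form z x"
  and sympl_form_scaleR_right: "sympl_form x (c *\<^sub>R z) = c * sympl_form x z"
  by (simp_all add: sympl_form_eq_inner linear_add[OF linear_rot] linear_diff[OF linear_rot] linear_cmul[OF linear_rot]
     inner_simps)

lemmas sympl_form_simps = sympl_form_add_left sympl_form_add_right sympl_form_diff_left
  sympl_form_diff_right sympl_form_scaleR_left sympl_form_scaleR_right

lemma continuous_on_sympl_form [continuous_intros]:
  "continuous_on S f \<Longrightarrow> continuous_on S g \<Longrightarrow> continuous_on S (\<lambda>x. sympl_form (f x) (g x))"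
  unfolding sympl_form_def by (intro continuous_intros)

lemma borel_measurable_sympl_form [measurable (raw)]:
  assumes "f \<in> borel_measurable M" "g \<in> borel_measurable M"
  shows "(\<lambda>x. sympl_form (f x) (g x)) \<in> borel_measurable M"
  by (rule borel_measurable_continuous_Pair[OF assms]) (intro continuous_intros)

lemma borel_measurable_laguerre_fun [measurable (raw)]:
  assumes [measurable]: "f \<in> borel_measurable M" "r \<in> borel_measurable M"
  shows "(\<lambda>x. laguerre_fun k (r x) (f x)) \<in> borel_measurable M"
  unfolding laguerre_fun_def laguerre_def by measurable

lemma laguerre_fun_minus [simp]: "laguerre_fun k r (- w) = laguerre_fun k r w"
  by (simp add: laguerre_fun_def)

text \<open>The generating function of the Laguerre functions is the Mehler kernel of the twisted Laplacian.\<close>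

definition mehler :: "real \<Rightarrow> real \<Rightarrow> complex^'n::finite \<Rightarrow> real" where
  "mehler t r w = (1 / (1 - t)) ^ CARD('n) * exp (- (r / 4 * ((1 + t) / (1 - t))) * (norm w)\<^sup>2)"

text \<open>The type n - 1 makes the power of 1/(1-t) equal to n, and the two exponents combine by
  2t/(1-t) + 1 = (1+t)/(1-t).\<close>

lemma laguerre_fun_sums_mehler:
  fixes w :: "complex^'n::finite"
  assumes t: "\<bar>t\<bar> < 1"
  shows "(\<lambda>k. t ^ k * laguerre_fun k r w) sums mehler t r w"
proof -
  have S: "Suc (CARD('n) - 1) = CARD('n)" by simp
  let ?x = "r / 2 * (norm w)\<^sup>2" and ?e = "exp (- (r / 4) * (norm w)\<^sup>2)"
  have "(\<lambda>k. t ^ k * laguerre (CARD('n) - 1) k ?x * ?e) sums (exp (- (?x * t / (1 - t))) / (1 - t) ^ Suc (CARD('n) - 1) * ?e)"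
    by (intro sums_mult2 laguerre_generating_function t)
  moreover have "exp (- (?x * t / (1 - t))) / (1 - t) ^ Suc (CARD('n) - 1) * ?e = mehler t r w"
  proof -
    have "- (?x * t / (1 - t)) + - (r / 4) * (norm w)\<^sup>2 = - (r / 4 * ((1 + t) / (1 - t))) * (norm w)\<^sup>2"
      using t by (simp add: divide_simps) (simp add: algebra_simps)
    then have *: "exp (- (?x * t / (1 - t))) * ?e = exp (- (r / 4 * ((1 + t) / (1 - t))) * (norm w)\<^sup>2)"
      by (metis exp_add)
    show ?thesis unfolding S mehler_def *[symmetric]
      by (simp only: power_one_over times_divide_eq_left mult_1_left)
  qed
  ultimately show ?thesis by (simp add: laguerre_fun_def mult.assoc)
qed

text \<open>A bound for the sum of |t|^k |\<phi>_k| with |t| \<le> 1/4, obtained from the generating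
  function at 1/4 and -x, where x = (r/2)|w|^2. The power is (1 - 1/4)^(-n) and the exponent is x/3
  - x/2 = -(r/12)|w|^2. It still decays because t/(1-t) < 1/2, that is t < 1/3.\<close>

definition gauss_majorant :: "real \<Rightarrow> complex^'n::finite \<Rightarrow> real" where
  "gauss_majorant r w = (4 / 3) ^ CARD('n) * exp (- (r / 12) * (norm w)\<^sup>2)"

lemma sum_laguerre_fun_le:
  fixes w :: "complex^'n::finite"
  assumes t: "\<bar>t\<bar> \<le> 1 / 4" and r: "r > 0"
  shows "(\<Sum>k<K. \<bar>t\<bar> ^ k * \<bar>laguerre_fun k r w\<bar>) \<le> gauss_majorant r w"
proof -
  have S: "Suc (CARD('n) - 1) = CARD('n)" by simp
  define x where "x = r / 2 * (norm w)\<^sup>2"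
  have x: "x \<ge> 0" using r by (simp add: x_def)
  let ?e = "exp (- (r / 4) * (norm w)\<^sup>2)"
  have "(\<lambda>k. (1/4) ^ k * laguerre (CARD('n) - 1) k (- x) * ?e) sums
      (exp (- ((- x) * (1/4) / (1 - 1/4))) / (1 - 1/4) ^ Suc (CARD('n) - 1) * ?e)"
    by (intro sums_mult2 laguerre_generating_function) auto
  moreover have "exp (- ((- x) * (1/4) / (1 - 1/4))) / (1 - 1/4) ^ Suc (CARD('n) - 1) * ?e = gauss_majorant r w"
  proof -
    have *: "exp (- ((- x) * (1/4) / (1 - 1/4))) * ?e = exp (- (r / 12) * (norm w)\<^sup>2)"
      by (simp add: x_def flip: exp_add)
    show ?thesis unfolding S gauss_majorant_def *[symmetric] by (simp add: power_divide)
  qed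
  ultimately have s: "(\<lambda>k. (1/4) ^ k * laguerre (CARD('n) - 1) k (- x) * ?e) sums gauss_majorant r w" by simp
  have nn: "0 \<le> laguerre (CARD('n) - 1) k (- x)" for k
    using abs_laguerre_le[of "CARD('n) - 1" k x] x by simp
  have "(\<Sum>k<K. \<bar>t\<bar> ^ k * \<bar>laguerre_fun k r w\<bar>) \<le> (\<Sum>k<K. (1/4) ^ k * laguerre (CARD('n) - 1) k (- x) * ?e)"
    using abs_laguerre_le[of "CARD('n) - 1" _ x] x t unfolding laguerre_fun_def x_def[symmetric]
    by (auto simp: abs_mult mult.assoc nn[simplified] intro!: sum_mono mult_mono power_mono mult_nonneg_nonneg)
  also have "\<dots> \<le> gauss_majorant r w"
    unfolding sums_unique[OF s] using nn by (intro sum_le_suminf sums_summable[OF s]) auto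
  finally show ?thesis .
qed

text \<open>A single term of the preceding sum at t = 1/4, which costs the factor 4^k.\<close>

lemma abs_laguerre_fun_le:
  assumes "r > 0"
  shows "\<bar>laguerre_fun k r w\<bar> \<le> 4 ^ k * gauss_majorant r w"
proof -
  have "(1/4) ^ k * \<bar>laguerre_fun k r w\<bar> \<le> (\<Sum>j<Suc k. \<bar>1/4\<bar> ^ j * \<bar>laguerre_fun j r w\<bar>)"
    by (simp add: sum_nonneg)
  also have "\<dots> \<le> gauss_majorant r w"
    by (rule sum_laguerre_fun_le) (use assms in auto)
  finally show ?thesis by (simp add: field_simps power_divide)
qed

lemma gauss_majorant_integrable: "r > 0 \<Longrightarrow> integrable lborel (gauss_majorant r :: complex^'n::finite \<Rightarrow> real)"
  using gauss_integral[of "r / 12", where 'a="complex^'n"]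
  unfolding gauss_majorant_def by (auto simp: has_bochner_integral_iff)

lemma gauss_majorant_nonneg: "gauss_majorant r w \<ge> 0"
  by (simp add: gauss_majorant_def)

lemma gauss_majorant_le: "r > 0 \<Longrightarrow> gauss_majorant r (w::complex^'n::finite) \<le> (4/3) ^ CARD('n)"
  by (simp add: gauss_majorant_def mult_le_cancel_left1)

lemma borel_measurable_gauss_majorant [measurable]: "gauss_majorant r \<in> borel_measurable borel"
  unfolding gauss_majorant_def[abs_def] by measurable

text \<open>Twisted convolution written with an integral kernel. The phase is that of
  \<open>twisted_proj\<close> after w = z - y, since the symplectic form vanishes on the diagonal;
  the factor (r/(2 pi))^n is the one that makes the Laguerre kernels idempotent.\<close>

definition twist :: "real \<Rightarrow> (complex^'n::finite \<Rightarrow> real) \<Rightarrow> complex^'n \<Rightarrow> complex^'n \<Rightarrow> complex" where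
  "twist r \<phi> z y = of_real ((r / (2 * pi)) ^ CARD('n) * \<phi> (z - y)) * cis (- (r / 2) * sympl_form z y)"

abbreviation "proj_kernel r k \<equiv> twist r (laguerre_fun k r)"
abbreviation "mehler_kernel r t \<equiv> twist r (mehler t r)"

lemma DIM_complex_vec: "DIM(complex^'n::finite) = 2 * CARD('n)"
  by simp

text \<open>The semigroup law of the twisted Laplacian in multiplicative form. It is a Gaussian
  integral: after completing the square the remaining phase is linear.\<close>

lemma mehler_kernel_compose:
  fixes z y :: "complex^'n::finite"
  assumes r: "r > 0" and t: "\<bar>t\<bar> < 1" and s: "\<bar>s\<bar> < 1"
  shows "(LINT x|lborel. mehler_kernel r t z x * mehler_kernel r s x y) = mehler_kernel r (t * s) z y"
proof -
  define \<alpha> \<beta> where "\<alpha> = r / 4 * ((1 + t) / (1 - t))" and "\<beta> = r / 4 * ((1 + s) / (1 - s))"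
  have pos: "\<alpha> > 0" "\<beta> > 0" using r t s by (auto simp: \<alpha>_def \<beta>_def)
  define c where "c = \<alpha> + \<beta>"
  have c: "c > 0" using pos by (simp add: c_def)
  \<comment> \<open>The minimiser of \<alpha>|z - x|^2 + \<beta>|x - y|^2 in x, about which the
    square is completed.\<close>
  define m where "m = (\<alpha> / c) *\<^sub>R z + (\<beta> / c) *\<^sub>R y"
  define d where "d = z - y"
  have ts: "\<bar>t * s\<bar> < 1" using t s by (metis abs_mult abs_ge_zero mult_strict_mono' mult_1)
  have one: "\<alpha> / c + \<beta> / c = 1" using c by (simp add: c_def add_divide_distrib[symmetric])
  have zm: "z - m = (\<beta> / c) *\<^sub>R d"
  proof -
    have "z - m = (\<alpha> / c + \<beta> / c) *\<^sub>R z - m" unfolding one by simp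
    then show ?thesis by (simp add: m_def d_def algebra_simps)
  qed
  have my: "m - y = (\<alpha> / c) *\<^sub>R d"
  proof -
    have "m - y = m - (\<alpha> / c + \<beta> / c) *\<^sub>R y" unfolding one by simp
    then show ?thesis by (simp add: m_def d_def algebra_simps)
  qed
  have quad: "\<alpha> * (norm (z - (m + u)))\<^sup>2 + \<beta> * (norm (m + u - y))\<^sup>2 = c * (norm u)\<^sup>2 + \<alpha> * \<beta> / c * (norm d)\<^sup>2" for u
  proof -
    have e: "z - (m + u) = (\<beta> / c) *\<^sub>R d - u" "m + u - y = (\<alpha> / c) *\<^sub>R d + u"
      using zm my by (auto simp: algebra_simps)
    have "\<alpha> * (norm (z - (m + u)))\<^sup>2 + \<beta> * (norm (m + u - y))\<^sup>2 =
       \<alpha> * ((\<beta> / c)\<^sup>2 * (d \<bullet> d) - 2 * (\<beta> / c) * (d \<bullet> u) + u \<bullet> u) + \<beta> * ((\<alpha> / c)\<^sup>2 * (d \<bullet> d) + 2 * (\<alpha> / c) * (d \<bullet> u) + u \<bullet> u)"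
      unfolding e power2_norm_eq_inner
      by (simp add: inner_simps inner_commute[of u d] power2_eq_square algebra_simps)
    also have "\<dots> = c * (u \<bullet> u) + \<alpha> * \<beta> / c * (\<alpha> / c + \<beta> / c) * (d \<bullet> d)"
      by (simp add: c_def power2_eq_square algebra_simps)
    finally show ?thesis unfolding one by (simp add: power2_norm_eq_inner)
  qed
  \<comment> \<open>Around \<open>m\<close> the phase splits into the target phase between z and y
    and a part linear in \<open>u\<close>, which leaves the Fourier transform of a Gaussian.\<close>
  have phase: "sympl_form z (m + u) + sympl_form (m + u) y = sympl_form z y + rot d \<bullet> u" for u
  proof -
    have "sympl_form z (m + u) + sympl_form (m + u) y = (sympl_form z u - sympl_form y u) + (\<alpha> / c + \<beta> / c) * sympl_form z y"
      by (simp add: m_def sympl_form_simps sympl_form_swap[of u y] algebra_simps)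
    then show ?thesis unfolding one by (simp add: d_def sympl_form_eq_inner[symmetric] sympl_form_simps)
  qed
  define C where "C = (r / (2 * pi)) ^ CARD('n)"
  define D where "D = C\<^sup>2 * (1 / (1 - t)) ^ CARD('n) * (1 / (1 - s)) ^ CARD('n)"
  have integrand: "mehler_kernel r t z (m + u) * mehler_kernel r s (m + u) y =
     of_real (D * exp (- (\<alpha> * \<beta> / c) * (norm d)\<^sup>2)) * cis (- (r / 2) * sympl_form z y) *
       (of_real (exp (- c * (norm u)\<^sup>2)) * cis ((- (r / 2)) *\<^sub>R rot d \<bullet> u))" for u
  proof -
    have "mehler_kernel r t z (m + u) * mehler_kernel r s (m + u) y =
       of_real (D * (exp (- \<alpha> * (norm (z - (m + u)))\<^sup>2) * exp (- \<beta> * (norm (m + u - y))\<^sup>2))) *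
       (cis (- (r / 2) * sympl_form z (m + u)) * cis (- (r / 2) * sympl_form (m + u) y))"
      unfolding twist_def mehler_def C_def[symmetric] D_def \<alpha>_def[symmetric] \<beta>_def[symmetric]
      by (simp add: power2_eq_square)
    also have "exp (- \<alpha> * (norm (z - (m + u)))\<^sup>2) * exp (- \<beta> * (norm (m + u - y))\<^sup>2) =
        exp (- (\<alpha> * \<beta> / c) * (norm d)\<^sup>2) * exp (- c * (norm u)\<^sup>2)"
      using quad[of u] by (simp flip: exp_add)
    also have "cis (- (r / 2) * sympl_form z (m + u)) * cis (- (r / 2) * sympl_form (m + u) y) =
        cis (- (r / 2) * sympl_form z y) * cis ((- (r / 2)) *\<^sub>R rot d \<bullet> u)"
      unfolding cis_mult distrib_left[symmetric] phase by (simp add: distrib_left)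
    finally show ?thesis by (simp add: mult_ac)
  qed
  have meas: "(\<lambda>x. mehler_kernel r t z x * mehler_kernel r s x y) \<in> borel_measurable borel"
    unfolding twist_def mehler_def by measurable
  have "(LINT x|lborel. mehler_kernel r t z x * mehler_kernel r s x y) =
     (LINT u|lborel. mehler_kernel r t z (m + u) * mehler_kernel r s (m + u) y)"
    by (rule integral_lborel_translate[OF meas, symmetric])
  also have "\<dots> = of_real (D * exp (- (\<alpha> * \<beta> / c) * (norm d)\<^sup>2)) * cis (- (r / 2) * sympl_form z y) *
       of_real (sqrt (pi / c) ^ DIM(complex^'n) * exp (- (norm ((- (r / 2)) *\<^sub>R rot d))\<^sup>2 / (4 * c)))"
    unfolding integrand integral_mult_right_zero
    using gauss_fourier[OF c, of "(- (r / 2)) *\<^sub>R rot d"] by (simp only: has_bochner_integral_iff)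
  also have "\<dots> = of_real (D * sqrt (pi / c) ^ DIM(complex^'n) *
      (exp (- (\<alpha> * \<beta> / c) * (norm d)\<^sup>2) * exp (- (norm ((- (r / 2)) *\<^sub>R rot d))\<^sup>2 / (4 * c)))) * cis (- (r / 2) * sympl_form z y)"
    by (simp only: of_real_mult mult_ac)
  \<comment> \<open>The Fourier transform adds r^2/16 to the product \<alpha> \<beta>. The quotient
    by \<open>c\<close> is the addition formula of coth, as (1+t)/(1-t) = coth a for t =
    exp(-2a).\<close>
  also have "exp (- (\<alpha> * \<beta> / c) * (norm d)\<^sup>2) * exp (- (norm ((- (r / 2)) *\<^sub>R rot d))\<^sup>2 / (4 * c)) =
     exp (- (r / 4 * ((1 + t * s) / (1 - t * s))) * (norm d)\<^sup>2)"
  proof -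
    have nz: "1 - t \<noteq> 0" "1 - s \<noteq> 0" "1 - t * s \<noteq> 0" using t s ts by auto
    have ceq: "c = r / 2 * ((1 - t * s) / ((1 - t) * (1 - s)))"
      unfolding c_def \<alpha>_def \<beta>_def using nz by (simp add: divide_simps) (simp add: algebra_simps)
    have h1: "\<alpha> * \<beta> + r\<^sup>2 / 16 = r\<^sup>2 / 8 * ((1 + t * s) / ((1 - t) * (1 - s)))"
      unfolding \<alpha>_def \<beta>_def using nz by (simp add: divide_simps power2_eq_square) (simp add: algebra_simps)
    have h2: "r\<^sup>2 / 8 * (U / P) / (r / 2 * (T / P)) = r / 4 * (U / T)" if "P \<noteq> 0" "T \<noteq> 0" for P T U
      using that r by (simp add: field_simps power2_eq_square)
    have "(\<alpha> * \<beta> + r\<^sup>2 / 16) / c = r / 4 * ((1 + t * s) / (1 - t * s))"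
      unfolding ceq h1 by (rule h2) (use nz in auto)
    moreover have "- (\<alpha> * \<beta> / c) * (norm d)\<^sup>2 + - (norm ((- (r / 2)) *\<^sub>R rot d))\<^sup>2 / (4 * c) = - ((\<alpha> * \<beta> + r\<^sup>2 / 16) / c) * (norm d)\<^sup>2"
      by (simp add: power_mult_distrib power_divide add_divide_distrib algebra_simps)
    ultimately show ?thesis by (simp only: exp_add[symmetric])
  qed
  also have "D * sqrt (pi / c) ^ DIM(complex^'n) = C * (1 / (1 - t * s)) ^ CARD('n)"
  proof -
    have nz: "1 - t \<noteq> 0" "1 - s \<noteq> 0" "1 - t * s \<noteq> 0" using t s ts by auto
    have ceq: "c = r / 2 * ((1 - t * s) / ((1 - t) * (1 - s)))"
      unfolding c_def \<alpha>_def \<beta>_def using nz by (simp add: divide_simps) (simp add: algebra_simps)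
    have "sqrt (pi / c) ^ DIM(complex^'n) = (pi / c) ^ CARD('n)"
      unfolding DIM_complex_vec power_mult using c by simp
    moreover have "r / (2 * pi) * (1 / P) * (1 / Q) * (pi / (r / 2 * (T / (P * Q)))) = 1 / T"
      if "P \<noteq> 0" "Q \<noteq> 0" "T \<noteq> 0" for P Q T
      using that r by (simp add: field_simps)
    then have "r / (2 * pi) * (1 / (1 - t)) * (1 / (1 - s)) * (pi / c) = 1 / (1 - t * s)"
      unfolding ceq using nz by blast
    ultimately show ?thesis
      unfolding D_def C_def power2_eq_square by (metis (no_types, lifting) mult.assoc power_mult_distrib)
  qed
  finally show ?thesis unfolding twist_def mehler_def C_def d_def by (simp add: mult.assoc)
qed

lemma sums_integral_dominated:
  fixes f :: "nat \<Rightarrow> 'a \<Rightarrow> 'b::{banach, second_countable_topology}"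
  assumes f: "\<And>k. integrable M (f k)" and F: "F \<in> borel_measurable M"
    and s: "\<And>x. x \<in> space M \<Longrightarrow> (\<lambda>k. f k x) sums F x"
    and w: "integrable M w" and le: "\<And>K x. x \<in> space M \<Longrightarrow> norm (\<Sum>k<K. f k x) \<le> w x"
  shows "(\<lambda>k. integral\<^sup>L M (f k)) sums integral\<^sup>L M F"
proof -
  have "(\<lambda>K. LINT x|M. (\<Sum>k<K. f k x)) \<longlonglongrightarrow> integral\<^sup>L M F"
    using f F s w le
    by (intro integral_dominated_convergence[where w=w]) (auto simp: sums_def intro!: AE_I2)
  then show ?thesis unfolding sums_def using f by (simp add: integral_sum)
qed

lemma twist_hermitian:
  assumes "\<And>w. \<phi> (- w) = \<phi> w"
  shows "twist r \<phi> y z = cnj (twist r \<phi> z y)"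
proof -
  have "\<phi> (y - z) = \<phi> (z - y)" using assms[of "z - y"] by simp
  then show ?thesis by (simp add: twist_def sympl_form_swap[of y z] cis_cnj)
qed

lemma borel_measurable_twist [measurable (raw)]:
  assumes [measurable]: "\<phi> \<in> borel_measurable borel" "f \<in> borel_measurable M" "g \<in> borel_measurable M"
  shows "(\<lambda>x. twist r \<phi> (f x) (g x)) \<in> borel_measurable M"
  unfolding twist_def by measurable

lemma borel_measurable_mehler [measurable]: "mehler t r \<in> borel_measurable borel"
  unfolding mehler_def[abs_def] by measurable

lemma mehler_minus [simp]: "mehler t r (- w) = mehler t r w"
  by (simp add: mehler_def)

lemma abs_mehler_le:
  fixes w :: "complex^'n::finite"
  assumes "r > 0" "\<bar>t\<bar> < 1"
  shows "\<bar>mehler t r w\<bar> \<le> (1 / (1 - t)) ^ CARD('n)"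
proof -
  have "0 \<le> r / 4 * ((1 + t) / (1 - t)) * (norm w)\<^sup>2" using assms by auto
  then have "exp (- (r / 4 * ((1 + t) / (1 - t))) * (norm w)\<^sup>2) \<le> 1" by simp
  then show ?thesis using assms by (simp add: mehler_def abs_mult power_abs mult_le_cancel_left1)
qed

lemma norm_twist:
  fixes z :: "complex^'n::finite"
  shows "r > 0 \<Longrightarrow> norm (twist r \<phi> z y) = (r / (2 * pi)) ^ CARD('n) * \<bar>\<phi> (z - y)\<bar>"
  by (simp add: twist_def norm_mult abs_mult power_abs norm_power norm_divide)

lemma proj_kernel_sums:
  "\<bar>t\<bar> < 1 \<Longrightarrow> (\<lambda>k. of_real t ^ k * proj_kernel r k z y) sums mehler_kernel r t z y"
  for z :: "complex^'n::finite"
proof -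
  assume "\<bar>t\<bar> < 1"
  then have "(\<lambda>k. of_real ((r / (2 * pi)) ^ CARD('n) * (t ^ k * laguerre_fun k r (z - y)))) sums
     complex_of_real ((r / (2 * pi)) ^ CARD('n) * mehler t r (z - y))"
    by (intro sums_of_real sums_mult laguerre_fun_sums_mehler)
  then have "(\<lambda>k. of_real ((r / (2 * pi)) ^ CARD('n) * (t ^ k * laguerre_fun k r (z - y))) * cis (- (r / 2) * sympl_form z y)) sums
     (complex_of_real ((r / (2 * pi)) ^ CARD('n) * mehler t r (z - y)) * cis (- (r / 2) * sympl_form z y))"
    by (rule sums_mult2)
  then show ?thesis by (simp add: twist_def mult_ac)
qed

lemma integrable_laguerre_fun_mult:
  fixes p :: "complex^'n::finite \<Rightarrow> complex"
  assumes r: "r > 0" and [measurable]: "p \<in> borel_measurable borel" and B: "\<And>x. norm (p x) \<le> B"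
  shows "integrable lborel (\<lambda>x. of_real (laguerre_fun k r (z - x)) * p x)"
proof (rule Bochner_Integration.integrable_bound)
  show "integrable lborel (\<lambda>x. (4 ^ k * B) * gauss_majorant r (z - x))"
    by (intro integrable_mult_right integrable_lborel_reflect gauss_majorant_integrable r)
  have B0: "0 \<le> B" using B[of 0] norm_ge_zero order_trans by blast
  show "AE x in lborel. norm (of_real (laguerre_fun k r (z - x)) * p x) \<le> norm ((4 ^ k * B) * gauss_majorant r (z - x))"
  proof (rule AE_I2)
    fix x
    have "\<bar>laguerre_fun k r (z - x)\<bar> * norm (p x) \<le> (4 ^ k * gauss_majorant r (z - x)) * B"
      by (intro mult_mono abs_laguerre_fun_le r B) (auto simp: gauss_majorant_nonneg)
    then show "norm (of_real (laguerre_fun k r (z - x)) * p x) \<le> norm ((4 ^ k * B) * gauss_majorant r (z - x))"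
      using B0 by (simp add: norm_mult abs_mult gauss_majorant_nonneg mult_ac)
  qed
qed simp

text \<open>For |t| \<le> 1/4 the partial sums have the integrable majorant
  \<open>gauss_majorant\<close>, so a bounded \<open>p\<close> may be integrated termwise.\<close>

lemma laguerre_fun_integral_sums:
  fixes p :: "complex^'n::finite \<Rightarrow> complex"
  assumes r: "r > 0" and t: "\<bar>t\<bar> \<le> 1 / 4" and p [measurable]: "p \<in> borel_measurable borel" and B: "\<And>x. norm (p x) \<le> B"
  shows "(\<lambda>k. of_real t ^ k * (LINT x|lborel. of_real (laguerre_fun k r (z - x)) * p x)) sums
     (LINT x|lborel. of_real (mehler t r (z - x)) * p x)"
proof -
  have B0: "0 \<le> B" using B[of 0] norm_ge_zero order_trans by blast
  have "(\<lambda>k. LINT x|lborel. of_real t ^ k * (of_real (laguerre_fun k r (z - x)) * p x)) sums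
     (LINT x|lborel. of_real (mehler t r (z - x)) * p x)"
  proof (rule sums_integral_dominated)
    show "integrable lborel (\<lambda>x. of_real t ^ k * (of_real (laguerre_fun k r (z - x)) * p x))" for k
      by (intro integrable_mult_right integrable_laguerre_fun_mult[OF r p B])
    show "integrable lborel (\<lambda>x. gauss_majorant r (z - x) * B)"
      by (intro integrable_mult_left integrable_lborel_reflect gauss_majorant_integrable r)
    fix x
    have "(\<lambda>k. complex_of_real (t ^ k * laguerre_fun k r (z - x)) * p x) sums (of_real (mehler t r (z - x)) * p x)"
      using t by (intro sums_mult2 sums_of_real laguerre_fun_sums_mehler) auto
    then show "(\<lambda>k. of_real t ^ k * (of_real (laguerre_fun k r (z - x)) * p x)) sums (of_real (mehler t r (z - x)) * p x)"
      by (simp add: mult.assoc)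
    show "norm (\<Sum>k<K. of_real t ^ k * (of_real (laguerre_fun k r (z - x)) * p x)) \<le> gauss_majorant r (z - x) * B" for K
    proof -
      have "norm (\<Sum>k<K. of_real t ^ k * (of_real (laguerre_fun k r (z - x)) * p x)) \<le>
          (\<Sum>k<K. \<bar>t\<bar> ^ k * \<bar>laguerre_fun k r (z - x)\<bar>) * norm (p x)"
        unfolding sum_distrib_right by (rule order_trans[OF norm_sum]) (simp add: norm_mult norm_power mult.assoc)
      also have "\<dots> \<le> gauss_majorant r (z - x) * B"
        by (intro mult_mono sum_laguerre_fun_le t r B) (auto simp: gauss_majorant_nonneg)
      finally show ?thesis .
    qed
  qed auto
  then show ?thesis by simp
qed

lemma twist_as_left:
  fixes z :: "complex^'n::finite"
  shows "twist r \<phi> z x * h x = of_real (\<phi> (z - x)) * (of_real ((r / (2 * pi)) ^ CARD('n)) * cis (- (r / 2) * sympl_form z x) * h x)"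
  by (simp add: twist_def mult_ac)

lemma twist_as_right:
  fixes y :: "complex^'n::finite"
  assumes "\<And>w. \<phi> (- w) = \<phi> w"
  shows "h x * twist r \<phi> x y = of_real (\<phi> (y - x)) * (of_real ((r / (2 * pi)) ^ CARD('n)) * cis (- (r / 2) * sympl_form x y) * h x)"
  using assms[of "y - x"] by (simp add: twist_def mult_ac)

lemma
  fixes h :: "complex^'n::finite \<Rightarrow> complex"
  assumes r: "r > 0" and t: "\<bar>t\<bar> \<le> 1 / 4" and [measurable]: "h \<in> borel_measurable borel" and B: "\<And>x. norm (h x) \<le> B"
  shows proj_kernel_sums_left:
    "(\<lambda>k. of_real t ^ k * (LINT x|lborel. proj_kernel r k z x * h x)) sums (LINT x|lborel. mehler_kernel r t z x * h x)"
  and proj_kernel_sums_right: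
    "(\<lambda>k. of_real t ^ k * (LINT x|lborel. h x * proj_kernel r k x y)) sums (LINT x|lborel. h x * mehler_kernel r t x y)"
proof -
  have B': "norm (of_real ((r / (2 * pi)) ^ CARD('n)) * cis a * h x) \<le> (r / (2 * pi)) ^ CARD('n) * B" for a x
    using B[of x] r by (simp add: norm_mult norm_power norm_divide)
  show "(\<lambda>k. of_real t ^ k * (LINT x|lborel. proj_kernel r k z x * h x)) sums (LINT x|lborel. mehler_kernel r t z x * h x)"
    unfolding twist_as_left by (rule laguerre_fun_integral_sums[OF r t _ B']) measurable
  show "(\<lambda>k. of_real t ^ k * (LINT x|lborel. h x * proj_kernel r k x y)) sums (LINT x|lborel. h x * mehler_kernel r t x y)"
    unfolding twist_as_right[of "laguerre_fun _ r", OF laguerre_fun_minus] twist_as_right[of "mehler t r", OF mehler_minus]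
    by (rule laguerre_fun_integral_sums[OF r t _ B']) measurable
qed

text \<open>The coefficient of t^j in the semigroup law, both sides being power series in t. Since
  \<open>power_series_zero\<close> asks for the identity only near 0, the radius 1/4 of termwise
  integration is enough.\<close>

lemma proj_kernel_mehler_kernel:
  fixes z :: "complex^'n::finite"
  assumes r: "r > 0" and s: "\<bar>s\<bar> < 1"
  shows "(LINT x|lborel. proj_kernel r j z x * mehler_kernel r s x y) = of_real s ^ j * proj_kernel r j z y"
proof -
  have "(LINT x|lborel. proj_kernel r j z x * mehler_kernel r s x y) - of_real s ^ j * proj_kernel r j z y = 0"
  proof (rule power_series_zero[of "1/4"])
    fix t :: real assume t: "\<bar>t\<bar> < 1 / 4"
    have ts: "\<bar>t * s\<bar> < 1" using t s mult_left_mono[of "\<bar>s\<bar>" 1 "\<bar>t\<bar>"] by (simp add: abs_mult)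
    have "(\<lambda>k. of_real t ^ k * (LINT x|lborel. proj_kernel r k z x * mehler_kernel r s x y)) sums mehler_kernel r (t * s) z y"
      unfolding mehler_kernel_compose[OF r less_trans[OF t] s, of z y, simplified, symmetric]
      using t s r abs_mehler_le[OF r s]
      by (intro proj_kernel_sums_left[where B="(r / (2 * pi)) ^ CARD('n) * (1 / (1 - s)) ^ CARD('n)"])
         (auto simp: norm_twist intro!: mult_left_mono)
    from sums_diff[OF this proj_kernel_sums[OF ts, of r z y]]
    show "(\<lambda>k. of_real t ^ k * ((LINT x|lborel. proj_kernel r k z x * mehler_kernel r s x y) - of_real s ^ k * proj_kernel r k z y)) sums 0"
      by (simp add: algebra_simps power_mult_distrib)
  qed simp
  then show ?thesis by simp
qed

lemma norm_proj_kernel_le: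
  fixes z :: "complex^'n::finite"
  assumes r: "r > 0"
  shows "norm (proj_kernel r k z y) \<le> ((r / (2 * pi)) ^ CARD('n) * 4 ^ k) * gauss_majorant r (z - y)"
  using abs_laguerre_fun_le[OF r, of k "z - y"] r by (auto simp: norm_twist mult.assoc intro!: mult_left_mono)

lemma norm_proj_kernel_bounded:
  fixes z :: "complex^'n::finite"
  assumes r: "r > 0"
  shows "norm (proj_kernel r k z y) \<le> ((r / (2 * pi)) ^ CARD('n) * 4 ^ k) * (4 / 3) ^ CARD('n)"
  using r by (intro order_trans[OF norm_proj_kernel_le] mult_left_mono gauss_majorant_le) auto

text \<open>The same comparison in the second parameter: the right side of the preceding lemma is a
  single monomial in \<open>s\<close>, which forces orthogonality for different indices.\<close>

lemma proj_kernel_compose: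
  fixes z :: "complex^'n::finite"
  assumes r: "r > 0"
  shows "(LINT x|lborel. proj_kernel r j z x * proj_kernel r k x y) = (if j = k then proj_kernel r j z y else 0)"
proof -
  have "(LINT x|lborel. proj_kernel r j z x * proj_kernel r k x y) - (if k = j then proj_kernel r j z y else 0) = 0"
  proof (rule power_series_zero[where s="1/4" and k=k and a="\<lambda>k. (LINT x|lborel. proj_kernel r j z x * proj_kernel r k x y) - (if k = j then proj_kernel r j z y else 0)"])
    fix s :: real assume s: "\<bar>s\<bar> < 1 / 4"
    have "(\<lambda>k. of_real s ^ k * (LINT x|lborel. proj_kernel r j z x * proj_kernel r k x y)) sums (of_real s ^ j * proj_kernel r j z y)"
      unfolding proj_kernel_mehler_kernel[OF r less_trans[OF s], of j z y, simplified, symmetric]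
      using s r norm_proj_kernel_bounded[OF r, of j z]
      by (intro proj_kernel_sums_right) auto
    moreover have "(\<lambda>k. if k = j then of_real s ^ k * proj_kernel r k z y else 0) sums (of_real s ^ j * proj_kernel r j z y)"
      by (rule sums_single)
    ultimately have "(\<lambda>k. of_real s ^ k * (LINT x|lborel. proj_kernel r j z x * proj_kernel r k x y) -
        (if k = j then of_real s ^ k * proj_kernel r k z y else 0)) sums
        (of_real s ^ j * proj_kernel r j z y - of_real s ^ j * proj_kernel r j z y)"
      by (rule sums_diff)
    moreover have "of_real s ^ k * (LINT x|lborel. proj_kernel r j z x * proj_kernel r k x y) -
        (if k = j then of_real s ^ k * proj_kernel r k z y else 0) =
        of_real s ^ k * ((LINT x|lborel. proj_kernel r j z x * proj_kernel r k x y) - (if k = j then proj_kernel r j z y else 0))" for k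
      by (simp add: algebra_simps)
    ultimately show "(\<lambda>k. of_real s ^ k * ((LINT x|lborel. proj_kernel r j z x * proj_kernel r k x y) -
        (if k = j then proj_kernel r j z y else 0))) sums 0" by simp
  qed simp
  then show ?thesis by auto
qed

lemma integrable_proj_kernel_mult:
  fixes h :: "complex^'n::finite \<Rightarrow> complex"
  assumes r: "r > 0" and [measurable]: "h \<in> borel_measurable borel" and B: "\<And>x. norm (h x) \<le> B"
  shows "integrable lborel (\<lambda>x. proj_kernel r k z x * h x)"
  unfolding twist_as_left using B r
  by (intro integrable_laguerre_fun_mult[OF r, where B="(r / (2 * pi)) ^ CARD('n) * B"])
     (auto simp: norm_mult norm_power norm_divide)

text \<open>The reproducing property turns the diagonal value of the kernel into an upper bound.\<close>

lemma abs_laguerre_fun_le_0: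
  fixes w :: "complex^'n::finite"
  assumes r: "r > 0"
  shows "\<bar>laguerre_fun k r w\<bar> \<le> laguerre_fun k r (0 :: complex^'n)"
proof -
  let ?K = "proj_kernel r k :: complex^'n \<Rightarrow> _"
  let ?C = "(r / (2 * pi)) ^ CARD('n)"
  have C: "?C > 0" using r by simp
  have herm: "?K x z = cnj (?K z x)" for x z by (rule twist_hermitian) simp
  have sq: "?K z x * ?K x z = of_real ((norm (?K z x))\<^sup>2)" for x z
    unfolding herm[of x z] by (simp flip: complex_norm_square)
  have i: "integrable lborel (\<lambda>x. ?K z x * ?K x y)" for z y
    by (rule integrable_proj_kernel_mult[OF r _ norm_proj_kernel_bounded[OF r]]) measurable
  have i2: "integrable lborel (\<lambda>x. (norm (?K z x))\<^sup>2)" for z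
    using i[of z z] unfolding sq by (simp only: complex_of_real_integrable_eq)
  \<comment> \<open>The kernel is Hermitian and idempotent, so the integral of |K(z,x)|^2 over x is
    K(z,z), a value independent of z.\<close>
  have diag: "(LINT x|lborel. (norm (?K z x))\<^sup>2) = ?C * laguerre_fun k r (0 :: complex^'n)" for z
  proof -
    have "complex_of_real (LINT x|lborel. (norm (?K z x))\<^sup>2) = ?K z z"
      using proj_kernel_compose[OF r, of k z k z] unfolding sq by (simp only: integral_complex_of_real if_True simp_thms)
    also have "\<dots> = of_real (?C * laguerre_fun k r (0 :: complex^'n))" by (simp add: twist_def)
    finally show ?thesis by (simp only: of_real_eq_iff)
  qed
  have "?C * \<bar>laguerre_fun k r w\<bar> = norm (?K w 0)" using r by (simp add: norm_twist)
  also have "\<dots> = norm (LINT x|lborel. ?K w x * ?K x 0)" using proj_kernel_compose[OF r, of k w k 0] by simp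
  also have "\<dots> \<le> (LINT x|lborel. norm (?K w x * ?K x 0))" by (rule integral_norm_bound)
  \<comment> \<open>The Cauchy-Schwarz inequality in the form a b \<le> (a^2 + b^2)/2; nothing is
    lost, as both squares have the same integral.\<close>
  also have "\<dots> \<le> (LINT x|lborel. ((norm (?K w x))\<^sup>2 + (norm (?K 0 x))\<^sup>2) / 2)"
  proof (rule integral_mono[OF integrable_norm[OF i]])
    show "integrable lborel (\<lambda>x. ((norm (?K w x))\<^sup>2 + (norm (?K 0 x))\<^sup>2) / 2)" using i2 by simp
    fix x
    have "0 \<le> (norm (?K w x) - norm (?K x 0))\<^sup>2" by simp
    then have "norm (?K w x) * norm (?K x 0) \<le> ((norm (?K w x))\<^sup>2 + (norm (?K x 0))\<^sup>2) / 2"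
      unfolding power2_diff by (simp add: field_simps)
    then show "norm (?K w x * ?K x 0) \<le> ((norm (?K w x))\<^sup>2 + (norm (?K 0 x))\<^sup>2) / 2"
      unfolding norm_mult using herm[of x 0] by simp
  qed
  also have "\<dots> = ?C * laguerre_fun k r (0 :: complex^'n)"
    using i2 diag by simp
  finally show ?thesis using C by simp
qed

lemma borel_measurable_cnj' [measurable (raw)]:
  "f \<in> borel_measurable M \<Longrightarrow> (\<lambda>x. cnj (f x)) \<in> borel_measurable M"
  by (rule measurable_compose[where N=borel])
     (auto intro!: borel_measurable_continuous_onI continuous_intros)

section \<open>The special Hermite expansion\<close>

text \<open>A class inside L^2 that the projections and the changes of frame preserve. On it all
  inner products are plain convergent integrals and Fubini applies directly.\<close>

definition bounded_integrable :: "('a::euclidean_space \<Rightarrow> complex) \<Rightarrow> bool" where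
  "bounded_integrable h \<longleftrightarrow> integrable lborel h \<and> (\<exists>B. \<forall>x. norm (h x) \<le> B)"

lemma bounded_integrableE:
  assumes "bounded_integrable h"
  obtains B where "B > 0" "\<And>x. norm (h x) \<le> B" "h \<in> borel_measurable borel" "integrable lborel h"
proof -
  obtain B where B: "\<And>x. norm (h x) \<le> B" and i: "integrable lborel h"
    using assms by (auto simp: bounded_integrable_def)
  show thesis
  proof (rule that[of "max B 1"])
    show "norm (h x) \<le> max B 1" for x using B[of x] by auto
    show "h \<in> borel_measurable borel" using borel_measurable_integrable[OF i] by simp
  qed (use i in auto)
qed

lemma bounded_integrable_mult_cnj:
  assumes "bounded_integrable f" "bounded_integrable g"
  shows "integrable lborel (\<lambda>x. f x * cnj (g x))"
proof -
  obtain B where f: "B > 0" "\<And>x. norm (f x) \<le> B" "f \<in> borel_measurable borel" "integrable lborel f"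
    by (rule bounded_integrableE[OF assms(1)]) blast
  obtain C where g: "C > 0" "\<And>x. norm (g x) \<le> C" "g \<in> borel_measurable borel" "integrable lborel g"
    by (rule bounded_integrableE[OF assms(2)]) blast
  note [measurable] = f(3) g(3)
  show ?thesis
    by (rule Bochner_Integration.integrable_bound[where f="\<lambda>x. B * norm (g x)"])
       (use f g in \<open>auto simp: norm_mult intro!: mult_right_mono\<close>)
qed

definition lag_proj :: "real \<Rightarrow> nat \<Rightarrow> (complex^'n::finite \<Rightarrow> complex) \<Rightarrow> complex^'n \<Rightarrow> complex" where
  "lag_proj r k h z = (LINT y|lborel. proj_kernel r k z y * h y)"

lemma twisted_proj_eq_lag_proj:
  fixes h :: "complex^'n::finite \<Rightarrow> complex"
  assumes [measurable]: "h \<in> borel_measurable borel"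
  shows "of_real ((r / (2 * pi)) ^ CARD('n)) * twisted_proj k r h z = lag_proj r k h z"
proof -
  let ?f = "\<lambda>y. of_real ((r / (2 * pi)) ^ CARD('n)) * (h y * of_real (laguerre_fun k r (z - y)) * cis (r / 2 * sympl_form z (z - y)))"
  have "lag_proj r k h z = (LINT y|lborel. ?f y)"
    unfolding lag_proj_def by (intro Bochner_Integration.integral_cong refl) (simp add: twist_def sympl_form_simps mult_ac)
  also have "\<dots> = (LINT w|lborel. ?f (z - w))"
    by (rule integral_lborel_reflect[symmetric]) measurable
  also have "\<dots> = of_real ((r / (2 * pi)) ^ CARD('n)) * twisted_proj k r h z"
    by (simp add: twisted_proj_def sympl_form_def)
  finally show ?thesis ..
qed

lemma borel_measurable_lag_proj [measurable]:
  assumes [measurable]: "h \<in> borel_measurable borel"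
  shows "lag_proj r k h \<in> borel_measurable borel"
  unfolding lag_proj_def[abs_def] by measurable

text \<open>Boundedness comes from the bounded kernel, integrability from its Gaussian decay in z -
  y, as in Young's inequality.\<close>

lemma bounded_integrable_lag_proj:
  fixes h :: "complex^'n::finite \<Rightarrow> complex"
  assumes r: "r > 0" and h: "bounded_integrable h"
  shows "bounded_integrable (lag_proj r k h)"
  unfolding bounded_integrable_def
proof
  obtain B where hB: "B > 0" "\<And>x. norm (h x) \<le> B" "h \<in> borel_measurable borel" "integrable lborel h"
    by (rule bounded_integrableE[OF h]) blast
  note [measurable] = hB(3)
  note i = integrable_proj_kernel_mult[OF r hB(3,2)]
  let ?D = "(r / (2 * pi)) ^ CARD('n) * 4 ^ k"
  let ?C = "?D * (4 / 3) ^ CARD('n)"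
  have "norm (lag_proj r k h z) \<le> ?C * (LINT y|lborel. norm (h y))" for z
  proof -
    have "norm (lag_proj r k h z) \<le> (LINT y|lborel. norm (proj_kernel r k z y * h y))"
      unfolding lag_proj_def by (rule integral_norm_bound)
    also have "\<dots> \<le> (LINT y|lborel. ?C * norm (h y))"
      using hB(4) norm_proj_kernel_bounded[OF r, of k z]
      by (intro integral_mono integrable_norm i) (auto simp: norm_mult intro!: mult_right_mono)
    finally show ?thesis by simp
  qed
  then show "\<exists>B. \<forall>z. norm (lag_proj r k h z) \<le> B" by blast
  have m: "(\<lambda>(y, z). proj_kernel r k z y * h y) \<in> borel_measurable (lborel \<Otimes>\<^sub>M lborel)" by measurable
  have maj: "integrable lborel (\<lambda>z. gauss_majorant r (z - y))" for y :: "complex^'n"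
    using integrable_lborel_affine[OF _ gauss_majorant_integrable[OF r], of 1 "- y"] by (simp add: add.commute)
  have ik: "integrable lborel (\<lambda>z. proj_kernel r k z y * h y)" for y
  proof (intro integrable_mult_left)
    show "integrable lborel (\<lambda>z. proj_kernel r k z y)"
    proof (rule Bochner_Integration.integrable_bound[OF integrable_mult_right[OF maj, of ?D]])
      show "AE x in lborel. norm (proj_kernel r k x y) \<le> norm (?D * gauss_majorant r (x - y))"
        using norm_proj_kernel_le[OF r, of k _ y] r by (intro AE_I2) (auto simp: abs_mult gauss_majorant_nonneg)
    qed simp
  qed
  have "integrable (lborel \<Otimes>\<^sub>M lborel) (\<lambda>(y, z). proj_kernel r k z y * h y)"
  proof (rule lborel_pair.Fubini_integrable[OF m])
    show "integrable lborel (\<lambda>y. LINT z|lborel. norm (case (y, z) of (y, z) \<Rightarrow> proj_kernel r k z y * h y))"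
    proof (rule Bochner_Integration.integrable_bound)
      show "integrable lborel (\<lambda>y. (?D * (LINT w|lborel. gauss_majorant r (w :: complex^'n))) * norm (h y))"
        using hB(4) by simp
      show "AE y in lborel. norm (LINT z|lborel. norm (case (y, z) of (y, z) \<Rightarrow> proj_kernel r k z y * h y))
        \<le> norm ((?D * (LINT w|lborel. gauss_majorant r (w :: complex^'n))) * norm (h y))"
      proof (rule AE_I2)
        fix y
        have "(LINT z|lborel. norm (proj_kernel r k z y * h y)) \<le> (LINT z|lborel. (?D * gauss_majorant r (z - y)) * norm (h y))"
          using norm_proj_kernel_le[OF r, of k _ y] maj
          by (intro integral_mono integrable_norm ik) (auto simp: norm_mult intro!: mult_right_mono)
        also have "\<dots> = (?D * (LINT w|lborel. gauss_majorant r (w :: complex^'n))) * norm (h y)"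
          using integral_lborel_translate[of "gauss_majorant r" "- y"] by (simp add: add.commute)
        finally show "norm (LINT z|lborel. norm (case (y, z) of (y, z) \<Rightarrow> proj_kernel r k z y * h y))
          \<le> norm ((?D * (LINT w|lborel. gauss_majorant r (w :: complex^'n))) * norm (h y))"
          by (simp add: integral_nonneg)
      qed
    qed measurable
  qed (use ik in simp)
  from lborel_pair.integrable_snd[OF this]
  show "integrable lborel (lag_proj r k h)" unfolding lag_proj_def[abs_def] .
qed

lemma lag_proj_self_adjoint:
  fixes h g :: "complex^'n::finite \<Rightarrow> complex"
  assumes r: "r > 0" and h: "bounded_integrable h" and g: "bounded_integrable g"
  shows "(LINT z|lborel. lag_proj r k h z * cnj (g z)) = (LINT z|lborel. h z * cnj (lag_proj r k g z))"
proof -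
  obtain B where hB: "h \<in> borel_measurable borel" "integrable lborel h"
    by (rule bounded_integrableE[OF h]) blast
  obtain C where gC: "g \<in> borel_measurable borel" "integrable lborel g"
    by (rule bounded_integrableE[OF g]) blast
  note [measurable] = hB(1) gC(1)
  let ?D = "((r / (2 * pi)) ^ CARD('n) * 4 ^ k) * (4 / 3) ^ CARD('n)"
  let ?F = "\<lambda>z y. proj_kernel r k z y * h y * cnj (g z)"
  have "integrable (lborel \<Otimes>\<^sub>M lborel) (\<lambda>(z, y). (?D * norm (g z)) * norm (h y))"
    using hB gC by (intro lborel_pair.integrable_product_mult) auto
  then have i: "integrable (lborel \<Otimes>\<^sub>M lborel) (\<lambda>(z, y). ?F z y)"
  proof (rule Bochner_Integration.integrable_bound)
    show "AE x in lborel \<Otimes>\<^sub>M lborel. norm (case x of (z, y) \<Rightarrow> ?F z y) \<le> norm (case x of (z, y) \<Rightarrow> (?D * norm (g z)) * norm (h y))"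
    proof (rule AE_I2, safe)
      fix z y :: "complex^'n"
      have "norm (?F z y) = norm (proj_kernel r k z y) * (norm (h y) * norm (g z))" by (simp add: norm_mult)
      also have "\<dots> \<le> ?D * (norm (h y) * norm (g z))"
        by (intro mult_right_mono norm_proj_kernel_bounded r) auto
      finally show "norm (?F z y) \<le> norm ((?D * norm (g z)) * norm (h y))" using r by (simp add: abs_mult mult_ac)
    qed
  qed measurable
  have "(LINT z|lborel. lag_proj r k h z * cnj (g z)) = (LINT z|lborel. LINT y|lborel. ?F z y)"
    by (simp add: lag_proj_def)
  also have "\<dots> = (LINT y|lborel. LINT z|lborel. ?F z y)"
    using lborel_pair.Fubini_integral[OF i] by simp
  also have "\<dots> = (LINT y|lborel. h y * cnj (lag_proj r k g y))"
  proof (rule Bochner_Integration.integral_cong[OF refl])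
    fix y :: "complex^'n"
    have herm: "proj_kernel r k z y = cnj (proj_kernel r k y z)" for z by (rule twist_hermitian) simp
    have "?F z y = h y * cnj (proj_kernel r k y z * g z)" for z
      by (simp add: herm[of z] mult_ac)
    then have "(LINT z|lborel. ?F z y) = h y * (LINT z|lborel. cnj (proj_kernel r k y z * g z))"
      by (simp only: integral_mult_right_zero)
    then show "(LINT z|lborel. ?F z y) = h y * cnj (lag_proj r k g y)"
      by (simp only: lag_proj_def Bochner_Integration.integral_cnj)
  qed
  finally show ?thesis .
qed

lemma lag_proj_compose:
  fixes h :: "complex^'n::finite \<Rightarrow> complex"
  assumes r: "r > 0" and h: "bounded_integrable h"
  shows "lag_proj r j (lag_proj r k h) z = (if j = k then lag_proj r k h z else 0)"
proof -
  obtain B where hB: "h \<in> borel_measurable borel" "integrable lborel h"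
    by (rule bounded_integrableE[OF h]) blast
  note [measurable] = hB(1)
  let ?D = "((r / (2 * pi)) ^ CARD('n) * 4 ^ k) * (4 / 3) ^ CARD('n)"
  let ?F = "\<lambda>x y. proj_kernel r j z x * (proj_kernel r k x y * h y)"
  have "integrable lborel (\<lambda>x. proj_kernel r j z x * 1)"
    by (rule integrable_proj_kernel_mult[OF r, where B=1]) auto
  then have "integrable (lborel \<Otimes>\<^sub>M lborel) (\<lambda>(x, y). (?D * norm (proj_kernel r j z x)) * norm (h y))"
    using hB by (intro lborel_pair.integrable_product_mult) auto
  then have i: "integrable (lborel \<Otimes>\<^sub>M lborel) (\<lambda>(x, y). ?F x y)"
  proof (rule Bochner_Integration.integrable_bound)
    show "AE x in lborel \<Otimes>\<^sub>M lborel. norm (case x of (x, y) \<Rightarrow> ?F x y) \<le> norm (case x of (x, y) \<Rightarrow> (?D * norm (proj_kernel r j z x)) * norm (h y))"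
    proof (rule AE_I2, safe)
      fix x y :: "complex^'n"
      have "norm (?F x y) = norm (proj_kernel r k x y) * (norm (h y) * norm (proj_kernel r j z x))" by (simp add: norm_mult)
      also have "\<dots> \<le> ?D * (norm (h y) * norm (proj_kernel r j z x))"
        by (intro mult_right_mono norm_proj_kernel_bounded r) auto
      finally show "norm (?F x y) \<le> norm ((?D * norm (proj_kernel r j z x)) * norm (h y))" using r by (simp add: abs_mult mult_ac)
    qed
  qed measurable
  have "lag_proj r j (lag_proj r k h) z = (LINT x|lborel. LINT y|lborel. ?F x y)"
    by (simp add: lag_proj_def)
  also have "\<dots> = (LINT y|lborel. LINT x|lborel. ?F x y)"
    using lborel_pair.Fubini_integral[OF i] by simp
  also have "\<dots> = (LINT y|lborel. (LINT x|lborel. proj_kernel r j z x * proj_kernel r k x y) * h y)"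
    by (simp flip: mult.assoc)
  also have "\<dots> = (if j = k then lag_proj r k h z else 0)"
    by (simp add: proj_kernel_compose[OF r] lag_proj_def)
  finally show ?thesis .
qed

text \<open>Bessel's inequality for mutually orthogonal ranges with coefficients of modulus at most
  1. It rests on the nonnegative norm of \<open>w\<close> minus its partial sum, since completeness
  of the projections is still to be proved.\<close>

lemma
  fixes w :: "complex^'n::finite \<Rightarrow> complex"
  assumes r: "r > 0" and w: "bounded_integrable w" and c: "\<And>k. norm (c k) \<le> 1"
  shows integrable_lag_proj_sum: "integrable lborel (\<lambda>z. (norm (\<Sum>k<K. c k * lag_proj r k w z))\<^sup>2)"
    and lag_proj_bessel:
      "(LINT z|lborel. (norm (\<Sum>k<K. c k * lag_proj r k w z))\<^sup>2) \<le> (LINT z|lborel. (norm (w z))\<^sup>2)"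
proof -
  let ?a = "\<lambda>k. lag_proj r k w"
  note a = bounded_integrable_lag_proj[OF r w]
  have sq: "of_real ((norm x)\<^sup>2) = x * cnj x" for x :: complex
    by (rule complex_norm_square)
  \<comment> \<open>By self-adjointness and idempotence N k is both the inner product of
    \<open>w\<close> with its projection and the squared norm of that projection. All mixed inner
    products below are therefore N k or 0.\<close>
  define N where "N = (\<lambda>k. LINT z|lborel. (norm (?a k z))\<^sup>2)"
  have N: "(LINT z|lborel. ?a k z * cnj (?a k z)) = of_real (N k)" for k
    unfolding N_def by (simp only: sq[symmetric] integral_complex_of_real)
  have N0: "N k \<ge> 0" for k unfolding N_def by (simp add: integral_nonneg)
  have wa: "(LINT z|lborel. w z * cnj (?a k z)) = of_real (N k)" for k
    using lag_proj_self_adjoint[OF r w a[of k], of k] lag_proj_compose[OF r w, of k k] N by simp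
  have aw: "(LINT z|lborel. ?a k z * cnj (w z)) = of_real (N k)" for k
    using lag_proj_self_adjoint[OF r w w, of k] wa by simp
  have aa: "(LINT z|lborel. ?a j z * cnj (?a k z)) = (if j = k then of_real (N k) else 0)" for j k
    using lag_proj_self_adjoint[OF r w a[of k], of j] lag_proj_compose[OF r w, of j k] wa by auto
  note i = bounded_integrable_mult_cnj[OF a a] bounded_integrable_mult_cnj[OF w a] bounded_integrable_mult_cnj[OF a w]
    bounded_integrable_mult_cnj[OF w w]
  have e1: "of_real ((norm (\<Sum>k<K. c k * ?a k z))\<^sup>2) = (\<Sum>j<K. \<Sum>k<K. (c j * cnj (c k)) * (?a j z * cnj (?a k z)))" for z
    unfolding complex_norm_square cnj_sum sum_product by (simp add: mult_ac)
  have i1: "integrable lborel (\<lambda>z. of_real ((norm (\<Sum>k<K. c k * ?a k z))\<^sup>2) :: complex)"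
    unfolding e1 by (intro Bochner_Integration.integrable_sum integrable_mult_right i)
  then show "integrable lborel (\<lambda>z. (norm (\<Sum>k<K. c k * ?a k z))\<^sup>2)"
    by (simp only: complex_of_real_integrable_eq)
  have cc: "c j * cnj (c j) = of_real ((norm (c j))\<^sup>2)" for j by (simp only: complex_norm_square)
  have "complex_of_real (LINT z|lborel. (norm (\<Sum>k<K. c k * ?a k z))\<^sup>2) =
      (\<Sum>j<K. \<Sum>k<K. (c j * cnj (c k)) * (if j = k then of_real (N k) else 0))"
    unfolding integral_complex_of_real[symmetric] e1 by (simp add: i aa)
  also have "\<dots> = (\<Sum>j<K. of_real ((norm (c j))\<^sup>2 * N j))"
    by (intro sum.cong refl) (simp add: sum.delta' if_distrib[of "\<lambda>x. _ * x"] cc cong: if_cong)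
  finally have "(LINT z|lborel. (norm (\<Sum>k<K. c k * ?a k z))\<^sup>2) = (\<Sum>j<K. (norm (c j))\<^sup>2 * N j)"
    by (simp only: of_real_sum[symmetric] of_real_eq_iff)
  also have "\<dots> \<le> (\<Sum>j<K. 1 * N j)"
    using c N0 by (intro sum_mono mult_right_mono) (auto simp: power_le_one)
  also have "\<dots> \<le> (LINT z|lborel. (norm (w z))\<^sup>2)"
  proof -
    have e2: "of_real ((norm (w z - (\<Sum>k<K. ?a k z)))\<^sup>2) = w z * cnj (w z) - (\<Sum>k<K. w z * cnj (?a k z)) - (\<Sum>k<K. ?a k z * cnj (w z))
        + (\<Sum>j<K. \<Sum>k<K. ?a j z * cnj (?a k z))" for z
      unfolding complex_norm_square complex_cnj_diff cnj_sum sum_product[symmetric] sum_distrib_left[symmetric] sum_distrib_right[symmetric]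
      by (simp add: algebra_simps)
    define W where "W = (LINT z|lborel. (norm (w z))\<^sup>2)"
    have W: "(LINT z|lborel. w z * cnj (w z)) = of_real W"
      by (simp only: sq[symmetric] integral_complex_of_real W_def)
    have "complex_of_real (LINT z|lborel. (norm (w z - (\<Sum>k<K. ?a k z)))\<^sup>2) =
       of_real W - (\<Sum>k<K. of_real (N k)) - (\<Sum>k<K. of_real (N k)) + (\<Sum>j<K. \<Sum>k<K. if j = k then of_real (N k) else 0)"
      unfolding integral_complex_of_real[symmetric] e2 by (simp add: i aa wa aw W)
    also have "\<dots> = of_real (W - (\<Sum>k<K. N k))"
      by (simp add: sum.delta')
    finally have "(LINT z|lborel. (norm (w z - (\<Sum>k<K. ?a k z)))\<^sup>2) = W - (\<Sum>k<K. N k)"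
      by (simp only: of_real_eq_iff)
    moreover have "0 \<le> (LINT z|lborel. (norm (w z - (\<Sum>k<K. ?a k z)))\<^sup>2)" by (simp add: integral_nonneg)
    ultimately show ?thesis by (simp add: W_def)
  qed
  finally show "(LINT z|lborel. (norm (\<Sum>k<K. c k * ?a k z))\<^sup>2) \<le> (LINT z|lborel. (norm (w z))\<^sup>2)" .
qed

text \<open>Beyond |t| = 1/4 the Gaussian majorant is lost, but |\<phi>_k(w)| \<le> \<phi>_k(0)
  bounds all partial sums by the Mehler value at 0. A constant suffices here because
  \<open>h\<close> is integrable.\<close>

lemma lag_proj_abel_sums:
  fixes h :: "complex^'n::finite \<Rightarrow> complex"
  assumes r: "r > 0" and t: "0 \<le> t" "t < 1" and h: "bounded_integrable h"
  shows "(\<lambda>k. of_real t ^ k * lag_proj r k h z) sums (LINT y|lborel. mehler_kernel r t z y * h y)"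
proof -
  obtain B where hB: "\<And>x. norm (h x) \<le> B" "h \<in> borel_measurable borel" "integrable lborel h"
    by (rule bounded_integrableE[OF h]) blast
  note [measurable] = hB(2)
  have t1: "\<bar>t\<bar> < 1" using t by simp
  let ?C = "(r / (2 * pi)) ^ CARD('n)"
  have s0: "(\<lambda>k. t ^ k * laguerre_fun k r (0 :: complex^'n)) sums mehler t r (0 :: complex^'n)"
    by (rule laguerre_fun_sums_mehler[OF t1])
  have "(\<lambda>k. LINT y|lborel. of_real t ^ k * (proj_kernel r k z y * h y)) sums (LINT y|lborel. mehler_kernel r t z y * h y)"
  proof (rule sums_integral_dominated)
    show "integrable lborel (\<lambda>y. of_real t ^ k * (proj_kernel r k z y * h y))" for k
      by (intro integrable_mult_right integrable_proj_kernel_mult[OF r hB(2,1)])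
    show "integrable lborel (\<lambda>y. (?C * mehler t r (0 :: complex^'n)) * norm (h y))" using hB(3) by simp
    show "(\<lambda>k. of_real t ^ k * (proj_kernel r k z y * h y)) sums (mehler_kernel r t z y * h y)" for y
      using sums_mult2[OF proj_kernel_sums[OF t1, of r z y], of "h y"] by (simp add: mult.assoc)
    show "norm (\<Sum>k<K. of_real t ^ k * (proj_kernel r k z y * h y)) \<le> (?C * mehler t r (0 :: complex^'n)) * norm (h y)" for K y
    proof -
      have "norm (\<Sum>k<K. of_real t ^ k * (proj_kernel r k z y * h y)) \<le> (\<Sum>k<K. ?C * (t ^ k * laguerre_fun k r (0::complex^'n))) * norm (h y)"
        unfolding sum_distrib_right using abs_laguerre_fun_le_0[OF r, of _ "z - y"] t r
        by (intro order_trans[OF norm_sum] sum_mono)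
           (auto simp: norm_mult norm_power norm_twist mult_ac intro!: mult_left_mono)
      also have "\<dots> \<le> (?C * mehler t r (0 :: complex^'n)) * norm (h y)"
      proof -
        have "0 \<le> laguerre_fun k r (0::complex^'n)" for k
          using abs_laguerre_fun_le_0[OF r, of k "0 :: complex^'n"] by simp
        then have "(\<Sum>k<K. t ^ k * laguerre_fun k r (0::complex^'n)) \<le> mehler t r (0 :: complex^'n)"
          unfolding sums_unique[OF s0] using t by (intro sum_le_suminf sums_summable[OF s0]) auto
        then show ?thesis using r unfolding sum_distrib_left[symmetric] by (intro mult_right_mono mult_left_mono) auto
      qed
      finally show ?thesis .
    qed
  qed measurable
  then show ?thesis by (simp add: lag_proj_def)
qed

text \<open>For t near 1 the Mehler kernel is a Gaussian with large exponent (r/4)(1+t)/(1-t). Its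
  phase is absorbed into \<open>h\<close>, where it equals 1 at y = z.\<close>

lemma mehler_kernel_tendsto:
  fixes h :: "complex^'n::finite \<Rightarrow> complex"
  assumes r: "r > 0" and hm [measurable]: "h \<in> borel_measurable borel" and B: "\<And>x. norm (h x) \<le> B" and c: "isCont h z"
  shows "(\<lambda>n. LINT y|lborel. mehler_kernel r (1 - 1 / real (n + 2)) z y * h y) \<longlonglongrightarrow> h z"
proof -
  \<comment> \<open>The sequence starts at 1/2, so all its members lie strictly between 0 and
    1.\<close>
  define t where "t = (\<lambda>n. 1 - 1 / real (n + 2))"
  have t: "t n < 1" "0 < t n" for n by (auto simp: t_def divide_simps)
  have tl: "t \<longlonglongrightarrow> 1" unfolding t_def
    using tendsto_diff[OF tendsto_const LIMSEQ_ignore_initial_segment[OF lim_1_over_n[where 'a=real], of 2], of 1] by simp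
  define a where "a = (\<lambda>n. r / 4 * ((1 + t n) / (1 - t n)))"
  have aeq: "r / 4 * ((1 + t n) / (1 - t n)) = a n" for n by (simp add: a_def)
  have a: "a n > 0" for n using r t[of n] by (simp add: a_def)
  define H where "H = (\<lambda>y. cis (- (r / 2) * sympl_form z y) * h y)"
  have [measurable]: "H \<in> borel_measurable borel" unfolding H_def by measurable
  let ?C = "r / (2 * pi)"
  have eq: "(LINT y|lborel. mehler_kernel r (t n) z y * h y) =
     of_real ((?C * (4 / (r * (1 + t n)))) ^ CARD('n)) *
       (LINT u|lborel. of_real (exp (- (norm u)\<^sup>2)) * H (z + (1 / sqrt (a n)) *\<^sub>R u))" for n
  proof -
    have "(LINT y|lborel. mehler_kernel r (t n) z y * h y) =
      (LINT y|lborel. of_real ((?C * (1 / (1 - t n))) ^ CARD('n)) * (of_real (exp (- a n * (norm (z - y))\<^sup>2)) * H y))"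
      unfolding twist_def mehler_def H_def aeq power_mult_distrib of_real_mult by (simp only: mult_ac)
    also have "\<dots> = of_real ((?C * (1 / (1 - t n))) ^ CARD('n)) * (of_real ((1 / sqrt (a n)) ^ DIM(complex^'n)) *
        (LINT u|lborel. of_real (exp (- (norm u)\<^sup>2)) * H (z + (1 / sqrt (a n)) *\<^sub>R u)))"
      unfolding integral_mult_right_zero by (subst gauss_convolution[OF a]) auto
    also have "(1 / sqrt (a n)) ^ DIM(complex^'n) = (1 / a n) ^ CARD('n)"
      unfolding DIM_complex_vec power_mult using a[of n] by (simp add: power_divide)
    also have "of_real ((?C * (1 / (1 - t n))) ^ CARD('n)) * (of_real ((1 / a n) ^ CARD('n)) * x) =
        of_real ((?C * (4 / (r * (1 + t n)))) ^ CARD('n)) * x" for x :: complex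
    proof -
      have "?C * (1 / (1 - t n)) * (1 / a n) = ?C * (4 / (r * (1 + t n)))"
      proof -
        have "?C * (1 / P) * (1 / (r / 4 * (Q / P))) = ?C * (4 / (r * Q))" if "P > 0" "Q > 0" for P Q
          using r that by (simp add: field_simps)
        note this[of "1 - t n" "1 + t n"]
        then show ?thesis unfolding aeq using t[of n] by simp
      qed
      then show ?thesis by (metis mult.assoc of_real_mult power_mult_distrib)
    qed
    finally show ?thesis .
  qed
  have "(\<lambda>n. (1 / a n)) \<longlonglongrightarrow> (4 / r) * ((1 - 1) / (1 + 1))"
  proof -
    have "1 / a n = (4 / r) * ((1 - t n) / (1 + t n))" for n
      using r t[of n] by (simp add: a_def)
    moreover have "(\<lambda>n. (4 / r) * ((1 - t n) / (1 + t n))) \<longlonglongrightarrow> (4 / r) * ((1 - 1) / (1 + 1))"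
      by (intro tendsto_intros tl) simp
    ultimately show ?thesis by simp
  qed
  then have e0: "(\<lambda>n. 1 / sqrt (a n)) \<longlonglongrightarrow> 0"
    using tendsto_real_sqrt[of "\<lambda>n. 1 / a n" 0 sequentially] by (simp add: real_sqrt_divide)
  have "isCont (\<lambda>y. cis (- (r / 2) * sympl_form z y)) z"
  proof -
    have "continuous_on UNIV (\<lambda>y. cis (- (r / 2) * sympl_form z y))" by (intro continuous_intros)
    then show ?thesis by (simp add: continuous_on_eq_continuous_at)
  qed
  then have "isCont H z" unfolding H_def using c by (intro continuous_intros)
  then have lim: "(\<lambda>n. LINT u|lborel. of_real (exp (- (norm u)\<^sup>2)) * H (z + (1 / sqrt (a n)) *\<^sub>R u)) \<longlonglongrightarrow>
      of_real (sqrt pi ^ DIM(complex^'n)) * H z"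
    by (rule gauss_approximate_identity[where B=B]) (use B e0 in \<open>auto simp: H_def norm_mult\<close>)
  have "(\<lambda>n. of_real ((?C * (4 / (r * (1 + t n)))) ^ CARD('n)) *
       (LINT u|lborel. of_real (exp (- (norm u)\<^sup>2)) * H (z + (1 / sqrt (a n)) *\<^sub>R u))) \<longlonglongrightarrow>
       of_real ((?C * (4 / (r * (1 + 1)))) ^ CARD('n)) * (of_real (sqrt pi ^ DIM(complex^'n)) * H z)"
    using r by (intro tendsto_mult tendsto_of_real tendsto_power tendsto_divide tendsto_add tendsto_const tl lim) auto
  \<comment> \<open>The normalisations cancel: r/(2 pi) from \<open>twist\<close>, 2/r from the
    limit of the Mehler prefactor after rescaling, and pi from the Gaussian integral.\<close>
  moreover have "of_real ((?C * (4 / (r * (1 + 1)))) ^ CARD('n)) * (of_real (sqrt pi ^ DIM(complex^'n)) * H z) = h z"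
  proof -
    have "sqrt pi ^ DIM(complex^'n) = pi ^ CARD('n)"
      unfolding DIM_complex_vec power_mult by simp
    moreover have "?C * (4 / (r * (1 + 1))) * pi = 1" using r by (simp add: field_simps)
    then have "(?C * (4 / (r * (1 + 1)))) ^ CARD('n) * pi ^ CARD('n) = 1"
      by (metis power_mult_distrib power_one)
    ultimately show ?thesis unfolding H_def by (simp only: mult.assoc[symmetric] of_real_mult[symmetric]) simp
  qed
  ultimately show ?thesis unfolding eq[symmetric] by (simp add: t_def)
qed

text \<open>Abel summation: the series is known to converge absolutely, so its value is the limit of the Mehler integrals.\<close>

lemma lag_proj_sums:
  fixes h :: "complex^'n::finite \<Rightarrow> complex"
  assumes r: "r > 0" and h: "bounded_integrable h" and c: "isCont h z"
    and s: "summable (\<lambda>k. norm (lag_proj r k h z))"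
  shows "(\<lambda>k. lag_proj r k h z) sums h z"
proof -
  obtain B where hB: "\<And>x. norm (h x) \<le> B" "h \<in> borel_measurable borel"
    by (rule bounded_integrableE[OF h]) blast
  define t where "t = (\<lambda>n. 1 - 1 / real (n + 2))"
  have t: "t n < 1" "0 \<le> t n" for n by (auto simp: t_def divide_simps)
  have tl: "t \<longlonglongrightarrow> 1" unfolding t_def
    using tendsto_diff[OF tendsto_const LIMSEQ_ignore_initial_segment[OF lim_1_over_n[where 'a=real], of 2], of 1] by simp
  have "(\<lambda>n. \<Sum>k. of_real (t n) ^ k * lag_proj r k h z) \<longlonglongrightarrow> (\<Sum>k. lag_proj r k h z)"
  proof -
    let ?a = "\<lambda>k n. complex_of_real (t n) ^ k * lag_proj r k h z"
    let ?b = "\<lambda>k. complex_of_real 1 ^ k * lag_proj r k h z"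
    have "eventually (\<lambda>n. summable (\<lambda>k. norm (?a k n))) sequentially \<and> summable (\<lambda>k. norm (?b k)) \<and>
        ((\<lambda>n. suminf (\<lambda>k. ?a k n)) \<longlongrightarrow> suminf ?b) sequentially"
    proof (rule tannerys_theorem[where M="\<lambda>k. norm (lag_proj r k h z)"])
      show "(?a k \<longlongrightarrow> ?b k) sequentially" for k
        by (intro tendsto_intros tl)
      show "\<forall>\<^sub>F (k, n) in at_top \<times>\<^sub>F sequentially. norm (?a k n) \<le> norm (lag_proj r k h z)"
        using t by (intro always_eventually) (auto simp: norm_mult norm_power mult_left_le_one_le power_le_one less_imp_le)
    qed (use s in auto)
    then show ?thesis by simp
  qed
  moreover have "(\<Sum>k. of_real (t n) ^ k * lag_proj r k h z) = (LINT y|lborel. mehler_kernel r (t n) z y * h y)" for n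
    using lag_proj_abel_sums[OF r t(2) t(1) h] by (simp add: sums_iff)
  moreover have "(\<lambda>n. LINT y|lborel. mehler_kernel r (t n) z y * h y) \<longlonglongrightarrow> h z"
    unfolding t_def by (rule mehler_kernel_tendsto[OF r hB(2,1) c])
  ultimately have "(\<Sum>k. lag_proj r k h z) = h z" by (simp add: LIMSEQ_unique)
  then show ?thesis using summable_norm_cancel[OF s] by (simp add: sums_iff)
qed

section \<open>Schwartz functions and resolvents of affine vector fields\<close>

text \<open>Iterated derivatives never leave \<open>P\<close>, so a closure proof needs only one
  first derivative. The last entry of the list is the innermost derivative, hence the reversed list
  induction.\<close>

lemma schwartz_coinduct:
  assumes "P f"
    and step: "\<And>f. P f \<Longrightarrow> (\<forall>x. f differentiable (at x)) \<and>
      (\<forall>N::nat. \<exists>C. \<forall>x. (1 + norm x) ^ N * norm (f x) \<le> C) \<and> (\<forall>b\<in>Basis. P (dir_deriv b f))"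
  shows "schwartz f"
proof -
  have "(\<forall>x. foldr dir_deriv bs f differentiable (at x)) \<and>
     (\<forall>N::nat. bounded (range (\<lambda>x. (1 + norm x) ^ N *\<^sub>R foldr dir_deriv bs f x)))" if "bs \<in> lists Basis" "P f" for bs f
    using that
  proof (induction bs arbitrary: f rule: rev_induct)
    case Nil
    have "bounded (range (\<lambda>x. (1 + norm x) ^ N *\<^sub>R f x))" for N
    proof -
      obtain C where "\<forall>x. (1 + norm x) ^ N * norm (f x) \<le> C" using step[OF Nil(2)] by blast
      then show ?thesis by (auto simp: bounded_iff abs_mult power_abs intro!: exI[of _ C])
    qed
    with step[OF Nil(2)] show ?case by simp
  next
    case (snoc b bs)
    then show ?case using step[OF snoc(3)] by simp
  qed
  with assms(1) show ?thesis by (auto simp: schwartz_def)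
qed

lemma schwartz_dir_deriv: "schwartz f \<Longrightarrow> b \<in> Basis \<Longrightarrow> schwartz (dir_deriv b f)"
  unfolding schwartz_def
proof
  fix bs :: "'a list" assume a: "\<forall>bs\<in>lists Basis. (\<forall>x. foldr dir_deriv bs f differentiable (at x)) \<and>
      (\<forall>N. bounded (range (\<lambda>x. (1 + norm x) ^ N *\<^sub>R foldr dir_deriv bs f x)))" "b \<in> Basis" "bs \<in> lists Basis"
  then have "bs @ [b] \<in> lists Basis" by auto
  from bspec[OF a(1) this] show "(\<forall>x. foldr dir_deriv bs (dir_deriv b f) differentiable (at x)) \<and>
      (\<forall>N. bounded (range (\<lambda>x. (1 + norm x) ^ N *\<^sub>R foldr dir_deriv bs (dir_deriv b f) x)))" by simp
qed

lemma schwartz_differentiable: "schwartz f \<Longrightarrow> f differentiable (at x)"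
  unfolding schwartz_def by (drule bspec[of _ _ "[]"]) auto

lemma schwartz_decay: "schwartz f \<Longrightarrow> \<exists>C. \<forall>x. (1 + norm x) ^ N * norm (f x) \<le> C"
proof -
  assume "schwartz f"
  then have "bounded (range (\<lambda>x. (1 + norm x) ^ N *\<^sub>R f x))"
    unfolding schwartz_def by (drule_tac bspec[of _ _ "[]"]) auto
  then obtain C where "\<forall>x. norm ((1 + norm x) ^ N *\<^sub>R f x) \<le> C" by (auto simp: bounded_iff)
  then show ?thesis by (auto simp: abs_mult power_abs)
qed

lemma schwartz_continuous: "schwartz f \<Longrightarrow> continuous_on UNIV f"
  by (simp add: continuous_on_eq_continuous_at schwartz_differentiable differentiable_imp_continuous_within)

lemma schwartz_borel_measurable: "schwartz f \<Longrightarrow> f \<in> borel_measurable borel"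
  by (intro borel_measurable_continuous_onI schwartz_continuous)

lemma schwartz_has_derivative: "schwartz f \<Longrightarrow> (f has_derivative frechet_derivative f (at x)) (at x)"
  using schwartz_differentiable frechet_derivative_works by blast

lemma dir_deriv_eqI: "(f has_derivative D) (at x) \<Longrightarrow> dir_deriv b f x = D b"
  using frechet_derivative_at[of f D x] by (simp add: dir_deriv_def)

lemma frechet_derivative_eq_dir_deriv:
  assumes "f differentiable (at x)"
  shows "frechet_derivative f (at x) v = (\<Sum>b\<in>Basis. (v \<bullet> b) *\<^sub>R dir_deriv b f x)"
proof -
  have l: "linear (frechet_derivative f (at x))"
    using assms by (rule linear_frechet_derivative)
  have "frechet_derivative f (at x) v = frechet_derivative f (at x) (\<Sum>b\<in>Basis. (v \<bullet> b) *\<^sub>R b)"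
    by (simp add: euclidean_representation)
  also have "\<dots> = (\<Sum>b\<in>Basis. (v \<bullet> b) *\<^sub>R frechet_derivative f (at x) b)"
    by (simp add: linear_sum[OF l] linear_cmul[OF l])
  finally show ?thesis by (simp add: dir_deriv_def)
qed

lemma schwartz_zero: "schwartz (\<lambda>_. 0)"
  by (rule schwartz_coinduct[of "\<lambda>f. f = (\<lambda>_. 0)"]) (auto simp: dir_deriv_def frechet_derivative_const)

lemma schwartz_add:
  assumes "schwartz f" "schwartz g" shows "schwartz (\<lambda>x. f x + g x)"
proof (rule schwartz_coinduct[of "\<lambda>h. \<exists>f g. schwartz f \<and> schwartz g \<and> h = (\<lambda>x. f x + g x)"])
  show "\<exists>f' g'. schwartz f' \<and> schwartz g' \<and> (\<lambda>x. f x + g x) = (\<lambda>x. f' x + g' x)" using assms by blast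
  fix h :: "'a \<Rightarrow> complex" assume "\<exists>f g. schwartz f \<and> schwartz g \<and> h = (\<lambda>x. f x + g x)"
  then obtain f g where fg: "schwartz f" "schwartz g" and h: "h = (\<lambda>x. f x + g x)" by blast
  have "\<exists>C. \<forall>x. (1 + norm x) ^ N * norm (h x) \<le> C" for N
  proof -
    obtain C D where C: "\<And>x. (1 + norm x) ^ N * norm (f x) \<le> C" and D: "\<And>x. (1 + norm x) ^ N * norm (g x) \<le> D"
      using schwartz_decay[OF fg(1)] schwartz_decay[OF fg(2)] by metis
    have "(1 + norm x) ^ N * norm (h x) \<le> C + D" for x
    proof -
      have "(1 + norm x) ^ N * norm (h x) \<le> (1 + norm x) ^ N * (norm (f x) + norm (g x))"
        unfolding h by (intro mult_left_mono norm_triangle_ineq) auto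
      also have "\<dots> \<le> C + D" using C[of x] D[of x] by (simp add: distrib_left)
      finally show ?thesis .
    qed
    then show ?thesis by blast
  qed
  moreover have e: "dir_deriv b h = (\<lambda>x. dir_deriv b f x + dir_deriv b g x)" for b
    unfolding h by (rule ext, rule dir_deriv_eqI[THEN trans])
      (auto intro!: has_derivative_add schwartz_has_derivative fg simp: dir_deriv_def)
  ultimately show "(\<forall>x. h differentiable (at x)) \<and> (\<forall>N::nat. \<exists>C. \<forall>x. (1 + norm x) ^ N * norm (h x) \<le> C) \<and>
      (\<forall>b\<in>Basis. \<exists>f g. schwartz f \<and> schwartz g \<and> dir_deriv b h = (\<lambda>x. f x + g x))"
  proof (intro conjI allI ballI)
    show "h differentiable (at x)" for x
      unfolding h by (intro differentiable_add schwartz_differentiable fg)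
    show "\<exists>f g. schwartz f \<and> schwartz g \<and> dir_deriv b h = (\<lambda>x. f x + g x)" if "b \<in> Basis" for b
      by (rule exI[of _ "dir_deriv b f"], rule exI[of _ "dir_deriv b g"]) (simp add: e schwartz_dir_deriv fg that)
  qed blast
qed

lemma schwartz_cmult:
  assumes "schwartz f" shows "schwartz (\<lambda>x. c * f x)"
proof (rule schwartz_coinduct[of "\<lambda>h. \<exists>f. schwartz f \<and> h = (\<lambda>x. c * f x)"])
  show "\<exists>f'. schwartz f' \<and> (\<lambda>x. c * f x) = (\<lambda>x. c * f' x)" using assms by blast
  fix h :: "'a \<Rightarrow> complex" assume "\<exists>f. schwartz f \<and> h = (\<lambda>x. c * f x)"
  then obtain f where f: "schwartz f" and h: "h = (\<lambda>x. c * f x)" by blast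
  have "\<exists>C. \<forall>x. (1 + norm x) ^ N * norm (h x) \<le> C" for N
  proof -
    obtain C where C: "\<And>x. (1 + norm x) ^ N * norm (f x) \<le> C" using schwartz_decay[OF f] by metis
    have "(1 + norm x) ^ N * norm (h x) \<le> norm c * C" for x
      using mult_left_mono[OF C[of x], of "norm c"] by (simp add: h norm_mult mult_ac)
    then show ?thesis by blast
  qed
  moreover have e: "dir_deriv b h = (\<lambda>x. c * dir_deriv b f x)" for b
    unfolding h by (rule ext, rule dir_deriv_eqI[THEN trans])
      (auto intro!: has_derivative_mult_right schwartz_has_derivative f simp: dir_deriv_def)
  ultimately show "(\<forall>x. h differentiable (at x)) \<and> (\<forall>N::nat. \<exists>C. \<forall>x. (1 + norm x) ^ N * norm (h x) \<le> C) \<and>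
      (\<forall>b\<in>Basis. \<exists>f. schwartz f \<and> dir_deriv b h = (\<lambda>x. c * f x))"
  proof (intro conjI allI ballI)
    show "h differentiable (at x)" for x
      unfolding h by (intro differentiable_mult differentiable_const schwartz_differentiable f)
    show "\<exists>f. schwartz f \<and> dir_deriv b h = (\<lambda>x. c * f x)" if "b \<in> Basis" for b
      by (rule exI[of _ "dir_deriv b f"]) (simp add: e schwartz_dir_deriv f that)
  qed blast
qed

text \<open>The product rule leaves a second Schwartz term, so the class for the coinduction
  consists of sums of a linear factor times \<open>f\<close> and a further \<open>g\<close>, not of
  products alone.\<close>

lemma schwartz_inner_mult:
  assumes "schwartz f" shows "schwartz (\<lambda>x. of_real (u \<bullet> x) * f x)"
proof (rule schwartz_coinduct[of "\<lambda>h. \<exists>f g. schwartz f \<and> schwartz g \<and> h = (\<lambda>x. of_real (u \<bullet> x) * f x + g x)"])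
  show "\<exists>f' g'. schwartz f' \<and> schwartz g' \<and> (\<lambda>x. of_real (u \<bullet> x) * f x) = (\<lambda>x. of_real (u \<bullet> x) * f' x + g' x)"
    using assms schwartz_zero by (intro exI[of _ f] exI[of _ "\<lambda>_. 0"]) auto
  fix h :: "'a \<Rightarrow> complex" assume "\<exists>f g. schwartz f \<and> schwartz g \<and> h = (\<lambda>x. of_real (u \<bullet> x) * f x + g x)"
  then obtain f g where fg: "schwartz f" "schwartz g" and h: "h = (\<lambda>x. of_real (u \<bullet> x) * f x + g x)" by blast
  have "\<exists>C. \<forall>x. (1 + norm x) ^ N * norm (h x) \<le> C" for N
  proof -
    obtain C D where C: "\<And>x. (1 + norm x) ^ Suc N * norm (f x) \<le> C" and D: "\<And>x. (1 + norm x) ^ N * norm (g x) \<le> D"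
      using schwartz_decay[OF fg(1)] schwartz_decay[OF fg(2)] by metis
    have "(1 + norm x) ^ N * norm (h x) \<le> norm u * C + D" for x
    proof -
      have "norm (h x) \<le> \<bar>u \<bullet> x\<bar> * norm (f x) + norm (g x)"
        unfolding h by (rule order_trans[OF norm_triangle_ineq]) (simp add: norm_mult)
      also have "\<dots> \<le> (norm u * (1 + norm x)) * norm (f x) + norm (g x)"
        using Cauchy_Schwarz_ineq2[of u x] norm_ge_zero[of u] by (intro add_right_mono mult_right_mono) (auto simp: distrib_left add_increasing)
      finally have "(1 + norm x) ^ N * norm (h x) \<le> (1 + norm x) ^ N * ((norm u * (1 + norm x)) * norm (f x) + norm (g x))"
        by (intro mult_left_mono) auto
      also have "\<dots> = norm u * ((1 + norm x) ^ Suc N * norm (f x)) + (1 + norm x) ^ N * norm (g x)"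
        by (simp add: algebra_simps)
      also have "\<dots> \<le> norm u * C + D" by (intro add_mono mult_left_mono C D) auto
      finally show ?thesis .
    qed
    then show ?thesis by blast
  qed
  then have dec: "\<forall>N::nat. \<exists>C. \<forall>x. (1 + norm x) ^ N * norm (h x) \<le> C" by blast
  have hd: "(h has_derivative (\<lambda>v. of_real (u \<bullet> x) * frechet_derivative f (at x) v + of_real (u \<bullet> v) * f x + frechet_derivative g (at x) v)) (at x)" for x
    unfolding h by (auto intro!: derivative_eq_intros schwartz_has_derivative fg)
  have e: "dir_deriv b h = (\<lambda>x. of_real (u \<bullet> x) * dir_deriv b f x + (of_real (u \<bullet> b) * f x + dir_deriv b g x))" for b
    by (rule ext, rule dir_deriv_eqI[OF hd, THEN trans]) (simp add: dir_deriv_def)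
  show "(\<forall>x. h differentiable (at x)) \<and> (\<forall>N::nat. \<exists>C. \<forall>x. (1 + norm x) ^ N * norm (h x) \<le> C) \<and>
      (\<forall>b\<in>Basis. \<exists>f g. schwartz f \<and> schwartz g \<and> dir_deriv b h = (\<lambda>x. of_real (u \<bullet> x) * f x + g x))"
  proof (intro conjI allI ballI)
    show "h differentiable (at x)" for x
      using hd by (auto simp: differentiable_def)
    show "\<exists>f g. schwartz f \<and> schwartz g \<and> dir_deriv b h = (\<lambda>x. of_real (u \<bullet> x) * f x + g x)" if "b \<in> Basis" for b
      by (rule exI[of _ "dir_deriv b f"], rule exI[of _ "\<lambda>x. of_real (u \<bullet> b) * f x + dir_deriv b g x"])
        (simp add: e schwartz_dir_deriv schwartz_add schwartz_cmult fg that)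
  qed (use dec in blast)
qed

lemma schwartz_sum: "finite I \<Longrightarrow> (\<And>i. i \<in> I \<Longrightarrow> schwartz (f i)) \<Longrightarrow> schwartz (\<lambda>x. \<Sum>i\<in>I. f i x)"
  by (induction I rule: finite_induct) (auto intro: schwartz_zero schwartz_add)

text \<open>The coefficient of the derivative along \<open>b\<close> is (a + T x) . b, and the
  adjoint of \<open>T\<close> turns this into a constant plus a linear functional of x, the case of
  \<open>schwartz_inner_mult\<close>.\<close>

lemma schwartz_affine_field:
  assumes f: "schwartz f" and T: "linear T"
  shows "schwartz (\<lambda>x. f x - frechet_derivative f (at x) (a + T x))"
proof -
  have adj: "adjoint T b \<bullet> x = T x \<bullet> b" for b x
    by (simp add: inner_commute[of "adjoint T b"] adjoint_works[OF T])
  have "f x - frechet_derivative f (at x) (a + T x) =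
     f x + (\<Sum>b\<in>Basis. (of_real (- (a \<bullet> b)) * dir_deriv b f x + of_real ((- adjoint T b) \<bullet> x) * dir_deriv b f x))" for x
    by (simp add: frechet_derivative_eq_dir_deriv[OF schwartz_differentiable[OF f]] inner_add_left adj
       scaleR_conv_of_real algebra_simps sum.distrib sum_subtractf sum_negf)
  moreover have "schwartz (\<lambda>x. f x + (\<Sum>b\<in>Basis. (of_real (- (a \<bullet> b)) * dir_deriv b f x + of_real ((- adjoint T b) \<bullet> x) * dir_deriv b f x)))"
    by (intro schwartz_add schwartz_sum schwartz_cmult schwartz_inner_mult schwartz_dir_deriv f finite_Basis)
  ultimately show ?thesis by (simp only:)
qed

text \<open>The product form has two purposes: the weight splits over pairs (V, Z), and each factor
  is exactly what two resolvents of a central derivative produce on the Fourier side.\<close>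

definition cauchy_weight :: "'a::euclidean_space \<Rightarrow> real" where
  "cauchy_weight x = (\<Prod>b\<in>Basis. 1 / (1 + (x \<bullet> b)\<^sup>2))"

lemma cauchy_weight_pos: "cauchy_weight x > 0"
  unfolding cauchy_weight_def by (intro prod_pos) (auto simp: add_pos_nonneg)

lemma cauchy_weight_le_1: "cauchy_weight x \<le> 1"
  unfolding cauchy_weight_def by (intro prod_le_1) (auto simp: add_pos_nonneg)

lemma borel_measurable_cauchy_weight [measurable]: "cauchy_weight \<in> borel_measurable borel"
  unfolding cauchy_weight_def[abs_def] by measurable

lemma integrable_cauchy_weight: "integrable lborel cauchy_weight"
proof -
  have "integrable lborel (\<lambda>x::real. 1 / (1 + x\<^sup>2))"
    using integrable_inverse_1_plus_square by (simp add: set_integrable_def divide_inverse)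
  then show ?thesis unfolding cauchy_weight_def[abs_def] by (intro integrable_lborel_prod)
qed

lemma cauchy_weight_Pair: "cauchy_weight (V, Z) = cauchy_weight V * cauchy_weight Z"
proof -
  have "cauchy_weight (V, Z) = (\<Prod>b\<in>(\<lambda>u. (u, 0)) ` Basis. 1 / (1 + ((V, Z) \<bullet> b)\<^sup>2)) * (\<Prod>b\<in>Pair 0 ` Basis. 1 / (1 + ((V, Z) \<bullet> b)\<^sup>2))"
    unfolding cauchy_weight_def Basis_prod_def by (rule prod.union_disjoint) auto
  also have "\<dots> = cauchy_weight V * cauchy_weight Z"
    unfolding cauchy_weight_def by (subst (1 2) prod.reindex) (auto simp: inj_on_def)
  finally show ?thesis .
qed

text \<open>Each factor 1 + (x . b)^2 is at most (1 + |x|)^2, so twice the dimension in extra powers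
  of decay pays for the weight.\<close>

lemma schwartz_weight_decay:
  fixes f :: "'a::euclidean_space \<Rightarrow> complex"
  assumes "schwartz f"
  obtains C where "C \<ge> 0" "\<And>x. (1 + norm x) ^ N * norm (f x) \<le> C * cauchy_weight x"
proof -
  obtain C where C: "\<And>x. (1 + norm x) ^ (N + 2 * DIM('a)) * norm (f x) \<le> C"
    using schwartz_decay[OF assms] by metis
  have C0: "C \<ge> 0" by (rule order_trans[OF _ C[of 0]]) simp
  have "(1 + norm x) ^ N * norm (f x) \<le> C * cauchy_weight x" for x
  proof -
    have "(\<Prod>b\<in>Basis. 1 + (x \<bullet> b)\<^sup>2) \<le> (\<Prod>b\<in>(Basis::'a set). (1 + norm x)\<^sup>2)"
    proof (intro prod_mono conjI)
      fix b :: 'a assume "b \<in> Basis"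
      then have "\<bar>x \<bullet> b\<bar> \<le> norm x" by (rule Basis_le_norm)
      then have "(x \<bullet> b)\<^sup>2 \<le> (norm x)\<^sup>2" by (metis abs_le_square_iff abs_norm_cancel)
      then show "1 + (x \<bullet> b)\<^sup>2 \<le> (1 + norm x)\<^sup>2" using norm_ge_zero[of x] by (simp add: power2_sum add_increasing2)
    qed auto
    also have "\<dots> = (1 + norm x) ^ (2 * DIM('a))" by (simp add: power_mult)
    finally have P: "(\<Prod>b\<in>Basis. 1 + (x \<bullet> b)\<^sup>2) \<le> (1 + norm x) ^ (2 * DIM('a))" .
    have w: "cauchy_weight x = 1 / (\<Prod>b\<in>Basis. 1 + (x \<bullet> b)\<^sup>2)"
      by (simp add: cauchy_weight_def prod_dividef)
    have pos: "(\<Prod>b\<in>Basis. 1 + (x \<bullet> b)\<^sup>2) > 0" by (intro prod_pos) (auto simp: add_pos_nonneg)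
    have "(1 + norm x) ^ N * norm (f x) * (\<Prod>b\<in>Basis. 1 + (x \<bullet> b)\<^sup>2) \<le> (1 + norm x) ^ N * norm (f x) * (1 + norm x) ^ (2 * DIM('a))"
      by (intro mult_left_mono P) auto
    also have "\<dots> \<le> C" using C[of x] by (simp add: power_add mult_ac)
    finally show ?thesis unfolding w using pos by (simp add: field_simps)
  qed
  with C0 show ?thesis by (rule that)
qed

lemma schwartz_bounded_integrable:
  assumes "schwartz f"
  shows "integrable lborel f" "\<exists>B. \<forall>x. norm (f x) \<le> B"
proof -
  obtain C where C: "C \<ge> 0" "\<And>x. (1 + norm x) ^ 0 * norm (f x) \<le> C * cauchy_weight x"
    by (rule schwartz_weight_decay[OF assms, where N=0]) blast
  show "integrable lborel f"
  proof (rule Bochner_Integration.integrable_bound[OF integrable_mult_right[OF integrable_cauchy_weight, of C]])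
    have "norm (f x) \<le> norm (C * cauchy_weight x)" for x
      using C(2)[of x] abs_ge_self[of "C * cauchy_weight x"] by simp
    then show "AE x in lborel. norm (f x) \<le> norm (C * cauchy_weight x)" by simp
  qed (use schwartz_borel_measurable[OF assms] in simp)
  show "\<exists>B. \<forall>x. norm (f x) \<le> B"
    using schwartz_decay[OF assms, of 0] by simp
qed

lemma frechet_derivative_along_line:
  assumes "schwartz f"
  shows "((\<lambda>s. f (p + s *\<^sub>R v)) has_vector_derivative frechet_derivative f (at (p + s *\<^sub>R v)) v) (at s within S)"
proof -
  have "((\<lambda>s. p + s *\<^sub>R v) has_vector_derivative v) (at s within S)"
    by (auto intro!: derivative_eq_intros)
  from vector_derivative_diff_chain_within[OF this has_derivative_at_withinI[OF schwartz_has_derivative[OF assms]]]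
  show ?thesis by (simp add: o_def)
qed

lemma integrable_exp_half_line: "integrable lborel (\<lambda>s::real. indicator {0<..} s * exp (- s))"
proof (rule Bochner_Integration.integrable_bound)
  show "integrable lborel (\<lambda>x::real. x ^ 0 * exp (- x) * indicator {0..} x)"
    using has_bochner_integral_I0i_power_exp_m'[of 0] by (simp add: has_bochner_integral_iff)
qed (auto simp: indicator_def)

text \<open>The resolvent at 1 of the generator of a flow, obtained by integrating \<open>d/ds (e\<^sup>-\<^sup>s G(s))\<close>.\<close>

lemma exp_weighted_FTC:
  fixes G g :: "real \<Rightarrow> complex"
  assumes G: "\<And>s. (G has_vector_derivative g s) (at s)" and g: "continuous_on UNIV g"
    and B: "\<And>s. norm (G s) \<le> B" and B': "\<And>s. norm (g s) \<le> B'"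
  shows "has_bochner_integral lborel (\<lambda>s. indicator {0<..} s *\<^sub>R (exp (- s) *\<^sub>R (G s - g s))) (G 0)"
proof -
  have cG: "continuous_on UNIV G"
    using G by (meson continuous_at_imp_continuous_on has_vector_derivative_continuous)
  let ?f = "\<lambda>s. exp (- s) *\<^sub>R (G s - g s)"
  have cf: "continuous_on UNIV ?f" by (intro continuous_intros cG g)
  have [measurable]: "?f \<in> borel_measurable borel" by (intro borel_measurable_continuous_onI cf)
  have i: "integrable lborel (\<lambda>s. indicator {0<..} s *\<^sub>R ?f s)"
  proof (rule Bochner_Integration.integrable_bound[OF integrable_mult_left[OF integrable_exp_half_line, of "B + B'"]])
    show "AE s in lborel. norm (indicator {0<..} s *\<^sub>R ?f s) \<le> norm (indicator {0<..} s * exp (- s) * (B + B'))"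
    proof (rule AE_I2)
      fix s :: real
      have "norm (G s - g s) \<le> B + B'"
        using B[of s] B'[of s] norm_triangle_ineq4[of "G s" "g s"] by linarith
      then show "norm (indicator {0<..} s *\<^sub>R ?f s) \<le> norm (indicator {0<..} s * exp (- s) * (B + B'))"
        by (auto simp: indicator_def abs_mult intro: order_trans[OF _ abs_ge_self])
    qed
  qed measurable
  have e: "einterval 0 \<infinity> = {0::real<..}" by (auto simp: einterval_def zero_ereal_def)
  have "(LBINT x=0..\<infinity>. ?f x) = 0 - (- exp (- 0) *\<^sub>R G 0)"
  proof (rule interval_integral_FTC_integrable)
    show "((\<lambda>s. - exp (- s) *\<^sub>R G s) has_vector_derivative ?f s) (at s)" for s
      using G[of s] by (auto intro!: derivative_eq_intros simp: algebra_simps)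
    show "isCont ?f s" for s using cf by (simp add: continuous_on_eq_continuous_at)
    show "set_integrable lborel (einterval 0 \<infinity>) ?f" using i by (simp add: e set_integrable_def)
    have "isCont (\<lambda>s. - exp (- s) *\<^sub>R G s) 0"
      using cG by (intro continuous_intros) (auto simp: continuous_on_eq_continuous_at)
    then have "((\<lambda>s. - exp (- s) *\<^sub>R G s) \<longlongrightarrow> - exp (- 0) *\<^sub>R G 0) (at_right 0)"
      by (simp add: isCont_def filterlim_at_split)
    then show "(((\<lambda>s. - exp (- s) *\<^sub>R G s) \<circ> real_of_ereal) \<longlongrightarrow> - exp (- 0) *\<^sub>R G 0) (at_right 0)"
      by (simp add: zero_ereal_def ereal_tendsto_simps)
    have "((\<lambda>s. - exp (- s) *\<^sub>R G s) \<longlongrightarrow> 0) at_top"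
    proof (rule Lim_null_comparison[where g="\<lambda>s. exp (- s) * B"])
      show "\<forall>\<^sub>F s in at_top. norm (- exp (- s) *\<^sub>R G s) \<le> exp (- s) * B"
        using B by (intro always_eventually) auto
      have "((\<lambda>s::real. exp (- s)) \<longlongrightarrow> 0) at_top"
        using exp_at_bot filterlim_compose filterlim_uminus_at_bot_at_top by blast
      then show "((\<lambda>s. exp (- s) * B) \<longlongrightarrow> 0) at_top" by (rule tendsto_mult_left_zero)
    qed
    then show "(((\<lambda>s. - exp (- s) *\<^sub>R G s) \<circ> real_of_ereal) \<longlongrightarrow> 0) (at_left \<infinity>)"
      by (simp add: ereal_tendsto_simps)
  qed simp
  then have "(LINT s|lborel. indicator {0<..} s *\<^sub>R ?f s) = G 0"
    by (simp add: interval_lebesgue_integral_def set_lebesgue_integral_def e)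
  with i show ?thesis by (simp add: has_bochner_integral_iff)
qed

text \<open>The preceding formula for G(s) = f(p + s v), which inverts 1 minus the derivative along
  \<open>v\<close>. A variable field that stays constant along its own trajectories is covered as
  well.\<close>

lemma schwartz_resolvent:
  assumes f: "schwartz f"
  shows "has_bochner_integral lborel (\<lambda>s. indicator {0<..} s *\<^sub>R (exp (- s) *\<^sub>R
    (f (p + s *\<^sub>R v) - frechet_derivative f (at (p + s *\<^sub>R v)) v))) (f p)"
proof -
  have D: "frechet_derivative f (at x) v = (\<Sum>b\<in>Basis. (v \<bullet> b) *\<^sub>R dir_deriv b f x)" for x
    by (rule frechet_derivative_eq_dir_deriv[OF schwartz_differentiable[OF f]])
  have sD: "schwartz (\<lambda>x. \<Sum>b\<in>Basis. (v \<bullet> b) *\<^sub>R dir_deriv b f x)"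
    unfolding scaleR_conv_of_real by (intro schwartz_sum schwartz_cmult schwartz_dir_deriv f finite_Basis)
  obtain B where B: "\<And>x. norm (f x) \<le> B" using schwartz_bounded_integrable(2)[OF f] by blast
  obtain B' where B': "\<And>x. norm (\<Sum>b\<in>Basis. (v \<bullet> b) *\<^sub>R dir_deriv b f x) \<le> B'" using schwartz_bounded_integrable(2)[OF sD] by blast
  have "has_bochner_integral lborel (\<lambda>s. indicator {0<..} s *\<^sub>R (exp (- s) *\<^sub>R
    (f (p + s *\<^sub>R v) - frechet_derivative f (at (p + s *\<^sub>R v)) v))) (f (p + 0 *\<^sub>R v))"
  proof (rule exp_weighted_FTC)
    show "((\<lambda>s. f (p + s *\<^sub>R v)) has_vector_derivative frechet_derivative f (at (p + s *\<^sub>R v)) v) (at s)" for s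
      by (rule frechet_derivative_along_line[OF f])
    show "continuous_on UNIV (\<lambda>s. frechet_derivative f (at (p + s *\<^sub>R v)) v)"
      unfolding D by (intro continuous_on_compose2[OF schwartz_continuous[OF sD]] continuous_intros) auto
  qed (use B B' in \<open>auto simp: D\<close>)
  then show ?thesis by simp
qed

section \<open>The partial Fourier transform\<close>

lemma schwartz_slice_decay:
  fixes f :: "'v::euclidean_space \<times> 'z::euclidean_space \<Rightarrow> complex"
  assumes "schwartz f"
  obtains C where "C \<ge> 0" "\<And>V Z. (1 + norm V) ^ N * norm (f (V, Z)) \<le> C * cauchy_weight V * cauchy_weight Z"
proof -
  obtain C where C: "C \<ge> 0" "\<And>x. (1 + norm x) ^ N * norm (f x) \<le> C * cauchy_weight x"
    by (rule schwartz_weight_decay[OF assms, where N=N]) blast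
  have "(1 + norm V) ^ N * norm (f (V, Z)) \<le> C * cauchy_weight V * cauchy_weight Z" for V Z
  proof -
    have "norm V \<le> norm (V, Z)" by (metis norm_fst_le fst_conv)
    then have "(1 + norm V) ^ N * norm (f (V, Z)) \<le> (1 + norm (V, Z)) ^ N * norm (f (V, Z))"
      by (intro mult_right_mono power_mono) auto
    also have "\<dots> \<le> C * cauchy_weight V * cauchy_weight Z" using C(2)[of "(V, Z)"] by (simp add: cauchy_weight_Pair)
    finally show ?thesis .
  qed
  with C(1) show ?thesis by (rule that)
qed

lemma
  fixes f :: "'v::euclidean_space \<times> 'z::euclidean_space \<Rightarrow> complex"
  assumes f: "schwartz f"
  shows integrable_schwartz_slice: "integrable lborel (\<lambda>Z. f (V, Z))"
    and integrable_fourier_z: "integrable lborel (\<lambda>Z. cis (\<eta> \<bullet> Z) * f (V, Z))"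
proof -
  obtain C where C: "C \<ge> 0" "\<And>V Z. (1 + norm V) ^ 0 * norm (f (V, Z)) \<le> C * cauchy_weight V * cauchy_weight Z"
    by (rule schwartz_slice_decay[OF f, where N=0]) blast
  note [measurable] = schwartz_borel_measurable[OF f]
  have "norm (f (V, Z)) \<le> norm (C * cauchy_weight V * cauchy_weight Z)" for Z
    using C(2)[of V Z] abs_ge_self[of "C * cauchy_weight V * cauchy_weight Z"] by simp
  then have "AE Z in lborel. norm (f (V, Z)) \<le> norm (C * cauchy_weight V * cauchy_weight Z)" by simp
  then show i: "integrable lborel (\<lambda>Z. f (V, Z))"
    by (rule Bochner_Integration.integrable_bound[OF integrable_mult_right[OF integrable_cauchy_weight], rotated]) measurable
  show "integrable lborel (\<lambda>Z. cis (\<eta> \<bullet> Z) * f (V, Z))"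
    by (rule Bochner_Integration.integrable_bound[OF i]) (auto simp: norm_mult)
qed

lemma borel_measurable_fourier_z:
  fixes f :: "'v::euclidean_space \<times> 'z::euclidean_space \<Rightarrow> complex"
  assumes f: "schwartz f" and [measurable]: "g \<in> borel_measurable M" "h \<in> borel_measurable M"
  shows "(\<lambda>x. fourier_z f (g x) (h x)) \<in> borel_measurable M"
proof -
  note [measurable] = schwartz_borel_measurable[OF f]
  show ?thesis unfolding fourier_z_def by measurable
qed

lemma fourier_z_decay:
  fixes f :: "'v::euclidean_space \<times> 'z::euclidean_space \<Rightarrow> complex"
  assumes f: "schwartz f"
  obtains C where "C \<ge> 0" "\<And>\<eta> V. (1 + norm V) ^ N * norm (fourier_z f \<eta> V) \<le> C * cauchy_weight V"
proof -
  obtain C where C: "C \<ge> 0" "\<And>V Z. (1 + norm V) ^ N * norm (f (V, Z)) \<le> C * cauchy_weight V * cauchy_weight Z"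
    by (rule schwartz_slice_decay[OF f, where N=N]) blast
  let ?I = "LINT Z|lborel. cauchy_weight (Z::'z)"
  have "(1 + norm V) ^ N * norm (fourier_z f \<eta> V) \<le> (C * ?I) * cauchy_weight V" for \<eta> V
  proof -
    have "norm (fourier_z f \<eta> V) \<le> (LINT Z|lborel. norm (cis (\<eta> \<bullet> Z) * f (V, Z)))"
      unfolding fourier_z_def by (rule integral_norm_bound)
    then have "(1 + norm V) ^ N * norm (fourier_z f \<eta> V) \<le> (1 + norm V) ^ N * (LINT Z|lborel. norm (cis (\<eta> \<bullet> Z) * f (V, Z)))"
      by (rule mult_left_mono) auto
    also have "\<dots> = (LINT Z|lborel. (1 + norm V) ^ N * norm (f (V, Z)))"
      by (simp add: norm_mult)
    also have "\<dots> \<le> (LINT Z|lborel. C * cauchy_weight V * cauchy_weight (Z::'z))"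
    proof (rule Bochner_Integration.integral_mono)
      show "integrable lborel (\<lambda>Z. (1 + norm V) ^ N * norm (f (V, Z)))"
        by (intro integrable_mult_right integrable_norm integrable_schwartz_slice f)
      show "integrable lborel (\<lambda>Z::'z. C * cauchy_weight V * cauchy_weight Z)"
        by (intro integrable_mult_right integrable_cauchy_weight)
    qed (rule C(2))
    finally show ?thesis by (simp add: mult_ac)
  qed
  moreover have "C * ?I \<ge> 0" using C(1) by (intro mult_nonneg_nonneg Bochner_Integration.integral_nonneg) (auto simp: less_imp_le[OF cauchy_weight_pos])
  ultimately show ?thesis using that by blast
qed

lemma fourier_z_translate:
  fixes f :: "'v::euclidean_space \<times> 'z::euclidean_space \<Rightarrow> complex"
  assumes f: "schwartz f"
  shows "(LINT Z|lborel. cis (\<eta> \<bullet> Z) * f (V, Z + t)) = cis (- (\<eta> \<bullet> t)) * fourier_z f \<eta> V"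
proof -
  note [measurable] = schwartz_borel_measurable[OF f]
  have "cis (\<eta> \<bullet> Z) * f (V, Z + t) = cis (- (\<eta> \<bullet> t)) * (cis (\<eta> \<bullet> (t + Z)) * f (V, t + Z))" for Z
    unfolding mult.assoc[symmetric] cis_mult by (simp add: inner_add_right add.commute)
  then have "(LINT Z|lborel. cis (\<eta> \<bullet> Z) * f (V, Z + t)) = (LINT Z|lborel. cis (- (\<eta> \<bullet> t)) * (cis (\<eta> \<bullet> (t + Z)) * f (V, t + Z)))"
    by (simp only:)
  also have "\<dots> = cis (- (\<eta> \<bullet> t)) * (LINT Z|lborel. cis (\<eta> \<bullet> (t + Z)) * f (V, t + Z))"
    by (rule integral_mult_right_zero)
  also have "(LINT Z|lborel. cis (\<eta> \<bullet> (t + Z)) * f (V, t + Z)) = fourier_z f \<eta> V"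
    unfolding fourier_z_def by (rule integral_lborel_translate) measurable
  finally show ?thesis .
qed

text \<open>Under the partial Fourier transform the flow of an affine vector field becomes a twisted translation.\<close>

lemma fourier_z_resolvent:
  fixes f :: "'v::euclidean_space \<times> 'z::euclidean_space \<Rightarrow> complex" and \<l> :: "'v \<Rightarrow> 'z"
  assumes f: "schwartz f" and T: "linear T" and field: "\<And>V Z. a + T (V, Z) = (e, \<l> V)"
    and inv: "\<And>V s. \<l> (V + s *\<^sub>R e) = \<l> V"
  defines "g \<equiv> \<lambda>x. f x - frechet_derivative f (at x) (a + T x)"
  shows "has_bochner_integral lborel (\<lambda>s. indicator {0<..} s *\<^sub>R (exp (- s) *\<^sub>R
    (cis (- (s * (\<eta> \<bullet> \<l> V))) * fourier_z g \<eta> (V + s *\<^sub>R e)))) (fourier_z f \<eta> V)"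
proof -
  have g: "schwartz g" unfolding g_def by (rule schwartz_affine_field[OF f T])
  note [measurable] = schwartz_borel_measurable[OF f] schwartz_borel_measurable[OF g]
  obtain C where C: "C \<ge> 0" "\<And>V Z. (1 + norm V) ^ 0 * norm (g (V, Z)) \<le> C * cauchy_weight V * cauchy_weight Z"
    by (rule schwartz_slice_decay[OF g, where N=0]) blast
  \<comment> \<open>The majorant must not depend on V, because V moves along the flow while Z is
    integrated.\<close>
  have gb: "norm (g (V, Z)) \<le> C * cauchy_weight Z" for V Z
  proof -
    have "norm (g (V, Z)) \<le> (C * cauchy_weight Z) * cauchy_weight V" using C(2)[of V Z] by (simp add: mult_ac)
    also have "\<dots> \<le> C * cauchy_weight Z"
      using mult_left_mono[OF cauchy_weight_le_1[of V], of "C * cauchy_weight Z"] C(1) cauchy_weight_pos[of Z] by simp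
    finally show ?thesis .
  qed
  let ?\<Phi> = "\<lambda>s Z. indicator {0<..} s *\<^sub>R (exp (- s) *\<^sub>R (cis (\<eta> \<bullet> Z) * g (V + s *\<^sub>R e, Z + s *\<^sub>R \<l> V)))"
  have res: "(LINT s|lborel. ?\<Phi> s Z) = cis (\<eta> \<bullet> Z) * f (V, Z)" for Z
  proof -
    \<comment> \<open>The assumption \<open>inv\<close> keeps the field constant along its
      trajectory, so the flow line through (V, Z) is straight and \<open>schwartz_resolvent\<close>
      applies.\<close>
    have "f ((V, Z) + s *\<^sub>R (e, \<l> V)) - frechet_derivative f (at ((V, Z) + s *\<^sub>R (e, \<l> V))) (e, \<l> V) =
        g (V + s *\<^sub>R e, Z + s *\<^sub>R \<l> V)" for s
      by (simp add: g_def field inv)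
    with schwartz_resolvent[OF f, of "(V, Z)" "(e, \<l> V)"]
    have "(LINT s|lborel. indicator {0<..} s *\<^sub>R (exp (- s) *\<^sub>R g (V + s *\<^sub>R e, Z + s *\<^sub>R \<l> V))) = f (V, Z)"
      by (simp add: has_bochner_integral_iff)
    moreover have "?\<Phi> s Z = cis (\<eta> \<bullet> Z) * (indicator {0<..} s *\<^sub>R (exp (- s) *\<^sub>R g (V + s *\<^sub>R e, Z + s *\<^sub>R \<l> V)))" for s
      by simp
    ultimately show ?thesis by (simp only: integral_mult_right_zero)
  qed
  have iw: "integrable lborel (\<lambda>Z. cauchy_weight (Z + t))" for t :: 'z
    using integrable_lborel_affine[OF _ integrable_cauchy_weight, of 1 t] by (simp add: add.commute)
  have w: "(LINT Z|lborel. cauchy_weight (Z + t)) = (LINT Z|lborel. cauchy_weight (Z :: 'z))" for t :: 'z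
    using integral_lborel_translate[of cauchy_weight t] by (simp add: add.commute)
  have n\<Phi>: "norm (?\<Phi> s Z) \<le> indicator {0<..} s * exp (- s) * (C * cauchy_weight (Z + s *\<^sub>R \<l> V))" for s Z
    using gb[of "V + s *\<^sub>R e" "Z + s *\<^sub>R \<l> V"] by (auto simp: norm_mult indicator_def)
  have i2: "integrable lborel (\<lambda>Z. ?\<Phi> s Z)" for s
    by (rule Bochner_Integration.integrable_bound[OF integrable_mult_right[OF integrable_mult_right[OF iw[of "s *\<^sub>R \<l> V"], of C], of "indicator {0<..} s * exp (- s)"]])
       (use n\<Phi>[of s] in \<open>auto intro: order_trans[OF _ abs_ge_self]\<close>)
  have i: "integrable (lborel \<Otimes>\<^sub>M lborel) (\<lambda>(s, Z). ?\<Phi> s Z)"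
  proof (rule lborel_pair.Fubini_integrable)
    show "integrable lborel (\<lambda>s. LINT Z|lborel. norm (case (s, Z) of (s, Z) \<Rightarrow> ?\<Phi> s Z))"
    proof (rule Bochner_Integration.integrable_bound[OF integrable_mult_left[OF integrable_exp_half_line, of "C * (LINT Z|lborel. cauchy_weight (Z :: 'z))"]])
      show "AE s in lborel. norm (LINT Z|lborel. norm (case (s, Z) of (s, Z) \<Rightarrow> ?\<Phi> s Z)) \<le>
         norm (indicator {0<..} s * exp (- s) * (C * (LINT Z|lborel. cauchy_weight (Z :: 'z))))"
      proof (rule AE_I2)
        fix s :: real
        have "(LINT Z|lborel. norm (?\<Phi> s Z)) \<le> (LINT Z|lborel. indicator {0<..} s * exp (- s) * (C * cauchy_weight (Z + s *\<^sub>R \<l> V)))"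
          by (intro Bochner_Integration.integral_mono integrable_norm i2 integrable_mult_right iw n\<Phi>)
        also have "\<dots> = indicator {0<..} s * exp (- s) * (C * (LINT Z|lborel. cauchy_weight (Z :: 'z)))"
          by (simp only: integral_mult_right_zero w)
        finally show "norm (LINT Z|lborel. norm (case (s, Z) of (s, Z) \<Rightarrow> ?\<Phi> s Z)) \<le>
         norm (indicator {0<..} s * exp (- s) * (C * (LINT Z|lborel. cauchy_weight (Z :: 'z))))"
          using Bochner_Integration.integral_nonneg[of lborel "\<lambda>Z. norm (?\<Phi> s Z)"] by simp
      qed
    qed measurable
  qed (use i2 in auto)
  \<comment> \<open>The shift of Z leaves the Fourier integral as a phase depending on V, while the
    shift of V remains; together they are the twisted translation.\<close>
  have inner: "(LINT Z|lborel. ?\<Phi> s Z) = indicator {0<..} s *\<^sub>R (exp (- s) *\<^sub>R (cis (- (s * (\<eta> \<bullet> \<l> V))) * fourier_z g \<eta> (V + s *\<^sub>R e)))" for s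
    using fourier_z_translate[OF g, of \<eta> "V + s *\<^sub>R e" "s *\<^sub>R \<l> V"] by simp
  have "integrable lborel (\<lambda>s. LINT Z|lborel. ?\<Phi> s Z)"
    using lborel_pair.integrable_fst[OF i] by simp
  moreover have "(LINT s|lborel. LINT Z|lborel. ?\<Phi> s Z) = (LINT Z|lborel. LINT s|lborel. ?\<Phi> s Z)"
    using lborel_pair.Fubini_integral[OF i] by simp
  ultimately show ?thesis unfolding inner res by (simp add: has_bochner_integral_iff fourier_z_def)
qed

text \<open>The constant c = 1/(1 + i a) is chosen so that G(s) = c exp(-i s a) satisfies G - G' =
  exp(-i s a). The integral is then G(0) = c.\<close>

lemma exp_cis_half_line:
  "has_bochner_integral lborel (\<lambda>s. indicator {0<..} s *\<^sub>R (exp (- s) *\<^sub>R cis (- (s * a)))) (1 / (1 + \<i> * of_real a))"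
proof -
  define c where "c = 1 / (1 + \<i> * complex_of_real a)"
  have c1: "(1 + \<i> * of_real a) * c = 1" by (simp add: c_def complex_eq_iff)
  have "has_bochner_integral lborel (\<lambda>s. indicator {0<..} s *\<^sub>R (exp (- s) *\<^sub>R
      (cis (- (s * a)) * c - (- (\<i> * of_real a * cis (- (s * a)) * c))))) (cis (- (0 * a)) * c)"
  proof (rule exp_weighted_FTC)
    show "((\<lambda>s. cis (- (s * a)) * c) has_vector_derivative - (\<i> * of_real a * cis (- (s * a)) * c)) (at s)" for s
      unfolding has_vector_derivative_def
      by (auto intro!: derivative_eq_intros simp: scaleR_conv_of_real algebra_simps)
    show "continuous_on UNIV (\<lambda>s. - (\<i> * of_real a * cis (- (s * a)) * c))"
      by (intro continuous_intros)
  qed (auto simp: norm_mult intro: order_refl)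
  moreover have "cis x * c - (- (\<i> * of_real a * cis x * c)) = cis x" for x
  proof -
    have "cis x * c - (- (\<i> * of_real a * cis x * c)) = cis x * ((1 + \<i> * of_real a) * c)"
      by (simp add: algebra_simps)
    then show ?thesis by (simp only: c1 mult_1_right)
  qed
  ultimately show ?thesis by (simp add: c_def[symmetric])
qed

text \<open>The flow of a central field shifts Z alone, so the twisted translation degenerates to a
  phase and the resolvent to division by 1 + i (\<eta> . b).\<close>

lemma norm_fourier_z_central:
  fixes f :: "'v::euclidean_space \<times> 'z::euclidean_space \<Rightarrow> complex"
  assumes f: "schwartz f"
  shows "norm (fourier_z f \<eta> V) =
    norm (fourier_z (\<lambda>x. f x - frechet_derivative f (at x) (0, b)) \<eta> V) / sqrt (1 + (\<eta> \<bullet> b)\<^sup>2)"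
proof -
  let ?g = "\<lambda>x. f x - frechet_derivative f (at x) (0, b)"
  have "has_bochner_integral lborel (\<lambda>s. indicator {0<..} s *\<^sub>R (exp (- s) *\<^sub>R
    (cis (- (s * (\<eta> \<bullet> b))) * fourier_z ?g \<eta> V))) (fourier_z f \<eta> V)"
    using fourier_z_resolvent[OF f linear_zero, of "(0, b)" 0 "\<lambda>_. b" \<eta> V] by simp
  moreover have "has_bochner_integral lborel (\<lambda>s. (indicator {0<..} s *\<^sub>R (exp (- s) *\<^sub>R
    cis (- (s * (\<eta> \<bullet> b))))) * fourier_z ?g \<eta> V) (1 / (1 + \<i> * of_real (\<eta> \<bullet> b)) * fourier_z ?g \<eta> V)"
    by (intro has_bochner_integral_mult_left exp_cis_half_line)
  ultimately have "fourier_z f \<eta> V = 1 / (1 + \<i> * of_real (\<eta> \<bullet> b)) * fourier_z ?g \<eta> V"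
    by (simp add: has_bochner_integral_iff)
  moreover have "norm (1 + \<i> * complex_of_real (\<eta> \<bullet> b)) = sqrt (1 + (\<eta> \<bullet> b)\<^sup>2)"
    by (simp add: cmod_def)
  ultimately show ?thesis by (simp only: norm_mult norm_divide norm_one mult_1_left times_divide_eq_left)
qed

text \<open>Two resolvents in the same central direction divide the modulus by 1 + (\<eta> . b)^2,
  one factor of the weight. This replaces integration by parts in Z.\<close>

lemma fourier_z_weight:
  fixes f :: "'v::euclidean_space \<times> 'z::euclidean_space \<Rightarrow> complex"
  assumes "schwartz f"
  obtains g where "schwartz g" "\<And>\<eta> V. norm (fourier_z f \<eta> V) = cauchy_weight \<eta> * norm (fourier_z g \<eta> V)"
proof -
  have "\<exists>g. schwartz g \<and> (\<forall>\<eta> V. norm (fourier_z f \<eta> V) = (\<Prod>b\<in>B. 1 / (1 + (\<eta> \<bullet> b)\<^sup>2)) * norm (fourier_z g \<eta> V))"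
    if "finite B" for B
    using that
  proof (induction B rule: finite_induct)
    case empty
    then show ?case using assms by auto
  next
    case (insert b B)
    then obtain g where g: "schwartz g" and e: "\<And>\<eta> V. norm (fourier_z f \<eta> V) = (\<Prod>b\<in>B. 1 / (1 + (\<eta> \<bullet> b)\<^sup>2)) * norm (fourier_z g \<eta> V)"
      by blast
    let ?D = "\<lambda>g :: 'v \<times> 'z \<Rightarrow> complex. \<lambda>x. g x - frechet_derivative g (at x) (0, b)"
    have D: "schwartz (?D g)" if "schwartz g" for g
      using schwartz_affine_field[OF that linear_zero, of "(0, b)"] by simp
    have "norm (fourier_z g \<eta> V) = 1 / (1 + (\<eta> \<bullet> b)\<^sup>2) * norm (fourier_z (?D (?D g)) \<eta> V)" for \<eta> V
    proof -
      have "norm (fourier_z g \<eta> V) = norm (fourier_z (?D (?D g)) \<eta> V) / (sqrt (1 + (\<eta> \<bullet> b)\<^sup>2) * sqrt (1 + (\<eta> \<bullet> b)\<^sup>2))"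
        using norm_fourier_z_central[OF g, of \<eta> V b] norm_fourier_z_central[OF D[OF g], of \<eta> V b] by simp
      then show ?thesis by (simp flip: real_sqrt_mult power2_eq_square add: add_nonneg_nonneg)
    qed
    then have "\<forall>\<eta> V. norm (fourier_z f \<eta> V) = (\<Prod>b\<in>insert b B. 1 / (1 + (\<eta> \<bullet> b)\<^sup>2)) * norm (fourier_z (?D (?D g)) \<eta> V)"
      using insert(1,2) by (simp add: e)
    then show ?case using D[OF D[OF g]] by blast
  qed
  from this[OF finite_Basis] show ?thesis using that unfolding cauchy_weight_def by blast
qed

lemma fourier_z_joint_decay:
  fixes f :: "'v::euclidean_space \<times> 'z::euclidean_space \<Rightarrow> complex"
  assumes "schwartz f"
  obtains C where "C \<ge> 0" "\<And>\<eta> V. norm (fourier_z f \<eta> V) \<le> C * cauchy_weight \<eta> * cauchy_weight V"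
proof -
  obtain g where g: "schwartz g" and e: "\<And>\<eta> V. norm (fourier_z f \<eta> V) = cauchy_weight \<eta> * norm (fourier_z g \<eta> V)"
    by (rule fourier_z_weight[OF assms]) blast
  obtain C where C: "C \<ge> 0" "\<And>\<eta> V. (1 + norm V) ^ 0 * norm (fourier_z g \<eta> V) \<le> C * cauchy_weight V"
    by (rule fourier_z_decay[OF g, where N=0]) blast
  have "norm (fourier_z f \<eta> V) \<le> C * cauchy_weight \<eta> * cauchy_weight V" for \<eta> V
    using mult_left_mono[OF C(2)[of V \<eta>] less_imp_le[OF cauchy_weight_pos[of \<eta>]]] by (simp add: e mult_ac)
  with C(1) show ?thesis by (rule that)
qed

lemma onorm_frechet_derivative_diff_le:
  fixes f :: "'a::euclidean_space \<Rightarrow> complex" and M :: real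
  assumes f: "f differentiable (at x)" "f differentiable (at y)" and M: "\<And>b. b \<in> Basis \<Longrightarrow> norm (dir_deriv b f x - dir_deriv b f y) \<le> M"
    and M0: "M \<ge> 0"
  shows "onorm (\<lambda>v. frechet_derivative f (at x) v - frechet_derivative f (at y) v) \<le> DIM('a) * M"
proof (rule onorm_bound)
  fix v :: 'a
  have "norm (frechet_derivative f (at x) v - frechet_derivative f (at y) v) =
      norm (\<Sum>b\<in>Basis. (v \<bullet> b) *\<^sub>R (dir_deriv b f x - dir_deriv b f y))"
    by (simp add: frechet_derivative_eq_dir_deriv[OF f(1)] frechet_derivative_eq_dir_deriv[OF f(2)] sum_subtractf scaleR_diff_right)
  also have "\<dots> \<le> (\<Sum>b\<in>(Basis::'a set). norm v * M)"
    by (rule order_trans[OF norm_sum sum_mono]) (auto intro!: mult_mono M Basis_le_norm)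
  finally show "norm (frechet_derivative f (at x) v - frechet_derivative f (at y) v) \<le> DIM('a) * M * norm v"
    by (simp add: mult_ac)
qed (use M0 in auto)

lemma onorm_frechet_derivative_le:
  fixes f :: "'a::euclidean_space \<Rightarrow> complex" and M :: real
  assumes f: "f differentiable (at x)" and M: "\<And>b. b \<in> Basis \<Longrightarrow> norm (dir_deriv b f x) \<le> M"
    and M0: "M \<ge> 0"
  shows "onorm (frechet_derivative f (at x)) \<le> DIM('a) * M"
proof (rule onorm_bound)
  fix v :: 'a
  have "norm (frechet_derivative f (at x) v) = norm (\<Sum>b\<in>Basis. (v \<bullet> b) *\<^sub>R dir_deriv b f x)"
    by (simp add: frechet_derivative_eq_dir_deriv[OF f])
  also have "\<dots> \<le> (\<Sum>b\<in>(Basis::'a set). norm v * M)"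
    by (rule order_trans[OF norm_sum sum_mono]) (auto intro!: mult_mono M Basis_le_norm)
  finally show "norm (frechet_derivative f (at x) v) \<le> DIM('a) * M * norm v"
    by (simp add: mult_ac)
qed (use M0 in auto)

text \<open>Two applications of the mean value inequality. An error quadratic in \<open>h\<close>,
  with \<open>M\<close> taken over the segment alone, can later be integrated over the central
  variable.\<close>

lemma schwartz_taylor:
  fixes f :: "'a::euclidean_space \<Rightarrow> complex" and M :: real
  assumes f: "schwartz f"
    and M: "\<And>b b' y. b \<in> Basis \<Longrightarrow> b' \<in> Basis \<Longrightarrow> y \<in> closed_segment x (x + h) \<Longrightarrow> norm (dir_deriv b' (dir_deriv b f) y) \<le> M"
  shows "norm (f (x + h) - f x - frechet_derivative f (at x) h) \<le> (DIM('a))\<^sup>2 * M * (norm h)\<^sup>2"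
proof -
  let ?S = "closed_segment x (x + h)"
  obtain b0 :: 'a where b0: "b0 \<in> Basis" using nonempty_Basis by blast
  have M0: "0 \<le> M" by (rule order_trans[OF norm_ge_zero M[OF b0 b0 ends_in_segment(1)]])
  have 1: "norm (dir_deriv b f y - dir_deriv b f x) \<le> DIM('a) * M * norm h" if b: "b \<in> Basis" and y: "y \<in> ?S" for b y
  proof -
    note sb = schwartz_dir_deriv[OF f b]
    have "norm (dir_deriv b f y - dir_deriv b f x) \<le> DIM('a) * M * norm (y - x)"
    proof (rule differentiable_bound[of ?S])
      show "(dir_deriv b f has_derivative frechet_derivative (dir_deriv b f) (at z)) (at z within ?S)" for z
        by (rule has_derivative_at_withinI[OF schwartz_has_derivative[OF sb]])
      show "onorm (frechet_derivative (dir_deriv b f) (at z)) \<le> DIM('a) * M" if "z \<in> ?S" for z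
        by (rule onorm_frechet_derivative_le[OF schwartz_differentiable[OF sb] M[OF b _ that] M0])
    qed (use y in auto)
    also have "\<dots> \<le> DIM('a) * M * norm h"
      using segment_bound(1)[OF y] M0 by (intro mult_left_mono) auto
    finally show ?thesis .
  qed
  have "norm (f (x + h) - f x - frechet_derivative f (at x) (x + h - x)) \<le> norm (x + h - x) * (DIM('a) * (DIM('a) * M * norm h))"
  proof (rule differentiable_bound_linearization[of x "x + h" ?S f "\<lambda>y. frechet_derivative f (at y)" x])
    show "x + t *\<^sub>R (x + h - x) \<in> ?S" if "t \<in> {0..1}" for t
      using that by (auto simp: closed_segment_def algebra_simps intro!: exI[of _ t])
    show "(f has_derivative frechet_derivative f (at z)) (at z within ?S)" for z
      by (rule has_derivative_at_withinI[OF schwartz_has_derivative[OF f]])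
    show "onorm (frechet_derivative f (at z) - frechet_derivative f (at x)) \<le> DIM('a) * (DIM('a) * M * norm h)" if "z \<in> ?S" for z
      unfolding fun_diff_def using M0 by (intro onorm_frechet_derivative_diff_le schwartz_differentiable f 1 that) auto
  qed auto
  then show ?thesis by (simp add: power2_eq_square mult_ac)
qed

lemma has_derivative_quadratic_error:
  assumes D: "bounded_linear D" and K: "\<And>h. norm (F (x + h) - F x - D h) \<le> K * (norm h)\<^sup>2"
  shows "(F has_derivative D) (at x)"
  unfolding has_derivative_at
proof
  show "(\<lambda>h. norm (F (x + h) - F x - D h) / norm h) \<midarrow>0\<rightarrow> 0"
  proof (rule Lim_null_comparison[where g="\<lambda>h. K * norm h"])
    show "\<forall>\<^sub>F h in at 0. norm (norm (F (x + h) - F x - D h) / norm h) \<le> K * norm h"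
      using K by (intro eventually_at_filter[THEN iffD2] always_eventually) (auto simp: divide_simps power2_eq_square mult_ac)
    show "((\<lambda>h. K * norm h) \<longlongrightarrow> 0) (at 0)"
      by (auto intro!: tendsto_eq_intros)
  qed
qed (rule D)

text \<open>Differentiation under the integral by a remainder estimate: the second derivatives of
  \<open>f\<close> are bounded by a multiple of \<open>cauchy_weight Z\<close>, so the Taylor error
  stays quadratic after integration.\<close>

lemma has_derivative_fourier_z:
  fixes f :: "'v::euclidean_space \<times> 'z::euclidean_space \<Rightarrow> complex"
  assumes f: "schwartz f"
  shows "(fourier_z f \<eta> has_derivative (\<lambda>k. \<Sum>b\<in>Basis. (k \<bullet> b) *\<^sub>R fourier_z (dir_deriv (b, 0) f) \<eta> V)) (at V)"
proof -
  have "\<exists>C\<ge>0. \<forall>V Z. norm (dir_deriv (snd p) (dir_deriv (fst p) f) (V, Z)) \<le> C * cauchy_weight Z"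
    if "p \<in> Basis \<times> Basis" for p
  proof -
    have "schwartz (dir_deriv (snd p) (dir_deriv (fst p) f))" using that by (auto intro!: schwartz_dir_deriv f)
    then obtain C where C: "C \<ge> 0" "\<And>V Z. (1 + norm V) ^ 0 * norm (dir_deriv (snd p) (dir_deriv (fst p) f) (V, Z)) \<le> C * cauchy_weight V * cauchy_weight Z"
      by (rule schwartz_slice_decay[where N=0]) blast
    have "norm (dir_deriv (snd p) (dir_deriv (fst p) f) (V, Z)) \<le> C * cauchy_weight Z" for V Z
    proof -
      have "norm (dir_deriv (snd p) (dir_deriv (fst p) f) (V, Z)) \<le> (C * cauchy_weight Z) * cauchy_weight V" using C(2)[of V Z] by (simp add: mult_ac)
      also have "\<dots> \<le> C * cauchy_weight Z"
        using mult_left_mono[OF cauchy_weight_le_1[of V], of "C * cauchy_weight Z"] C(1) cauchy_weight_pos[of Z] by simp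
      finally show ?thesis .
    qed
    with C(1) show ?thesis by blast
  qed
  then obtain c where c: "\<And>p. p \<in> Basis \<times> Basis \<Longrightarrow> c p \<ge> 0"
    "\<And>p V Z. p \<in> Basis \<times> Basis \<Longrightarrow> norm (dir_deriv (snd p) (dir_deriv (fst p) f) (V, Z)) \<le> c p * cauchy_weight Z"
    by metis
  define C where "C = (\<Sum>p\<in>Basis \<times> Basis. c p)"
  have C: "norm (dir_deriv b' (dir_deriv b f) (V, Z)) \<le> C * cauchy_weight Z" if "b \<in> Basis" "b' \<in> Basis" for b b' V Z
  proof -
    have "c (b, b') \<le> C" unfolding C_def using that c(1) by (intro member_le_sum) auto
    then have "c (b, b') * cauchy_weight Z \<le> C * cauchy_weight Z" by (intro mult_right_mono less_imp_le[OF cauchy_weight_pos])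
    with c(2)[of "(b, b')" V Z] that show ?thesis by auto
  qed
  let ?d = "DIM('v \<times> 'z)"
  let ?D = "\<lambda>k. \<Sum>b\<in>Basis. (k \<bullet> b) *\<^sub>R fourier_z (dir_deriv (b, 0) f) \<eta> V"
  have b0: "(b, 0) \<in> (Basis :: ('v \<times> 'z) set)" if "b \<in> Basis" for b using that by (auto simp: Basis_prod_def)
  have Df: "frechet_derivative f (at p) (k, 0) = (\<Sum>b\<in>Basis. (k \<bullet> b) *\<^sub>R dir_deriv (b, 0) f p)" for p k
  proof -
    have l: "linear (frechet_derivative f (at p))"
      by (rule linear_frechet_derivative[OF schwartz_differentiable[OF f]])
    have "(k, 0) = (\<Sum>b\<in>Basis. (k \<bullet> b) *\<^sub>R (b, 0 :: 'z))"
      by (simp add: prod_eq_iff fst_sum snd_sum euclidean_representation)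
    then have "frechet_derivative f (at p) (k, 0) = frechet_derivative f (at p) (\<Sum>b\<in>Basis. (k \<bullet> b) *\<^sub>R (b, 0))"
      by (simp only:)
    then show ?thesis by (simp only: linear_sum[OF l] linear_cmul[OF l] dir_deriv_def)
  qed
  have "norm (fourier_z f \<eta> (V + k) - fourier_z f \<eta> V - ?D k) \<le> (?d\<^sup>2 * C * (LINT Z|lborel. cauchy_weight (Z::'z))) * (norm k)\<^sup>2" for k
  proof -
    let ?R = "\<lambda>Z. f (V + k, Z) - f (V, Z) - frechet_derivative f (at (V, Z)) (k, 0)"
    have i: "integrable lborel (\<lambda>Z. cis (\<eta> \<bullet> Z) * dir_deriv (b, 0) f (V, Z))" if "b \<in> Basis" for b
      by (intro integrable_fourier_z schwartz_dir_deriv f b0 that)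
    have e: "cis (\<eta> \<bullet> Z) * ?R Z = cis (\<eta> \<bullet> Z) * f (V + k, Z) - cis (\<eta> \<bullet> Z) * f (V, Z) -
        (\<Sum>b\<in>Basis. (k \<bullet> b) *\<^sub>R (cis (\<eta> \<bullet> Z) * dir_deriv (b, 0) f (V, Z)))" for Z
      by (simp add: Df sum_distrib_left algebra_simps)
    have iR: "integrable lborel (\<lambda>Z. cis (\<eta> \<bullet> Z) * ?R Z)"
      unfolding e by (intro Bochner_Integration.integrable_diff Bochner_Integration.integrable_sum integrable_scaleR_right integrable_fourier_z f i)
    have "fourier_z f \<eta> (V + k) - fourier_z f \<eta> V - ?D k = (LINT Z|lborel. cis (\<eta> \<bullet> Z) * ?R Z)"
      unfolding e by (simp add: fourier_z_def integrable_fourier_z[OF f] i)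
    also have "norm \<dots> \<le> (LINT Z|lborel. norm (cis (\<eta> \<bullet> Z) * ?R Z))" by (rule integral_norm_bound)
    also have "\<dots> \<le> (LINT Z|lborel. ?d\<^sup>2 * (C * cauchy_weight (Z::'z)) * (norm k)\<^sup>2)"
    proof (rule Bochner_Integration.integral_mono)
      show "integrable lborel (\<lambda>Z. norm (cis (\<eta> \<bullet> Z) * ?R Z))" by (rule integrable_norm[OF iR])
      show "integrable lborel (\<lambda>Z::'z. ?d\<^sup>2 * (C * cauchy_weight Z) * (norm k)\<^sup>2)"
        by (intro integrable_mult_left integrable_mult_right integrable_cauchy_weight)
      fix Z
      \<comment> \<open>Only V moves along the segment, so one weight in Z serves for all of its
        points.\<close>
      have "norm (f ((V, Z) + (k, 0)) - f (V, Z) - frechet_derivative f (at (V, Z)) (k, 0)) \<le> ?d\<^sup>2 * (C * cauchy_weight Z) * (norm (k, 0::'z))\<^sup>2"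
      proof (rule schwartz_taylor[OF f])
        fix b b' y assume b: "b \<in> (Basis :: ('v \<times> 'z) set)" "b' \<in> (Basis :: ('v \<times> 'z) set)" and "y \<in> closed_segment (V, Z) ((V, Z) + (k, 0))"
        then obtain t where "y = (1 - t) *\<^sub>R (V, Z) + t *\<^sub>R ((V, Z) + (k, 0))" by (auto simp: closed_segment_def)
        then have "y = (V + t *\<^sub>R k, Z)" by (simp add: algebra_simps)
        then show "norm (dir_deriv b' (dir_deriv b f) y) \<le> C * cauchy_weight Z" using C[OF b] by simp
      qed
      then show "norm (cis (\<eta> \<bullet> Z) * ?R Z) \<le> ?d\<^sup>2 * (C * cauchy_weight Z) * (norm k)\<^sup>2"
        by (simp add: norm_mult norm_Pair)
    qed
    also have "\<dots> = (?d\<^sup>2 * C * (LINT Z|lborel. cauchy_weight (Z::'z))) * (norm k)\<^sup>2" by simp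
    finally show ?thesis .
  qed
  moreover have "bounded_linear ?D"
    by (intro bounded_linear_sum bounded_linear_scaleR_left[THEN bounded_linear_compose] bounded_linear_inner_left)
  ultimately show ?thesis by (intro has_derivative_quadratic_error)
qed

lemma schwartz_fourier_z:
  fixes f :: "'v::euclidean_space \<times> 'z::euclidean_space \<Rightarrow> complex"
  assumes "schwartz f"
  shows "schwartz (fourier_z f \<eta>)"
proof (rule schwartz_coinduct[of "\<lambda>h. \<exists>f :: 'v \<times> 'z \<Rightarrow> complex. schwartz f \<and> h = fourier_z f \<eta>"])
  show "\<exists>f' :: 'v \<times> 'z \<Rightarrow> complex. schwartz f' \<and> fourier_z f \<eta> = fourier_z f' \<eta>" using assms by blast
  fix h assume "\<exists>f :: 'v \<times> 'z \<Rightarrow> complex. schwartz f \<and> h = fourier_z f \<eta>"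
  then obtain f :: "'v \<times> 'z \<Rightarrow> complex" where f: "schwartz f" and h: "h = fourier_z f \<eta>" by blast
  show "(\<forall>x. h differentiable (at x)) \<and> (\<forall>N::nat. \<exists>C. \<forall>x. (1 + norm x) ^ N * norm (h x) \<le> C) \<and>
      (\<forall>b\<in>Basis. \<exists>f :: 'v \<times> 'z \<Rightarrow> complex. schwartz f \<and> dir_deriv b h = fourier_z f \<eta>)"
  proof (intro conjI allI ballI)
    show "h differentiable (at x)" for x
      unfolding h differentiable_def using has_derivative_fourier_z[OF f] by blast
    show "\<exists>C. \<forall>x. (1 + norm x) ^ N * norm (h x) \<le> C" for N
    proof -
      obtain C where C: "C \<ge> 0" "\<And>\<eta> V. (1 + norm V) ^ N * norm (fourier_z f \<eta> V) \<le> C * cauchy_weight V"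
        by (rule fourier_z_decay[OF f, where N=N]) blast
      have "(1 + norm x) ^ N * norm (h x) \<le> C" for x
        using C(2)[of x \<eta>] mult_left_mono[OF cauchy_weight_le_1[of x] C(1)] by (simp add: h)
      then show ?thesis by blast
    qed
    show "\<exists>f :: 'v \<times> 'z \<Rightarrow> complex. schwartz f \<and> dir_deriv b h = fourier_z f \<eta>" if b: "b \<in> Basis" for b
    proof (intro exI conjI)
      show "schwartz (dir_deriv (b, 0) f)" using b by (intro schwartz_dir_deriv f) (auto simp: Basis_prod_def)
      show "dir_deriv b h = fourier_z (dir_deriv (b, 0) f) \<eta>"
      proof
        fix V
        have "dir_deriv b h V = (\<Sum>b'\<in>Basis. (b \<bullet> b') *\<^sub>R fourier_z (dir_deriv (b', 0) f) \<eta> V)"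
          unfolding h by (rule dir_deriv_eqI[OF has_derivative_fourier_z[OF f]])
        also have "\<dots> = fourier_z (dir_deriv (b, 0) f) \<eta> V"
          using b by (simp add: inner_Basis if_distrib[of "\<lambda>x. x *\<^sub>R _"] cong: if_cong)
        finally show "dir_deriv b h V = fourier_z (dir_deriv (b, 0) f) \<eta> V" .
      qed
    qed
  qed
qed

section \<open>Polar coordinates\<close>

lemma sets_sphere_measure: "sets (sphere_measure :: 'z::euclidean_space measure) = sets (restrict_space borel (sphere 0 1))"
  by (simp add: sphere_measure_def)

lemma space_sphere_measure: "space (sphere_measure :: 'z::euclidean_space measure) = sphere 0 1"
  by (simp add: sphere_measure_def space_scale_measure space_restrict_space)

lemma measurable_sphere_measure_ident: "(\<lambda>\<omega>. \<omega>) \<in> (sphere_measure :: 'z::euclidean_space measure) \<rightarrow>\<^sub>M borel"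
  by (subst measurable_cong_sets[OF sets_sphere_measure refl]) (simp add: measurable_restrict_space1)

lemma measurable_sgn_sphere:
  "(sgn :: 'z::euclidean_space \<Rightarrow> 'z) \<in> restrict_space lborel (ball 0 1 - {0}) \<rightarrow>\<^sub>M restrict_space borel (sphere 0 1)"
  by (rule measurable_restrict_space3) (auto simp: norm_sgn sgn_div_norm[abs_def])

lemma nn_integral_sphere_measure:
  fixes G :: "'z::euclidean_space \<Rightarrow> ennreal"
  assumes [measurable]: "G \<in> borel_measurable borel"
  shows "(\<integral>\<^sup>+\<omega>. G \<omega> \<partial>sphere_measure) = of_nat DIM('z) * (\<integral>\<^sup>+x. G (sgn x) * indicator (ball 0 1 - {0}) x \<partial>lborel)"
proof -
  have G: "G \<in> borel_measurable (restrict_space borel (sphere 0 1))" by (simp add: measurable_restrict_space1)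
  then have G': "G \<in> borel_measurable (distr (restrict_space lborel (ball 0 1 - {0})) (restrict_space borel (sphere 0 1)) sgn)"
    by simp
  show ?thesis
    unfolding sphere_measure_def
    by (subst nn_integral_scale_measure[OF G'], subst nn_integral_distr[OF measurable_sgn_sphere G'],
        subst nn_integral_restrict_space) auto
qed

lemma nn_integral_lborel_scale:
  fixes f :: "'a::euclidean_space \<Rightarrow> ennreal"
  assumes c: "c > 0" and f: "f \<in> borel_measurable borel"
  shows "(\<integral>\<^sup>+x. f (c *\<^sub>R x) \<partial>lborel) = ennreal ((1 / c) ^ DIM('a)) * (\<integral>\<^sup>+x. f x \<partial>lborel)"
proof -
  have "(\<integral>\<^sup>+x. f x \<partial>lborel) = ennreal (\<bar>c\<bar> ^ DIM('a)) * (\<integral>\<^sup>+x. f (0 + c *\<^sub>R x) \<partial>lborel)"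
    using c f by (intro nn_integral_lborel_affine) auto
  moreover have "ennreal ((1 / c) ^ DIM('a)) * ennreal (\<bar>c\<bar> ^ DIM('a)) = 1"
    using c by (simp add: power_one_over flip: ennreal_mult)
  ultimately show ?thesis by (simp add: mult.assoc[symmetric])
qed

lemma nn_integral_inverse_power_tail:
  fixes a :: real
  assumes a: "a > 0" and d: "d > 0"
  shows "ennreal (real d) * (\<integral>\<^sup>+s. ennreal (1 / s ^ Suc d) * indicator {a<..} s \<partial>lborel) = ennreal (1 / a ^ d)"
proof -
  have "(\<integral>\<^sup>+s. ennreal (1 / s ^ Suc d) * indicator {a ..} s \<partial>lborel) = ennreal (0 - (- 1 / (real d * a ^ d)))"
  proof (rule nn_integral_FTC_atLeast)
    show "DERIV (\<lambda>s. - 1 / (real d * s ^ d)) s :> 1 / s ^ Suc d" if "a \<le> s" for s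
    proof -
      have s: "s > 0" using a that by simp
      obtain e where e: "d = Suc e" using d by (cases d) auto
      have "DERIV (\<lambda>s. - (1 / real d) * inverse (s ^ d)) s :> - (1 / real d) * - (inverse (s ^ d) * (real d * (1 * s ^ (d - Suc 0))) * inverse (s ^ d))"
        using s by (intro DERIV_cmult DERIV_inverse' DERIV_power DERIV_ident) auto
      moreover have "- (1 / real d) * - (inverse (s ^ d) * (real d * (1 * s ^ (d - Suc 0))) * inverse (s ^ d)) = 1 / s ^ Suc d"
        unfolding e using s by (simp add: divide_inverse)
      moreover have "(\<lambda>s. - 1 / (real d * s ^ d)) = (\<lambda>s. - (1 / real d) * inverse (s ^ d))"
        by (simp add: divide_inverse fun_eq_iff)
      ultimately show ?thesis by (simp only:)
    qed
    show "((\<lambda>s. - 1 / (real d * s ^ d)) \<longlongrightarrow> 0) at_top"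
    proof (rule tendsto_divide_0[OF tendsto_const])
      have "filterlim (\<lambda>s. real d * s ^ d) at_top at_top"
        using d by (intro filterlim_tendsto_pos_mult_at_top[OF tendsto_const] filterlim_pow_at_top filterlim_ident) auto
      then show "filterlim (\<lambda>s. real d * s ^ d) at_infinity at_top" by (rule filterlim_at_top_imp_at_infinity)
    qed
  qed (use a in auto)
  moreover have "(\<integral>\<^sup>+s. ennreal (1 / s ^ Suc d) * indicator {a ..} s \<partial>lborel) = (\<integral>\<^sup>+s. ennreal (1 / s ^ Suc d) * indicator {a<..} s \<partial>lborel)"
  proof (rule nn_integral_cong_AE)
    show "AE s in lborel. ennreal (1 / s ^ Suc d) * indicator {a ..} s = ennreal (1 / s ^ Suc d) * indicator {a<..} s"
      using AE_lborel_singleton[of a] by eventually_elim (auto simp: indicator_def)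
  qed
  moreover have "ennreal (real d) * ennreal (0 - (- 1 / (real d * a ^ d))) = ennreal (real d * (0 - (- 1 / (real d * a ^ d))))"
    by (rule ennreal_mult[symmetric]) (use a in auto)
  moreover have "real d * (0 - (- 1 / (real d * a ^ d))) = 1 / a ^ d" using d by simp
  ultimately show ?thesis by (simp only:)
qed

text \<open>Both sides are turned into a double integral over \<open>s\<close> and \<open>y = s x\<close> with \<open>|x| < 1\<close>.\<close>

lemma nn_integral_polar:
  fixes F :: "'z::euclidean_space \<Rightarrow> ennreal"
  assumes [measurable]: "F \<in> borel_measurable borel"
  shows "(\<integral>\<^sup>+r. ennreal (r ^ (DIM('z) - 1)) * (\<integral>\<^sup>+\<omega>. F (r *\<^sub>R \<omega>) \<partial>sphere_measure) * indicator {0<..} r \<partial>lborel) =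
    (\<integral>\<^sup>+\<eta>. F \<eta> \<partial>lborel)"
proof -
  let ?d = "DIM('z)"
  have d: "Suc (?d - 1) = ?d" "0 < ?d" by auto
  have [measurable]: "sgn \<in> borel_measurable (borel :: 'z measure)" by (simp add: sgn_div_norm[abs_def])
  define B where "B = ball 0 1 - {0::'z}"
  have B [measurable]: "B \<in> sets borel"
    by (auto simp: B_def)
  have "(\<integral>\<^sup>+r. ennreal (r ^ (?d - 1)) * (\<integral>\<^sup>+\<omega>. F (r *\<^sub>R \<omega>) \<partial>sphere_measure) * indicator {0<..} r \<partial>lborel) =
     (\<integral>\<^sup>+r. \<integral>\<^sup>+x. ennreal (r ^ (?d - 1)) * (of_nat ?d * (F (r *\<^sub>R sgn x) * indicator B x)) * indicator {0<..} r \<partial>lborel \<partial>lborel)"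
  proof (rule nn_integral_cong)
    fix r :: real
    show "ennreal (r ^ (?d - 1)) * (\<integral>\<^sup>+\<omega>. F (r *\<^sub>R \<omega>) \<partial>sphere_measure) * indicator {0<..} r =
      (\<integral>\<^sup>+x. ennreal (r ^ (?d - 1)) * (of_nat ?d * (F (r *\<^sub>R sgn x) * indicator B x)) * indicator {0<..} r \<partial>lborel)"
    proof -
      have "(\<integral>\<^sup>+\<omega>. F (r *\<^sub>R \<omega>) \<partial>sphere_measure) = of_nat ?d * (\<integral>\<^sup>+x. F (r *\<^sub>R sgn x) * indicator B x \<partial>lborel)"
        unfolding B_def by (rule nn_integral_sphere_measure) measurable
      moreover have "(\<integral>\<^sup>+x. a * (b * h x) * c \<partial>lborel) = a * (b * (\<integral>\<^sup>+x. h x \<partial>lborel)) * c"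
        if "h \<in> borel_measurable lborel" for a b c and h :: "'z \<Rightarrow> ennreal"
        using that by (simp add: nn_integral_multc nn_integral_cmult)
      from this[of "\<lambda>x. F (r *\<^sub>R sgn x) * indicator B x"]
      have "(\<integral>\<^sup>+x. ennreal (r ^ (?d - 1)) * (of_nat ?d * (F (r *\<^sub>R sgn x) * indicator B x)) * indicator {0<..} r \<partial>lborel) =
          ennreal (r ^ (?d - 1)) * (of_nat ?d * (\<integral>\<^sup>+x. F (r *\<^sub>R sgn x) * indicator B x \<partial>lborel)) * indicator {0<..} r"
        by measurable
      ultimately show ?thesis by (simp only:)
    qed
  qed
  also have "\<dots> = (\<integral>\<^sup>+x. \<integral>\<^sup>+r. ennreal (r ^ (?d - 1)) * (of_nat ?d * (F (r *\<^sub>R sgn x) * indicator B x)) * indicator {0<..} r \<partial>lborel \<partial>lborel)"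
    by (rule lborel_pair.Fubini'[symmetric]) measurable
  \<comment> \<open>The substitution r = |x| s at fixed x: then r sgn(x) = s x, and the Jacobian
    completes |x|^(d-1) to |x|^d.\<close>
  also have "\<dots> = (\<integral>\<^sup>+x. \<integral>\<^sup>+s. of_nat ?d * indicator B x * ennreal (norm x ^ ?d) * (ennreal (s ^ (?d - 1)) * F (s *\<^sub>R x) * indicator {0<..} s) \<partial>lborel \<partial>lborel)"
  proof (rule nn_integral_cong)
    fix x :: 'z
    show "(\<integral>\<^sup>+r. ennreal (r ^ (?d - 1)) * (of_nat ?d * (F (r *\<^sub>R sgn x) * indicator B x)) * indicator {0<..} r \<partial>lborel) =
       (\<integral>\<^sup>+s. of_nat ?d * indicator B x * ennreal (norm x ^ ?d) * (ennreal (s ^ (?d - 1)) * F (s *\<^sub>R x) * indicator {0<..} s) \<partial>lborel)"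
    proof (cases "x = 0")
      case False
      then have nx: "norm x > 0" by simp
      have "(\<integral>\<^sup>+r. ennreal (r ^ (?d - 1)) * (of_nat ?d * (F (r *\<^sub>R sgn x) * indicator B x)) * indicator {0<..} r \<partial>lborel) =
        ennreal (norm x) * (\<integral>\<^sup>+s. ennreal ((norm x * s) ^ (?d - 1)) * (of_nat ?d * (F ((norm x * s) *\<^sub>R sgn x) * indicator B x)) * indicator {0<..} (norm x * s) \<partial>lborel)"
        using nn_integral_real_affine[of "\<lambda>r. ennreal (r ^ (?d - 1)) * (of_nat ?d * (F (r *\<^sub>R sgn x) * indicator B x)) * indicator {0<..} r" "norm x" 0] nx by simp
      also have "\<dots> = (\<integral>\<^sup>+s. ennreal (norm x) * (ennreal ((norm x * s) ^ (?d - 1)) * (of_nat ?d * (F ((norm x * s) *\<^sub>R sgn x) * indicator B x)) * indicator {0<..} (norm x * s)) \<partial>lborel)"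
        by (rule nn_integral_cmult[symmetric]) measurable
      also have "\<dots> = (\<integral>\<^sup>+s. of_nat ?d * indicator B x * ennreal (norm x ^ ?d) * (ennreal (s ^ (?d - 1)) * F (s *\<^sub>R x) * indicator {0<..} s) \<partial>lborel)"
      proof (rule nn_integral_cong)
        fix s :: real
        have 1: "(norm x * s) *\<^sub>R sgn x = s *\<^sub>R x" using nx by (simp add: sgn_div_norm)
        have 2: "ennreal (norm x) * ennreal ((norm x * s) ^ (?d - 1)) = ennreal (norm x ^ ?d) * ennreal (s ^ (?d - 1))" if "s > 0"
        proof -
          have "norm x * (norm x * s) ^ (?d - 1) = norm x ^ Suc (?d - 1) * s ^ (?d - 1)" by (simp only: power_mult_distrib power_Suc mult_ac)
          then show ?thesis unfolding d(1) using that by (simp flip: ennreal_mult)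
        qed
        show "ennreal (norm x) * (ennreal ((norm x * s) ^ (?d - 1)) * (of_nat ?d * (F ((norm x * s) *\<^sub>R sgn x) * indicator B x)) * indicator {0<..} (norm x * s)) =
           of_nat ?d * indicator B x * ennreal (norm x ^ ?d) * (ennreal (s ^ (?d - 1)) * F (s *\<^sub>R x) * indicator {0<..} s)"
        proof (cases "s > 0")
          case True
          then have "indicator {0<..} (norm x * s) = (1::ennreal)" "indicator {0<..} s = (1::ennreal)" using nx by auto
          then have "ennreal (norm x) * (ennreal ((norm x * s) ^ (?d - 1)) * (of_nat ?d * (F ((norm x * s) *\<^sub>R sgn x) * indicator B x)) * indicator {0<..} (norm x * s)) =
              (ennreal (norm x) * ennreal ((norm x * s) ^ (?d - 1))) * (of_nat ?d * indicator B x * F (s *\<^sub>R x) * indicator {0<..} s)"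
            unfolding 1 by (simp only: mult_ac)
          then show ?thesis unfolding 2[OF True] by (simp only: mult_ac)
        next
          case False
          then show ?thesis using nx by (simp add: zero_less_mult_iff)
        qed
      qed
      finally show ?thesis .
    qed (simp add: B_def)
  qed
  also have "\<dots> = (\<integral>\<^sup>+s. \<integral>\<^sup>+x. of_nat ?d * indicator B x * ennreal (norm x ^ ?d) * (ennreal (s ^ (?d - 1)) * F (s *\<^sub>R x) * indicator {0<..} s) \<partial>lborel \<partial>lborel)"
    by (rule lborel_pair.Fubini') measurable
  \<comment> \<open>The substitution y = s x at fixed s turns |x| < 1 into |y| < s, and the powers
    of s collect to 1/s^(d+1).\<close>
  also have "\<dots> = (\<integral>\<^sup>+s. \<integral>\<^sup>+y. of_nat ?d * (F y * ennreal (norm y ^ ?d)) * (ennreal (1 / s ^ Suc ?d) * (if norm y < s then 1 else 0) * (if y = 0 then 0 else 1)) \<partial>lborel \<partial>lborel)"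
  proof (rule nn_integral_cong)
    fix s :: real
    show "(\<integral>\<^sup>+x. of_nat ?d * indicator B x * ennreal (norm x ^ ?d) * (ennreal (s ^ (?d - 1)) * F (s *\<^sub>R x) * indicator {0<..} s) \<partial>lborel) =
       (\<integral>\<^sup>+y. of_nat ?d * (F y * ennreal (norm y ^ ?d)) * (ennreal (1 / s ^ Suc ?d) * (if norm y < s then 1 else 0) * (if y = 0 then 0 else 1)) \<partial>lborel)"
    proof (cases "s > 0")
      case s: True
      let ?G = "\<lambda>y. of_nat ?d * (F y * ennreal (norm y ^ ?d)) * (ennreal (1 / s ^ Suc ?d) * (if norm y < s then 1 else 0) * (if y = 0 then 0 else 1))"
      have "of_nat ?d * indicator B x * ennreal (norm x ^ ?d) * (ennreal (s ^ (?d - 1)) * F (s *\<^sub>R x) * indicator {0<..} s) =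
         ennreal (s ^ ?d) * ?G (s *\<^sub>R x)" for x
      proof -
        have i: "indicator B x = ((if norm (s *\<^sub>R x) < s then 1 else 0) * (if s *\<^sub>R x = 0 then 0 else 1) :: ennreal)"
          using s by (auto simp: indicator_def B_def mult_less_cancel_left1 split: if_splits)
        have "norm x ^ ?d * s ^ (?d - 1) = s ^ ?d * (norm (s *\<^sub>R x) ^ ?d * (1 / s ^ Suc ?d))"
        proof -
          have "s ^ ?d = s * s ^ (?d - 1)" by (metis d(1) power_Suc)
          then show ?thesis using s by (simp add: power_mult_distrib field_simps)
        qed
        then have "ennreal (norm x ^ ?d) * ennreal (s ^ (?d - 1)) = ennreal (s ^ ?d) * (ennreal (norm (s *\<^sub>R x) ^ ?d) * ennreal (1 / s ^ Suc ?d))"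
          using s by (simp flip: ennreal_mult)
        moreover have "indicator {0<..} s = (1::ennreal)" using s by simp
        moreover have "of_nat ?d * indicator B x * ennreal (norm x ^ ?d) * (ennreal (s ^ (?d - 1)) * F (s *\<^sub>R x) * indicator {0<..} s) =
           (ennreal (norm x ^ ?d) * ennreal (s ^ (?d - 1))) * (of_nat ?d * F (s *\<^sub>R x) * indicator B x * indicator {0<..} s)"
          by (simp only: mult_ac)
        ultimately show ?thesis unfolding i by (simp only: mult_ac mult_1_left mult_1_right)
      qed
      then have "(\<integral>\<^sup>+x. of_nat ?d * indicator B x * ennreal (norm x ^ ?d) * (ennreal (s ^ (?d - 1)) * F (s *\<^sub>R x) * indicator {0<..} s) \<partial>lborel) =
         ennreal (s ^ ?d) * (\<integral>\<^sup>+x. ?G (s *\<^sub>R x) \<partial>lborel)"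
        by (simp only: nn_integral_cmult) (rule nn_integral_cmult, measurable)
      also have "(\<integral>\<^sup>+x. ?G (s *\<^sub>R x) \<partial>lborel) = ennreal ((1 / s) ^ ?d) * (\<integral>\<^sup>+x. ?G x \<partial>lborel)"
        by (rule nn_integral_lborel_scale[OF s]) measurable
      also have "ennreal (s ^ ?d) * (ennreal ((1 / s) ^ ?d) * X) = X" for X
        using s by (simp add: power_one_over mult.assoc[symmetric] flip: ennreal_mult)
      finally show ?thesis .
    next
      case False
      then have "\<not> norm y < s" for y :: 'z using norm_ge_zero[of y] by linarith
      with False show ?thesis by simp
    qed
  qed
  also have "\<dots> = (\<integral>\<^sup>+y. \<integral>\<^sup>+s. of_nat ?d * (F y * ennreal (norm y ^ ?d)) * (ennreal (1 / s ^ Suc ?d) * (if norm y < s then 1 else 0) * (if y = 0 then 0 else 1)) \<partial>lborel \<partial>lborel)"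
    by (rule lborel_pair.Fubini'[symmetric]) measurable
  \<comment> \<open>The integral of d/s^(d+1) over s > |y| is |y|^(-d), which cancels |y|^d; only
    the null set y = 0 is excepted.\<close>
  also have "\<dots> = (\<integral>\<^sup>+y. F y * (if y = 0 then 0 else 1) \<partial>lborel)"
  proof (rule nn_integral_cong)
    fix y :: 'z
    show "(\<integral>\<^sup>+s. of_nat ?d * (F y * ennreal (norm y ^ ?d)) * (ennreal (1 / s ^ Suc ?d) * (if norm y < s then 1 else 0) * (if y = 0 then 0 else 1)) \<partial>lborel) = F y * (if y = 0 then 0 else 1)"
    proof (cases "y = 0")
      case False
      then have ny: "norm y > 0" by simp
      have if_indicator: "(if norm y < s then 1 else 0) = (indicator {norm y<..} s :: ennreal)" for s
        by (simp add: indicator_def)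
      have "(\<integral>\<^sup>+s. of_nat ?d * (F y * ennreal (norm y ^ ?d)) * (ennreal (1 / s ^ Suc ?d) * (if norm y < s then 1 else 0) * (if y = 0 then 0 else 1)) \<partial>lborel) =
         of_nat ?d * (F y * ennreal (norm y ^ ?d)) * (\<integral>\<^sup>+s. ennreal (1 / s ^ Suc ?d) * indicator {norm y<..} s \<partial>lborel)"
        using False by (simp add: if_indicator nn_integral_cmult del: power_Suc)
      also have "\<dots> = (F y * ennreal (norm y ^ ?d)) * (ennreal (real ?d) * (\<integral>\<^sup>+s. ennreal (1 / s ^ Suc ?d) * indicator {norm y<..} s \<partial>lborel))"
        by (simp only: ennreal_of_nat_eq_real_of_nat mult_ac)
      also have "\<dots> = F y * (ennreal (norm y ^ ?d) * ennreal (1 / norm y ^ ?d))"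
        unfolding nn_integral_inverse_power_tail[OF ny d(2)] by (simp add: mult.assoc)
      also have "\<dots> = F y" using ny by (simp flip: ennreal_mult)
      finally show ?thesis using False by simp
    qed (simp add: B_def)
  qed
  also have "\<dots> = (\<integral>\<^sup>+y. F y \<partial>lborel)"
  proof (rule nn_integral_cong_AE)
    show "AE y in lborel. F y * (if y = 0 then 0 else 1) = F y"
      using AE_lborel_singleton[of "0 :: 'z"] by eventually_elim auto
  qed
  finally show ?thesis .
qed

section \<open>The branches of the multiplier\<close>

text \<open>An identity of measures, so that nonnegative and complex integrals follow alike. The
  change of variables for absolutely integrable functions treats sets that meet the image in finite
  measure, and exhaustion by bounded intervals does the rest.\<close>

lemma distr_change_of_variables:
  fixes s \<delta> :: "real \<Rightarrow> real"
  assumes I [measurable]: "I \<in> sets borel" and R [measurable]: "s ` I \<in> sets borel"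
    and d: "\<And>x. x \<in> I \<Longrightarrow> (s has_field_derivative \<delta> x) (at x)" and inj: "inj_on s I"
    and [measurable]: "s \<in> borel_measurable borel" "\<delta> \<in> borel_measurable borel"
  shows "distr (density lborel (\<lambda>x. ennreal (indicator I x * \<bar>\<delta> x\<bar>))) borel s =
    density lborel (\<lambda>y. ennreal (indicator (s ` I) y))" (is "?M = ?N")
proof (rule measure_eqI)
  fix A assume "A \<in> sets ?M"
  then have A [measurable]: "A \<in> sets borel" by simp
  have M: "emeasure ?M B = (\<integral>\<^sup>+x. ennreal (indicator I x * (\<bar>\<delta> x\<bar> * indicator B (s x))) \<partial>lborel)" if [measurable]: "B \<in> sets borel" for B
  proof -
    have "s -` B \<in> sets borel" using measurable_sets[of s borel borel B] by simp
    then have "emeasure ?M B = (\<integral>\<^sup>+x. ennreal (indicator I x * \<bar>\<delta> x\<bar>) * indicator (s -` B) x \<partial>lborel)"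
      by (simp add: emeasure_distr emeasure_density)
    then show ?thesis by (auto intro!: nn_integral_cong simp: indicator_def)
  qed
  have N: "emeasure ?N B = emeasure lborel (B \<inter> s ` I)" if [measurable]: "B \<in> sets borel" for B
  proof -
    have "emeasure ?N B = (\<integral>\<^sup>+x. indicator (s ` I) x * indicator B x \<partial>lborel)"
      by (subst emeasure_density) (auto simp: ennreal_indicator)
    also have "\<dots> = (\<integral>\<^sup>+x. indicator (B \<inter> s ` I) x \<partial>lborel)"
      by (simp add: indicator_inter_arith mult.commute)
    finally have "emeasure ?N B = (\<integral>\<^sup>+x. indicator (B \<inter> s ` I) x \<partial>lborel)" .
    then show ?thesis by simp
  qed
  have fin: "emeasure ?M B = emeasure ?N B" if Bs [measurable]: "B \<in> sets borel" and f: "emeasure lborel (B \<inter> s ` I) < \<infinity>" for B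
  proof -
    have "((\<lambda>x. 1::real) has_integral measure lborel (B \<inter> s ` I)) (B \<inter> s ` I)"
      by (rule has_integral_measure_lborel) (use f in auto)
    then have hi: "((\<lambda>x. indicator B x :: real) has_integral measure lborel (B \<inter> s ` I)) (s ` I)"
      by (subst (asm) has_integral_restrict_UNIV[symmetric], subst has_integral_restrict_UNIV[symmetric])
         (erule has_integral_eq[rotated], auto simp: indicator_def)
    then have "(\<lambda>x. indicator B x :: real) absolutely_integrable_on (s ` I)"
      by (intro nonnegative_absolutely_integrable_1) (auto simp: integrable_on_def)
    then have "(\<lambda>x. \<bar>\<delta> x\<bar> * indicator B (s x)) absolutely_integrable_on I \<and>
       integral I (\<lambda>x. \<bar>\<delta> x\<bar> * indicator B (s x)) = measure lborel (B \<inter> s ` I)"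
      using d inj hi by (subst has_absolute_integral_change_of_variables_1') (auto intro: has_field_derivative_at_within)
    then have "((\<lambda>x. \<bar>\<delta> x\<bar> * indicator B (s x)) has_integral measure lborel (B \<inter> s ` I)) I"
      using set_lebesgue_integral_eq_integral(1) by (metis has_integral_integrable_integral)
    then have "(\<integral>\<^sup>+x. ennreal (indicator I x * (\<bar>\<delta> x\<bar> * indicator B (s x))) \<partial>lborel) = ennreal (measure lborel (B \<inter> s ` I))"
      by (intro nn_integral_has_integral_lebesgue) auto
    moreover have "emeasure lborel (B \<inter> s ` I) = ennreal (measure lborel (B \<inter> s ` I))"
      using f by (intro emeasure_eq_ennreal_measure) auto
    ultimately show ?thesis by (simp only: M[OF Bs] N[OF Bs])
  qed
  define B where "B = (\<lambda>n::nat. A \<inter> {- real n..real n})"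
  have B [measurable]: "B n \<in> sets borel" for n by (simp add: B_def)
  have UB: "(\<Union>n. B n) = A"
  proof -
    have "x \<in> (\<Union>n. B n)" if "x \<in> A" for x
    proof -
      obtain n where "\<bar>x\<bar> \<le> real n" using real_arch_simple by blast
      then show ?thesis using that by (auto simp: B_def abs_le_iff intro!: exI[of _ n])
    qed
    then show ?thesis by (auto simp: B_def)
  qed
  have inc: "incseq B" by (auto simp: incseq_def B_def)
  have "emeasure ?M (B n) = emeasure ?N (B n)" for n
  proof (rule fin)
    have "emeasure lborel (B n \<inter> s ` I) \<le> emeasure lborel {- real n..real n}"
      by (intro emeasure_mono) (auto simp: B_def)
    also have "\<dots> < \<infinity>" by simp
    finally show "emeasure lborel (B n \<inter> s ` I) < \<infinity>" .
  qed simp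
  then show "emeasure ?M A = emeasure ?N A"
    using SUP_emeasure_incseq[of B ?M] SUP_emeasure_incseq[of B ?N] inc B UB by (simp add: image_subset_iff)
qed simp

locale proper_branch =
  fixes n k :: nat and m :: "real \<Rightarrow> real \<Rightarrow> real"
  assumes proper: "proper_function n m"
    and diff: "\<And>\<mu>. \<mu> > 0 \<Longrightarrow> k \<in> mu_indices n m \<mu> \<Longrightarrow> mu_sol n m k differentiable (at \<mu>)"
begin

abbreviation "J \<equiv> joint_mult n m k"
abbreviation "s \<equiv> mu_sol n m k"

definition "I = {\<mu>. k \<in> mu_indices n m \<mu>}"

lemma I_eq: "I = J ` {0<..}"
  by (auto simp: I_def mu_indices_def)

lemma J_pos: "r > 0 \<Longrightarrow> J r > 0"
  using proper by (simp add: proper_function_def)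

lemma J_inj: "inj_on J {0<..}"
proof -
  have "strict_mono_on {0<..} J \<or> strict_antimono_on {0<..} J" using proper by (simp add: proper_function_def)
  then show ?thesis
    by (auto simp: inj_on_def monotone_on_def) (metis greaterThan_iff less_irrefl linorder_neqE_linordered_idom)+
qed

lemma J_continuous: "continuous_on {0<..} J"
  using proper by (intro differentiable_imp_continuous_on) (simp add: proper_function_def)

lemma s_J: "r > 0 \<Longrightarrow> s (J r) = r"
  unfolding mu_sol_def using J_inj by (intro the_equality) (auto simp: inj_on_def)

lemma J_s: "\<mu> \<in> I \<Longrightarrow> J (s \<mu>) = \<mu>" and s_pos: "\<mu> \<in> I \<Longrightarrow> s \<mu> > 0"
  by (auto simp: I_eq s_J)

lemma I_pos: "\<mu> \<in> I \<Longrightarrow> \<mu> > 0"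
  by (auto simp: I_eq J_pos)

lemma s_image: "s ` I = {0<..}"
  by (force simp: I_eq s_J image_image)

lemma s_inj: "inj_on s I"
  by (metis J_s inj_on_inverseI)

lemma I_open: "open I"
  unfolding I_eq by (intro Further_Topology.invariance_of_domain J_continuous J_inj) auto

lemma I_borel [measurable]: "I \<in> sets borel"
  using I_open by simp

lemma s_deriv: "\<mu> \<in> I \<Longrightarrow> (s has_field_derivative deriv s \<mu>) (at \<mu>)"
  using diff[of \<mu>] I_pos[of \<mu>] by (simp add: I_def DERIV_deriv_iff_real_differentiable)

text \<open>The inverse branch is continuous on \<open>I\<close>. Off \<open>I\<close> the
  description has no witness and always denotes the same fixed value, so the function is Borel on
  the whole line.\<close>

lemma s_measurable [measurable]: "s \<in> borel_measurable borel"
proof -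
  have "s = (\<lambda>\<mu>. if \<mu> \<in> I then s \<mu> else (THE r. False))"
  proof
    fix \<mu>
    have "(\<lambda>r. r > 0 \<and> J r = \<mu>) = (\<lambda>_. False)" if "\<mu> \<notin> I" using that by (auto simp: I_eq)
    then show "s \<mu> = (if \<mu> \<in> I then s \<mu> else (THE r. False))" by (simp add: mu_sol_def)
  qed
  moreover have "continuous_on I s"
    using s_deriv by (intro continuous_at_imp_continuous_on) (auto intro: DERIV_isCont)
  then have "(\<lambda>\<mu>. if \<mu> \<in> I then s \<mu> else (THE r. False)) \<in> borel_measurable borel"
    by (intro borel_measurable_continuous_on_if I_borel) auto
  ultimately show ?thesis by metis
qed

definition "\<delta> \<mu> = (if \<mu> \<in> I then deriv s \<mu> else 0)"

text \<open>The derivative of a branch need not be continuous, so measurability comes from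
  difference quotients with steps 1/(i+1). The shifted point may leave \<open>I\<close>, where
  \<open>s\<close> is still Borel.\<close>

lemma \<delta>_measurable [measurable]: "\<delta> \<in> borel_measurable borel"
proof (rule borel_measurable_LIMSEQ_real)
  let ?u = "\<lambda>i \<mu>. if \<mu> \<in> I then (s (\<mu> + 1 / real (Suc i)) - s \<mu>) / (1 / real (Suc i)) else 0"
  show "?u i \<in> borel_measurable borel" for i by measurable
  show "(\<lambda>i. ?u i \<mu>) \<longlonglongrightarrow> \<delta> \<mu>" for \<mu>
  proof (cases "\<mu> \<in> I")
    case True
    have l: "((\<lambda>h. (s (\<mu> + h) - s \<mu>) / h) \<longlongrightarrow> deriv s \<mu>) (at 0)"
      using s_deriv[OF True] by (simp add: DERIV_def)
    have "filterlim (\<lambda>i. 1 / real (Suc i)) (at 0) sequentially"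
      using LIMSEQ_Suc[OF lim_1_over_n[where 'a=real]] by (auto simp: filterlim_at)
    from filterlim_compose[OF l this] show ?thesis using True by (simp add: \<delta>_def)
  qed (simp add: \<delta>_def)
qed

lemma distr_branch:
  "distr (density lborel (\<lambda>\<mu>. ennreal (indicator I \<mu> * \<bar>\<delta> \<mu>\<bar>))) borel s = density lborel (\<lambda>r. ennreal (indicator {0<..} r))"
  using distr_change_of_variables[of I s \<delta>] s_deriv s_inj unfolding s_image by (simp add: \<delta>_def)

lemma nn_integral_branch:
  assumes [measurable]: "F \<in> borel_measurable borel"
  shows "(\<integral>\<^sup>+\<mu>. ennreal (indicator I \<mu> * \<bar>\<delta> \<mu>\<bar>) * F (s \<mu>) \<partial>lborel) = (\<integral>\<^sup>+r. F r * indicator {0<..} r \<partial>lborel)"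
proof -
  have "(\<integral>\<^sup>+\<mu>. ennreal (indicator I \<mu> * \<bar>\<delta> \<mu>\<bar>) * F (s \<mu>) \<partial>lborel) =
     (\<integral>\<^sup>+r. F r \<partial>distr (density lborel (\<lambda>\<mu>. ennreal (indicator I \<mu> * \<bar>\<delta> \<mu>\<bar>))) borel s)"
    by (simp add: nn_integral_distr nn_integral_density)
  also have "\<dots> = (\<integral>\<^sup>+r. F r * indicator {0<..} r \<partial>lborel)"
    unfolding distr_branch by (simp add: nn_integral_density mult.commute ennreal_indicator)
  finally show ?thesis .
qed

lemma integral_branch:
  fixes H :: "real \<Rightarrow> complex"
  assumes [measurable]: "H \<in> borel_measurable borel"
  shows "(LINT \<mu>|lborel. (indicator I \<mu> * \<bar>\<delta> \<mu>\<bar>) *\<^sub>R H (s \<mu>)) = (LINT r|lborel. indicator {0<..} r *\<^sub>R H r)"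
proof -
  have "(LINT \<mu>|lborel. (indicator I \<mu> * \<bar>\<delta> \<mu>\<bar>) *\<^sub>R H (s \<mu>)) =
     (LINT r|distr (density lborel (\<lambda>\<mu>. ennreal (indicator I \<mu> * \<bar>\<delta> \<mu>\<bar>))) borel s. H r)"
    by (simp add: integral_distr integral_density)
  also have "\<dots> = (LINT r|lborel. indicator {0<..} r *\<^sub>R H r)"
    unfolding distr_branch by (simp add: integral_density)
  finally show ?thesis .
qed

end

section \<open>Bounds independent of the symplectic frames\<close>

lemma integral_exp_half_line: "(LINT s|lborel. indicator {0<..} s * exp (- s)) = (1::real)"
proof -
  have e: "indicator {0<..} s *\<^sub>R (exp (- s) *\<^sub>R cis (- (s * 0))) = complex_of_real (indicator {0<..} s * exp (- s))" for s :: real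
    by (simp add: indicator_def scaleR_conv_of_real)
  have "complex_of_real (LINT s|lborel. indicator {0<..} s * exp (- s)) = complex_of_real 1"
    using has_bochner_integral_integral_eq[OF exp_cis_half_line[of 0]]
    unfolding e integral_complex_of_real by simp
  then show ?thesis by (simp only: of_real_eq_iff)
qed

text \<open>Jensen's inequality for the probability measure exp(-s) ds on the half-line, in the form
  that a variance is nonnegative, followed by exp(-s) \<le> 1. The bound \<open>M\<close> secures
  integrability and leaves no trace in the estimate.\<close>

lemma exp_average_square_le:
  fixes u :: "real \<Rightarrow> real"
  assumes [measurable]: "u \<in> borel_measurable borel" and u: "\<And>s. 0 \<le> u s" "\<And>s. u s \<le> M"
    and x: "0 \<le> x" "x \<le> (LINT s|lborel. indicator {0<..} s * exp (- s) * u s)"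
  shows "ennreal (x\<^sup>2) \<le> (\<integral>\<^sup>+s. ennreal ((u s)\<^sup>2) \<partial>lborel)"
proof -
  let ?e = "\<lambda>s::real. indicator {0<..} s * exp (- s)"
  have M: "0 \<le> M" using u[of 0] by linarith
  have i1: "integrable lborel (\<lambda>s. ?e s * u s)"
    by (rule Bochner_Integration.integrable_bound[OF integrable_mult_left[OF integrable_exp_half_line, of M]])
       (use u M in \<open>auto simp: indicator_def abs_mult\<close>)
  have i2: "integrable lborel (\<lambda>s. ?e s * (u s)\<^sup>2)"
    by (rule Bochner_Integration.integrable_bound[OF integrable_mult_left[OF integrable_exp_half_line, of "M\<^sup>2"]])
       (use u M in \<open>auto simp: indicator_def abs_mult power_mono\<close>)
  define \<theta> where "\<theta> = (LINT s|lborel. ?e s * u s)"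
  have "0 \<le> (LINT s|lborel. ?e s * (u s - \<theta>)\<^sup>2)" by (intro Bochner_Integration.integral_nonneg) (auto simp: indicator_def)
  also have "(\<lambda>s. ?e s * (u s - \<theta>)\<^sup>2) = (\<lambda>s. ?e s * (u s)\<^sup>2 - (2 * \<theta>) * (?e s * u s) + \<theta>\<^sup>2 * ?e s)"
    by (auto simp: power2_diff algebra_simps)
  also have "integral\<^sup>L lborel \<dots> = (LINT s|lborel. ?e s * (u s)\<^sup>2) - (2 * \<theta>) * \<theta> + \<theta>\<^sup>2 * 1"
    using i1 i2 integrable_exp_half_line integral_exp_half_line by (simp add: \<theta>_def)
  finally have "\<theta>\<^sup>2 \<le> (LINT s|lborel. ?e s * (u s)\<^sup>2)" by (simp add: power2_eq_square)
  moreover have "x\<^sup>2 \<le> \<theta>\<^sup>2" using x unfolding \<theta>_def by (intro power_mono) auto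
  ultimately have "ennreal (x\<^sup>2) \<le> ennreal (LINT s|lborel. ?e s * (u s)\<^sup>2)" by (intro ennreal_leI) linarith
  also have "\<dots> = (\<integral>\<^sup>+s. ennreal (?e s * (u s)\<^sup>2) \<partial>lborel)"
    by (rule nn_integral_eq_integral[symmetric, OF i2]) (auto simp: indicator_def)
  also have "\<dots> \<le> (\<integral>\<^sup>+s. ennreal ((u s)\<^sup>2) \<partial>lborel)"
    by (intro nn_integral_mono ennreal_leI) (auto simp: indicator_def mult_left_le_one_le)
  finally show ?thesis .
qed

text \<open>Twisted translations commute with twisted convolution. The phases agree because the form
  is bilinear and changes sign when its arguments are swapped.\<close>

lemma twisted_proj_translate:
  "twisted_proj k r (\<lambda>y. cis (r / 2 * sympl_form y b) * h (y + b)) z = cis (r / 2 * sympl_form z b) * twisted_proj k r h (z + b)"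
proof -
  have "cis (r / 2 * sympl_form (z - w) b) * h (z - w + b) * of_real (laguerre_fun k r w) * cis (r / 2 * sympl_form z w) =
     cis (r / 2 * sympl_form z b) * (h (z + b - w) * of_real (laguerre_fun k r w) * cis (r / 2 * sympl_form (z + b) w))" for w
  proof -
    have "r / 2 * sympl_form (z - w) b + r / 2 * sympl_form z w = r / 2 * sympl_form z b + r / 2 * sympl_form (z + b) w"
      by (simp add: sympl_form_simps sympl_form_swap[of w b] algebra_simps)
    then have "cis (r / 2 * sympl_form (z - w) b) * cis (r / 2 * sympl_form z w) = cis (r / 2 * sympl_form z b) * cis (r / 2 * sympl_form (z + b) w)"
      by (simp only: cis_mult)
    moreover have "z - w + b = z + b - w" by simp
    ultimately show ?thesis by (simp only: mult_ac)
  qed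
  then show ?thesis unfolding twisted_proj_def sympl_form_def[symmetric] by (simp only: integral_mult_right_zero)
qed

lemma integrable_laguerre_fun:
  "r > 0 \<Longrightarrow> integrable lborel (\<lambda>w :: complex^'n::finite. complex_of_real (laguerre_fun k r w))"
  using integrable_laguerre_fun_mult[of r "\<lambda>_. 1" 1 k 0] by simp

lemma norm_twisted_proj_le:
  fixes h :: "complex^'n::finite \<Rightarrow> complex"
  assumes r: "r > 0" and [measurable]: "h \<in> borel_measurable borel" and B: "\<And>y. norm (h y) \<le> B"
  shows "norm (twisted_proj k r h z) \<le> B * (LINT w|lborel. \<bar>laguerre_fun k r (w :: complex^'n)\<bar>)"
proof -
  have i: "integrable lborel (\<lambda>w :: complex^'n. B * \<bar>laguerre_fun k r w\<bar>)"
    using integrable_norm[OF integrable_laguerre_fun[OF r, of k, where 'n='n]] by simp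
  have "norm (twisted_proj k r h z) \<le> (LINT w|lborel. norm (h (z - w) * of_real (laguerre_fun k r w) * cis (r / 2 * sympl_form z w)))"
    unfolding twisted_proj_def sympl_form_def[symmetric] by (rule integral_norm_bound)
  also have "\<dots> \<le> (LINT w|lborel. B * \<bar>laguerre_fun k r (w :: complex^'n)\<bar>)"
  proof (rule Bochner_Integration.integral_mono[OF _ i])
    show le: "norm (h (z - w) * of_real (laguerre_fun k r w) * cis (r / 2 * sympl_form z w)) \<le> B * \<bar>laguerre_fun k r w\<bar>" for w
      using B[of "z - w"] by (auto simp: norm_mult intro!: mult_right_mono)
    show "integrable lborel (\<lambda>w. norm (h (z - w) * of_real (laguerre_fun k r w) * cis (r / 2 * sympl_form z w)))"
    proof (rule Bochner_Integration.integrable_bound[OF i])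
      show "AE w in lborel. norm (norm (h (z - w) * of_real (laguerre_fun k r w) * cis (r / 2 * sympl_form z w))) \<le> norm (B * \<bar>laguerre_fun k r w\<bar>)"
        using order_trans[OF le abs_ge_self] by (intro AE_I2) simp
    qed measurable
  qed
  finally show ?thesis by simp
qed

lemma borel_measurable_twisted_proj [measurable]:
  assumes [measurable]: "h \<in> borel_measurable borel"
  shows "twisted_proj k r h \<in> borel_measurable borel"
  unfolding twisted_proj_def[abs_def] sympl_form_def[symmetric] by measurable

text \<open>A resolvent is an average of twisted translations, each of which commutes with the
  projection. The factor exp(-s) and the integrable Laguerre function allow the projection to pass
  under the integral.\<close>

lemma
  fixes h h' :: "complex^'n::finite \<Rightarrow> complex"
  assumes r: "r > 0" and [measurable]: "h' \<in> borel_measurable borel" and B: "\<And>y. norm (h' y) \<le> B"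
    and h: "\<And>y. has_bochner_integral lborel (\<lambda>s. indicator {0<..} s *\<^sub>R (exp (- s) *\<^sub>R
       (cis (r / 2 * sympl_form y (s *\<^sub>R b)) * h' (y + s *\<^sub>R b)))) (h y)"
  shows twisted_proj_resolvent: "has_bochner_integral lborel (\<lambda>s. indicator {0<..} s *\<^sub>R (exp (- s) *\<^sub>R
       (cis (r / 2 * sympl_form z (s *\<^sub>R b)) * twisted_proj k r h' (z + s *\<^sub>R b)))) (twisted_proj k r h z)"
proof -
  let ?G = "\<lambda>s y. indicator {0<..} s *\<^sub>R (exp (- s) *\<^sub>R (cis (r / 2 * sympl_form y (s *\<^sub>R b)) * h' (y + s *\<^sub>R b)))"
  let ?\<Phi> = "\<lambda>s w. ?G s (z - w) * of_real (laguerre_fun k r w) * cis (r / 2 * sympl_form z w)"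
  have "integrable lborel (\<lambda>s. indicator {0<..} s * exp (- s) * B)"
    by (rule integrable_mult_left[OF integrable_exp_half_line])
  from lborel_pair.integrable_product_mult[OF this integrable_norm[OF integrable_laguerre_fun[OF r, of k, where 'n='n]]]
  have i: "integrable (lborel \<Otimes>\<^sub>M lborel) (\<lambda>(s, w). ?\<Phi> s w)"
  proof (rule Bochner_Integration.integrable_bound)
    show "AE x in lborel \<Otimes>\<^sub>M lborel. norm (case x of (s, w) \<Rightarrow> ?\<Phi> s w) \<le>
       norm (case x of (s, w) \<Rightarrow> indicator {0<..} s * exp (- s) * B * norm (complex_of_real (laguerre_fun k r w)))"
    proof (rule AE_I2, safe)
      fix s :: real and w :: "complex^'n"
      have "norm (h' (z - w + s *\<^sub>R b)) \<le> B" by (rule B)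
      then have "indicator {0<..} s * exp (- s) * norm (h' (z - w + s *\<^sub>R b)) * \<bar>laguerre_fun k r w\<bar> \<le>
          indicator {0<..} s * exp (- s) * B * \<bar>laguerre_fun k r w\<bar>"
        by (intro mult_right_mono mult_left_mono) auto
      also have "\<dots> \<le> \<bar>\<dots>\<bar>" by (rule abs_ge_self)
      finally show "norm (?\<Phi> s w) \<le> norm (indicator {0<..} s * exp (- s) * B * norm (complex_of_real (laguerre_fun k r w)))"
        by (simp add: norm_mult abs_mult mult.assoc)
    qed
  qed measurable
  have inner_s: "(LINT s|lborel. ?\<Phi> s w) = h (z - w) * of_real (laguerre_fun k r w) * cis (r / 2 * sympl_form z w)" for w
    by (simp only: integral_mult_left_zero has_bochner_integral_integral_eq[OF h])
  have inner_w: "(LINT w|lborel. ?\<Phi> s w) = indicator {0<..} s *\<^sub>R (exp (- s) *\<^sub>R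
       (cis (r / 2 * sympl_form z (s *\<^sub>R b)) * twisted_proj k r h' (z + s *\<^sub>R b)))" for s
  proof -
    have "?\<Phi> s w = indicator {0<..} s *\<^sub>R (exp (- s) *\<^sub>R ((cis (r / 2 * sympl_form (z - w) (s *\<^sub>R b)) * h' (z - w + s *\<^sub>R b)) *
        of_real (laguerre_fun k r w) * cis (r / 2 * sympl_form z w)))" for w
      by simp
    then have "(LINT w|lborel. ?\<Phi> s w) = indicator {0<..} s *\<^sub>R (exp (- s) *\<^sub>R
        twisted_proj k r (\<lambda>y. cis (r / 2 * sympl_form y (s *\<^sub>R b)) * h' (y + s *\<^sub>R b)) z)"
      by (simp only: twisted_proj_def sympl_form_def[symmetric] integral_scaleR_right)
    then show ?thesis by (simp only: twisted_proj_translate)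
  qed
  have "integrable lborel (\<lambda>s. LINT w|lborel. ?\<Phi> s w)"
    using lborel_pair.integrable_fst[OF i] by simp
  moreover have "(LINT s|lborel. LINT w|lborel. ?\<Phi> s w) = (LINT w|lborel. LINT s|lborel. ?\<Phi> s w)"
    using lborel_pair.Fubini_integral[OF i] by simp
  ultimately show ?thesis
    unfolding inner_w inner_s twisted_proj_def[of k r h, unfolded sympl_form_def[symmetric]] by (simp add: has_bochner_integral_iff)
qed

text \<open>The resolvent commutes with any combination of the projections, and its phases have
  modulus 1. A point value is thus traded for a square integral along the line through
  \<open>z\<close> in direction \<open>b\<close>, with constant 1 whatever the coefficients.\<close>

lemma twisted_proj_sum_square_le:
  fixes h h' :: "complex^'n::finite \<Rightarrow> complex"
  assumes r: "r > 0" and h' [measurable]: "h' \<in> borel_measurable borel" and B: "\<And>y. norm (h' y) \<le> B"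
    and h: "\<And>y. has_bochner_integral lborel (\<lambda>s. indicator {0<..} s *\<^sub>R (exp (- s) *\<^sub>R
       (cis (r / 2 * sympl_form y (s *\<^sub>R b)) * h' (y + s *\<^sub>R b)))) (h y)"
  shows "ennreal ((norm (\<Sum>k<K. c k * twisted_proj k r h z))\<^sup>2) \<le>
     (\<integral>\<^sup>+s. ennreal ((norm (\<Sum>k<K. c k * twisted_proj k r h' (z + s *\<^sub>R b)))\<^sup>2) \<partial>lborel)"
proof (rule exp_average_square_le)
  let ?a = "\<lambda>z. \<Sum>k<K. c k * twisted_proj k r h' z"
  define M where "M = (\<Sum>k<K. norm (c k) * (B * (LINT w|lborel. \<bar>laguerre_fun k r (w :: complex^'n)\<bar>)))"
  show "norm (?a (z + s *\<^sub>R b)) \<le> M" for s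
    unfolding M_def by (rule order_trans[OF norm_sum sum_mono])
      (auto simp: norm_mult intro!: mult_left_mono norm_twisted_proj_le[OF r h' B])
  note res = twisted_proj_resolvent[OF r h' B h, of z]
  have "has_bochner_integral lborel (\<lambda>s. \<Sum>k<K. c k * (indicator {0<..} s *\<^sub>R (exp (- s) *\<^sub>R
       (cis (r / 2 * sympl_form z (s *\<^sub>R b)) * twisted_proj k r h' (z + s *\<^sub>R b))))) (\<Sum>k<K. c k * twisted_proj k r h z)"
    by (intro has_bochner_integral_sum has_bochner_integral_mult_right res)
  from has_bochner_integral_integral_eq[OF this]
  have "norm (\<Sum>k<K. c k * twisted_proj k r h z) = norm (LINT s|lborel. (\<Sum>k<K. c k * (indicator {0<..} s *\<^sub>R (exp (- s) *\<^sub>R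
       (cis (r / 2 * sympl_form z (s *\<^sub>R b)) * twisted_proj k r h' (z + s *\<^sub>R b))))))"
    by (simp only:)
  also have "\<dots> \<le> (LINT s|lborel. norm (\<Sum>k<K. c k * (indicator {0<..} s *\<^sub>R (exp (- s) *\<^sub>R
       (cis (r / 2 * sympl_form z (s *\<^sub>R b)) * twisted_proj k r h' (z + s *\<^sub>R b))))))"
    by (rule integral_norm_bound)
  also have "(\<lambda>s. norm (\<Sum>k<K. c k * (indicator {0<..} s *\<^sub>R (exp (- s) *\<^sub>R
       (cis (r / 2 * sympl_form z (s *\<^sub>R b)) * twisted_proj k r h' (z + s *\<^sub>R b)))))) = (\<lambda>s. indicator {0<..} s * exp (- s) * norm (?a (z + s *\<^sub>R b)))"
  proof
    fix s :: real
    have "(\<Sum>k<K. c k * (indicator {0<..} s *\<^sub>R (exp (- s) *\<^sub>R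
       (cis (r / 2 * sympl_form z (s *\<^sub>R b)) * twisted_proj k r h' (z + s *\<^sub>R b))))) =
       (indicator {0<..} s * exp (- s)) *\<^sub>R (cis (r / 2 * sympl_form z (s *\<^sub>R b)) * ?a (z + s *\<^sub>R b))"
      unfolding sum_distrib_left scaleR_sum_right by (intro sum.cong refl) (simp add: mult_ac)
    then show "norm (\<Sum>k<K. c k * (indicator {0<..} s *\<^sub>R (exp (- s) *\<^sub>R
       (cis (r / 2 * sympl_form z (s *\<^sub>R b)) * twisted_proj k r h' (z + s *\<^sub>R b))))) = indicator {0<..} s * exp (- s) * norm (?a (z + s *\<^sub>R b))"
      by (simp add: norm_mult abs_mult)
  qed
  finally show "norm (\<Sum>k<K. c k * twisted_proj k r h z) \<le> (LINT s|lborel. indicator {0<..} s * exp (- s) * norm (?a (z + s *\<^sub>R b)))" .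
qed auto

section \<open>Symplectic coordinates on the complement of the centre\<close>

lemma sum_UNIV_Plus: "(\<Sum>s\<in>UNIV. f s) = (\<Sum>i\<in>UNIV. f (Inl i)) + (\<Sum>i\<in>UNIV. f (Inr i))"
  for f :: "'a::finite + 'b::finite \<Rightarrow> 'c::comm_monoid_add"
  by (simp add: sum.Plus UNIV_Plus_UNIV[symmetric] del: UNIV_Plus_UNIV)

lemma to_cvec_of_cvec [simp]: "to_cvec (of_cvec z) = z"
  by (simp add: to_cvec_def of_cvec_def vec_eq_iff)

lemma of_cvec_to_cvec [simp]: "of_cvec (to_cvec y) = y"
  by (auto simp: to_cvec_def of_cvec_def vec_eq_iff split: sum.split)

lemma linear_to_cvec: "linear to_cvec"
  by (rule linearI) (auto simp: to_cvec_def vec_eq_iff complex_eq_iff)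

lemma bij_to_cvec: "bij to_cvec"
  by (rule o_bij[of of_cvec]) (auto simp: fun_eq_iff)

text \<open>The sign is a clash of conventions: Im(z conj(w)) is Im z Re w - Re z Im w, the negative
  of the form given by J. It cancels later against the sign of the phase under the Fourier
  transform.\<close>

lemma sympl_form_to_cvec: "sympl_form (to_cvec y) (to_cvec y') = - (y \<bullet> (Jmat *v y'))"
proof -
  have "y \<bullet> (Jmat *v y') = (\<Sum>i\<in>UNIV. y $ Inl i * y' $ Inr i) - (\<Sum>i\<in>UNIV. y $ Inr i * y' $ Inl i)"
    by (simp add: inner_vec_def matrix_vector_mult_def sum_UNIV_Plus Jmat_def if_distrib[of "\<lambda>x. x * _"] sum_negf cong: if_cong)
  then show ?thesis
    by (simp add: sympl_form_def to_cvec_def Im_sum sum_subtractf mult.commute)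
qed

locale metivier_frames =
  fixes br :: "'v::euclidean_space \<times> 'z::euclidean_space \<Rightarrow> 'v \<times> 'z \<Rightarrow> 'v \<times> 'z"
    and A :: "'z \<Rightarrow> 'v \<Rightarrow> real^('n::finite + 'n)"
  assumes bil: "bilinear br" and alt: "br X X = 0" and frames: "symplectic_frames br A"
begin

definition bk :: "'v \<Rightarrow> 'v \<Rightarrow> 'z" where "bk U V = snd (br (U, 0) (V, 0))"

definition L :: "'z \<Rightarrow> 'v \<Rightarrow> complex^'n" where "L \<omega> = to_cvec \<circ> A \<omega>"

text \<open>One minus the left-invariant vector field in direction \<open>e\<close>, the field of
  the sub-Laplacian with its central part (1/2)[V, e]. It is written as a constant plus a linear map
  of the point, the shape required by \<open>fourier_z_resolvent\<close>.\<close>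

definition D :: "'v \<Rightarrow> ('v \<times> 'z \<Rightarrow> complex) \<Rightarrow> 'v \<times> 'z \<Rightarrow> complex" where
  "D e f = (\<lambda>x. f x - frechet_derivative f (at x) ((e, 0) + (0, (1/2) *\<^sub>R bk (fst x) e)))"

lemma bk_self [simp]: "bk U U = 0"
  by (simp add: bk_def alt)

lemma linear_bk: "linear (\<lambda>U. bk U V)"
proof (rule linearI)
  show "bk (U + U') V = bk U V + bk U' V" for U U'
    using bilinear_ladd[OF bil, of "(U, 0)" "(U', 0)" "(V, 0)"] by (simp add: bk_def)
  show "bk (c *\<^sub>R U) V = c *\<^sub>R bk U V" for c U
    using bilinear_lmul[OF bil, of c "(U, 0)" "(V, 0)"] by (simp add: bk_def)
qed

lemma linear_field: "linear (\<lambda>x :: 'v \<times> 'z. (0 :: 'v, (1/2) *\<^sub>R bk (fst x) e))"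
  by (rule linearI) (simp_all add: linear_add[OF linear_bk] linear_cmul[OF linear_bk] scaleR_add_right)

lemma schwartz_D: "schwartz f \<Longrightarrow> schwartz (D e f)"
  unfolding D_def by (rule schwartz_affine_field[OF _ linear_field])

lemma linear_A: "\<omega> \<in> sphere 0 1 \<Longrightarrow> linear (A \<omega>)"
  and bij_A: "\<omega> \<in> sphere 0 1 \<Longrightarrow> bij (A \<omega>)"
  using frames by (auto simp: symplectic_frames_def)

lemma linear_L: "\<omega> \<in> sphere 0 1 \<Longrightarrow> linear (L \<omega>)"
  unfolding L_def by (intro linear_compose linear_A linear_to_cvec)

lemma bij_L: "\<omega> \<in> sphere 0 1 \<Longrightarrow> bij (L \<omega>)"
  unfolding L_def by (intro bij_comp bij_A bij_to_cvec)

lemma L_inv [simp]: "\<omega> \<in> sphere 0 1 \<Longrightarrow> L \<omega> (inv (L \<omega>) z) = z"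
  and inv_L [simp]: "\<omega> \<in> sphere 0 1 \<Longrightarrow> inv (L \<omega>) (L \<omega> V) = V"
  using bij_L[of \<omega>] by (auto simp: bij_is_surj bij_is_inj surj_f_inv_f inv_f_f)

lemma sympl_form_L: "\<omega> \<in> sphere 0 1 \<Longrightarrow> sympl_form (L \<omega> U) (L \<omega> V) = - (\<omega> \<bullet> bk U V)"
  using frames by (simp add: symplectic_frames_def L_def sympl_form_to_cvec Bform_def[symmetric] bk_def)

lemma spec_proj_eq:
  assumes \<omega>: "\<omega> \<in> sphere 0 1"
  shows "spec_proj A k r \<omega> g V = twisted_proj k r (\<lambda>z. g (inv (L \<omega>) z)) (L \<omega> V)"
proof -
  have "inv (A \<omega>) (of_cvec z) = inv (L \<omega>) z" for z
  proof -
    have "L \<omega> (inv (A \<omega>) (of_cvec z)) = z"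
      using bij_A[OF \<omega>] by (simp add: L_def bij_is_surj surj_f_inv_f)
    then show ?thesis using inv_L[OF \<omega>] by metis
  qed
  then show ?thesis by (simp add: spec_proj_def L_def)
qed

lemma measurable_L: "\<omega> \<in> sphere 0 1 \<Longrightarrow> L \<omega> \<in> borel_measurable borel"
  and measurable_inv_L: "\<omega> \<in> sphere 0 1 \<Longrightarrow> inv (L \<omega>) \<in> borel_measurable borel"
  and continuous_inv_L: "\<omega> \<in> sphere 0 1 \<Longrightarrow> continuous_on UNIV (inv (L \<omega>))"
  using linear_L[of \<omega>] linear_inv[OF linear_L bij_L, of \<omega>]
  by (auto intro!: borel_measurable_continuous_onI linear_continuous_on simp: linear_conv_bounded_linear)

text \<open>The bracket of \<open>e\<close> with itself vanishes, so the field is constant along its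
  trajectories. In frame coordinates its phase is that of the twisted translation by multiples of
  \<open>L \<omega> e\<close>, and the frame leaves no constant behind.\<close>

lemma spec_proj_sum_square_step:
  assumes f: "schwartz f" and \<omega>: "\<omega> \<in> sphere 0 1" and r: "r > 0"
  shows "ennreal ((norm (\<Sum>k<K. c k * spec_proj A k r \<omega> (fourier_z f (r *\<^sub>R \<omega>)) V))\<^sup>2) \<le>
    (\<integral>\<^sup>+s. ennreal ((norm (\<Sum>k<K. c k * spec_proj A k r \<omega> (fourier_z (D e f) (r *\<^sub>R \<omega>)) (V + s *\<^sub>R e)))\<^sup>2) \<partial>lborel)"
proof -
  let ?\<eta> = "r *\<^sub>R \<omega>" and ?i = "inv (L \<omega>)"
  note [measurable] = measurable_inv_L[OF \<omega>]
  have sD: "schwartz (D e f)" by (rule schwartz_D[OF f])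
  obtain C where C: "C \<ge> 0" "\<And>\<eta> V. (1 + norm V) ^ 0 * norm (fourier_z (D e f) \<eta> V) \<le> C * cauchy_weight V"
    by (rule fourier_z_decay[OF sD, where N=0]) blast
  have B: "norm (fourier_z (D e f) ?\<eta> (?i y)) \<le> C" for y
    using C(2)[of "?i y" ?\<eta>] mult_left_mono[OF cauchy_weight_le_1[of "?i y"] C(1)] by simp
  have m: "(\<lambda>z. fourier_z (D e f) ?\<eta> (?i z)) \<in> borel_measurable borel"
    by (intro borel_measurable_fourier_z[OF sD]) measurable
  have LV: "L \<omega> V + s *\<^sub>R L \<omega> e = L \<omega> (V + s *\<^sub>R e)" for V s
    using linear_L[OF \<omega>] by (simp add: linear_add linear_cmul)
  have res: "has_bochner_integral lborel (\<lambda>s. indicator {0<..} s *\<^sub>R (exp (- s) *\<^sub>R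
       (cis (r / 2 * sympl_form y (s *\<^sub>R L \<omega> e)) * fourier_z (D e f) ?\<eta> (?i (y + s *\<^sub>R L \<omega> e))))) (fourier_z f ?\<eta> (?i y))" for y
  proof -
    obtain Y where y: "y = L \<omega> Y" using L_inv[OF \<omega>] by metis
    have "has_bochner_integral lborel (\<lambda>s. indicator {0<..} s *\<^sub>R (exp (- s) *\<^sub>R
      (cis (- (s * (?\<eta> \<bullet> ((1/2) *\<^sub>R bk Y e)))) * fourier_z (D e f) ?\<eta> (Y + s *\<^sub>R e)))) (fourier_z f ?\<eta> Y)"
      unfolding D_def
      by (rule fourier_z_resolvent[OF f linear_field])
         (simp_all add: linear_add[OF linear_bk] linear_cmul[OF linear_bk])
    \<comment> \<open>The minus sign of \<open>sympl_form_L\<close> meets the minus sign of the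
      Fourier phase, and the factor 1/2 of the left-invariant field gives r/2.\<close>
    moreover have "- (s * (?\<eta> \<bullet> ((1/2) *\<^sub>R bk Y e))) = r / 2 * sympl_form y (s *\<^sub>R L \<omega> e)" for s
      by (simp add: y sympl_form_simps sympl_form_L[OF \<omega>])
    ultimately show ?thesis by (simp only: y LV inv_L[OF \<omega>])
  qed
  show ?thesis
    using twisted_proj_sum_square_le[OF r m B res, where c=c and K=K and z="L \<omega> V"]
    by (simp add: spec_proj_eq[OF \<omega>] LV)
qed

lemma borel_measurable_spec_proj_sum:
  assumes f: "schwartz f" and \<omega>: "\<omega> \<in> sphere 0 1"
  shows "(\<lambda>V. \<Sum>k<K. c k * spec_proj A k r \<omega> (fourier_z f \<eta>) V) \<in> borel_measurable borel"
proof -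
  note [measurable] = measurable_inv_L[OF \<omega>] measurable_L[OF \<omega>] borel_measurable_fourier_z[OF f]
  show ?thesis unfolding spec_proj_eq[OF \<omega>] by measurable
qed

text \<open>The directions are used up one at a time; after all of them the translations fill out \<open>\<vv>\<close>.\<close>

lemma spec_proj_sum_square_le:
  assumes "schwartz f"
  obtains g where "schwartz g" "\<And>\<omega> r c K V. \<omega> \<in> sphere 0 1 \<Longrightarrow> r > 0 \<Longrightarrow>
     ennreal ((norm (\<Sum>k<K. c k * spec_proj A k r \<omega> (fourier_z f (r *\<^sub>R \<omega>)) V))\<^sup>2) \<le>
     (\<integral>\<^sup>+Y. ennreal ((norm (\<Sum>k<K. c k * spec_proj A k r \<omega> (fourier_z g (r *\<^sub>R \<omega>)) Y))\<^sup>2) \<partial>lborel)"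
proof -
  interpret P: product_sigma_finite "\<lambda>_::'v. lborel :: real measure" ..
  define N where "N = (\<lambda>g r \<omega> c K V. ennreal ((norm (\<Sum>k<(K::nat). c k * spec_proj A k r \<omega> (fourier_z g (r *\<^sub>R \<omega>)) V))\<^sup>2))"
  have Nm: "N g r \<omega> c K \<in> borel_measurable borel" if "schwartz g" "\<omega> \<in> sphere 0 1" for g r \<omega> c K
    using borel_measurable_spec_proj_sum[OF that] unfolding N_def by measurable
  \<comment> \<open>The order of quantifiers matters: \<open>g\<close> arises from \<open>f\<close>
    by applying \<open>D\<close> in the directions of \<open>B\<close>, before \<omega>, r and the
    coefficients are given, so it knows nothing of the frame.\<close>
  have "\<exists>g. schwartz g \<and> (\<forall>\<omega>\<in>sphere 0 1. \<forall>r>0. \<forall>c K V.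
     N f r \<omega> c K V \<le> (\<integral>\<^sup>+x. N g r \<omega> c K (V + (\<Sum>b\<in>B. x b *\<^sub>R b)) \<partial>(\<Pi>\<^sub>M b\<in>B. lborel)))" if "finite B" for B :: "'v set"
    using that
  proof (induction B rule: finite_induct)
    case empty
    then show ?case using assms by (intro exI[of _ f]) (simp add: PiM_empty nn_integral_count_space_finite)
  next
    case (insert e B)
    then obtain g where g: "schwartz g" and le: "\<And>\<omega> r c K V. \<omega> \<in> sphere 0 1 \<Longrightarrow> r > 0 \<Longrightarrow>
       N f r \<omega> c K V \<le> (\<integral>\<^sup>+x. N g r \<omega> c K (V + (\<Sum>b\<in>B. x b *\<^sub>R b)) \<partial>(\<Pi>\<^sub>M b\<in>B. lborel))"
      by blast
    have "N f r \<omega> c K V \<le> (\<integral>\<^sup>+x. N (D e g) r \<omega> c K (V + (\<Sum>b\<in>insert e B. x b *\<^sub>R b)) \<partial>(\<Pi>\<^sub>M b\<in>insert e B. lborel))"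
      if \<omega>: "\<omega> \<in> sphere 0 1" and r: "r > 0" for \<omega> r c K V
    proof -
      note [measurable] = Nm[OF schwartz_D[OF g] \<omega>]
      have "N f r \<omega> c K V \<le> (\<integral>\<^sup>+x. N g r \<omega> c K (V + (\<Sum>b\<in>B. x b *\<^sub>R b)) \<partial>(\<Pi>\<^sub>M b\<in>B. lborel))"
        by (rule le[OF \<omega> r])
      also have "\<dots> \<le> (\<integral>\<^sup>+x. \<integral>\<^sup>+y. N (D e g) r \<omega> c K (V + (\<Sum>b\<in>B. x b *\<^sub>R b) + y *\<^sub>R e) \<partial>lborel \<partial>(\<Pi>\<^sub>M b\<in>B. lborel))"
        by (rule nn_integral_mono) (simp add: N_def spec_proj_sum_square_step[OF g \<omega> r])
      also have "\<dots> = (\<integral>\<^sup>+x. \<integral>\<^sup>+y. N (D e g) r \<omega> c K (V + (\<Sum>b\<in>insert e B. (x(e := y)) b *\<^sub>R b)) \<partial>lborel \<partial>(\<Pi>\<^sub>M b\<in>B. lborel))"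
      proof -
        have "(\<Sum>b\<in>insert e B. (x(e := y)) b *\<^sub>R b) = (\<Sum>b\<in>B. x b *\<^sub>R b) + y *\<^sub>R e" for x y
        proof -
          have "(\<Sum>b\<in>B. (x(e := y)) b *\<^sub>R b) = (\<Sum>b\<in>B. x b *\<^sub>R b)" using insert(2) by (intro sum.cong) auto
          then show ?thesis using insert(1,2) by simp
        qed
        then show ?thesis by (simp only: add.assoc)
      qed
      also have "\<dots> = (\<integral>\<^sup>+x. N (D e g) r \<omega> c K (V + (\<Sum>b\<in>insert e B. x b *\<^sub>R b)) \<partial>(\<Pi>\<^sub>M b\<in>insert e B. lborel))"
        by (rule P.product_nn_integral_insert[symmetric, OF insert(1,2)]) measurable
      finally show ?thesis .
    qed
    then show ?case using schwartz_D[OF g] by blast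
  qed
  from this[OF finite_Basis] obtain g where g: "schwartz g" and le: "\<And>\<omega> r c K V. \<omega> \<in> sphere 0 1 \<Longrightarrow> r > 0 \<Longrightarrow>
       N f r \<omega> c K V \<le> (\<integral>\<^sup>+x. N g r \<omega> c K (V + (\<Sum>b\<in>Basis. x b *\<^sub>R b)) \<partial>(\<Pi>\<^sub>M b\<in>Basis. lborel))"
    by blast
  have "N f r \<omega> c K V \<le> (\<integral>\<^sup>+Y. N g r \<omega> c K Y \<partial>lborel)" if \<omega>: "\<omega> \<in> sphere 0 1" and r: "r > 0" for \<omega> r c K V
  proof -
    note [measurable] = Nm[OF g \<omega>]
    have "(\<integral>\<^sup>+x. N g r \<omega> c K (V + (\<Sum>b\<in>Basis. x b *\<^sub>R b)) \<partial>(\<Pi>\<^sub>M b\<in>Basis. lborel)) = (\<integral>\<^sup>+Y. N g r \<omega> c K (V + Y) \<partial>lborel)"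
      by (subst lborel_eq) (simp add: nn_integral_distr)
    also have "\<dots> = (\<integral>\<^sup>+Y. N g r \<omega> c K Y \<partial>lborel)"
      by (rule nn_integral_lborel_translate) measurable
    finally show ?thesis using le[OF \<omega> r, of c K V] by simp
  qed
  with g show ?thesis using that[of g] unfolding N_def by blast
qed

lemma bounded_integrable_frame:
  assumes g: "bounded_integrable g" and \<omega>: "\<omega> \<in> sphere 0 1"
  shows "bounded_integrable (\<lambda>z. g (inv (L \<omega>) z))"
proof -
  obtain B where gB: "\<And>x. norm (g x) \<le> B" "g \<in> borel_measurable borel" "integrable lborel g"
    by (rule bounded_integrableE[OF g]) blast
  note [measurable] = gB(2) measurable_inv_L[OF \<omega>]
  obtain c where c: "c > 0" "\<And>f. f \<in> borel_measurable borel \<Longrightarrow>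
     (\<integral>\<^sup>+y. f y \<partial>lborel) = ennreal c * (\<integral>\<^sup>+x. f (L \<omega> x) \<partial>lborel)"
    by (rule lborel_linear_image[OF linear_L[OF \<omega>] bij_L[OF \<omega>]]) blast
  have "(\<integral>\<^sup>+z. ennreal (norm (g (inv (L \<omega>) z))) \<partial>lborel) = ennreal c * (\<integral>\<^sup>+x. ennreal (norm (g x)) \<partial>lborel)"
    using c(2)[of "\<lambda>z. ennreal (norm (g (inv (L \<omega>) z)))"] \<omega> by simp
  also have "\<dots> < \<infinity>" using gB(3) by (simp add: integrable_iff_bounded ennreal_mult_less_top)
  finally have "integrable lborel (\<lambda>z. g (inv (L \<omega>) z))" by (simp add: integrable_iff_bounded)
  then show ?thesis using gB(1) unfolding bounded_integrable_def by blast
qed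

lemma schwartz_fourier_z_bounded_integrable:
  "schwartz f \<Longrightarrow> bounded_integrable (fourier_z f \<eta>)" for f :: "'v \<times> 'z \<Rightarrow> complex"
  using schwartz_bounded_integrable[OF schwartz_fourier_z[of f \<eta>]] by (simp add: bounded_integrable_def)

lemma spec_proj_eq_lag_proj:
  assumes g: "bounded_integrable g" and \<omega>: "\<omega> \<in> sphere 0 1"
  shows "of_real ((r / (2 * pi)) ^ CARD('n)) * spec_proj A k r \<omega> g V = lag_proj r k (\<lambda>z. g (inv (L \<omega>) z)) (L \<omega> V)"
proof -
  obtain B where [measurable]: "g \<in> borel_measurable borel"
    by (rule bounded_integrableE[OF g]) blast
  note [measurable] = measurable_inv_L[OF \<omega>]
  show ?thesis unfolding spec_proj_eq[OF \<omega>] by (rule twisted_proj_eq_lag_proj) measurable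
qed

text \<open>The Jacobian of \<open>A\<^sub>\<omega>\<close> enters on both sides and cancels, so the bound does not depend on the frame.\<close>

lemma nn_integral_spec_proj_sum_le:
  assumes g: "bounded_integrable g" and \<omega>: "\<omega> \<in> sphere 0 1" and r: "r > 0" and a: "\<And>k. norm (a k) \<le> 1"
  shows "(\<integral>\<^sup>+Y. ennreal ((norm (\<Sum>k<K. a k * (of_real ((r / (2 * pi)) ^ CARD('n)) * spec_proj A k r \<omega> g Y)))\<^sup>2) \<partial>lborel)
    \<le> (\<integral>\<^sup>+Y. ennreal ((norm (g Y))\<^sup>2) \<partial>lborel)"
proof -
  let ?h = "\<lambda>z. g (inv (L \<omega>) z)"
  note h = bounded_integrable_frame[OF g \<omega>]
  obtain B where [measurable]: "?h \<in> borel_measurable borel"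
    by (rule bounded_integrableE[OF h]) blast
  obtain c where c: "c > 0" "\<And>f. f \<in> borel_measurable borel \<Longrightarrow>
     (\<integral>\<^sup>+y. f y \<partial>lborel) = ennreal c * (\<integral>\<^sup>+x. f (L \<omega> x) \<partial>lborel)"
    by (rule lborel_linear_image[OF linear_L[OF \<omega>] bij_L[OF \<omega>]]) blast
  let ?S = "\<lambda>z. \<Sum>k<K. a k * lag_proj r k ?h z"
  have "ennreal c * (\<integral>\<^sup>+Y. ennreal ((norm (?S (L \<omega> Y)))\<^sup>2) \<partial>lborel) = (\<integral>\<^sup>+z. ennreal ((norm (?S z))\<^sup>2) \<partial>lborel)"
    by (rule c(2)[symmetric]) measurable
  also have "\<dots> = ennreal (LINT z|lborel. (norm (?S z))\<^sup>2)"
    by (rule nn_integral_eq_integral[OF integrable_lag_proj_sum[OF r h a]]) auto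
  also have "\<dots> \<le> ennreal (LINT z|lborel. (norm (?h z))\<^sup>2)"
    by (rule ennreal_leI[OF lag_proj_bessel[OF r h a]])
  also have "\<dots> = (\<integral>\<^sup>+z. ennreal ((norm (?h z))\<^sup>2) \<partial>lborel)"
  proof (rule nn_integral_eq_integral[symmetric])
    show "integrable lborel (\<lambda>z. (norm (?h z))\<^sup>2)"
      using bounded_integrable_mult_cnj[OF h h]
      by (simp only: complex_norm_square[symmetric] complex_of_real_integrable_eq)
  qed auto
  also have "\<dots> = ennreal c * (\<integral>\<^sup>+Y. ennreal ((norm (g Y))\<^sup>2) \<partial>lborel)"
    using c(2)[of "\<lambda>z. ennreal ((norm (?h z))\<^sup>2)"] \<omega> by simp
  finally have "ennreal c * (\<integral>\<^sup>+Y. ennreal ((norm (?S (L \<omega> Y)))\<^sup>2) \<partial>lborel) \<le> ennreal c * (\<integral>\<^sup>+Y. ennreal ((norm (g Y))\<^sup>2) \<partial>lborel)" .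
  then show ?thesis
    using c(1) unfolding spec_proj_eq_lag_proj[OF g \<omega>] by (subst (asm) ennreal_mult_le_mult_iff) auto
qed

text \<open>The estimate on which all convergence rests. The L^2 norm over the complement is bounded
  by Bessel's inequality uniformly in the frame, while the decay in \<eta> comes from the Fourier
  transform of the auxiliary function \<open>g\<close>.\<close>

lemma spec_proj_sum_bound:
  assumes f: "schwartz f"
  obtains C where "C \<ge> 0" "\<And>\<omega> r K V. \<omega> \<in> sphere 0 1 \<Longrightarrow> r > 0 \<Longrightarrow>
     (\<Sum>k<K. (r / (2 * pi)) ^ CARD('n) * norm (spec_proj A k r \<omega> (fourier_z f (r *\<^sub>R \<omega>)) V)) \<le> C * cauchy_weight (r *\<^sub>R \<omega>)"
proof -
  obtain g where g: "schwartz g" and le: "\<And>\<omega> r c K V. \<omega> \<in> sphere 0 1 \<Longrightarrow> r > 0 \<Longrightarrow>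
     ennreal ((norm (\<Sum>k<K. c k * spec_proj A k r \<omega> (fourier_z f (r *\<^sub>R \<omega>)) V))\<^sup>2) \<le>
     (\<integral>\<^sup>+Y. ennreal ((norm (\<Sum>k<K. c k * spec_proj A k r \<omega> (fourier_z g (r *\<^sub>R \<omega>)) Y))\<^sup>2) \<partial>lborel)"
    by (rule spec_proj_sum_square_le[OF f]) blast
  obtain C where C: "C \<ge> 0" "\<And>\<eta> V. norm (fourier_z g \<eta> V) \<le> C * cauchy_weight \<eta> * cauchy_weight V"
    by (rule fourier_z_joint_decay[OF g]) blast
  let ?w = "LINT V|lborel. cauchy_weight (V :: 'v)"
  have w0: "?w \<ge> 0" by (intro Bochner_Integration.integral_nonneg less_imp_le[OF cauchy_weight_pos])
  have "(\<Sum>k<K. (r / (2 * pi)) ^ CARD('n) * norm (spec_proj A k r \<omega> (fourier_z f (r *\<^sub>R \<omega>)) V)) \<le> (C * sqrt ?w) * cauchy_weight (r *\<^sub>R \<omega>)"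
    if \<omega>: "\<omega> \<in> sphere 0 1" and r: "r > 0" for \<omega> r K V
  proof -
    let ?\<eta> = "r *\<^sub>R \<omega>" and ?p = "(r / (2 * pi)) ^ CARD('n)"
    define u where "u k = spec_proj A k r \<omega> (fourier_z f ?\<eta>) V" for k
    \<comment> \<open>Coefficients that rotate each term onto the nonnegative axis, so the modulus
      of the finite sum becomes the sum of moduli.\<close>
    define a where "a k = cnj (sgn (u k))" for k
    have a1: "norm (a k) \<le> 1" for k by (simp add: a_def norm_sgn)
    have au: "a k * u k = of_real (norm (u k))" for k
    proof (cases "u k = 0")
      case False
      have "cnj (u k) * u k = of_real ((norm (u k))\<^sup>2)" by (simp only: complex_norm_square mult.commute)
      then show ?thesis using False by (simp add: a_def sgn_div_norm scaleR_conv_of_real field_simps power2_eq_square)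
    qed (simp add: a_def)
    have "norm (\<Sum>k<K. (a k * of_real ?p) * u k) = (\<Sum>k<K. ?p * norm (u k))"
    proof -
      have "(a k * of_real ?p) * u k = of_real (?p * norm (u k))" for k
        using au[of k] by (simp add: mult_ac)
      then have "(\<Sum>k<K. (a k * of_real ?p) * u k) = of_real (\<Sum>k<K. ?p * norm (u k))" by (simp only: of_real_sum)
      moreover have "0 \<le> (\<Sum>k<K. ?p * norm (u k))" using r by (intro sum_nonneg mult_nonneg_nonneg) auto
      ultimately show ?thesis by (simp only: norm_of_real abs_of_nonneg)
    qed
    then have "ennreal ((\<Sum>k<K. ?p * norm (u k))\<^sup>2) \<le>
       (\<integral>\<^sup>+Y. ennreal ((norm (\<Sum>k<K. (a k * of_real ?p) * spec_proj A k r \<omega> (fourier_z g ?\<eta>) Y))\<^sup>2) \<partial>lborel)"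
      using le[OF \<omega> r, where c="\<lambda>k. a k * of_real ?p" and K=K and V=V] unfolding u_def[symmetric] by (simp only:)
    also have "\<dots> \<le> (\<integral>\<^sup>+Y. ennreal ((norm (fourier_z g ?\<eta> Y))\<^sup>2) \<partial>lborel)"
      using nn_integral_spec_proj_sum_le[OF schwartz_fourier_z_bounded_integrable[OF g] \<omega> r a1, where K=K]
      by (simp only: mult.assoc)
    also have "\<dots> \<le> (\<integral>\<^sup>+Y. ennreal ((C * cauchy_weight ?\<eta>)\<^sup>2 * cauchy_weight (Y :: 'v)) \<partial>lborel)"
    proof (intro nn_integral_mono ennreal_leI)
      fix Y
      have "(norm (fourier_z g ?\<eta> Y))\<^sup>2 \<le> (C * cauchy_weight ?\<eta> * cauchy_weight Y)\<^sup>2"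
        by (intro power_mono C) auto
      also have "\<dots> = (C * cauchy_weight ?\<eta>)\<^sup>2 * (cauchy_weight Y)\<^sup>2" by (simp add: power_mult_distrib)
      also have "\<dots> \<le> (C * cauchy_weight ?\<eta>)\<^sup>2 * cauchy_weight Y"
        using cauchy_weight_le_1[of Y] less_imp_le[OF cauchy_weight_pos[of Y]]
        by (intro mult_left_mono) (auto simp: power2_eq_square mult_left_le)
      finally show "(norm (fourier_z g ?\<eta> Y))\<^sup>2 \<le> (C * cauchy_weight ?\<eta>)\<^sup>2 * cauchy_weight Y" .
    qed
    also have "\<dots> = ennreal ((C * cauchy_weight ?\<eta>)\<^sup>2 * ?w)"
      by (subst nn_integral_eq_integral) (auto intro!: AE_I2 integrable_cauchy_weight mult_nonneg_nonneg less_imp_le[OF cauchy_weight_pos])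
    finally have "(\<Sum>k<K. ?p * norm (u k))\<^sup>2 \<le> (C * cauchy_weight ?\<eta>)\<^sup>2 * ?w"
      using w0 by (subst (asm) ennreal_le_iff) auto
    also have "\<dots> = ((C * sqrt ?w) * cauchy_weight ?\<eta>)\<^sup>2" using w0 by (simp add: power_mult_distrib)
    finally have "(\<Sum>k<K. ?p * norm (u k)) \<le> (C * sqrt ?w) * cauchy_weight ?\<eta>"
      using C(1) w0 by (elim power2_le_imp_le) (auto intro!: mult_nonneg_nonneg less_imp_le[OF cauchy_weight_pos])
    then show ?thesis by (simp only: u_def)
  qed
  moreover have "C * sqrt ?w \<ge> 0" using C(1) w0 by simp
  ultimately show ?thesis using that by blast
qed

text \<open>The uniform bound supplies the absolute convergence demanded by the Abel argument, and
  continuity of the transported function comes from the Schwartz property of the partial Fourier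
  transform.\<close>

lemma spec_proj_sums:
  assumes f: "schwartz f" and \<omega>: "\<omega> \<in> sphere 0 1" and r: "r > 0"
  shows "(\<lambda>k. of_real ((r / (2 * pi)) ^ CARD('n)) * spec_proj A k r \<omega> (fourier_z f (r *\<^sub>R \<omega>)) V) sums fourier_z f (r *\<^sub>R \<omega>) V"
proof -
  let ?g = "fourier_z f (r *\<^sub>R \<omega>)"
  let ?h = "\<lambda>z. ?g (inv (L \<omega>) z)"
  note g = schwartz_fourier_z_bounded_integrable[OF f, of "r *\<^sub>R \<omega>"]
  have "continuous_on UNIV ?h"
    by (rule continuous_on_compose2[OF schwartz_continuous[OF schwartz_fourier_z[OF f]] continuous_inv_L[OF \<omega>]]) auto
  then have c: "isCont ?h z" for z by (simp add: continuous_on_eq_continuous_at)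
  obtain C where "\<And>\<omega> r K V. \<omega> \<in> sphere 0 1 \<Longrightarrow> r > 0 \<Longrightarrow>
     (\<Sum>k<K. (r / (2 * pi)) ^ CARD('n) * norm (spec_proj A k r \<omega> (fourier_z f (r *\<^sub>R \<omega>)) V)) \<le> C * cauchy_weight (r *\<^sub>R \<omega>)"
    by (rule spec_proj_sum_bound[OF f]) blast
  note C = this[OF \<omega> r]
  have n: "norm (lag_proj r k ?h (L \<omega> V)) = (r / (2 * pi)) ^ CARD('n) * norm (spec_proj A k r \<omega> ?g V)" for k
    unfolding spec_proj_eq_lag_proj[OF g \<omega>, symmetric] using r by (simp add: norm_mult norm_power norm_divide)
  have "summable (\<lambda>k. norm (lag_proj r k ?h (L \<omega> V)))"
  proof (rule summableI_nonneg_bounded[where x="C * cauchy_weight (r *\<^sub>R \<omega>)"])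
    show "(\<Sum>k<K. norm (lag_proj r k ?h (L \<omega> V))) \<le> C * cauchy_weight (r *\<^sub>R \<omega>)" for K
      unfolding n by (rule C)
  qed (rule norm_ge_zero)
  from lag_proj_sums[OF r bounded_integrable_frame[OF g \<omega>] c this]
  show ?thesis unfolding spec_proj_eq_lag_proj[OF g \<omega>] using \<omega> by simp
qed

end

text \<open>Two conclusions with the same \<open>c\<close>: the real one computes \<open>c\<close>
  from a Gaussian, the complex one applies it to a projection.\<close>

lemma integral_lborel_linear_image:
  fixes L :: "'a::euclidean_space \<Rightarrow> 'b::euclidean_space"
  assumes lin: "linear L" and bij: "bij L"
  obtains c :: real where "c > 0"
    "\<And>f :: 'b \<Rightarrow> 'c::{banach, second_countable_topology}. f \<in> borel_measurable borel \<Longrightarrow> (LINT y|lborel. f y) = c *\<^sub>R (LINT x|lborel. f (L x))"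
    "\<And>f :: 'b \<Rightarrow> real. f \<in> borel_measurable borel \<Longrightarrow> (LINT y|lborel. f y) = c * (LINT x|lborel. f (L x))"
proof -
  have L [measurable]: "L \<in> borel_measurable borel"
    using lin by (intro borel_measurable_continuous_onI linear_continuous_on linear_conv_bounded_linear[THEN iffD1])
  obtain c where c: "c > 0" "\<And>f. f \<in> borel_measurable borel \<Longrightarrow>
     (\<integral>\<^sup>+y. f y \<partial>lborel) = ennreal c * (\<integral>\<^sup>+x. f (L x) \<partial>lborel)"
    by (rule lborel_linear_image[OF lin bij]) blast
  have eq: "lborel = density (distr lborel borel L) (\<lambda>_. ennreal c)"
  proof (rule measure_eqI)
    fix B :: "'b set" assume "B \<in> sets lborel"
    then have [measurable]: "B \<in> sets borel" by simp
    have "emeasure lborel B = (\<integral>\<^sup>+y. indicator B y \<partial>lborel)" by simp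
    also have "\<dots> = ennreal c * (\<integral>\<^sup>+x. indicator B (L x) \<partial>lborel)" by (rule c(2)) measurable
    also have "\<dots> = emeasure (density (distr lborel borel L) (\<lambda>_. ennreal c)) B"
    proof -
      have "(\<lambda>x. indicator B (L x) :: ennreal) = indicator (L -` B)" by (auto simp: indicator_def)
      moreover have "L -` B \<in> sets borel" using measurable_sets[OF L, of B] by simp
      ultimately show ?thesis by (simp add: emeasure_density nn_integral_cmult emeasure_distr)
    qed
    finally show "emeasure lborel B = emeasure (density (distr lborel borel L) (\<lambda>_. ennreal c)) B" .
  qed simp
  show ?thesis
  proof (rule that[OF c(1)])
    show "(LINT y|lborel. f y) = c *\<^sub>R (LINT x|lborel. f (L x))" if "f \<in> borel_measurable borel" for f :: "'b \<Rightarrow> 'c"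
      using that c(1) by (subst eq) (simp add: integral_density integral_distr)
    show "(LINT y|lborel. f y) = c * (LINT x|lborel. f (L x))" if "f \<in> borel_measurable borel" for f :: "'b \<Rightarrow> real"
      using that c(1) by (subst eq) (simp add: integral_density integral_distr)
  qed
qed

lemma continuous_on_to_cvec: "continuous_on UNIV to_cvec"
  using linear_to_cvec by (intro linear_continuous_on) (simp add: linear_conv_bounded_linear)

context metivier_frames
begin

text \<open>A jointly measurable version of \<open>L\<close>; the Jacobian is recovered from a Gaussian integral.\<close>

definition L' :: "'z \<Rightarrow> 'v \<Rightarrow> complex^'n" where
  "L' \<omega> V = (\<Sum>b\<in>Basis. (V \<bullet> b) *\<^sub>R to_cvec (A \<omega> b))"

lemma L'_eq: "\<omega> \<in> sphere 0 1 \<Longrightarrow> L' \<omega> V = L \<omega> V"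
proof -
  assume \<omega>: "\<omega> \<in> sphere 0 1"
  have "L \<omega> V = L \<omega> (\<Sum>b\<in>Basis. (V \<bullet> b) *\<^sub>R b)" by (simp add: euclidean_representation)
  also have "\<dots> = L' \<omega> V"
    by (simp add: L'_def linear_sum[OF linear_L[OF \<omega>]] linear_cmul[OF linear_L[OF \<omega>]]) (simp add: L_def)
  finally show ?thesis by simp
qed

lemma measurable_L' [measurable (raw)]:
  assumes o: "w \<in> M \<rightarrow>\<^sub>M sphere_measure" and [measurable]: "v \<in> borel_measurable M"
  shows "(\<lambda>x. L' (w x) (v x)) \<in> borel_measurable M"
proof -
  have "(\<lambda>\<omega>. A \<omega> b) \<in> borel_measurable sphere_measure" for b
    using frames unfolding symplectic_frames_def by (subst measurable_cong_sets[OF sets_sphere_measure refl]) auto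
  then have [measurable]: "(\<lambda>x. A (w x) b) \<in> borel_measurable M" for b
    using measurable_compose[OF o] by blast
  have [measurable]: "to_cvec \<in> borel_measurable borel"
    by (intro borel_measurable_continuous_onI continuous_on_to_cvec)
  show ?thesis unfolding L'_def by measurable
qed

text \<open>Pulling the integral back to the complement removes the inverse frame, as differences of
  frame values come from V - W. What remains is built from \<open>L'\<close> and a ratio of Gaussian
  integrals, so its dependence on \<omega> is measurable.\<close>

lemma spec_proj_frame_integral:
  assumes [measurable]: "g \<in> borel_measurable borel" and \<omega>: "\<omega> \<in> sphere 0 1"
  shows "spec_proj A k r \<omega> g V =
    ((LINT z|lborel. exp (- (norm (z :: complex^'n))\<^sup>2)) / (LINT W|lborel. exp (- (norm (L' \<omega> W))\<^sup>2))) *\<^sub>R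
    (LINT W|lborel. g (V - W) * of_real (laguerre_fun k r (L' \<omega> W)) * cis (r / 2 * sympl_form (L' \<omega> V) (L' \<omega> W)))"
proof -
  note [measurable] = measurable_inv_L[OF \<omega>]
  obtain c where c: "c > 0"
    "\<And>f :: complex^'n \<Rightarrow> complex. f \<in> borel_measurable borel \<Longrightarrow> (LINT y|lborel. f y) = c *\<^sub>R (LINT x|lborel. f (L \<omega> x))"
    "\<And>f :: complex^'n \<Rightarrow> real. f \<in> borel_measurable borel \<Longrightarrow> (LINT y|lborel. f y) = c * (LINT x|lborel. f (L \<omega> x))"
    by (rule integral_lborel_linear_image[OF linear_L[OF \<omega>] bij_L[OF \<omega>]]) blast
  let ?P = "LINT z|lborel. exp (- (norm (z :: complex^'n))\<^sup>2)" and ?Q = "LINT W|lborel. exp (- (norm (L' \<omega> W))\<^sup>2)"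
  have "?P = sqrt pi ^ DIM(complex^'n)"
    using gauss_integral[of 1, where 'a="complex^'n"] by (simp add: has_bochner_integral_iff)
  then have "?P > 0" by (simp only: zero_less_power real_sqrt_gt_zero pi_gt_zero)
  moreover have "?P = c * ?Q" unfolding L'_eq[OF \<omega>] by (rule c(3)) measurable
  ultimately have "?P / ?Q = c" by auto
  moreover have "spec_proj A k r \<omega> g V =
    c *\<^sub>R (LINT W|lborel. g (inv (L \<omega>) (L \<omega> V - L \<omega> W)) * of_real (laguerre_fun k r (L \<omega> W)) * cis (r / 2 * sympl_form (L \<omega> V) (L \<omega> W)))"
    unfolding spec_proj_eq[OF \<omega>] twisted_proj_def sympl_form_def[symmetric] by (rule c(2)) measurable
  moreover have "inv (L \<omega>) (L \<omega> V - L \<omega> W) = V - W" for W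
    by (simp only: linear_diff[OF linear_L[OF \<omega>], symmetric] inv_L[OF \<omega>])
  ultimately show ?thesis by (simp only: L'_eq[OF \<omega>])
qed

end

section \<open>The restriction operator\<close>

locale restriction_frames = metivier_frames br A
  for br :: "'v::euclidean_space \<times> 'z::euclidean_space \<Rightarrow> 'v \<times> 'z \<Rightarrow> 'v \<times> 'z"
    and A :: "'z \<Rightarrow> 'v \<Rightarrow> real^('n::finite + 'n)" +
  fixes m :: "real \<Rightarrow> real \<Rightarrow> real" and f :: "'v \<times> 'z \<Rightarrow> complex" and n p :: nat
  assumes n: "n = CARD('n)" and p: "p = CARD('n) + DIM('z) - 1"
    and proper: "proper_function n m"
    and diff: "\<And>k \<mu>. \<mu> > 0 \<Longrightarrow> k \<in> mu_indices n m \<mu> \<Longrightarrow> mu_sol n m k differentiable (at \<mu>)"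
    and f: "schwartz f"
begin

lemma branch: "proper_branch n k m"
  by unfold_locales (use proper diff in auto)

definition sp :: "nat \<Rightarrow> real \<Rightarrow> 'z \<Rightarrow> 'v \<Rightarrow> complex" where
  "sp k r \<omega> V = spec_proj A k r \<omega> (fourier_z f (r *\<^sub>R \<omega>)) V"

abbreviation s :: "nat \<Rightarrow> real \<Rightarrow> real" where "s \<equiv> mu_sol n m"
abbreviation \<sigma> :: "'z measure" where "\<sigma> \<equiv> sphere_measure"

text \<open>The weight in front of the k-th spherical integral, extended by 0 to those \<mu> for
  which \<mu>_k does not exist; this makes it a Borel function of \<mu> on the line.\<close>

definition wt :: "nat \<Rightarrow> real \<Rightarrow> real" where
  "wt k \<mu> = indicator (proper_branch.I n k m) \<mu> * \<bar>proper_branch.\<delta> n k m \<mu>\<bar> * s k \<mu> ^ p"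

lemma mem_I: "\<mu> \<in> proper_branch.I n k m \<longleftrightarrow> k \<in> mu_indices n m \<mu>"
  by (simp add: proper_branch.I_def[OF branch])

lemma s_pos: "k \<in> mu_indices n m \<mu> \<Longrightarrow> s k \<mu> > 0"
  using proper_branch.s_pos[OF branch] by (simp add: mem_I)

lemma wt_in: "k \<in> mu_indices n m \<mu> \<Longrightarrow> wt k \<mu> = s k \<mu> ^ p * \<bar>deriv (s k) \<mu>\<bar>"
  using proper_branch.\<delta>_def[OF branch, of k \<mu>] by (simp add: wt_def mem_I)

lemma wt_out: "k \<notin> mu_indices n m \<mu> \<Longrightarrow> wt k \<mu> = 0"
  by (simp add: wt_def mem_I)

lemma wt_nonneg: "wt k \<mu> \<ge> 0"
  using wt_in[of k \<mu>] wt_out[of k \<mu>] s_pos[of k \<mu>] by (cases "k \<in> mu_indices n m \<mu>") auto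

lemma mu_indices_nonpos: "\<mu> \<le> 0 \<Longrightarrow> mu_indices n m \<mu> = {}"
  using proper_branch.I_pos[OF branch] by (force simp: mem_I)

lemma measurable_s [measurable]: "s k \<in> borel_measurable borel"
  by (rule proper_branch.s_measurable[OF branch])

lemma measurable_wt [measurable]: "wt k \<in> borel_measurable borel"
proof -
  note [measurable] = proper_branch.\<delta>_measurable[OF branch, of k] proper_branch.I_borel[OF branch, of k]
  show ?thesis unfolding wt_def[abs_def] by measurable
qed

text \<open>Every use of Fubini and Tonelli below needs joint measurability in radius, direction and
  V. It is read off from the frame integral, which no longer contains the inverse of a
  frame.\<close>

lemma measurable_sp [measurable (raw)]:
  assumes \<rho> [measurable]: "\<rho> \<in> borel_measurable M" and w [measurable]: "w \<in> M \<rightarrow>\<^sub>M \<sigma>" and v [measurable]: "v \<in> borel_measurable M"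
  shows "(\<lambda>x. sp k (\<rho> x) (w x) (v x)) \<in> borel_measurable M"
proof -
  have [measurable]: "w \<in> borel_measurable M"
    using measurable_compose[OF w measurable_sphere_measure_ident] .
  have F [measurable]: "(\<lambda>x. fourier_z f (\<rho> (fst x) *\<^sub>R w (fst x)) (v (fst x) - snd x)) \<in> borel_measurable (M \<Otimes>\<^sub>M lborel)"
    by (rule borel_measurable_fourier_z[OF f]) measurable
  let ?q = "\<lambda>x. ((LINT z|lborel. exp (- (norm (z :: complex^'n))\<^sup>2)) / (LINT W|lborel. exp (- (norm (L' (w x) W))\<^sup>2))) *\<^sub>R
    (LINT W|lborel. fourier_z f (\<rho> x *\<^sub>R w x) (v x - W) * of_real (laguerre_fun k (\<rho> x) (L' (w x) W)) * cis (\<rho> x / 2 * sympl_form (L' (w x) (v x)) (L' (w x) W)))"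
  have "?q \<in> borel_measurable M"
  proof -
    have "(\<lambda>x. LINT W|lborel. fourier_z f (\<rho> x *\<^sub>R w x) (v x - W) * of_real (laguerre_fun k (\<rho> x) (L' (w x) W)) * cis (\<rho> x / 2 * sympl_form (L' (w x) (v x)) (L' (w x) W))) \<in> borel_measurable M"
    proof (rule lborel.borel_measurable_lebesgue_integral)
      have "(\<lambda>x. fourier_z f (\<rho> (fst x) *\<^sub>R w (fst x)) (v (fst x) - snd x) * of_real (laguerre_fun k (\<rho> (fst x)) (L' (w (fst x)) (snd x))) * cis (\<rho> (fst x) / 2 * sympl_form (L' (w (fst x)) (v (fst x))) (L' (w (fst x)) (snd x))))
        \<in> borel_measurable (M \<Otimes>\<^sub>M lborel)" by measurable
      then show "(\<lambda>(x, W). fourier_z f (\<rho> x *\<^sub>R w x) (v x - W) * of_real (laguerre_fun k (\<rho> x) (L' (w x) W)) * cis (\<rho> x / 2 * sympl_form (L' (w x) (v x)) (L' (w x) W)))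
        \<in> borel_measurable (M \<Otimes>\<^sub>M lborel)" by (simp add: case_prod_unfold)
    qed
    then show ?thesis by measurable
  qed
  moreover have "?q x = sp k (\<rho> x) (w x) (v x)" if "x \<in> space M" for x
  proof -
    have \<omega>: "w x \<in> sphere 0 1" using measurable_space[OF w that] by (simp add: space_sphere_measure)
    show ?thesis unfolding sp_def
      by (rule spec_proj_frame_integral[OF _ \<omega>, symmetric]) (intro schwartz_borel_measurable schwartz_fourier_z f)
  qed
  ultimately show ?thesis by (subst measurable_cong[where g="?q"]) auto
qed

text \<open>The sum over k is taken first by \<open>spec_proj_sum_bound\<close>; polar coordinates
  then turn the rest into the integral of \<open>cauchy_weight\<close>. The version in \<mu> equals
  the version in r branch by branch, and \<open>C\<close> does not depend on V.\<close>

lemma nn_integral_wt_bound: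
  obtains C where "C < \<infinity>" "\<And>V. (\<integral>\<^sup>+k. \<integral>\<^sup>+\<mu>. \<integral>\<^sup>+\<omega>. ennreal (wt k \<mu> * norm (sp k (s k \<mu>) \<omega> V)) \<partial>\<sigma> \<partial>lborel \<partial>count_space UNIV) \<le> C"
    "\<And>V. (\<integral>\<^sup>+k. \<integral>\<^sup>+r. \<integral>\<^sup>+\<omega>. ennreal (indicator {0<..} r * r ^ p * norm (sp k r \<omega> V)) \<partial>\<sigma> \<partial>lborel \<partial>count_space UNIV) \<le> C"
proof -
  interpret S: finite_measure \<sigma> by (rule finite_sphere_measure)
  interpret C: sigma_finite_measure "count_space (UNIV :: nat set)"
    by (rule sigma_finite_measure_count_space_countable) simp
  interpret CL: pair_sigma_finite "count_space (UNIV :: nat set)" "lborel :: real measure" ..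
  interpret CS: pair_sigma_finite "count_space (UNIV :: nat set)" \<sigma> ..
  let ?n = "CARD('n)" and ?d = "DIM('z)"
  obtain C where C: "C \<ge> 0" "\<And>\<omega> r K V. \<omega> \<in> sphere 0 1 \<Longrightarrow> r > 0 \<Longrightarrow>
     (\<Sum>k<K. (r / (2 * pi)) ^ ?n * norm (spec_proj A k r \<omega> (fourier_z f (r *\<^sub>R \<omega>)) V)) \<le> C * cauchy_weight (r *\<^sub>R \<omega>)"
    by (rule spec_proj_sum_bound[OF f]) blast
  let ?c = "(2 * pi) ^ ?n * C"
  have sum_k: "(\<integral>\<^sup>+k. ennreal (indicator {0<..} r * r ^ p * norm (sp k r \<omega> V)) \<partial>count_space UNIV) \<le>
      ennreal (r ^ (?d - 1)) * ennreal (?c * cauchy_weight (r *\<^sub>R \<omega>)) * indicator {0<..} r"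
    if \<omega>: "\<omega> \<in> sphere 0 1" for \<omega> V r
  proof (cases "r > 0")
    case r: True
    have "(\<integral>\<^sup>+k. ennreal (indicator {0<..} r * r ^ p * norm (sp k r \<omega> V)) \<partial>count_space UNIV) = (\<Sum>k. ennreal (r ^ p * norm (sp k r \<omega> V)))"
      using r by (simp add: nn_integral_count_space_nat)
    also have "\<dots> \<le> ennreal (r ^ (?d - 1) * (?c * cauchy_weight (r *\<^sub>R \<omega>)))"
    proof (rule suminf_le_const[OF summableI])
      fix K
      have "(\<Sum>k<K. ennreal (r ^ p * norm (sp k r \<omega> V))) = ennreal (\<Sum>k<K. r ^ p * norm (sp k r \<omega> V))"
        using r by (intro sum_ennreal) auto
      also have "(\<Sum>k<K. r ^ p * norm (sp k r \<omega> V)) = r ^ (?d - 1) * ((2 * pi) ^ ?n * (\<Sum>k<K. (r / (2 * pi)) ^ ?n * norm (sp k r \<omega> V)))"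
      proof -
        \<comment> \<open>The exponent n + d - 1 divides into n for the projections and d - 1 for
          the polar coordinates.\<close>
        have "p = (?d - 1) + ?n" by (simp add: p Suc_leI)
        then have "r ^ p = r ^ (?d - 1) * ((2 * pi) ^ ?n * (r / (2 * pi)) ^ ?n)"
          by (simp only: power_add) (simp add: power_divide)
        then show ?thesis by (simp only: sum_distrib_left mult.assoc)
      qed
      also have "ennreal \<dots> \<le> ennreal (r ^ (?d - 1) * (?c * cauchy_weight (r *\<^sub>R \<omega>)))"
        unfolding mult.assoc[of _ C] sp_def using r by (intro ennreal_leI mult_left_mono C(2) \<omega>) auto
      finally show "(\<Sum>k<K. ennreal (r ^ p * norm (sp k r \<omega> V))) \<le> ennreal (r ^ (?d - 1) * (?c * cauchy_weight (r *\<^sub>R \<omega>)))" .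
    qed
    also have "\<dots> = ennreal (r ^ (?d - 1)) * ennreal (?c * cauchy_weight (r *\<^sub>R \<omega>)) * indicator {0<..} r"
      using r C(1) by (subst ennreal_mult) (auto intro!: mult_nonneg_nonneg less_imp_le[OF cauchy_weight_pos])
    finally show ?thesis .
  qed simp
  let ?M = "\<integral>\<^sup>+\<eta>. ennreal (?c * cauchy_weight (\<eta> :: 'z)) \<partial>lborel"
  have "?M = ennreal (LINT \<eta>|lborel. ?c * cauchy_weight (\<eta> :: 'z))"
    using C(1) by (intro nn_integral_eq_integral integrable_mult_right integrable_cauchy_weight AE_I2) (auto intro!: mult_nonneg_nonneg less_imp_le[OF cauchy_weight_pos])
  then have M: "?M < \<infinity>" by simp
  have r_bound: "(\<integral>\<^sup>+k. \<integral>\<^sup>+r. \<integral>\<^sup>+\<omega>. ennreal (indicator {0<..} r * r ^ p * norm (sp k r \<omega> V)) \<partial>\<sigma> \<partial>lborel \<partial>count_space UNIV) \<le> ?M" for V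
  proof -
    have m1 [measurable]: "(\<lambda>(k, r, \<omega>). ennreal (indicator {0<..} r * r ^ p * norm (sp k r \<omega> V))) \<in> borel_measurable (count_space UNIV \<Otimes>\<^sub>M (lborel \<Otimes>\<^sub>M \<sigma>))"
      by (rule measurable_pair_measure_countable1) auto
    have m2: "(\<lambda>(k, r). \<integral>\<^sup>+\<omega>. ennreal (indicator {0<..} r * r ^ p * norm (sp k r \<omega> V)) \<partial>\<sigma>) \<in> borel_measurable (count_space UNIV \<Otimes>\<^sub>M lborel)"
      by (rule measurable_pair_measure_countable1) auto
    have "(\<integral>\<^sup>+k. \<integral>\<^sup>+r. \<integral>\<^sup>+\<omega>. ennreal (indicator {0<..} r * r ^ p * norm (sp k r \<omega> V)) \<partial>\<sigma> \<partial>lborel \<partial>count_space UNIV) =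
       (\<integral>\<^sup>+r. \<integral>\<^sup>+k. \<integral>\<^sup>+\<omega>. ennreal (indicator {0<..} r * r ^ p * norm (sp k r \<omega> V)) \<partial>\<sigma> \<partial>count_space UNIV \<partial>lborel)"
      using CL.Fubini'[OF m2] by simp
    also have "\<dots> = (\<integral>\<^sup>+r. \<integral>\<^sup>+\<omega>. \<integral>\<^sup>+k. ennreal (indicator {0<..} r * r ^ p * norm (sp k r \<omega> V)) \<partial>count_space UNIV \<partial>\<sigma> \<partial>lborel)"
    proof (rule nn_integral_cong)
      fix r :: real
      have "(\<lambda>(k, \<omega>). ennreal (indicator {0<..} r * r ^ p * norm (sp k r \<omega> V))) \<in> borel_measurable (count_space UNIV \<Otimes>\<^sub>M \<sigma>)"
        by (rule measurable_pair_measure_countable1) auto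
      from CS.Fubini'[OF this]
      show "(\<integral>\<^sup>+k. \<integral>\<^sup>+\<omega>. ennreal (indicator {0<..} r * r ^ p * norm (sp k r \<omega> V)) \<partial>\<sigma> \<partial>count_space UNIV) =
        (\<integral>\<^sup>+\<omega>. \<integral>\<^sup>+k. ennreal (indicator {0<..} r * r ^ p * norm (sp k r \<omega> V)) \<partial>count_space UNIV \<partial>\<sigma>)" by simp
    qed
    also have "\<dots> \<le> (\<integral>\<^sup>+r. \<integral>\<^sup>+\<omega>. ennreal (r ^ (?d - 1)) * ennreal (?c * cauchy_weight (r *\<^sub>R \<omega>)) * indicator {0<..} r \<partial>\<sigma> \<partial>lborel)"
      by (intro nn_integral_mono sum_k) (simp add: space_sphere_measure)
    also have "\<dots> = (\<integral>\<^sup>+r. ennreal (r ^ (?d - 1)) * (\<integral>\<^sup>+\<omega>. ennreal (?c * cauchy_weight (r *\<^sub>R \<omega>)) \<partial>\<sigma>) * indicator {0<..} r \<partial>lborel)"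
    proof (rule nn_integral_cong)
      fix r :: real
      note [measurable] = measurable_sphere_measure_ident
      have [measurable]: "(\<lambda>\<omega>. ennreal (?c * cauchy_weight (r *\<^sub>R \<omega>))) \<in> borel_measurable \<sigma>"
        by (rule measurable_compose[OF measurable_sphere_measure_ident]) measurable
      show "(\<integral>\<^sup>+\<omega>. ennreal (r ^ (?d - 1)) * ennreal (?c * cauchy_weight (r *\<^sub>R \<omega>)) * indicator {0<..} r \<partial>\<sigma>) =
        ennreal (r ^ (?d - 1)) * (\<integral>\<^sup>+\<omega>. ennreal (?c * cauchy_weight (r *\<^sub>R \<omega>)) \<partial>\<sigma>) * indicator {0<..} r"
        by (simp add: nn_integral_cmult nn_integral_multc)
    qed
    also have "\<dots> = ?M" by (rule nn_integral_polar) measurable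
    finally show ?thesis .
  qed
  \<comment> \<open>The substitution on the single branch \<open>k\<close>: the derivative in
    \<open>wt\<close> is the Jacobian, and the other factors are functions of r = \<mu>_k.\<close>
  have "(\<integral>\<^sup>+\<mu>. \<integral>\<^sup>+\<omega>. ennreal (wt k \<mu> * norm (sp k (s k \<mu>) \<omega> V)) \<partial>\<sigma> \<partial>lborel) =
     (\<integral>\<^sup>+r. \<integral>\<^sup>+\<omega>. ennreal (indicator {0<..} r * r ^ p * norm (sp k r \<omega> V)) \<partial>\<sigma> \<partial>lborel)" for k V
  proof -
    let ?F = "\<lambda>r. \<integral>\<^sup>+\<omega>. ennreal (indicator {0<..} r * r ^ p * norm (sp k r \<omega> V)) \<partial>\<sigma>"
    let ?g = "\<lambda>\<mu>. indicator (proper_branch.I n k m) \<mu> * \<bar>proper_branch.\<delta> n k m \<mu>\<bar>"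
    have m: "?F \<in> borel_measurable borel" by measurable
    have "(\<integral>\<^sup>+\<omega>. ennreal (wt k \<mu> * norm (sp k (s k \<mu>) \<omega> V)) \<partial>\<sigma>) = ennreal (?g \<mu>) * ?F (s k \<mu>)" for \<mu>
    proof -
      have "ennreal (wt k \<mu> * norm (sp k (s k \<mu>) \<omega> V)) = ennreal (?g \<mu>) * ennreal (indicator {0<..} (s k \<mu>) * s k \<mu> ^ p * norm (sp k (s k \<mu>) \<omega> V))" for \<omega>
        using s_pos[of k \<mu>] mem_I[of \<mu> k] by (auto simp: wt_def indicator_def mult.assoc simp flip: ennreal_mult)
      then show ?thesis by (simp add: nn_integral_cmult)
    qed
    then have "(\<integral>\<^sup>+\<mu>. \<integral>\<^sup>+\<omega>. ennreal (wt k \<mu> * norm (sp k (s k \<mu>) \<omega> V)) \<partial>\<sigma> \<partial>lborel) = (\<integral>\<^sup>+\<mu>. ennreal (?g \<mu>) * ?F (s k \<mu>) \<partial>lborel)"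
      by simp
    also have "\<dots> = (\<integral>\<^sup>+r. ?F r * indicator {0<..} r \<partial>lborel)"
      by (rule proper_branch.nn_integral_branch[OF branch m])
    also have "\<dots> = (\<integral>\<^sup>+r. ?F r \<partial>lborel)"
      by (intro nn_integral_cong) (auto simp: indicator_def)
    finally show ?thesis .
  qed
  with r_bound M show ?thesis using that[of ?M] by simp
qed

end

text \<open>The formula for nonnegative functions recast as an identity of measures, from which the
  complex version follows.\<close>

lemma distr_polar:
  "distr (density (lborel \<Otimes>\<^sub>M sphere_measure) (\<lambda>x. ennreal (indicator {0<..} (fst x) * fst x ^ (DIM('z) - 1)))) borel
    (\<lambda>x. fst x *\<^sub>R snd x) = (lborel :: 'z::euclidean_space measure)"
proof (rule measure_eqI)
  interpret S: finite_measure "sphere_measure :: 'z measure" by (rule finite_sphere_measure)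
  let ?M = "lborel \<Otimes>\<^sub>M (sphere_measure :: 'z measure)"
  let ?w = "\<lambda>x :: real \<times> 'z. ennreal (indicator {0<..} (fst x) * fst x ^ (DIM('z) - 1))"
  have s [measurable]: "snd \<in> ?M \<rightarrow>\<^sub>M borel"
    by (rule measurable_compose[OF measurable_snd measurable_sphere_measure_ident])
  fix B assume "B \<in> sets (distr (density ?M ?w) borel (\<lambda>x. fst x *\<^sub>R snd x))"
  then have [measurable]: "B \<in> sets borel" by simp
  have ms: "(\<lambda>x. fst x *\<^sub>R snd x) \<in> borel_measurable ?M" by measurable
  have [measurable]: "(\<lambda>x. indicator B (fst x *\<^sub>R snd x) :: ennreal) \<in> borel_measurable ?M"
    by (rule measurable_compose[OF ms]) measurable
  have "emeasure (distr (density ?M ?w) borel (\<lambda>x. fst x *\<^sub>R snd x)) B =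
      (\<integral>\<^sup>+y. indicator B y \<partial>distr (density ?M ?w) borel (\<lambda>x. fst x *\<^sub>R snd x))" by simp
  also have "\<dots> = (\<integral>\<^sup>+x. ?w x * indicator B (fst x *\<^sub>R snd x) \<partial>?M)"
    by (subst nn_integral_distr) (auto simp: nn_integral_density)
  also have "\<dots> = (\<integral>\<^sup>+r. \<integral>\<^sup>+\<omega>. ?w (r, \<omega>) * indicator B (r *\<^sub>R \<omega>) \<partial>sphere_measure \<partial>lborel)"
    by (subst S.nn_integral_fst[symmetric]) auto
  also have "\<dots> = (\<integral>\<^sup>+r. ennreal (r ^ (DIM('z) - 1)) * (\<integral>\<^sup>+\<omega>. indicator B (r *\<^sub>R \<omega>) \<partial>sphere_measure) * indicator {0<..} r \<partial>lborel)"
  proof (rule nn_integral_cong)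
    fix r :: real
    have "(\<lambda>\<omega>. indicator B (r *\<^sub>R \<omega>) :: ennreal) \<in> borel_measurable sphere_measure"
      by (rule measurable_compose[OF measurable_sphere_measure_ident]) measurable
    then show "(\<integral>\<^sup>+\<omega>. ?w (r, \<omega>) * indicator B (r *\<^sub>R \<omega>) \<partial>sphere_measure) =
       ennreal (r ^ (DIM('z) - 1)) * (\<integral>\<^sup>+\<omega>. indicator B (r *\<^sub>R \<omega>) \<partial>sphere_measure) * indicator {0<..} r"
      by (auto simp: nn_integral_cmult indicator_def)
  qed
  also have "\<dots> = (\<integral>\<^sup>+y. indicator B y \<partial>lborel)" by (rule nn_integral_polar) measurable
  finally show "emeasure (distr (density ?M ?w) borel (\<lambda>x. fst x *\<^sub>R snd x)) B = emeasure lborel B" by simp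
qed simp

lemma integral_polar:
  fixes F :: "'z::euclidean_space \<Rightarrow> complex"
  assumes [measurable]: "F \<in> borel_measurable borel"
  shows "(LINT x|(lborel \<Otimes>\<^sub>M sphere_measure). (indicator {0<..} (fst x) * fst x ^ (DIM('z) - 1)) *\<^sub>R F (fst x *\<^sub>R snd x)) = (LINT \<eta>|lborel. F \<eta>)"
proof -
  let ?M = "lborel \<Otimes>\<^sub>M (sphere_measure :: 'z measure)"
  have [measurable]: "snd \<in> ?M \<rightarrow>\<^sub>M borel"
    by (rule measurable_compose[OF measurable_snd measurable_sphere_measure_ident])
  have ms [measurable]: "(\<lambda>x. fst x *\<^sub>R snd x) \<in> borel_measurable ?M" by measurable
  have mF: "(\<lambda>x. F (fst x *\<^sub>R snd x)) \<in> borel_measurable ?M" by (rule measurable_compose[OF ms]) measurable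
  have "(LINT \<eta>|lborel. F \<eta>) = (LINT x|(density ?M (\<lambda>x. ennreal (indicator {0<..} (fst x) * fst x ^ (DIM('z) - 1)))). F (fst x *\<^sub>R snd x))"
    by (subst distr_polar[symmetric]) (rule integral_distr; simp)
  also have "\<dots> = (LINT x|?M. (indicator {0<..} (fst x) * fst x ^ (DIM('z) - 1)) *\<^sub>R F (fst x *\<^sub>R snd x))"
    using mF by (intro integral_density) (auto simp: indicator_def)
  finally show ?thesis ..
qed

text \<open>For complex families summability is absolute, so integrability and summability coincide,
  and otherwise both sides have the default value 0.\<close>

lemma integral_count_space_eq_infsum:
  fixes u :: "nat \<Rightarrow> complex"
  shows "(LINT k|count_space I. u k) = (\<Sum>\<^sub>\<infinity>k\<in>I. u k)"
proof (cases "integrable (count_space I) u")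
  case True
  then show ?thesis by (metis abs_summable_on_def infsetsum_def infsetsum_infsum)
next
  case False
  then have "\<not> u summable_on I"
    by (metis abs_summable_on_def abs_summable_equivalent summable_on_iff_abs_summable_on_complex)
  with False show ?thesis
    by (simp add: not_integrable_integral_eq infsum_not_exists)
qed

lemma ennreal_norm_integral_le:
  fixes g :: "'a \<Rightarrow> 'b::{banach, second_countable_topology}"
  shows "ennreal (norm (LINT x|M. g x)) \<le> (\<integral>\<^sup>+x. ennreal (norm (g x)) \<partial>M)"
  by (cases "integrable M g") (auto simp: integral_norm_bound_ennreal not_integrable_integral_eq)

lemma inverse_power_le_cauchy_weight:
  fixes x :: "'a::euclidean_space"
  shows "1 / (1 + norm x) ^ (2 * DIM('a)) \<le> cauchy_weight x"
proof -
  have "(\<Prod>b\<in>Basis. 1 + (x \<bullet> b)\<^sup>2) \<le> (\<Prod>b\<in>(Basis::'a set). (1 + norm x)\<^sup>2)"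
  proof (intro prod_mono conjI)
    fix b :: 'a assume "b \<in> Basis"
    then have "\<bar>x \<bullet> b\<bar> \<le> norm x" by (rule Basis_le_norm)
    then have "(x \<bullet> b)\<^sup>2 \<le> (norm x)\<^sup>2" by (metis abs_le_square_iff abs_norm_cancel)
    then show "1 + (x \<bullet> b)\<^sup>2 \<le> (1 + norm x)\<^sup>2" using norm_ge_zero[of x] by (simp add: power2_sum add_increasing2)
  qed auto
  also have "\<dots> = (1 + norm x) ^ (2 * DIM('a))" by (simp add: power_mult)
  finally have "1 / (1 + norm x) ^ (2 * DIM('a)) \<le> 1 / (\<Prod>b\<in>Basis. 1 + (x \<bullet> b)\<^sup>2)"
    by (intro divide_left_mono mult_pos_pos prod_pos) (auto simp: add_pos_nonneg)
  also have "\<dots> = cauchy_weight x" by (simp add: cauchy_weight_def prod_dividef)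
  finally show ?thesis .
qed

context restriction_frames
begin

lemma card_n: "CARD('n) = n" by (simp add: n)

lemma pn: "n + DIM('z) - 1 = p" by (simp add: p n)

lemma summand_eq:
  "k \<in> mu_indices n m \<mu> \<Longrightarrow> restriction_summand A m \<mu> f V k \<omega> = of_real (wt k \<mu>) * sp k (s k \<mu>) \<omega> V"
  unfolding restriction_summand_def Let_def card_n pn by (simp add: wt_in sp_def)

definition T :: "'v \<Rightarrow> 'z \<Rightarrow> nat \<Rightarrow> real \<Rightarrow> complex" where
  "T V Z k \<mu> = of_real (wt k \<mu>) * (LINT \<omega>|\<sigma>. cis (- s k \<mu> * (\<omega> \<bullet> Z)) * sp k (s k \<mu>) \<omega> V)"

lemma T_out: "k \<notin> mu_indices n m \<mu> \<Longrightarrow> T V Z k \<mu> = 0"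
  by (simp add: T_def wt_out)

lemma restriction_op_eq:
  "restriction_op A m \<mu> f (V, Z) = of_real (1 / (2 * pi) ^ (n + DIM('z))) * (\<Sum>\<^sub>\<infinity>k\<in>mu_indices n m \<mu>. T V Z k \<mu>)"
  unfolding restriction_op_def Let_def card_n pn prod.case T_def sp_def
  by (intro arg_cong2[where f="(*)"] refl infsum_cong) (simp add: wt_in)

text \<open>An index set that varies with \<mu> would block Fubini. The weight vanishes off it, so
  counting measure on all naturals can be used.\<close>

lemma restriction_op_eq_integral:
  "restriction_op A m \<mu> f (V, Z) = of_real (1 / (2 * pi) ^ (n + DIM('z))) * (LINT k|count_space UNIV. T V Z k \<mu>)"
  unfolding restriction_op_eq integral_count_space_eq_infsum
  by (intro arg_cong2[where f="(*)"] refl infsum_cong_neutral) (auto simp: T_out)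

text \<open>The total mass of the absolute values of the components at given \<mu> and V, possibly
  infinite. Where it is finite the defining series converges absolutely.\<close>

definition G :: "real \<Rightarrow> 'v \<Rightarrow> ennreal" where
  "G \<mu> V = (\<Sum>k. \<integral>\<^sup>+\<omega>. ennreal (wt k \<mu> * norm (sp k (s k \<mu>) \<omega> V)) \<partial>\<sigma>)"

lemma measurable_G [measurable (raw)]:
  assumes [measurable]: "u \<in> borel_measurable M" "v \<in> borel_measurable M"
  shows "(\<lambda>x. G (u x) (v x)) \<in> borel_measurable M"
proof -
  interpret S: finite_measure \<sigma> by (rule finite_sphere_measure)
  show ?thesis unfolding G_def by measurable
qed

lemma nn_integral_G:
  "(\<integral>\<^sup>+\<mu>. G \<mu> V \<partial>lborel) = (\<integral>\<^sup>+k. \<integral>\<^sup>+\<mu>. \<integral>\<^sup>+\<omega>. ennreal (wt k \<mu> * norm (sp k (s k \<mu>) \<omega> V)) \<partial>\<sigma> \<partial>lborel \<partial>count_space UNIV)"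
proof -
  interpret S: finite_measure \<sigma> by (rule finite_sphere_measure)
  show ?thesis unfolding G_def nn_integral_count_space_nat by (rule nn_integral_suminf) measurable
qed

lemma nn_integral_summand_le:
  assumes g: "\<And>k \<omega>. k \<in> mu_indices n m \<mu> \<Longrightarrow> g k \<omega> \<le> ennreal (wt k \<mu> * norm (sp k (s k \<mu>) \<omega> V))"
  shows "(\<integral>\<^sup>+k. \<integral>\<^sup>+\<omega>. g k \<omega> \<partial>\<sigma> \<partial>count_space (mu_indices n m \<mu>)) \<le> G \<mu> V"
proof -
  have "(\<integral>\<^sup>+k. \<integral>\<^sup>+\<omega>. g k \<omega> \<partial>\<sigma> \<partial>count_space (mu_indices n m \<mu>)) \<le>
     (\<integral>\<^sup>+k. \<integral>\<^sup>+\<omega>. ennreal (wt k \<mu> * norm (sp k (s k \<mu>) \<omega> V)) \<partial>\<sigma> \<partial>count_space (mu_indices n m \<mu>))"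
    using g by (intro nn_integral_mono) auto
  also have "\<dots> \<le> (\<integral>\<^sup>+k. \<integral>\<^sup>+\<omega>. ennreal (wt k \<mu> * norm (sp k (s k \<mu>) \<omega> V)) \<partial>\<sigma> \<partial>count_space UNIV)"
    by (subst nn_integral_count_space_indicator, simp) (auto intro!: nn_integral_mono simp: indicator_def)
  finally show ?thesis by (simp add: G_def nn_integral_count_space_nat)
qed

lemma norm_summand: "k \<in> mu_indices n m \<mu> \<Longrightarrow>
   ennreal (norm (restriction_summand A m \<mu> f V k \<omega>)) = ennreal (wt k \<mu> * norm (sp k (s k \<mu>) \<omega> V))"
  by (simp add: summand_eq norm_mult wt_nonneg)

lemma measurable_summand:
  assumes w: "w \<in> M \<rightarrow>\<^sub>M \<sigma>" and v: "v \<in> borel_measurable M" and \<kappa>: "\<kappa> \<in> M \<rightarrow>\<^sub>M count_space (mu_indices n m \<mu>)"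
  shows "(\<lambda>x. restriction_summand A m \<mu> f (v x) (\<kappa> x) (w x)) \<in> borel_measurable M"
proof (rule measurable_compose_countable'[OF _ \<kappa>])
  fix k assume k: "k \<in> mu_indices n m \<mu>"
  note [measurable] = w v
  show "(\<lambda>x. restriction_summand A m \<mu> f (v x) k (w x)) \<in> borel_measurable M"
    unfolding summand_eq[OF k] by measurable
qed simp

lemma converges_at_if_finite:
  assumes "G \<mu> V < \<infinity>"
  shows "restriction_converges_at A m \<mu> f V"
  unfolding restriction_converges_at_def card_n
proof (rule integrableI_bounded)
  interpret S: finite_measure \<sigma> by (rule finite_sphere_measure)
  have m: "(\<lambda>x. restriction_summand A m \<mu> f V (fst x) (snd x)) \<in> borel_measurable (count_space (mu_indices n m \<mu>) \<Otimes>\<^sub>M \<sigma>)"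
    by (rule measurable_summand) auto
  then show "(\<lambda>(k, \<omega>). restriction_summand A m \<mu> f V k \<omega>) \<in> borel_measurable (count_space (mu_indices n m \<mu>) \<Otimes>\<^sub>M \<sigma>)"
    by (simp add: case_prod_unfold)
  have "(\<integral>\<^sup>+x. ennreal (norm (restriction_summand A m \<mu> f V (fst x) (snd x))) \<partial>(count_space (mu_indices n m \<mu>) \<Otimes>\<^sub>M \<sigma>)) =
     (\<integral>\<^sup>+k. \<integral>\<^sup>+\<omega>. ennreal (norm (restriction_summand A m \<mu> f V k \<omega>)) \<partial>\<sigma> \<partial>count_space (mu_indices n m \<mu>))"
    using m by (subst S.nn_integral_fst[symmetric]) auto
  also have "\<dots> \<le> G \<mu> V" by (rule nn_integral_summand_le) (simp add: norm_summand)
  finally show "(\<integral>\<^sup>+x. ennreal (norm (case x of (k, \<omega>) \<Rightarrow> restriction_summand A m \<mu> f V k \<omega>)) \<partial>(count_space (mu_indices n m \<mu>) \<Otimes>\<^sub>M \<sigma>)) < \<infinity>"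
    using assms by (simp add: case_prod_unfold)
qed

text \<open>\<open>G\<close> has a finite integral over \<mu> for every V, so it is finite outside a
  null set of \<mu> that may depend on V.\<close>

lemma AE_converges_at: "AE \<mu> in lborel. restriction_converges_at A m \<mu> f V"
proof -
  obtain C where C: "C < \<infinity>" "\<And>V. (\<integral>\<^sup>+k. \<integral>\<^sup>+\<mu>. \<integral>\<^sup>+\<omega>. ennreal (wt k \<mu> * norm (sp k (s k \<mu>) \<omega> V)) \<partial>\<sigma> \<partial>lborel \<partial>count_space UNIV) \<le> C"
    by (rule nn_integral_wt_bound) blast
  have "(\<integral>\<^sup>+\<mu>. G \<mu> V \<partial>lborel) < \<infinity>" unfolding nn_integral_G by (rule le_less_trans[OF C(2) C(1)])
  then have "(\<integral>\<^sup>+\<mu>. G \<mu> V \<partial>lborel) \<noteq> \<infinity>" by simp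
  from nn_integral_PInf_AE[OF _ this] have "AE \<mu> in lborel. G \<mu> V \<noteq> \<infinity>" by measurable
  then show ?thesis by eventually_elim (rule converges_at_if_finite, simp add: less_top)
qed

text \<open>The integral of \<open>G\<close> over \<mu> is bounded uniformly in V, so dividing by
  the power 2 dim of 1 + |V| makes it integrable over V too. Tonelli then gives a finite weighted
  integral over V for almost every \<mu>.\<close>

lemma AE_tempered: "AE \<mu> in lborel. restriction_tempered A m \<mu> f"
proof -
  interpret S: finite_measure \<sigma> by (rule finite_sphere_measure)
  obtain C where C: "C < \<infinity>" "\<And>V. (\<integral>\<^sup>+k. \<integral>\<^sup>+\<mu>. \<integral>\<^sup>+\<omega>. ennreal (wt k \<mu> * norm (sp k (s k \<mu>) \<omega> V)) \<partial>\<sigma> \<partial>lborel \<partial>count_space UNIV) \<le> C"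
    by (rule nn_integral_wt_bound) blast
  let ?N = "2 * DIM('v)"
  let ?w = "\<lambda>V::'v. ennreal (1 / (1 + norm V) ^ ?N)"
  have "(\<integral>\<^sup>+\<mu>. \<integral>\<^sup>+V. ?w V * G \<mu> V \<partial>lborel \<partial>lborel) = (\<integral>\<^sup>+V. \<integral>\<^sup>+\<mu>. ?w V * G \<mu> V \<partial>lborel \<partial>lborel)"
    by (rule lborel_pair.Fubini') measurable
  also have "\<dots> = (\<integral>\<^sup>+V. ?w V * (\<integral>\<^sup>+\<mu>. G \<mu> V \<partial>lborel) \<partial>lborel)"
    by (intro nn_integral_cong nn_integral_cmult) measurable
  also have "\<dots> \<le> (\<integral>\<^sup>+V. ennreal (cauchy_weight (V :: 'v)) * C \<partial>lborel)"
    unfolding nn_integral_G by (intro nn_integral_mono mult_mono ennreal_leI inverse_power_le_cauchy_weight C) auto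
  also have "\<dots> = ennreal (LINT V|lborel. cauchy_weight (V :: 'v)) * C"
    by (simp add: nn_integral_multc nn_integral_eq_integral[OF integrable_cauchy_weight] less_imp_le[OF cauchy_weight_pos])
  also have "\<dots> < \<infinity>" using C(1) by (simp add: ennreal_mult_less_top)
  finally have "(\<integral>\<^sup>+\<mu>. \<integral>\<^sup>+V. ?w V * G \<mu> V \<partial>lborel \<partial>lborel) \<noteq> \<infinity>" by simp
  from nn_integral_PInf_AE[OF _ this] have "AE \<mu> in lborel. (\<integral>\<^sup>+V. ?w V * G \<mu> V \<partial>lborel) \<noteq> \<infinity>" by measurable
  then show ?thesis
  proof eventually_elim
    case (elim \<mu>)
    let ?M = "lborel \<Otimes>\<^sub>M (count_space (mu_indices n m \<mu>) \<Otimes>\<^sub>M \<sigma>)"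
    interpret I: sigma_finite_measure "count_space (mu_indices n m \<mu>)"
      by (rule sigma_finite_measure_count_space_countable) simp
    interpret IS: pair_sigma_finite "count_space (mu_indices n m \<mu>)" \<sigma> ..
    let ?h = "\<lambda>x. restriction_summand A m \<mu> f (fst x) (fst (snd x)) (snd (snd x)) /\<^sub>R (1 + norm (fst x)) ^ ?N"
    have m0: "(\<lambda>x. restriction_summand A m \<mu> f (fst x) (fst (snd x)) (snd (snd x))) \<in> borel_measurable ?M"
      by (rule measurable_summand) auto
    then have m: "?h \<in> borel_measurable ?M" by measurable
    have "integrable ?M ?h"
    proof (rule integrableI_bounded[OF m])
      have m2: "(\<lambda>x. restriction_summand A m \<mu> f V (fst x) (snd x)) \<in> borel_measurable (count_space (mu_indices n m \<mu>) \<Otimes>\<^sub>M \<sigma>)" for V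
        by (rule measurable_summand) auto
      have nh: "norm (?h (V, x)) = (1 / (1 + norm V) ^ ?N) * norm (restriction_summand A m \<mu> f V (fst x) (snd x))" for V x
        using norm_ge_zero[of V] by (simp add: divide_inverse power_abs)
      have "(\<integral>\<^sup>+x. ennreal (norm (?h x)) \<partial>?M) = (\<integral>\<^sup>+V. \<integral>\<^sup>+x. ennreal (norm (?h (V, x))) \<partial>(count_space (mu_indices n m \<mu>) \<Otimes>\<^sub>M \<sigma>) \<partial>lborel)"
        by (rule IS.nn_integral_fst[symmetric, OF measurable_compose[OF measurable_compose[OF m borel_measurable_norm] measurable_ennreal]])
      also have "\<dots> = (\<integral>\<^sup>+V. ?w V * (\<integral>\<^sup>+x. ennreal (norm (restriction_summand A m \<mu> f V (fst x) (snd x))) \<partial>(count_space (mu_indices n m \<mu>) \<Otimes>\<^sub>M \<sigma>)) \<partial>lborel)"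
      proof (rule nn_integral_cong)
        fix V
        have e: "ennreal (norm (?h (V, x))) = ?w V * ennreal (norm (restriction_summand A m \<mu> f V (fst x) (snd x)))" for x
          unfolding nh by (rule ennreal_mult) auto
        show "(\<integral>\<^sup>+x. ennreal (norm (?h (V, x))) \<partial>(count_space (mu_indices n m \<mu>) \<Otimes>\<^sub>M \<sigma>)) =
          ?w V * (\<integral>\<^sup>+x. ennreal (norm (restriction_summand A m \<mu> f V (fst x) (snd x))) \<partial>(count_space (mu_indices n m \<mu>) \<Otimes>\<^sub>M \<sigma>))"
          unfolding e by (rule nn_integral_cmult[OF measurable_compose[OF measurable_compose[OF m2 borel_measurable_norm] measurable_ennreal]])
      qed
      also have "\<dots> \<le> (\<integral>\<^sup>+V. ?w V * G \<mu> V \<partial>lborel)"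
      proof (intro nn_integral_mono mult_left_mono)
        fix V
        have "(\<integral>\<^sup>+x. ennreal (norm (restriction_summand A m \<mu> f V (fst x) (snd x))) \<partial>(count_space (mu_indices n m \<mu>) \<Otimes>\<^sub>M \<sigma>)) =
           (\<integral>\<^sup>+k. \<integral>\<^sup>+\<omega>. ennreal (norm (restriction_summand A m \<mu> f V k \<omega>)) \<partial>\<sigma> \<partial>count_space (mu_indices n m \<mu>))"
          using m2 by (subst S.nn_integral_fst[symmetric]) auto
        also have "\<dots> \<le> G \<mu> V" by (rule nn_integral_summand_le) (simp add: norm_summand)
        finally show "(\<integral>\<^sup>+x. ennreal (norm (restriction_summand A m \<mu> f V (fst x) (snd x))) \<partial>(count_space (mu_indices n m \<mu>) \<Otimes>\<^sub>M \<sigma>)) \<le> G \<mu> V" .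
      qed simp
      also have "\<dots> < \<infinity>" using elim by (simp add: less_top)
      finally show "(\<integral>\<^sup>+x. ennreal (norm (?h x)) \<partial>?M) < \<infinity>" .
    qed
    then show ?case unfolding restriction_tempered_def card_n by (intro exI[of _ ?N]) (simp add: case_prod_unfold)
  qed
qed

text \<open>The factor r^n split off from r^(n+d-1) is consumed here by the special Hermite
  expansion; r^(d-1) is left for the polar coordinates.\<close>

lemma sp_sums:
  assumes \<omega>: "\<omega> \<in> sphere 0 1" and r: "r > 0"
  shows "integrable (count_space UNIV) (\<lambda>k. sp k r \<omega> V)"
    and "of_real (r ^ n) * (LINT k|count_space UNIV. sp k r \<omega> V) = of_real ((2 * pi) ^ n) * fourier_z f (r *\<^sub>R \<omega>) V"
proof -
  obtain C where C: "\<And>\<omega> r K V. \<omega> \<in> sphere 0 1 \<Longrightarrow> r > 0 \<Longrightarrow>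
     (\<Sum>k<K. (r / (2 * pi)) ^ CARD('n) * norm (spec_proj A k r \<omega> (fourier_z f (r *\<^sub>R \<omega>)) V)) \<le> C * cauchy_weight (r *\<^sub>R \<omega>)"
    by (rule spec_proj_sum_bound[OF f]) blast
  have r0: "(r / (2 * pi)) ^ n > 0" using r by simp
  have "summable (\<lambda>k. (r / (2 * pi)) ^ n * norm (sp k r \<omega> V))"
    using C[OF \<omega> r] r0 unfolding card_n sp_def[symmetric]
    by (intro summableI_nonneg_bounded[where x="C * cauchy_weight (r *\<^sub>R \<omega>)"]) auto
  then have sn: "summable (\<lambda>k. norm (sp k r \<omega> V))" using r0 r by (subst (asm) summable_cmult_iff) simp
  then show i: "integrable (count_space UNIV) (\<lambda>k. sp k r \<omega> V)" by (simp add: integrable_count_space_nat_iff)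
  have "(\<lambda>k. of_real ((r / (2 * pi)) ^ n) * sp k r \<omega> V) sums fourier_z f (r *\<^sub>R \<omega>) V"
    using spec_proj_sums[OF f \<omega> r, of V] unfolding card_n sp_def .
  moreover have "(\<lambda>k. of_real ((r / (2 * pi)) ^ n) * sp k r \<omega> V) sums (of_real ((r / (2 * pi)) ^ n) * (\<Sum>k. sp k r \<omega> V))"
    by (intro sums_mult summable_sums summable_norm_cancel[OF sn])
  ultimately have "of_real ((r / (2 * pi)) ^ n) * (\<Sum>k. sp k r \<omega> V) = fourier_z f (r *\<^sub>R \<omega>) V" by (rule sums_unique2[symmetric])
  then have "of_real ((2 * pi) ^ n) * (of_real ((r / (2 * pi)) ^ n) * (\<Sum>k. sp k r \<omega> V)) = of_real ((2 * pi) ^ n) * fourier_z f (r *\<^sub>R \<omega>) V"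
    by (simp only:)
  moreover have "(2 * pi) ^ n * (r / (2 * pi)) ^ n = r ^ n" unfolding power_mult_distrib[symmetric] by simp
  ultimately show "of_real (r ^ n) * (LINT k|count_space UNIV. sp k r \<omega> V) = of_real ((2 * pi) ^ n) * fourier_z f (r *\<^sub>R \<omega>) V"
    unfolding integral_count_space_nat[OF i] by (metis mult.assoc of_real_mult)
qed

end

context restriction_frames
begin

text \<open>The order of operations changes twice: the sum over k goes outside for the substitution
  on each branch, then inside for the special Hermite expansion. Both exchanges rest on the bound
  that is uniform in V, so no exceptional set in (V, Z) arises.\<close>

lemma restriction_expansion:
  "integrable lborel (\<lambda>\<mu>. restriction_op A m \<mu> f (V, Z))"
  "(LINT \<mu>|lborel. restriction_op A m \<mu> f (V, Z)) = f (V, Z)"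
proof -
  interpret S: finite_measure \<sigma> by (rule finite_sphere_measure)
  interpret C: sigma_finite_measure "count_space (UNIV :: nat set)"
    by (rule sigma_finite_measure_count_space_countable) simp
  interpret CL: pair_sigma_finite "count_space (UNIV :: nat set)" "lborel :: real measure" ..
  interpret LS: pair_sigma_finite "lborel :: real measure" \<sigma> ..
  interpret CP: pair_sigma_finite "count_space (UNIV :: nat set)" "(lborel :: real measure) \<Otimes>\<^sub>M \<sigma>" ..
  let ?d = "DIM('z)" and ?K = "count_space (UNIV :: nat set)" and ?P = "(lborel :: real measure) \<Otimes>\<^sub>M \<sigma>"
  note [measurable] = measurable_sphere_measure_ident
  have snd_borel [measurable]: "(snd :: real \<times> 'z \<Rightarrow> 'z) \<in> borel_measurable ?P"
    by (rule measurable_compose[OF measurable_snd measurable_sphere_measure_ident])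
  have snd_borel' [measurable]: "(snd :: real \<times> 'z \<Rightarrow> 'z) \<in> borel_measurable (borel \<Otimes>\<^sub>M \<sigma>)"
    by (rule measurable_compose[OF measurable_snd measurable_sphere_measure_ident])
  obtain C where C: "C < \<infinity>" "\<And>V. (\<integral>\<^sup>+k. \<integral>\<^sup>+\<mu>. \<integral>\<^sup>+\<omega>. ennreal (wt k \<mu> * norm (sp k (s k \<mu>) \<omega> V)) \<partial>\<sigma> \<partial>lborel \<partial>count_space UNIV) \<le> C"
    "\<And>V. (\<integral>\<^sup>+k. \<integral>\<^sup>+r. \<integral>\<^sup>+\<omega>. ennreal (indicator {0<..} r * r ^ p * norm (sp k r \<omega> V)) \<partial>\<sigma> \<partial>lborel \<partial>count_space UNIV) \<le> C"
    by (rule nn_integral_wt_bound) blast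
  have osc: "(\<lambda>x. cis (- u x * (w x \<bullet> Z)) * sp k (u x) (w x) V) \<in> borel_measurable M"
    if [measurable]: "u \<in> borel_measurable M" "w \<in> M \<rightarrow>\<^sub>M \<sigma>" for k and u :: "'x \<Rightarrow> real" and w M
  proof -
    have [measurable]: "w \<in> borel_measurable M"
      using measurable_compose[OF that(2) measurable_sphere_measure_ident] .
    show ?thesis by measurable
  qed
  define H where "H = (\<lambda>k r. of_real (r ^ p) * (LINT \<omega>|\<sigma>. cis (- r * (\<omega> \<bullet> Z)) * sp k r \<omega> V))"
  have H [measurable]: "H k \<in> borel_measurable borel" for k
  proof -
    have "(\<lambda>x. cis (- fst x * (snd x \<bullet> Z)) * sp k (fst x) (snd x) V) \<in> borel_measurable (borel \<Otimes>\<^sub>M \<sigma>)"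
      by (rule osc) auto
    then have "(\<lambda>r. LINT \<omega>|\<sigma>. cis (- r * (\<omega> \<bullet> Z)) * sp k r \<omega> V) \<in> borel_measurable borel"
      by (intro S.borel_measurable_lebesgue_integral) (simp add: case_prod_unfold)
    then show ?thesis unfolding H_def by measurable
  qed
  have TH: "T V Z k \<mu> = (indicator (proper_branch.I n k m) \<mu> * \<bar>proper_branch.\<delta> n k m \<mu>\<bar>) *\<^sub>R H k (s k \<mu>)" for k \<mu>
    by (simp add: T_def H_def wt_def scaleR_conv_of_real)
  have Tm [measurable]: "T V Z k \<in> borel_measurable borel" for k
  proof -
    note [measurable] = proper_branch.\<delta>_measurable[OF branch, of k] proper_branch.I_borel[OF branch, of k]
    have [measurable]: "(\<lambda>\<mu>. H k (s k \<mu>)) \<in> borel_measurable borel"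
      by (rule measurable_compose[OF measurable_s H])
    show ?thesis unfolding TH[abs_def] by measurable
  qed
  have T_le: "ennreal (norm (T V Z k \<mu>)) \<le> (\<integral>\<^sup>+\<omega>. ennreal (wt k \<mu> * norm (sp k (s k \<mu>) \<omega> V)) \<partial>\<sigma>)" for k \<mu>
  proof -
    have "ennreal (norm (T V Z k \<mu>)) = ennreal (norm (LINT \<omega>|\<sigma>. of_real (wt k \<mu>) * (cis (- s k \<mu> * (\<omega> \<bullet> Z)) * sp k (s k \<mu>) \<omega> V)))"
      unfolding T_def by (simp only: integral_mult_right_zero)
    also have "\<dots> \<le> (\<integral>\<^sup>+\<omega>. ennreal (norm (of_real (wt k \<mu>) * (cis (- s k \<mu> * (\<omega> \<bullet> Z)) * sp k (s k \<mu>) \<omega> V))) \<partial>\<sigma>)"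
      by (rule ennreal_norm_integral_le)
    finally show ?thesis using wt_nonneg[of k \<mu>] by (simp add: norm_mult)
  qed
  have iT: "integrable (?K \<Otimes>\<^sub>M lborel) (\<lambda>(k, \<mu>). T V Z k \<mu>)"
  proof (rule integrableI_bounded)
    show m: "(\<lambda>(k, \<mu>). T V Z k \<mu>) \<in> borel_measurable (?K \<Otimes>\<^sub>M lborel)"
      by (rule measurable_pair_measure_countable1) auto
    have "(\<integral>\<^sup>+x. ennreal (norm (case x of (k, \<mu>) \<Rightarrow> T V Z k \<mu>)) \<partial>(?K \<Otimes>\<^sub>M lborel)) = (\<integral>\<^sup>+k. \<integral>\<^sup>+\<mu>. ennreal (norm (T V Z k \<mu>)) \<partial>lborel \<partial>?K)"
      using m by (subst lborel.nn_integral_fst[symmetric]) auto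
    also have "\<dots> \<le> C" by (rule order_trans[OF _ C(2)[of V]]) (intro nn_integral_mono T_le)
    finally show "(\<integral>\<^sup>+x. ennreal (norm (case x of (k, \<mu>) \<Rightarrow> T V Z k \<mu>)) \<partial>(?K \<Otimes>\<^sub>M lborel)) < \<infinity>"
      using C(1) by simp
  qed
  \<comment> \<open>The components before the substitution, as functions on radius and sphere; the
    indicator confines the radius to the half-line.\<close>
  define Q where "Q = (\<lambda>k (x :: real \<times> 'z). (indicator {0<..} (fst x) * fst x ^ p) *\<^sub>R (cis (- fst x * (snd x \<bullet> Z)) * sp k (fst x) (snd x) V))"
  have Qm: "Q k \<in> borel_measurable ?P" for k
  proof -
    have [measurable]: "(\<lambda>x. cis (- fst x * (snd x \<bullet> Z)) * sp k (fst x) (snd x) V) \<in> borel_measurable ?P"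
      by (rule osc) auto
    show ?thesis unfolding Q_def by measurable
  qed
  have nQ: "norm (Q k (r, \<omega>)) = indicator {0<..} r * r ^ p * norm (sp k r \<omega> V)" for k r \<omega>
    by (auto simp: Q_def norm_mult abs_mult indicator_def)
  have nnQ: "(\<integral>\<^sup>+x. ennreal (norm (Q k x)) \<partial>?P) = (\<integral>\<^sup>+r. \<integral>\<^sup>+\<omega>. ennreal (indicator {0<..} r * r ^ p * norm (sp k r \<omega> V)) \<partial>\<sigma> \<partial>lborel)" for k
    unfolding nQ[symmetric] by (rule S.nn_integral_fst[symmetric, OF measurable_compose[OF measurable_compose[OF Qm borel_measurable_norm] measurable_ennreal]])
  have iQ: "integrable (?K \<Otimes>\<^sub>M ?P) (\<lambda>(k, x). Q k x)"
  proof (rule integrableI_bounded)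
    show m: "(\<lambda>(k, x). Q k x) \<in> borel_measurable (?K \<Otimes>\<^sub>M ?P)"
      using Qm by (intro measurable_pair_measure_countable1) auto
    have "(\<integral>\<^sup>+x. ennreal (norm (case x of (k, y) \<Rightarrow> Q k y)) \<partial>(?K \<Otimes>\<^sub>M ?P)) = (\<integral>\<^sup>+k. \<integral>\<^sup>+y. ennreal (norm (Q k y)) \<partial>?P \<partial>?K)"
      using m by (subst LS.nn_integral_fst[symmetric]) auto
    also have "\<dots> \<le> C" unfolding nnQ by (rule C(3))
    finally show "(\<integral>\<^sup>+x. ennreal (norm (case x of (k, y) \<Rightarrow> Q k y)) \<partial>(?K \<Otimes>\<^sub>M ?P)) < \<infinity>"
      using C(1) by simp
  qed
  have iQk: "integrable ?P (Q k)" for k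
    using CP.AE_integrable_fst'[OF iQ] by (simp add: AE_count_space)
  \<comment> \<open>On the branch \<open>k\<close> the measure |\<mu>_k'| d\<mu> becomes dr on the
    whole half-line, for increasing and decreasing branches alike and whatever their range.\<close>
  have LT: "(LINT \<mu>|lborel. T V Z k \<mu>) = (LINT x|?P. Q k x)" for k
  proof -
    have "(LINT \<mu>|lborel. T V Z k \<mu>) = (LINT r|lborel. indicator {0<..} r *\<^sub>R H k r)"
      unfolding TH by (rule proper_branch.integral_branch[OF branch H])
    also have "\<dots> = (LINT r|lborel. LINT \<omega>|\<sigma>. Q k (r, \<omega>))"
    proof (intro Bochner_Integration.integral_cong refl)
      fix r :: real
      have "indicator {0<..} r *\<^sub>R H k r = (indicator {0<..} r * r ^ p) *\<^sub>R (LINT \<omega>|\<sigma>. cis (- r * (\<omega> \<bullet> Z)) * sp k r \<omega> V)"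
        by (simp add: H_def scaleR_conv_of_real)
      then show "indicator {0<..} r *\<^sub>R H k r = (LINT \<omega>|\<sigma>. Q k (r, \<omega>))"
        unfolding Q_def by (simp only: fst_conv snd_conv integral_scaleR_right)
    qed
    also have "\<dots> = (LINT x|?P. Q k x)"
      using LS.integral_fst'[OF iQk] by simp
    finally show ?thesis .
  qed
  let ?c = "of_real (1 / (2 * pi) ^ (n + ?d)) :: complex"
  show "integrable lborel (\<lambda>\<mu>. restriction_op A m \<mu> f (V, Z))"
    unfolding restriction_op_eq_integral by (intro integrable_mult_right CL.integrable_snd iT)
  have "(LINT \<mu>|lborel. restriction_op A m \<mu> f (V, Z)) = ?c * (LINT \<mu>|lborel. LINT k|?K. T V Z k \<mu>)"
    unfolding restriction_op_eq_integral by (rule integral_mult_right_zero)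
  also have "(LINT \<mu>|lborel. LINT k|?K. T V Z k \<mu>) = (LINT k|?K. LINT \<mu>|lborel. T V Z k \<mu>)"
    by (rule CL.Fubini_integral[OF iT])
  also have "\<dots> = (LINT k|?K. LINT x|?P. Q k x)" by (simp only: LT)
  also have "\<dots> = (LINT x|?P. LINT k|?K. Q k x)"
    by (rule CP.Fubini_integral[OF iQ, symmetric])
  also have "\<dots> = (LINT x|?P. of_real ((2 * pi) ^ n) * ((indicator {0<..} (fst x) * fst x ^ (?d - 1)) *\<^sub>R
      (cis (- ((fst x *\<^sub>R snd x) \<bullet> Z)) * fourier_z f (fst x *\<^sub>R snd x) V)))"
  proof (rule Bochner_Integration.integral_cong[OF refl])
    fix x assume "x \<in> space ?P"
    then have \<omega>: "snd x \<in> sphere 0 1" by (auto simp: space_pair_measure space_sphere_measure)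
    obtain r \<omega> where x: "x = (r, \<omega>)" by (cases x)
    show "(LINT k|?K. Q k x) = of_real ((2 * pi) ^ n) * ((indicator {0<..} (fst x) * fst x ^ (?d - 1)) *\<^sub>R
      (cis (- ((fst x *\<^sub>R snd x) \<bullet> Z)) * fourier_z f (fst x *\<^sub>R snd x) V))"
    proof (cases "r > 0")
      case r: True
      have "p = (?d - 1) + n" by (simp add: p n Suc_leI)
      then have rp: "complex_of_real (r ^ p) = of_real (r ^ (?d - 1)) * of_real (r ^ n)"
        by (simp only: power_add of_real_mult)
      have "Q k x = (of_real (r ^ (?d - 1)) * cis (- (r *\<^sub>R \<omega> \<bullet> Z)) * of_real (r ^ n)) * sp k r \<omega> V" for k
        using r by (simp add: Q_def x scaleR_conv_of_real rp mult_ac del: of_real_power)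
      then have "(LINT k|?K. Q k x) = (of_real (r ^ (?d - 1)) * cis (- (r *\<^sub>R \<omega> \<bullet> Z))) * (of_real (r ^ n) * (LINT k|?K. sp k r \<omega> V))"
        by (simp only: integral_mult_right_zero mult.assoc)
      also have "\<dots> = (of_real (r ^ (?d - 1)) * cis (- (r *\<^sub>R \<omega> \<bullet> Z))) * (of_real ((2 * pi) ^ n) * fourier_z f (r *\<^sub>R \<omega>) V)"
        using sp_sums(2)[OF _ r, of \<omega> V] \<omega> x by simp
      finally show ?thesis using r by (simp add: x scaleR_conv_of_real mult_ac)
    next
      case False
      then show ?thesis by (simp add: Q_def x)
    qed
  qed
  also have "\<dots> = of_real ((2 * pi) ^ n) * (LINT x|?P. (indicator {0<..} (fst x) * fst x ^ (?d - 1)) *\<^sub>R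
      (cis (- ((fst x *\<^sub>R snd x) \<bullet> Z)) * fourier_z f (fst x *\<^sub>R snd x) V))"
    by (rule integral_mult_right_zero)
  also have "(LINT x|?P. (indicator {0<..} (fst x) * fst x ^ (?d - 1)) *\<^sub>R
      (cis (- ((fst x *\<^sub>R snd x) \<bullet> Z)) * fourier_z f (fst x *\<^sub>R snd x) V)) = (LINT \<eta>|lborel. cis (- (\<eta> \<bullet> Z)) * fourier_z f \<eta> V)"
  proof (rule integral_polar)
    have [measurable]: "(\<lambda>\<eta>. fourier_z f \<eta> V) \<in> borel_measurable borel"
      by (rule borel_measurable_fourier_z[OF f]) auto
    show "(\<lambda>\<eta>. cis (- (\<eta> \<bullet> Z)) * fourier_z f \<eta> V) \<in> borel_measurable borel" by measurable
  qed
  also have "\<dots> = of_real ((2 * pi) ^ ?d) * f (V, Z)"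
    unfolding fourier_z_def
  proof (rule fourier_inversion)
    show "continuous_on UNIV (\<lambda>Z. f (V, Z))"
      by (intro continuous_on_compose2[OF schwartz_continuous[OF f]] continuous_intros) auto
    show "integrable lborel (\<lambda>Z. f (V, Z))" by (rule integrable_schwartz_slice[OF f])
    have "\<exists>B. \<forall>x. norm (f x) \<le> B" using schwartz_bounded_integrable(2)[OF f] by blast
    from someI_ex[OF this] show "norm (f (V, Z)) \<le> (SOME B. \<forall>x. norm (f x) \<le> B)" for Z
      by (rule spec)
    obtain D where D: "D \<ge> 0" "\<And>\<eta> V. norm (fourier_z f \<eta> V) \<le> D * cauchy_weight \<eta> * cauchy_weight V"
      by (rule fourier_z_joint_decay[OF f]) blast
    have "integrable lborel (\<lambda>\<eta>. fourier_z f \<eta> V)"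
    proof (rule Bochner_Integration.integrable_bound)
      show "integrable lborel (\<lambda>\<eta> :: 'z. D * cauchy_weight \<eta> * cauchy_weight V)"
        by (intro integrable_mult_left integrable_mult_right integrable_cauchy_weight)
      have "(\<lambda>\<eta>. fourier_z f \<eta> V) \<in> borel_measurable borel" by (rule borel_measurable_fourier_z[OF f]) auto
      then show "(\<lambda>\<eta>. fourier_z f \<eta> V) \<in> borel_measurable lborel" by simp
      show "AE \<eta> in lborel. norm (fourier_z f \<eta> V) \<le> norm (D * cauchy_weight \<eta> * cauchy_weight V)"
        by (intro AE_I2 order_trans[OF D(2)]) simp
    qed
    then show "integrable lborel (\<lambda>\<eta>. LINT x|lborel. cis (\<eta> \<bullet> x) * f (V, x))" by (simp only: fourier_z_def)
  qed
  \<comment> \<open>The prefactor cancels (2 pi)^n from the special Hermite expansion and (2 pi)^d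
    from Fourier inversion.\<close>
  also have "?c * (of_real ((2 * pi) ^ n) * (of_real ((2 * pi) ^ ?d) * f (V, Z))) = f (V, Z)"
  proof -
    have "1 / (2 * pi) ^ (n + ?d) * ((2 * pi) ^ n * (2 * pi) ^ ?d) = 1" by (simp add: power_add)
    then show ?thesis by (metis mult.assoc mult_1_left of_real_1 of_real_mult)
  qed
  finally show "(LINT \<mu>|lborel. restriction_op A m \<mu> f (V, Z)) = f (V, Z)" .
qed

end

lemma AE_lborel_fst:
  assumes "AE V in lborel. P V"
  shows "AE x in (lborel :: ('v::euclidean_space \<times> 'z::euclidean_space) measure). P (fst x)"
proof -
  obtain X where X: "X \<in> null_sets (lborel :: 'v measure)" "\<And>V. V \<in> space lborel - X \<Longrightarrow> P V"
    by (rule AE_E3[OF assms]) blast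
  have "X \<times> (UNIV :: 'z set) \<in> null_sets (lborel \<Otimes>\<^sub>M lborel)"
    using X(1) by (auto simp: null_sets_def lborel.emeasure_pair_measure_Times simp del: lborel_prod)
  then have "X \<times> (UNIV :: 'z set) \<in> null_sets lborel" by (simp add: lborel_prod)
  then show ?thesis by (rule AE_I') (use X(2) in \<open>fastforce simp: mem_Times_iff space_lborel\<close>)
qed

section \<open>The restriction operator as a superposition for fixed \<mu>\<close>

context restriction_frames
begin

abbreviation N :: "(nat \<times> real) measure" where
  "N \<equiv> count_space UNIV \<Otimes>\<^sub>M restrict_space borel {0<..}"

text \<open>Unit masses at the points (k, \<mu>_k(\<mu>)): for fixed \<mu> the spectrum in (k, r) is
  discrete, and only these radii occur.\<close>

definition \<nu> :: "real \<Rightarrow> (nat \<times> real) measure" where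
  "\<nu> \<mu> = distr (count_space (mu_indices n m \<mu>)) N (\<lambda>k. (k, s k \<mu>))"

lemma sets_\<nu>: "sets (\<nu> \<mu>) = sets N"
  by (simp add: \<nu>_def)

lemma space_N: "space N = UNIV \<times> {0<..}"
  by (simp add: space_pair_measure space_restrict_space)

lemma measurable_branches: "(\<lambda>k. (k, s k \<mu>)) \<in> count_space (mu_indices n m \<mu>) \<rightarrow>\<^sub>M N"
  by (simp add: measurable_count_space_eq1 space_N s_pos)

text \<open>The strip over a single index contains at most one atom, and countably many strips
  exhaust the space.\<close>

lemma sigma_finite_\<nu>: "sigma_finite_measure (\<nu> \<mu>)"
proof
  have sets: "{k} \<times> {0<..} \<in> sets N" for k :: nat
    by (intro pair_measureI) (auto simp: sets_restrict_space)
  have "emeasure (\<nu> \<mu>) ({k} \<times> {0<..}) \<noteq> \<infinity>" for k :: nat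
  proof -
    let ?B = "(\<lambda>k. (k, s k \<mu>)) -` ({k} \<times> {0<..}) \<inter> space (count_space (mu_indices n m \<mu>))"
    have "?B \<subseteq> {k}" "?B \<subseteq> mu_indices n m \<mu>" by auto
    then have "emeasure (count_space (mu_indices n m \<mu>)) ?B \<noteq> \<infinity>"
      by (subst emeasure_count_space) (auto intro: finite_subset)
    then show ?thesis unfolding \<nu>_def by (subst emeasure_distr[OF measurable_branches sets])
  qed
  then show "\<exists>A. countable A \<and> A \<subseteq> sets (\<nu> \<mu>) \<and> \<Union>A = space (\<nu> \<mu>) \<and> (\<forall>a\<in>A. emeasure (\<nu> \<mu>) a \<noteq> \<infinity>)"
    using sets by (intro exI[of _ "range (\<lambda>k::nat. {k} \<times> {0::real<..})"])
      (auto simp: sets_\<nu> sets_eq_imp_space_eq[OF sets_\<nu>] space_N)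
qed

text \<open>The index is discrete, so measurability in the radius for each fixed k is
  enough.\<close>

lemma measurable_component:
  assumes a: "\<And>k. a k \<in> borel_measurable (restrict_space borel {0<..})"
    and y: "y \<in> M \<rightarrow>\<^sub>M N" and w: "w \<in> M \<rightarrow>\<^sub>M \<sigma>" and v: "v \<in> borel_measurable M"
  shows "(\<lambda>x. a (fst (y x)) (snd (y x)) * sp (fst (y x)) (snd (y x)) (w x) (v x)) \<in> borel_measurable M"
proof (rule measurable_compose_countable'[where I=UNIV and g="\<lambda>x. fst (y x)"])
  show "(\<lambda>x. fst (y x)) \<in> M \<rightarrow>\<^sub>M count_space UNIV"
    by (rule measurable_compose[OF y measurable_fst])
  have r: "(\<lambda>x. snd (y x)) \<in> M \<rightarrow>\<^sub>M restrict_space borel {0<..}"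
    by (rule measurable_compose[OF y measurable_snd])
  have "(\<lambda>x::real. x) \<in> restrict_space borel {0<..} \<rightarrow>\<^sub>M borel" by (simp add: measurable_restrict_space1)
  from measurable_compose[OF r this]
  show "(\<lambda>x. a k (snd (y x)) * sp k (snd (y x)) (w x) (v x)) \<in> borel_measurable M" for k
    by (intro borel_measurable_times measurable_compose[OF r a] measurable_sp w v)
qed simp

lemma nn_integral_\<nu>:
  assumes "F \<in> borel_measurable (N \<Otimes>\<^sub>M \<sigma>)"
  shows "(\<integral>\<^sup>+x. F x \<partial>(\<nu> \<mu> \<Otimes>\<^sub>M \<sigma>)) = (\<integral>\<^sup>+k. \<integral>\<^sup>+\<omega>. F ((k, s k \<mu>), \<omega>) \<partial>\<sigma> \<partial>count_space (mu_indices n m \<mu>))"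
proof -
  interpret S: finite_measure \<sigma> by (rule finite_sphere_measure)
  have "sets (\<nu> \<mu> \<Otimes>\<^sub>M \<sigma>) = sets (N \<Otimes>\<^sub>M \<sigma>)" by (intro sets_pair_measure_cong sets_\<nu> refl)
  from measurable_cong_sets[OF this refl, of borel] assms have "F \<in> borel_measurable (\<nu> \<mu> \<Otimes>\<^sub>M \<sigma>)" by (rule ssubst)
  then have "(\<integral>\<^sup>+x. F x \<partial>(\<nu> \<mu> \<Otimes>\<^sub>M \<sigma>)) = (\<integral>\<^sup>+y. \<integral>\<^sup>+\<omega>. F (y, \<omega>) \<partial>\<sigma> \<partial>\<nu> \<mu>)"
    by (rule S.nn_integral_fst[symmetric])
  also have "\<dots> = (\<integral>\<^sup>+k. \<integral>\<^sup>+\<omega>. F ((k, s k \<mu>), \<omega>) \<partial>\<sigma> \<partial>count_space (mu_indices n m \<mu>))"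
    unfolding \<nu>_def
  proof (rule nn_integral_distr[OF measurable_branches])
    have "(\<lambda>y. \<integral>\<^sup>+\<omega>. F (y, \<omega>) \<partial>\<sigma>) \<in> borel_measurable N"
      using assms by (intro S.borel_measurable_nn_integral) (simp add: case_prod_unfold)
    then show "(\<lambda>y. \<integral>\<^sup>+\<omega>. F (y, \<omega>) \<partial>\<sigma>) \<in> borel_measurable (distr (count_space (mu_indices n m \<mu>)) N (\<lambda>k. (k, s k \<mu>)))"
      by simp
  qed
  finally show ?thesis .
qed

text \<open>One statement for both superpositions of the eigenvalue equation, with \<kappa> = 1 and
  \<kappa> = \<mu>. Amplitudes are prescribed at the atoms of \<open>\<nu> \<mu>\<close> alone,
  which is all that the integral sees.\<close>

lemma is_superposition_restriction_op:
  assumes temp: "restriction_tempered A m \<mu> f"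
    and a: "\<And>k. a k \<in> borel_measurable (restrict_space borel {0<..})"
    and eq: "\<And>k. k \<in> mu_indices n m \<mu> \<Longrightarrow> a k (s k \<mu>) = of_real (\<kappa> / (2 * pi) ^ (n + DIM('z))) * of_real (wt k \<mu>)"
  shows "is_superposition A (\<nu> \<mu>) a (\<lambda>k r \<omega>. fourier_z f (r *\<^sub>R \<omega>)) (\<lambda>x. of_real \<kappa> * restriction_op A m \<mu> f x)"
proof -
  interpret S: finite_measure \<sigma> by (rule finite_sphere_measure)
  interpret NU: sigma_finite_measure "\<nu> \<mu>" by (rule sigma_finite_\<nu>)
  interpret NS: pair_sigma_finite "\<nu> \<mu>" \<sigma> ..
  interpret I: sigma_finite_measure "count_space (mu_indices n m \<mu>)"
    by (rule sigma_finite_measure_count_space_countable) simp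
  interpret IS: pair_sigma_finite "count_space (mu_indices n m \<mu>)" \<sigma> ..
  interpret VIS: pair_sigma_finite "lborel :: 'v measure" "count_space (mu_indices n m \<mu>) \<Otimes>\<^sub>M \<sigma>" ..
  interpret VNS: pair_sigma_finite "lborel :: 'v measure" "\<nu> \<mu> \<Otimes>\<^sub>M \<sigma>" ..
  let ?I = "count_space (mu_indices n m \<mu>)"
  let ?c = "\<bar>\<kappa>\<bar> / (2 * pi) ^ (n + DIM('z))"
  define \<Phi> where "\<Phi> = (\<lambda>V (x :: (nat \<times> real) \<times> 'z). a (fst (fst x)) (snd (fst x)) * sp (fst (fst x)) (snd (fst x)) (snd x) V)"
  have setsN: "sets (\<nu> \<mu> \<Otimes>\<^sub>M \<sigma>) = sets (N \<Otimes>\<^sub>M \<sigma>)" by (intro sets_pair_measure_cong sets_\<nu> refl)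
  have measN: "F \<in> borel_measurable (\<nu> \<mu> \<Otimes>\<^sub>M \<sigma>) \<longleftrightarrow> F \<in> borel_measurable (N \<Otimes>\<^sub>M \<sigma>)" for F :: "_ \<Rightarrow> complex"
    by (subst measurable_cong_sets[OF setsN refl]) (rule refl)
  have m\<Phi>: "\<Phi> V \<in> borel_measurable (N \<Otimes>\<^sub>M \<sigma>)" for V
    unfolding \<Phi>_def by (intro measurable_component a) auto
  have m\<Phi>': "\<Phi> V \<in> borel_measurable (\<nu> \<mu> \<Otimes>\<^sub>M \<sigma>)" for V
    using m\<Phi> by (rule measN[THEN iffD2])
  have \<Phi>_eq: "\<Phi> V ((k, s k \<mu>), \<omega>) = of_real (\<kappa> / (2 * pi) ^ (n + DIM('z))) * restriction_summand A m \<mu> f V k \<omega>"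
    if "k \<in> mu_indices n m \<mu>" for V k \<omega>
    using that by (simp add: \<Phi>_def eq summand_eq)
  have \<Phi>_norm: "ennreal (norm (\<Phi> V ((k, s k \<mu>), \<omega>))) = ennreal ?c * ennreal (norm (restriction_summand A m \<mu> f V k \<omega>))"
    if "k \<in> mu_indices n m \<mu>" for V k \<omega>
    unfolding \<Phi>_eq[OF that] by (subst ennreal_mult[symmetric]) (auto simp: norm_mult norm_divide norm_power)
  have ms: "(\<lambda>x. restriction_summand A m \<mu> f V (fst x) (snd x)) \<in> borel_measurable (?I \<Otimes>\<^sub>M \<sigma>)" for V
    by (rule measurable_summand) auto
  note msn = measurable_compose[OF measurable_compose[OF ms borel_measurable_norm] measurable_ennreal]
  have nn\<Phi>: "(\<integral>\<^sup>+x. ennreal (norm (\<Phi> V x)) \<partial>(\<nu> \<mu> \<Otimes>\<^sub>M \<sigma>)) =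
     ennreal ?c * (\<integral>\<^sup>+x. ennreal (norm (restriction_summand A m \<mu> f V (fst x) (snd x))) \<partial>(?I \<Otimes>\<^sub>M \<sigma>))" for V
  proof -
    have "(\<integral>\<^sup>+x. ennreal (norm (\<Phi> V x)) \<partial>(\<nu> \<mu> \<Otimes>\<^sub>M \<sigma>)) = (\<integral>\<^sup>+k. \<integral>\<^sup>+\<omega>. ennreal (norm (\<Phi> V ((k, s k \<mu>), \<omega>))) \<partial>\<sigma> \<partial>?I)"
      by (rule nn_integral_\<nu>[OF measurable_compose[OF measurable_compose[OF m\<Phi> borel_measurable_norm] measurable_ennreal]])
    also have "\<dots> = (\<integral>\<^sup>+k. \<integral>\<^sup>+\<omega>. ennreal ?c * ennreal (norm (restriction_summand A m \<mu> f V k \<omega>)) \<partial>\<sigma> \<partial>?I)"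
      by (intro nn_integral_cong \<Phi>_norm) simp
    also have "\<dots> = (\<integral>\<^sup>+x. ennreal ?c * ennreal (norm (restriction_summand A m \<mu> f V (fst x) (snd x))) \<partial>(?I \<Otimes>\<^sub>M \<sigma>))"
      using msn by (subst S.nn_integral_fst[symmetric]) auto
    also have "\<dots> = ennreal ?c * (\<integral>\<^sup>+x. ennreal (norm (restriction_summand A m \<mu> f V (fst x) (snd x))) \<partial>(?I \<Otimes>\<^sub>M \<sigma>))"
      by (rule nn_integral_cmult[OF msn])
    finally show ?thesis .
  qed
  obtain L where temp': "integrable (lborel \<Otimes>\<^sub>M (?I \<Otimes>\<^sub>M \<sigma>)) (\<lambda>x. restriction_summand A m \<mu> f (fst x) (fst (snd x)) (snd (snd x)) /\<^sub>R (1 + norm (fst x)) ^ L)"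
    using temp unfolding restriction_tempered_def card_n by (auto simp: case_prod_unfold)
  let ?w = "\<lambda>V::'v. ennreal (1 / (1 + norm V) ^ L)"
  have wn: "ennreal (norm (z /\<^sub>R (1 + norm V) ^ L)) = ?w V * ennreal (norm z)" for z :: complex and V :: 'v
    by (subst ennreal_mult[symmetric]) (auto simp: divide_inverse power_abs)
  have fin: "(\<integral>\<^sup>+V. ?w V * (\<integral>\<^sup>+x. ennreal (norm (restriction_summand A m \<mu> f V (fst x) (snd x))) \<partial>(?I \<Otimes>\<^sub>M \<sigma>)) \<partial>lborel) < \<infinity>"
  proof -
    have "(\<integral>\<^sup>+x. ennreal (norm (restriction_summand A m \<mu> f (fst x) (fst (snd x)) (snd (snd x)) /\<^sub>R (1 + norm (fst x)) ^ L)) \<partial>(lborel \<Otimes>\<^sub>M (?I \<Otimes>\<^sub>M \<sigma>))) < \<infinity>"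
      using temp' by (simp only: integrable_iff_bounded)
    moreover have "(\<integral>\<^sup>+x. ennreal (norm (restriction_summand A m \<mu> f (fst x) (fst (snd x)) (snd (snd x)) /\<^sub>R (1 + norm (fst x)) ^ L)) \<partial>(lborel \<Otimes>\<^sub>M (?I \<Otimes>\<^sub>M \<sigma>))) =
      (\<integral>\<^sup>+V. \<integral>\<^sup>+x. ennreal (norm (restriction_summand A m \<mu> f V (fst x) (snd x) /\<^sub>R (1 + norm V) ^ L)) \<partial>(?I \<Otimes>\<^sub>M \<sigma>) \<partial>lborel)"
      using IS.nn_integral_fst[OF measurable_compose[OF measurable_compose[OF borel_measurable_integrable[OF temp'] borel_measurable_norm] measurable_ennreal]] by simp
    moreover have "(\<integral>\<^sup>+x. ennreal (norm (restriction_summand A m \<mu> f V (fst x) (snd x) /\<^sub>R (1 + norm V) ^ L)) \<partial>(?I \<Otimes>\<^sub>M \<sigma>)) =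
      ?w V * (\<integral>\<^sup>+x. ennreal (norm (restriction_summand A m \<mu> f V (fst x) (snd x))) \<partial>(?I \<Otimes>\<^sub>M \<sigma>))" for V
      unfolding wn by (rule nn_integral_cmult[OF msn])
    ultimately show ?thesis by simp
  qed
  have mall: "(\<lambda>x. \<Phi> (fst x) (snd x) /\<^sub>R (1 + norm (fst x)) ^ L) \<in> borel_measurable (lborel \<Otimes>\<^sub>M (\<nu> \<mu> \<Otimes>\<^sub>M \<sigma>))"
  proof -
    have "(\<lambda>x. fst (snd x)) \<in> lborel \<Otimes>\<^sub>M (\<nu> \<mu> \<Otimes>\<^sub>M \<sigma>) \<rightarrow>\<^sub>M \<nu> \<mu>" by measurable
    then have "(\<lambda>x. fst (snd x)) \<in> lborel \<Otimes>\<^sub>M (\<nu> \<mu> \<Otimes>\<^sub>M \<sigma>) \<rightarrow>\<^sub>M N"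
      by (subst (asm) measurable_cong_sets[OF refl sets_\<nu>])
    then have [measurable]: "(\<lambda>x. \<Phi> (fst x) (snd x)) \<in> borel_measurable (lborel \<Otimes>\<^sub>M (\<nu> \<mu> \<Otimes>\<^sub>M \<sigma>))"
      unfolding \<Phi>_def by (intro measurable_component a) auto
    show ?thesis by measurable
  qed
  have int: "integrable (lborel \<Otimes>\<^sub>M (\<nu> \<mu> \<Otimes>\<^sub>M \<sigma>)) (\<lambda>x. \<Phi> (fst x) (snd x) /\<^sub>R (1 + norm (fst x)) ^ L)"
  proof (rule integrableI_bounded[OF mall])
    have "(\<integral>\<^sup>+x. ennreal (norm (\<Phi> (fst x) (snd x) /\<^sub>R (1 + norm (fst x)) ^ L)) \<partial>(lborel \<Otimes>\<^sub>M (\<nu> \<mu> \<Otimes>\<^sub>M \<sigma>))) =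
      (\<integral>\<^sup>+V. \<integral>\<^sup>+x. ennreal (norm (\<Phi> V x /\<^sub>R (1 + norm V) ^ L)) \<partial>(\<nu> \<mu> \<Otimes>\<^sub>M \<sigma>) \<partial>lborel)"
      using NS.nn_integral_fst[OF measurable_compose[OF measurable_compose[OF mall borel_measurable_norm] measurable_ennreal]] by simp
    also have "\<dots> = (\<integral>\<^sup>+V. ennreal ?c * (?w V * (\<integral>\<^sup>+x. ennreal (norm (restriction_summand A m \<mu> f V (fst x) (snd x))) \<partial>(?I \<Otimes>\<^sub>M \<sigma>))) \<partial>lborel)"
    proof (rule nn_integral_cong)
      fix V :: 'v
      have "(\<integral>\<^sup>+x. ennreal (norm (\<Phi> V x /\<^sub>R (1 + norm V) ^ L)) \<partial>(\<nu> \<mu> \<Otimes>\<^sub>M \<sigma>)) = ?w V * (\<integral>\<^sup>+x. ennreal (norm (\<Phi> V x)) \<partial>(\<nu> \<mu> \<Otimes>\<^sub>M \<sigma>))"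
        unfolding wn by (rule nn_integral_cmult[OF measurable_compose[OF measurable_compose[OF m\<Phi>' borel_measurable_norm] measurable_ennreal]])
      then show "(\<integral>\<^sup>+x. ennreal (norm (\<Phi> V x /\<^sub>R (1 + norm V) ^ L)) \<partial>(\<nu> \<mu> \<Otimes>\<^sub>M \<sigma>)) =
        ennreal ?c * (?w V * (\<integral>\<^sup>+x. ennreal (norm (restriction_summand A m \<mu> f V (fst x) (snd x))) \<partial>(?I \<Otimes>\<^sub>M \<sigma>)))"
        unfolding nn\<Phi> by (simp only: mult_ac)
    qed
    also have "\<dots> = ennreal ?c * (\<integral>\<^sup>+V. ?w V * (\<integral>\<^sup>+x. ennreal (norm (restriction_summand A m \<mu> f V (fst x) (snd x))) \<partial>(?I \<Otimes>\<^sub>M \<sigma>)) \<partial>lborel)"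
    proof (rule nn_integral_cmult)
      have "(\<lambda>x. restriction_summand A m \<mu> f (fst x) (fst (snd x)) (snd (snd x))) \<in> borel_measurable (lborel \<Otimes>\<^sub>M (?I \<Otimes>\<^sub>M \<sigma>))"
        by (rule measurable_summand) auto
      from measurable_compose[OF measurable_compose[OF this borel_measurable_norm] measurable_ennreal]
      have [measurable]: "(\<lambda>V. \<integral>\<^sup>+x. ennreal (norm (restriction_summand A m \<mu> f V (fst x) (snd x))) \<partial>(?I \<Otimes>\<^sub>M \<sigma>)) \<in> borel_measurable lborel"
        by (intro IS.borel_measurable_nn_integral) (simp add: case_prod_unfold)
      show "(\<lambda>V. ?w V * (\<integral>\<^sup>+x. ennreal (norm (restriction_summand A m \<mu> f V (fst x) (snd x))) \<partial>(?I \<Otimes>\<^sub>M \<sigma>))) \<in> borel_measurable lborel"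
        by measurable
    qed
    also have "\<dots> < \<infinity>" using fin by (simp add: ennreal_mult_less_top)
    finally show "(\<integral>\<^sup>+x. ennreal (norm (\<Phi> (fst x) (snd x) /\<^sub>R (1 + norm (fst x)) ^ L)) \<partial>(lborel \<Otimes>\<^sub>M (\<nu> \<mu> \<Otimes>\<^sub>M \<sigma>))) < \<infinity>" .
  qed
  have "AE V in lborel. integrable (\<nu> \<mu> \<Otimes>\<^sub>M \<sigma>) (\<lambda>x. \<Phi> V x /\<^sub>R (1 + norm V) ^ L)"
    using VNS.AE_integrable_fst'[OF int] by simp
  then have "AE V in lborel. integrable (\<nu> \<mu> \<Otimes>\<^sub>M \<sigma>) (\<Phi> V)"
  proof eventually_elim
    case (elim V)
    have "(1 + norm V) ^ L \<noteq> 0" using norm_ge_zero[of V] by (simp add: add_nonneg_eq_0_iff)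
    then show ?case using integrable_scaleR_right[of "(1 + norm V) ^ L", OF elim] by simp
  qed
  then have "AE x in (lborel :: ('v \<times> 'z) measure). integrable (\<nu> \<mu> \<Otimes>\<^sub>M \<sigma>) (\<Phi> (fst x))"
    by (rule AE_lborel_fst)
  then have ae: "AE x in (lborel :: ('v \<times> 'z) measure). of_real \<kappa> * restriction_op A m \<mu> f x =
      (LINT y|(\<nu> \<mu> \<Otimes>\<^sub>M \<sigma>). cis (- snd (fst y) * (snd y \<bullet> snd x)) * \<Phi> (fst x) y)"
  proof eventually_elim
    case (elim x)
    obtain V Z where x: "x = (V, Z)" by (cases x)
    have i\<Phi>: "integrable (\<nu> \<mu> \<Otimes>\<^sub>M \<sigma>) (\<Phi> V)" using elim x by simp
    let ?g = "\<lambda>y :: (nat \<times> real) \<times> 'z. cis (- snd (fst y) * (snd y \<bullet> Z)) * \<Phi> V y"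
    have mc: "(\<lambda>y. cis (- snd (fst y) * (snd y \<bullet> Z))) \<in> borel_measurable (N \<Otimes>\<^sub>M \<sigma>)"
    proof -
      have "(\<lambda>x::real. x) \<in> restrict_space borel {0<..} \<rightarrow>\<^sub>M borel" by (simp add: measurable_restrict_space1)
      from measurable_compose[OF measurable_compose[OF measurable_fst measurable_snd] this]
      have [measurable]: "(\<lambda>y. snd (fst y)) \<in> borel_measurable (N \<Otimes>\<^sub>M \<sigma>)" .
      have [measurable]: "snd \<in> borel_measurable (N \<Otimes>\<^sub>M \<sigma>)"
        by (rule measurable_compose[OF measurable_snd measurable_sphere_measure_ident])
      show ?thesis by measurable
    qed
    have mg: "?g \<in> borel_measurable (N \<Otimes>\<^sub>M \<sigma>)" by (intro borel_measurable_times mc m\<Phi>)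
    then have mg': "?g \<in> borel_measurable (\<nu> \<mu> \<Otimes>\<^sub>M \<sigma>)" by (rule measN[THEN iffD2])
    have ig: "integrable (\<nu> \<mu> \<Otimes>\<^sub>M \<sigma>) ?g"
      by (rule Bochner_Integration.integrable_bound[OF i\<Phi> mg']) (simp add: norm_mult)
    have "(LINT y|(\<nu> \<mu> \<Otimes>\<^sub>M \<sigma>). ?g y) = (LINT u|\<nu> \<mu>. LINT \<omega>|\<sigma>. ?g (u, \<omega>))"
      by (rule NS.integral_fst'[OF ig, symmetric])
    also have "\<dots> = (LINT k|?I. LINT \<omega>|\<sigma>. ?g ((k, s k \<mu>), \<omega>))"
      unfolding \<nu>_def
    proof (rule integral_distr[OF measurable_branches])
      show "(\<lambda>u. LINT \<omega>|\<sigma>. ?g (u, \<omega>)) \<in> borel_measurable N"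
        using mg by (intro S.borel_measurable_lebesgue_integral) (simp add: case_prod_unfold)
    qed
    also have "\<dots> = (LINT k|?I. of_real (\<kappa> / (2 * pi) ^ (n + DIM('z))) * T V Z k \<mu>)"
    proof (intro Bochner_Integration.integral_cong refl)
      fix k assume "k \<in> space ?I"
      then have k: "k \<in> mu_indices n m \<mu>" by simp
      have "?g ((k, s k \<mu>), \<omega>) = of_real (\<kappa> / (2 * pi) ^ (n + DIM('z))) * (of_real (wt k \<mu>) * (cis (- s k \<mu> * (\<omega> \<bullet> Z)) * sp k (s k \<mu>) \<omega> V))" for \<omega>
        by (simp add: \<Phi>_eq[OF k] summand_eq[OF k] mult_ac)
      then show "(LINT \<omega>|\<sigma>. ?g ((k, s k \<mu>), \<omega>)) = of_real (\<kappa> / (2 * pi) ^ (n + DIM('z))) * T V Z k \<mu>"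
        by (simp only: T_def integral_mult_right_zero)
    qed
    also have "\<dots> = of_real \<kappa> * (of_real (1 / (2 * pi) ^ (n + DIM('z))) * (LINT k|?I. T V Z k \<mu>))"
      by (simp only: integral_mult_right_zero) simp
    also have "\<dots> = of_real \<kappa> * restriction_op A m \<mu> f x"
      unfolding x restriction_op_eq integral_count_space_eq_infsum ..
    finally show ?case by (simp add: x)
  qed
  show ?thesis
    unfolding is_superposition_def
  proof (intro conjI allI)
    show "sigma_finite_measure (\<nu> \<mu>)" by (rule sigma_finite_\<nu>)
    show "sets (\<nu> \<mu>) = sets (count_space UNIV \<Otimes>\<^sub>M restrict_space borel {0<..})" by (rule sets_\<nu>)
    show "schwartz (fourier_z f (r *\<^sub>R \<omega>))" for r \<omega> by (rule schwartz_fourier_z[OF f])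
    show "\<exists>L. integrable (lborel \<Otimes>\<^sub>M (\<nu> \<mu> \<Otimes>\<^sub>M \<sigma>)) (\<lambda>(V, (k, r), \<omega>). (a k r * spec_proj A k r \<omega> (fourier_z f (r *\<^sub>R \<omega>)) V) /\<^sub>R (1 + norm V) ^ L)"
      using int by (intro exI[of _ L]) (simp add: \<Phi>_def sp_def case_prod_unfold)
    show "AE (V, Z) in lborel. of_real \<kappa> * restriction_op A m \<mu> f (V, Z) =
       (LINT ((k, r), \<omega>)|(\<nu> \<mu> \<Otimes>\<^sub>M \<sigma>). cis (- r * (\<omega> \<bullet> Z)) * (a k r * spec_proj A k r \<omega> (fourier_z f (r *\<^sub>R \<omega>)) V))"
      using ae by (simp add: \<Phi>_def sp_def case_prod_unfold)
  qed
qed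

text \<open>The measure \<open>\<nu> \<mu>\<close> charges only the points where the multiplier has
  the value \<mu>, so multiplying the amplitudes by the multiplier multiplies the superposition by
  \<mu>.\<close>

lemma joint_calculus_restriction_op:
  assumes temp: "restriction_tempered A m \<mu> f"
  shows "joint_calculus A m (restriction_op A m \<mu> f) (\<lambda>x. of_real \<mu> * restriction_op A m \<mu> f x)"
proof -
  \<comment> \<open>The derivative is taken at the fixed \<mu>, so each amplitude is a constant
    times a power of r; at the atom r = \<mu>_k it equals the required weight.\<close>
  define a where "a = (\<lambda>k r. complex_of_real (r ^ p * \<bar>deriv (s k) \<mu>\<bar> / (2 * pi) ^ (n + DIM('z))))"
  have ma: "a k \<in> borel_measurable (restrict_space borel {0<..})" for k
    unfolding a_def by (intro measurable_restrict_space1) measurable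
  have mJ: "(\<lambda>r. complex_of_real (joint_mult n m k r) * a k r) \<in> borel_measurable (restrict_space borel {0<..})" for k
    using borel_measurable_continuous_on_restrict[OF proper_branch.J_continuous[OF branch, of k]] ma[of k] by measurable
  have "is_superposition A (\<nu> \<mu>) a (\<lambda>k r \<omega>. fourier_z f (r *\<^sub>R \<omega>)) (\<lambda>x. of_real 1 * restriction_op A m \<mu> f x)"
    by (rule is_superposition_restriction_op[OF temp ma]) (simp add: a_def wt_in)
  \<comment> \<open>At the atom of index k the multiplier takes the value \<mu> by
    \<open>J_s\<close>.\<close>
  moreover have "is_superposition A (\<nu> \<mu>) (\<lambda>k r. of_real (joint_mult n m k r) * a k r) (\<lambda>k r \<omega>. fourier_z f (r *\<^sub>R \<omega>)) (\<lambda>x. of_real \<mu> * restriction_op A m \<mu> f x)"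
    by (rule is_superposition_restriction_op[OF temp mJ]) (simp add: a_def wt_in proper_branch.J_s[OF branch] mem_I)
  ultimately show ?thesis unfolding joint_calculus_def card_n by auto
qed

end

theorem theorem2p6:
  fixes br :: "'v::euclidean_space \<times> 'z::euclidean_space \<Rightarrow> 'v \<times> 'z \<Rightarrow> 'v \<times> 'z"
    and A :: "'z \<Rightarrow> 'v \<Rightarrow> real^('n::finite + 'n)"
    and m :: "real \<Rightarrow> real \<Rightarrow> real"
    and f :: "'v \<times> 'z \<Rightarrow> complex"
  assumes "metivier br"
    and "DIM('v) = 2 * CARD('n)"
    and "symplectic_frames br A"
    and "proper_function CARD('n) m"
    and "\<And>k \<mu>. \<mu> > 0 \<Longrightarrow> k \<in> mu_indices CARD('n) m \<mu> \<Longrightarrow>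
           mu_sol CARD('n) m k differentiable (at \<mu>)"
    and "schwartz f"
  shows "(\<forall>V. AE \<mu> in lborel. \<mu> > 0 \<longrightarrow> restriction_converges_at A m \<mu> f V) \<and>
         (\<forall>p. set_integrable lborel {0<..} (\<lambda>\<mu>. restriction_op A m \<mu> f p) \<and>
              f p = (LINT \<mu>:{0<..}|lborel. restriction_op A m \<mu> f p)) \<and>
         (AE \<mu> in lborel. \<mu> > 0 \<longrightarrow> restriction_tempered A m \<mu> f) \<and>
         (\<forall>\<mu>>0. restriction_tempered A m \<mu> f \<longrightarrow>
            joint_calculus A m (restriction_op A m \<mu> f) (\<lambda>p. of_real \<mu> * restriction_op A m \<mu> f p))"
proof -
  interpret restriction_frames br A m f "CARD('n)" "CARD('n) + DIM('z) - 1"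
    by unfold_locales (use assms in \<open>auto simp: metivier_def lie_bracket_def\<close>)
  \<comment> \<open>For \<mu> \<le> 0 there are no indices, since a proper multiplier is positive;
    the empty sum is 0, and the integral over the line is the one over the half-line.\<close>
  have half: "indicator {0<..} \<mu> *\<^sub>R restriction_op A m \<mu> f (V, Z) = restriction_op A m \<mu> f (V, Z)" for \<mu> V Z
    using mu_indices_nonpos[of \<mu>] by (cases "\<mu> > 0") (auto simp: restriction_op_eq)
  have "set_integrable lborel {0<..} (\<lambda>\<mu>. restriction_op A m \<mu> f q) \<and>
      f q = (LINT \<mu>:{0<..}|lborel. restriction_op A m \<mu> f q)" for q
  proof (cases q)
    case (Pair V Z)
    show ?thesis
      using restriction_expansion[of V Z] by (simp add: Pair set_integrable_def set_lebesgue_integral_def half)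
  qed
  moreover have "AE \<mu> in lborel. \<mu> > 0 \<longrightarrow> restriction_converges_at A m \<mu> f V" for V
    using AE_converges_at[of V] by eventually_elim simp
  moreover have "AE \<mu> in lborel. \<mu> > 0 \<longrightarrow> restriction_tempered A m \<mu> f"
    using AE_tempered by eventually_elim simp
  ultimately show ?thesis using joint_calculus_restriction_op by blast
qed

end
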